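(* Let $(A,\rho)=(A_1,\rho_1)*(A_2,\rho_2)$ be a reduced free product of C*-probability spaces. Let $z\in A_1$ and $a,b,c\in A_2$ be unitaries such that - $\rho_1(z)=\rho_2(a)=\rho_2(b)=\rho_2(c)=\rho_2(c^{-1}b)=\rho_2(c^{-1}a)=0$, and - $z$ belongs to the centralizer of $\rho_1$, and $a,b,c$ belong to the centralizer of $\rho_2$. Let $B=C^*(z^{-1}az,b,c)\subseteq A$. Then $B\subset(A,\rho)$, with $A$ represented on $L^2(A,\rho)$ via the GNS representation, has the PHP property, and consequently $B\subset(A,\rho)$ is a selfless inclusion.
   Context: **C*-probability spaces.** A C*-probability space $(A,\rho)$ is a unital C*-algebra $A$ with a state $\rho$ whose GNS representation is faithful (standing assumption on all states, except ultrapower states). Morphisms are unital state-preserving *-homomorphisms. An inclusion $B\subset(A,\rho)$ consists of a C*-probability space $(A,\rho)$ and a unital C*-subalgebra $B$ of $A$ with the restricted state $\rho|_B$. For an ultrafilter $\omega$ on a set $I$, $A^\omega=\ell^\infty(I,A)/\{(a_i):\lim_{i\to\omega}\|a_i\|=0\}$, with state $\rho^\omega((a_i)_i)=\lim_{i\to\omega}\rho(a_i)$; $B^\omega\subseteq A^\omega$ naturally. The symbol $*$ denotes the reduced free product of C*-probability spaces, with the free product state; $A_1,A_2$ are identified with C*-subalgebras of $A$. The centralizer of a state $\rho$ on $A$ is $\{x\in A:\rho(xy)=\rho(yx)\ \forall y\in A\}$. **Selfless inclusions.** $B\subset(A,\rho)$ is selfless if there exist a free ultrafilter $\omega$, a C*-probability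 space $(C,\kappa)$ with $C\ne\mathbb{C}$, and a state-preserving unital embedding of C*-algebras $\sigma\colon A*C\to A^\omega$ such that the restriction of $\sigma$ to the first factor $A$ is the diagonal inclusion $A\to A^\omega$ and $\sigma(B*C)\subseteq B^\omega$ (equivalently $\sigma(C)\subseteq B^\omega$). **PHP property.** Let $A\subseteq\mathbb{B}(H)$ be faithfully represented. The inclusion $B\subset(A,\rho)$ has the PHP (Powers–Haagerup–Pisier) property if for all finite sets $F\subset\ker(\rho)$, all $\epsilon>0$ and all $n\in\mathbb{N}$, there exist unitaries $u_1,\dots,u_n\in U(B)$ and projections $P_i,P_i^+\in\mathbb{B}(H)$ with $P_i^+\le P_i$, $i=1,\ldots,n$, such that: 1. $(P_i)_{i=1}^n$ is a pairwise orthogonal family; 2. $u_iP_i^+u_i^*\le P_i^+$ and $u_i(1-P_i)u_i^*\le P_i^+$ for all $i$; 3. $\|P_ixP_j\|<\epsilon$ for all $x\in F$ and all $i,j$. *)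

theory Defs
  imports
    Complex_Main
    "HOL-Library.Nonpos_Ints"
    "HOL-Algebra.Subrings"
    "HOL-Algebra.QuotRing"
    "HOL-Algebra.Algebraic_Closure_Type"
begin

section \<open>Unital C*-algebras\<close>

abbreviation complex_ring :: "complex ring"
  where "complex_ring \<equiv> ring_of_type_algebra"

record 'a cstar = "(complex, 'a) module" +
  star :: "'a \<Rightarrow> 'a"
  nrm :: "'a \<Rightarrow> real"

locale cstar_algebra = ring A + vs: Module.module complex_ring A
  for A :: "'a cstar" (structure) +
  assumes smult_mult_left: "\<lbrakk>x \<in> carrier A; y \<in> carrier A\<rbrakk> \<Longrightarrow> (c \<odot> x) \<otimes> y = c \<odot> (x \<otimes> y)"
    and smult_mult_right: "\<lbrakk>x \<in> carrier A; y \<in> carrier A\<rbrakk> \<Longrightarrow> x \<otimes> (c \<odot> y) = c \<odot> (x \<otimes> y)"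
    and star_closed: "x \<in> carrier A \<Longrightarrow> star A x \<in> carrier A"
    and star_star: "x \<in> carrier A \<Longrightarrow> star A (star A x) = x"
    and star_add: "\<lbrakk>x \<in> carrier A; y \<in> carrier A\<rbrakk> \<Longrightarrow> star A (x \<oplus> y) = star A x \<oplus> star A y"
    and star_smult: "x \<in> carrier A \<Longrightarrow> star A (c \<odot> x) = cnj c \<odot> star A x"
    and star_mult: "\<lbrakk>x \<in> carrier A; y \<in> carrier A\<rbrakk> \<Longrightarrow> star A (x \<otimes> y) = star A y \<otimes> star A x"
    and nrm_nonneg: "x \<in> carrier A \<Longrightarrow> 0 \<le> nrm A x"
    and nrm_eq_0_iff: "x \<in> carrier A \<Longrightarrow> nrm A x = 0 \<longleftrightarrow> x = \<zero>"
    and nrm_triangle: "\<lbrakk>x \<in> carrier A; y \<in> carrier A\<rbrakk> \<Longrightarrow> nrm A (x \<oplus> y) \<le> nrm A x + nrm A y"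
    and nrm_smult: "x \<in> carrier A \<Longrightarrow> nrm A (c \<odot> x) = cmod c * nrm A x"
    and nrm_mult: "\<lbrakk>x \<in> carrier A; y \<in> carrier A\<rbrakk> \<Longrightarrow> nrm A (x \<otimes> y) \<le> nrm A x * nrm A y"
    and cstar_identity: "x \<in> carrier A \<Longrightarrow> nrm A (star A x \<otimes> x) = (nrm A x)\<^sup>2"
    and complete: "\<lbrakk>\<And>n. s n \<in> carrier A;
        \<And>e. e > 0 \<Longrightarrow> \<exists>N. \<forall>m\<ge>N. \<forall>n\<ge>N. nrm A (s m \<ominus> s n) < e\<rbrakk>
        \<Longrightarrow> \<exists>x\<in>carrier A. (\<lambda>n. nrm A (s n \<ominus> x)) \<longlonglongrightarrow> 0"

text \<open>Unital *-homomorphisms; unitality is part of \<^const>\<open>ring_hom\<close>.\<close>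

definition cstar_hom :: "'a cstar \<Rightarrow> 'b cstar \<Rightarrow> ('a \<Rightarrow> 'b) set"
  where "cstar_hom A B = {f \<in> ring_hom A B.
    (\<forall>c. \<forall>x\<in>carrier A. f (c \<odot>\<^bsub>A\<^esub> x) = c \<odot>\<^bsub>B\<^esub> f x) \<and>
    (\<forall>x\<in>carrier A. f (star A x) = star B (f x))}"

definition unital_cstar_subalgebra :: "'a set \<Rightarrow> 'a cstar \<Rightarrow> bool"
  where "unital_cstar_subalgebra B A \<longleftrightarrow>
    subring B A \<and>
    (\<forall>c. \<forall>x\<in>B. c \<odot>\<^bsub>A\<^esub> x \<in> B) \<and>
    (\<forall>x\<in>B. star A x \<in> B) \<and>
    (\<forall>s. \<forall>x\<in>carrier A. (\<forall>n. s n \<in> B) \<and> (\<lambda>n. nrm A (s n \<ominus>\<^bsub>A\<^esub> x)) \<longlonglongrightarrow> 0 \<longrightarrow> x \<in> B)"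

definition cstar_generated :: "'a cstar \<Rightarrow> 'a set \<Rightarrow> 'a set"
  where "cstar_generated A S = \<Inter>{B. unital_cstar_subalgebra B A \<and> S \<subseteq> B}"

definition unitaries :: "'a cstar \<Rightarrow> 'a set"
  where "unitaries A = {u \<in> carrier A. star A u \<otimes>\<^bsub>A\<^esub> u = \<one>\<^bsub>A\<^esub> \<and> u \<otimes>\<^bsub>A\<^esub> star A u = \<one>\<^bsub>A\<^esub>}"

definition projections :: "'a cstar \<Rightarrow> 'a set"
  where "projections A = {p \<in> carrier A. p \<otimes>\<^bsub>A\<^esub> p = p \<and> star A p = p}"

text \<open>The order of a C*-algebra, whose positive elements are those of the form z*z.\<close>

definition cstar_le :: "'a cstar \<Rightarrow> 'a \<Rightarrow> 'a \<Rightarrow> bool"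
  where "cstar_le A x y \<longleftrightarrow> (\<exists>z\<in>carrier A. y \<ominus>\<^bsub>A\<^esub> x = star A z \<otimes>\<^bsub>A\<^esub> z)"


section \<open>Hilbert spaces and bounded operators\<close>

text \<open>As usual for modules in HOL-Algebra, the ring components \<^const>\<open>mult\<close> and \<^const>\<open>one\<close>
  of the record carry no meaning here.\<close>

record 'h hilb = "(complex, 'h) module" +
  hinner :: "'h \<Rightarrow> 'h \<Rightarrow> complex"

definition hnorm :: "'h hilb \<Rightarrow> 'h \<Rightarrow> real"
  where "hnorm H x = sqrt (Re (hinner H x x))"

text \<open>The inner product is linear in the first argument.\<close>

locale hilbert_space = Module.module complex_ring H
  for H :: "'h hilb" (structure) +
  assumes hinner_add: "\<lbrakk>x \<in> carrier H; y \<in> carrier H; z \<in> carrier H\<rbrakk>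
        \<Longrightarrow> hinner H (x \<oplus> y) z = hinner H x z + hinner H y z"
    and hinner_smult: "\<lbrakk>x \<in> carrier H; y \<in> carrier H\<rbrakk>
        \<Longrightarrow> hinner H (c \<odot> x) y = c * hinner H x y"
    and hinner_commute: "\<lbrakk>x \<in> carrier H; y \<in> carrier H\<rbrakk>
        \<Longrightarrow> hinner H x y = cnj (hinner H y x)"
    and hinner_nonneg: "x \<in> carrier H \<Longrightarrow> hinner H x x \<in> \<real>\<^sub>\<ge>\<^sub>0"
    and hinner_eq_0_iff: "x \<in> carrier H \<Longrightarrow> hinner H x x = 0 \<longleftrightarrow> x = \<zero>"
    and hilbert_complete: "\<lbrakk>\<And>n. s n \<in> carrier H;
        \<And>e. e > 0 \<Longrightarrow> \<exists>N. \<forall>m\<ge>N. \<forall>n\<ge>N. hnorm H (s m \<ominus> s n) < e\<rbrakk>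
        \<Longrightarrow> \<exists>x\<in>carrier H. (\<lambda>n. hnorm H (s n \<ominus> x)) \<longlonglongrightarrow> 0"

definition bounded_operators :: "'h hilb \<Rightarrow> ('h \<Rightarrow> 'h) set"
  where "bounded_operators H = {T \<in> carrier H \<rightarrow>\<^sub>E carrier H.
    (\<forall>x\<in>carrier H. \<forall>y\<in>carrier H. T (x \<oplus>\<^bsub>H\<^esub> y) = T x \<oplus>\<^bsub>H\<^esub> T y) \<and>
    (\<forall>c. \<forall>x\<in>carrier H. T (c \<odot>\<^bsub>H\<^esub> x) = c \<odot>\<^bsub>H\<^esub> T x) \<and>
    (\<exists>K. \<forall>x\<in>carrier H. hnorm H (T x) \<le> K * hnorm H x)}"

text \<open>The C*-algebra of all bounded operators on a Hilbert space.\<close>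

definition BH :: "'h hilb \<Rightarrow> ('h \<Rightarrow> 'h) cstar"
  where "BH H =
    \<lparr>carrier = bounded_operators H,
     monoid.mult = (\<lambda>S T. compose (carrier H) S T),
     one = (\<lambda>x\<in>carrier H. x),
     ring.zero = (\<lambda>x\<in>carrier H. \<zero>\<^bsub>H\<^esub>),
     add = (\<lambda>S T. \<lambda>x\<in>carrier H. S x \<oplus>\<^bsub>H\<^esub> T x),
     module.smult = (\<lambda>c T. \<lambda>x\<in>carrier H. c \<odot>\<^bsub>H\<^esub> T x),
     star = (\<lambda>T. THE S. S \<in> bounded_operators H \<and>
       (\<forall>x\<in>carrier H. \<forall>y\<in>carrier H. hinner H (T x) y = hinner H x (S y))),
     nrm = (\<lambda>T. SUP x\<in>{x \<in> carrier H. hnorm H x \<le> 1}. hnorm H (T x))\<rparr>"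

definition faithful_representation :: "'a cstar \<Rightarrow> 'h hilb \<Rightarrow> ('a \<Rightarrow> 'h \<Rightarrow> 'h) \<Rightarrow> bool"
  where "faithful_representation A H \<pi> \<longleftrightarrow>
    hilbert_space H \<and> \<pi> \<in> cstar_hom A (BH H) \<and> inj_on \<pi> (carrier A)"


section \<open>States and the GNS construction\<close>

definition state :: "'a cstar \<Rightarrow> ('a \<Rightarrow> complex) \<Rightarrow> bool"
  where "state A \<rho> \<longleftrightarrow>
    (\<forall>x\<in>carrier A. \<forall>y\<in>carrier A. \<rho> (x \<oplus>\<^bsub>A\<^esub> y) = \<rho> x + \<rho> y) \<and>
    (\<forall>c. \<forall>x\<in>carrier A. \<rho> (c \<odot>\<^bsub>A\<^esub> x) = c * \<rho> x) \<and>
    (\<forall>x\<in>carrier A. \<rho> (star A x \<otimes>\<^bsub>A\<^esub> x) \<in> \<real>\<^sub>\<ge>\<^sub>0) \<and>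
    \<rho> \<one>\<^bsub>A\<^esub> = 1"

text \<open>The space L2(A, rho) is the completion of A with respect to the semi-inner product
  (x, y) = rho(y* x), realised as Cauchy sequences modulo null sequences.\<close>

definition gns_seminorm :: "'a cstar \<Rightarrow> ('a \<Rightarrow> complex) \<Rightarrow> 'a \<Rightarrow> real"
  where "gns_seminorm A \<rho> x = sqrt (Re (\<rho> (star A x \<otimes>\<^bsub>A\<^esub> x)))"

definition gns_Cauchy :: "'a cstar \<Rightarrow> ('a \<Rightarrow> complex) \<Rightarrow> (nat \<Rightarrow> 'a) set"
  where "gns_Cauchy A \<rho> = {s. (\<forall>n. s n \<in> carrier A) \<and>
    (\<forall>e>0. \<exists>N. \<forall>m\<ge>N. \<forall>n\<ge>N. gns_seminorm A \<rho> (s m \<ominus>\<^bsub>A\<^esub> s n) < e)}"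

definition gns_rel :: "'a cstar \<Rightarrow> ('a \<Rightarrow> complex) \<Rightarrow> ((nat \<Rightarrow> 'a) \<times> (nat \<Rightarrow> 'a)) set"
  where "gns_rel A \<rho> = {(s, t). s \<in> gns_Cauchy A \<rho> \<and> t \<in> gns_Cauchy A \<rho> \<and>
    (\<lambda>n. gns_seminorm A \<rho> (s n \<ominus>\<^bsub>A\<^esub> t n)) \<longlonglongrightarrow> 0}"

definition L2 :: "'a cstar \<Rightarrow> ('a \<Rightarrow> complex) \<Rightarrow> (nat \<Rightarrow> 'a) set hilb"
  where "L2 A \<rho> =
    \<lparr>carrier = gns_Cauchy A \<rho> // gns_rel A \<rho>,
     monoid.mult = undefined,
     one = undefined,
     ring.zero = gns_rel A \<rho> `` {\<lambda>n. \<zero>\<^bsub>A\<^esub>},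
     add = (\<lambda>U V. \<Union>s\<in>U. \<Union>t\<in>V. gns_rel A \<rho> `` {\<lambda>n. s n \<oplus>\<^bsub>A\<^esub> t n}),
     module.smult = (\<lambda>c U. \<Union>s\<in>U. gns_rel A \<rho> `` {\<lambda>n. c \<odot>\<^bsub>A\<^esub> s n}),
     hinner = (\<lambda>U V. THE l. \<exists>s\<in>U. \<exists>t\<in>V. (\<lambda>n. \<rho> (star A (t n) \<otimes>\<^bsub>A\<^esub> s n)) \<longlonglongrightarrow> l)\<rparr>"

definition gns_rep :: "'a cstar \<Rightarrow> ('a \<Rightarrow> complex) \<Rightarrow> 'a \<Rightarrow> (nat \<Rightarrow> 'a) set \<Rightarrow> (nat \<Rightarrow> 'a) set"
  where "gns_rep A \<rho> x =
    (\<lambda>U\<in>carrier (L2 A \<rho>). \<Union>s\<in>U. gns_rel A \<rho> `` {\<lambda>n. x \<otimes>\<^bsub>A\<^esub> s n})"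

definition cstar_prob_space :: "'a cstar \<Rightarrow> ('a \<Rightarrow> complex) \<Rightarrow> bool"
  where "cstar_prob_space A \<rho> \<longleftrightarrow>
    cstar_algebra A \<and> state A \<rho> \<and> inj_on (gns_rep A \<rho>) (carrier A)"

definition centralizer :: "'a cstar \<Rightarrow> ('a \<Rightarrow> complex) \<Rightarrow> 'a set"
  where "centralizer A \<rho> =
    {x \<in> carrier A. \<forall>y\<in>carrier A. \<rho> (x \<otimes>\<^bsub>A\<^esub> y) = \<rho> (y \<otimes>\<^bsub>A\<^esub> x)}"

text \<open>State-preserving embeddings; the target state need not have a faithful GNS
  representation, since ultrapower states do not have one in general.\<close>

definition cstar_embedding ::
  "'a cstar \<Rightarrow> ('a \<Rightarrow> complex) \<Rightarrow> 'b cstar \<Rightarrow> ('b \<Rightarrow> complex) \<Rightarrow> ('a \<Rightarrow> 'b) \<Rightarrow> bool"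
  where "cstar_embedding A \<rho> B \<tau> f \<longleftrightarrow>
    f \<in> cstar_hom A B \<and> inj_on f (carrier A) \<and> (\<forall>x\<in>carrier A. \<tau> (f x) = \<rho> x)"

definition cstar_inclusion :: "'a set \<Rightarrow> 'a cstar \<Rightarrow> ('a \<Rightarrow> complex) \<Rightarrow> bool"
  where "cstar_inclusion B A \<rho> \<longleftrightarrow> cstar_prob_space A \<rho> \<and> unital_cstar_subalgebra B A"


section \<open>Reduced free products\<close>

text \<open>Freeness of a family of subalgebras: a product of centred elements in which neighbouring
  factors come from different subalgebras is centred. A word is a list of pairs of an index and
  an element of the subalgebra with that index.\<close>

definition free_family :: "'a cstar \<Rightarrow> ('a \<Rightarrow> complex) \<Rightarrow> ('k \<Rightarrow> 'a set) \<Rightarrow> bool"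
  where "free_family A \<rho> S \<longleftrightarrow>
    (\<forall>w. w \<noteq> [] \<and> distinct_adj (map fst w) \<and> (\<forall>(k, x)\<in>set w. x \<in> S k \<and> \<rho> x = 0)
      \<longrightarrow> \<rho> (foldr (\<lambda>x y. x \<otimes>\<^bsub>A\<^esub> y) (map snd w) \<one>\<^bsub>A\<^esub>) = 0)"

text \<open>Voiculescu's reduced free product of two C*-probability spaces is the (up to
  state-preserving isomorphism) unique C*-probability space containing both of them freely and
  generated by them. The predicate says that (A, rho), with the embeddings j1 and j2 of the two
  factors, is a reduced free product of (A1, rho1) and (A2, rho2); that the GNS
  representation of rho is faithful is part of \<^const>\<open>cstar_prob_space\<close>.\<close>

definition is_reduced_free_product ::
  "'a cstar \<Rightarrow> ('a \<Rightarrow> complex) \<Rightarrow> 'b cstar \<Rightarrow> ('b \<Rightarrow> complex) \<Rightarrow>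
   'c cstar \<Rightarrow> ('c \<Rightarrow> complex) \<Rightarrow> ('a \<Rightarrow> 'c) \<Rightarrow> ('b \<Rightarrow> 'c) \<Rightarrow> bool"
  where "is_reduced_free_product A1 \<rho>1 A2 \<rho>2 A \<rho> j1 j2 \<longleftrightarrow>
    cstar_prob_space A1 \<rho>1 \<and> cstar_prob_space A2 \<rho>2 \<and> cstar_prob_space A \<rho> \<and>
    cstar_embedding A1 \<rho>1 A \<rho> j1 \<and> cstar_embedding A2 \<rho>2 A \<rho> j2 \<and>
    free_family A \<rho> (\<lambda>first. if first then j1 ` carrier A1 else j2 ` carrier A2) \<and>
    cstar_generated A (j1 ` carrier A1 \<union> j2 ` carrier A2) = carrier A"


section \<open>Ultrapowers\<close>

definition free_ultrafilter :: "'i filter \<Rightarrow> bool"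
  where "free_ultrafilter \<omega> \<longleftrightarrow>
    \<omega> \<noteq> bot \<and>
    (\<forall>P. eventually P \<omega> \<or> eventually (\<lambda>i. \<not> P i) \<omega>) \<and>
    (\<forall>i. eventually (\<lambda>j. j \<noteq> i) \<omega>)"

text \<open>Bounded families in A, indexed by the whole type \<^typ>\<open>'i\<close>.\<close>

definition linf :: "'a cstar \<Rightarrow> ('i \<Rightarrow> 'a) cstar"
  where "linf A =
    \<lparr>carrier = {a. (\<forall>i. a i \<in> carrier A) \<and> bdd_above (range (\<lambda>i. nrm A (a i)))},
     monoid.mult = (\<lambda>a b i. a i \<otimes>\<^bsub>A\<^esub> b i),
     one = (\<lambda>i. \<one>\<^bsub>A\<^esub>),
     ring.zero = (\<lambda>i. \<zero>\<^bsub>A\<^esub>),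
     add = (\<lambda>a b i. a i \<oplus>\<^bsub>A\<^esub> b i),
     module.smult = (\<lambda>c a i. c \<odot>\<^bsub>A\<^esub> a i),
     star = (\<lambda>a i. star A (a i)),
     nrm = (\<lambda>a. SUP i. nrm A (a i))\<rparr>"

text \<open>The quotient of a C*-algebra by a closed two-sided ideal, with the quotient norm.\<close>

definition cstar_quot :: "'a cstar \<Rightarrow> 'a set \<Rightarrow> 'a set cstar"
  where "cstar_quot A J =
    \<lparr>carrier = carrier (A Quot J),
     monoid.mult = monoid.mult (A Quot J),
     one = one (A Quot J),
     ring.zero = ring.zero (A Quot J),
     add = add (A Quot J),
     module.smult = (\<lambda>c U. \<Union>x\<in>U. J +>\<^bsub>A\<^esub> (c \<odot>\<^bsub>A\<^esub> x)),
     star = (\<lambda>U. \<Union>x\<in>U. J +>\<^bsub>A\<^esub> star A x),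
     nrm = (\<lambda>U. INF x\<in>U. nrm A x)\<rparr>"

definition null_ideal :: "'a cstar \<Rightarrow> 'i filter \<Rightarrow> ('i \<Rightarrow> 'a) set"
  where "null_ideal A \<omega> = {a \<in> carrier (linf A). ((\<lambda>i. nrm A (a i)) \<longlongrightarrow> 0) \<omega>}"

definition ultrapower :: "'a cstar \<Rightarrow> 'i filter \<Rightarrow> ('i \<Rightarrow> 'a) set cstar"
  where "ultrapower A \<omega> = cstar_quot (linf A) (null_ideal A \<omega>)"

definition ultra_class :: "'a cstar \<Rightarrow> 'i filter \<Rightarrow> ('i \<Rightarrow> 'a) \<Rightarrow> ('i \<Rightarrow> 'a) set"
  where "ultra_class A \<omega> a = null_ideal A \<omega> +>\<^bsub>linf A\<^esub> a"

definition ultra_state ::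
  "('a \<Rightarrow> complex) \<Rightarrow> 'i filter \<Rightarrow> ('i \<Rightarrow> 'a) set \<Rightarrow> complex"
  where "ultra_state \<rho> \<omega> U = (THE l. \<exists>a\<in>U. ((\<lambda>i. \<rho> (a i)) \<longlongrightarrow> l) \<omega>)"

text \<open>The image in the ultrapower of A of the bounded families with values in B.\<close>

definition ultra_subalgebra :: "'a cstar \<Rightarrow> 'i filter \<Rightarrow> 'a set \<Rightarrow> ('i \<Rightarrow> 'a) set set"
  where "ultra_subalgebra A \<omega> B =
    {ultra_class A \<omega> a |a. a \<in> carrier (linf A) \<and> (\<forall>i. a i \<in> B)}"


section \<open>Selfless inclusions and the PHP property\<close>

text \<open>The definition of selflessness quantifies existentially over the index set of the
  ultrafilter and over the algebras C and A*C, which a HOL definition has to place in fixed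
  types; this loses nothing. Since A*C embeds into the ultrapower, the algebras C and A*C may
  be taken with carriers contained in that of the ultrapower. As for index sets, a witness
  with an arbitrary index set yields, after shrinking C to a separable nontrivial subalgebra and
  choosing approximations on finite subsets F of A up to 1/n, a witness indexed by the pairs
  (F, n). Below,
  D is A*C with factor embeddings \<open>jA\<close> and \<open>jC\<close>, and the C*-algebra B*C is the one generated by
  B and C in A*C.\<close>

definition selfless :: "'a set \<Rightarrow> 'a cstar \<Rightarrow> ('a \<Rightarrow> complex) \<Rightarrow> bool"
  where "selfless B A \<rho> \<longleftrightarrow> cstar_inclusion B A \<rho> \<and>
    (\<exists>(\<omega> :: ('a set \<times> nat) filter)
      (C :: ('a set \<times> nat \<Rightarrow> 'a) set cstar) \<kappa>
      (D :: ('a set \<times> nat \<Rightarrow> 'a) set cstar) \<delta> jA jC \<sigma>.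
      free_ultrafilter \<omega> \<and>
      cstar_prob_space C \<kappa> \<and>
      carrier C \<noteq> range (\<lambda>c. c \<odot>\<^bsub>C\<^esub> \<one>\<^bsub>C\<^esub>) \<and>
      is_reduced_free_product A \<rho> C \<kappa> D \<delta> jA jC \<and>
      cstar_embedding D \<delta> (ultrapower A \<omega>) (ultra_state \<rho> \<omega>) \<sigma> \<and>
      (\<forall>x\<in>carrier A. \<sigma> (jA x) = ultra_class A \<omega> (\<lambda>i. x)) \<and>
      \<sigma> ` cstar_generated D (jA ` B \<union> jC ` carrier C) \<subseteq> ultra_subalgebra A \<omega> B)"

definition PHP ::
  "'a set \<Rightarrow> 'a cstar \<Rightarrow> ('a \<Rightarrow> complex) \<Rightarrow> 'h hilb \<Rightarrow> ('a \<Rightarrow> 'h \<Rightarrow> 'h) \<Rightarrow> bool"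
  where "PHP B A \<rho> H \<pi> \<longleftrightarrow>
    cstar_inclusion B A \<rho> \<and> faithful_representation A H \<pi> \<and>
    (\<forall>F \<epsilon> n. finite F \<and> F \<subseteq> {x \<in> carrier A. \<rho> x = 0} \<and> 0 < (\<epsilon> :: real) \<longrightarrow>
      (\<exists>u P Q.
        (\<forall>i\<in>{1..n :: nat}.
          u i \<in> unitaries A \<and> u i \<in> B \<and>
          P i \<in> projections (BH H) \<and> Q i \<in> projections (BH H) \<and> cstar_le (BH H) (Q i) (P i)) \<and>
        (\<forall>i\<in>{1..n}. \<forall>j\<in>{1..n}. i \<noteq> j \<longrightarrow> P i \<otimes>\<^bsub>BH H\<^esub> P j = \<zero>\<^bsub>BH H\<^esub>) \<and>
        (\<forall>i\<in>{1..n}.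
          cstar_le (BH H) (\<pi> (u i) \<otimes>\<^bsub>BH H\<^esub> Q i \<otimes>\<^bsub>BH H\<^esub> star (BH H) (\<pi> (u i))) (Q i) \<and>
          cstar_le (BH H)
            (\<pi> (u i) \<otimes>\<^bsub>BH H\<^esub> (\<one>\<^bsub>BH H\<^esub> \<ominus>\<^bsub>BH H\<^esub> P i) \<otimes>\<^bsub>BH H\<^esub> star (BH H) (\<pi> (u i))) (Q i)) \<and>
        (\<forall>x\<in>F. \<forall>i\<in>{1..n}. \<forall>j\<in>{1..n}.
          nrm (BH H) (P i \<otimes>\<^bsub>BH H\<^esub> \<pi> x \<otimes>\<^bsub>BH H\<^esub> P j) < \<epsilon>)))"

end

(* Let N be the projection of L2(A) onto the closed span of the reduced words that start in A2, and let
v_p = (c z*az)^p b z*az. For centred x and distant large p, q, no cancellation brings the two ends of v_p* x v_q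
together, so that N v_p* x v_q N = 0; hence the projections v_p N v_p*, with the unitaries
v_p c z*az b c* v_p* of B, satisfy PHP, and for large p they kill any given finite sum of reduced words.

A normalised sum l of the cells P_i (u_i (1 - P_i) + u_i* ) then satisfies l* x l ~ rho(x), l* is small on
vectors from A, and h = l + l* lies in B, so in an ultrapower l is a creation operator over A. The norm of a
polynomial in h and A is bounded by its norm in the GNS representation of the vacuum state, up to a factor
polynomial in the degree (a Haagerup inequality). Applying this to powers of p*p removes the factor and shows that
this representation is faithful on C*(A, h); hence C*(A, h) is the reduced free product of A with C*(h). *)

theory Submission
imports Defs
begin

text \<open>The meeting of the tails dictates the shape of \<open>v p\<close>. In
  \<open>sA (v p) ** (x ** v q)\<close> the letters of x are used up and two shifted copies of the
  period-4 word c z* a z meet. A shift by an odd number of letters leaves nothing to merge; a shift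
  by two confronts a with c; a shift by a multiple of four cancels letter by letter until a final b
  confronts a c. The state vanishes on the merged letters c* a and c* b, so the result stays
  reduced. An unshifted meeting could leave a scalar, but its coefficient is zero because
  conjugation by the letters preserves the state.

  The operator l lives in the ultrapower of B(L2(A)), outside the ultrapower of A. The Fock space
  computations are therefore made there with an abstract l, and only l + l* is pulled back, along
  the isometric extension of the GNS representation. The Hilbert module behind the Haagerup
  inequality is replaced by finite matrices over A: their entries come from constant families, so a
  bound tested on vectors of A holds in every coordinate and survives multiplication by rows and
  columns of arbitrary operators.\<close>

notation (input) monoid.mult (infixl "**\<index>" 70) and add (infixl ".+\<index>" 65)
 and a_minus ("(_ .-\<index> _)" [65,66] 65) and module.smult (infixl "*.\<index>" 70)
 and tendsto (infixr "--->" 55) and iff (infixr "<->" 25)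
abbreviation (input) LIMSEQ_ascii (infix "---->" 60) where "f ----> l == (f ---> l) sequentially"
abbreviation (input) in_carrier (infix ".:" 50) where "x .: G == x \<in> carrier G"
abbreviation (input) mult_at ("_ **@_ _" [70,1000,71] 70) where "x **@G y == x **\<^bsub>G\<^esub> y"
abbreviation (input) add_at ("_ .+@_ _" [65,1000,66] 65) where "x .+@G y == x .+\<^bsub>G\<^esub> y"
abbreviation (input) minus_at ("_ .-@_ _" [65,1000,66] 65) where "x .-@G y == x .-\<^bsub>G\<^esub> y"
abbreviation (input) smult_at ("_ *.@_ _" [70,1000,71] 70) where "c *.@G y == c *.\<^bsub>G\<^esub> y"
abbreviation (input) one_at ("1@_" [1000] 1000) where "1@G == \<one>\<^bsub>G\<^esub>"
abbreviation (input) zero_at ("0@_" [1000] 1000) where "0@G == \<zero>\<^bsub>G\<^esub>"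
notation (input) star ("sA\<index>") and nrm ("nA\<index>")

subsection \<open>C*-algebras\<close>

lemma complex_ring_simps [simp]:
 "carrier complex_ring = UNIV"
 "x **@complex_ring y = x * y" "x .+@complex_ring y = x + y"
 "1@complex_ring = 1" "0@complex_ring = 0" by (simp_all add: ring_of_type_algebra_def)

lemma complex_ring_minus [simp]: "\<ominus>\<^bsub>complex_ring\<^esub> x = - x"
proof -
 interpret cring complex_ring by (rule cring_from_type_algebra)
 show ?thesis by (rule minus_equality) auto
qed

lemma square_le_1_imp: "(x::real)\<^sup>2 <= 1 ==> x <= 1" by (rule power2_le_imp_le) auto

context cstar_algebra
begin

lemma sm_closed [simp, intro]: "x .: A ==> c *. x .: A" by (rule vs.smult_closed) auto

lemma sm_add_l: "x .: A ==> (c + d) *. x = c *. x .+ d *. x" using vs.smult_l_distr[of c d x] by simp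

lemma sm_add_r: "x .: A ==> y .: A ==> c *. (x .+ y) = c *. x .+ c *. y" using vs.smult_r_distr[of c x y] by simp

lemma sm_sm [simp]: "x .: A ==> c *. (d *. x) = (c * d) *. x" using vs.smult_assoc1[of c d x] by simp

lemma sm_one [simp]: "x .: A ==> 1 *. x = x" using vs.smult_one[of x] by simp

lemma sm_zero [simp]: "x .: A ==> 0 *. x = \<zero>" "c *. \<zero> = \<zero>"
 using vs.smult_l_null[of x] vs.smult_r_null[of c] by simp_all

lemma minus_sm: "x .: A ==> \<ominus> x = (-1) *. x" using vs.smult_l_minus[of 1 x] by simp

lemma diff_sm: "x .: A ==> y .: A ==> x .- y = x .+ (-1) *. y" by (simp add: minus_sm minus_eq)

lemmas ring_nf = minus_eq l_distr r_distr l_minus r_minus minus_add minus_minus a_ac m_assoc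
 r_neg r_neg1 r_neg2 l_neg

lemma sm_diff_r: "x .: A ==> y .: A ==> c *. (x .- y) = c *. x .- c *. y" by (simp add: diff_sm sm_add_r)

lemma sm_uminus_l: "x .: A ==> (- c) *. x = \<ominus> (c *. x)" by (simp add: minus_sm)

lemma sm_twice: "x .: A ==> x .+ x = 2 *. x" using sm_add_l[of x 1 1] by simp

declare smult_mult_left [simp] smult_mult_right [simp]

lemma star_zero [simp]: "sA \<zero> = \<zero>" using star_smult[of "\<zero>" 0] by (simp add: star_closed)

declare star_closed [simp, intro] star_star [simp]

lemma star_one [simp]: "sA \<one> = \<one>"
proof -
 have "sA (sA \<one> ** \<one>) = sA \<one> ** sA (sA \<one>)" by (rule star_mult) auto
 thus ?thesis by simp
qed

lemma star_minus: "x .: A ==> sA (\<ominus> x) = \<ominus> sA x" by (simp add: minus_sm star_smult)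

lemma star_diff: "x .: A ==> y .: A ==> sA (x .- y) = sA x .- sA y" by (simp add: minus_eq star_add star_minus)

lemma nrm_zero [simp]: "nA \<zero> = 0" by (simp add: nrm_eq_0_iff)

lemma nrm_minus [simp]: "x .: A ==> nA (\<ominus> x) = nA x" by (simp add: minus_sm nrm_smult)

lemma nrm_diff_commute: "x .: A ==> y .: A ==> nA (x .- y) = nA (y .- x)"
proof -
 assume "x .: A" "y .: A"
 moreover from this have "x .- y = \<ominus> (y .- x)" by algebra
 ultimately show ?thesis by simp
qed

lemma nrm_triangle_diff:
 "x .: A ==> y .: A ==> nA (x .- y) <= nA x + nA y" using nrm_triangle[of x "\<ominus> y"] by (simp add: minus_eq)

lemma diff_trans:
 "x .: A ==> y .: A ==> w .: A ==> x .- w = (x .- y) .+ (y .- w)" by (simp add: minus_eq a_assoc r_neg1)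

lemma nrm_diff_trans: assumes "x .: A" "y .: A" "w .: A" shows "nA (x .- w) <= nA (x .- y) + nA (y .- w)"
 using nrm_triangle[of "x .- y" "y .- w"] diff_trans[of x y w] assms by simp

lemma nrm_le_diff: assumes "x .: A" "y .: A" shows "nA x <= nA y + nA (x .- y)"
 using nrm_diff_trans[of x y "\<zero>"] assms by (simp add: minus_eq)

lemma nrm_star [simp]: "x .: A ==> nA (sA x) = nA x"
proof -
 have le: "nA x <= nA (sA x)" if x: "x .: A" for x proof (cases "nA x = 0")
  case False
  have "(nA x)\<^sup>2 <= nA (sA x) * nA x" using cstar_identity[OF x] nrm_mult[of "sA x" x] x by simp
  thus ?thesis using False nrm_nonneg[OF x] by (simp add: power2_eq_square)
 qed (use x nrm_nonneg in auto)
 assume "x .: A"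
 thus ?thesis using le[of x] le[of "sA x"] by simp
qed

lemma nrm_one_le: "nA \<one> <= 1"
proof (cases "nA \<one> = 0")
 case False
 have "(nA \<one>)\<^sup>2 = nA \<one>" using cstar_identity[of "\<one>"] by simp
 thus ?thesis using False by (simp add: power2_eq_square)
qed auto

lemma diff_eq_zero_iff: "x .: A ==> y .: A ==> x .- y = \<zero> <-> x = y" by (metis minus_eq r_right_minus_eq)

lemma nrm_diff_0_iff: "x .: A ==> y .: A ==> nA (x .- y) = 0 <-> x = y" by (simp add: nrm_eq_0_iff diff_eq_zero_iff)

lemma mult_diff: assumes "x .: A" "y .: A" "x' .: A" "y' .: A"
 shows "x ** y .- x' ** y' = (x .- x') ** y .+ x' ** (y .- y')" using assms by algebra

lemma nrm_mult_le: assumes "x .: A" "y .: A" "nA x <= c" "nA y <= d" shows "nA (x ** y) <= c * d"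
 using nrm_mult[of x y] mult_mono[of "nA x" c "nA y" d] assms nrm_nonneg by (meson order_trans)

section \<open>Norm convergence and majorised sequences\<close>

definition converges :: "(nat => 'a) => 'a => bool"
 where "converges s x <-> (\<forall>n. s n .: A) & x .: A & (%n. nA (s n .- x)) ----> 0"

lemma converges_unique: assumes "converges s x" "converges s y" shows "x = y"
proof -
 have c: "!!n. s n .: A" "x .: A" "y .: A" and l: "(%n. nA (s n .- x)) ----> 0" "(%n. nA (s n .- y)) ----> 0"
  using assms by (auto simp: converges_def)
 have "nA (x .- y) <= nA (s n .- x) + nA (s n .- y)" for n
  using nrm_diff_trans[of x "s n" y] c by (simp add: nrm_diff_commute)
 hence "nA (x .- y) <= 0 + 0" by (intro LIMSEQ_le_const[OF tendsto_add[OF l]]) auto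
 thus ?thesis using nrm_nonneg[of "x .- y"] c nrm_diff_0_iff by force
qed

lemma converges_const: "x .: A ==> converges (%_. x) x" by (simp add: converges_def r_neg minus_eq)

lemma converges_add: assumes "converges s x" "converges t y" shows "converges (%n. s n .+ t n) (x .+ y)"
proof -
 have c: "!!n. s n .: A" "x .: A" "!!n. t n .: A" "y .: A"
  and l: "(%n. nA (s n .- x)) ----> 0" "(%n. nA (t n .- y)) ----> 0" using assms by (auto simp: converges_def)
 have eq: "s n .+ t n .- (x .+ y) = (s n .- x) .+ (t n .- y)" for n using c(1)[of n] c(3)[of n] c(2,4) by algebra
 have "(%n. nA (s n .+ t n .- (x .+ y))) ----> 0" proof (rule tendsto_sandwich[OF _ _ tendsto_const])
  show "(%n. nA (s n .- x) + nA (t n .- y)) ----> 0" using tendsto_add[OF l] by simp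
 qed (use c nrm_triangle nrm_nonneg eq in "auto intro!: always_eventually")
 thus ?thesis using c by (simp add: converges_def)
qed

lemma converges_smult: assumes "converges s x" shows "converges (%n. c *. s n) (c *. x)"
proof -
 have c: "!!n. s n .: A" "x .: A" and l: "(%n. nA (s n .- x)) ----> 0" using assms by (auto simp: converges_def)
 have "(%n. nA (c *. s n .- c *. x)) = (%n. cmod c * nA (s n .- x))"
  using c by (simp add: sm_diff_r[symmetric] nrm_smult)
 also have "... ----> 0" using tendsto_mult_right_zero[OF l] .
 finally show ?thesis using c by (simp add: converges_def)
qed

lemma converges_star: assumes "converges s x" shows "converges (%n. sA (s n)) (sA x)"
 using assms by (simp add: converges_def star_diff[symmetric])

lemma converges_nrm: assumes "converges s x" shows "(%n. nA (s n)) ----> nA x"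
proof -
 have c: "!!n. s n .: A" "x .: A" and l: "(%n. nA (s n .- x)) ----> 0" using assms by (auto simp: converges_def)
 have "\<bar>nA (s n) - nA x\<bar> <= nA (s n .- x)" for n
  using nrm_le_diff[of "s n" x] nrm_le_diff[of x "s n"] c by (simp add: nrm_diff_commute abs_le_iff)
 hence "(%n. nA (s n) - nA x) ----> 0"
  by (intro tendsto_sandwich[OF _ _ tendsto_const l, THEN tendsto_rabs_zero_cancel]) auto
 thus ?thesis by (simp add: LIM_zero_iff)
qed

lemma converges_mult: assumes "converges s x" "converges t y" shows "converges (%n. s n ** t n) (x ** y)"
proof -
 have c: "!!n. s n .: A" "x .: A" "!!n. t n .: A" "y .: A"
  and l: "(%n. nA (s n .- x)) ----> 0" "(%n. nA (t n .- y)) ----> 0" using assms by (auto simp: converges_def)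
 have le: "nA (s n ** t n .- x ** y)
   <= nA (s n .- x) * nA (t n) + nA x * nA (t n .- y)" for n unfolding mult_diff[OF c(1,3,2,4)]
  by (rule order_trans[OF nrm_triangle add_mono]) (auto intro: nrm_mult c)
 have "(%n. nA (s n .- x) * nA (t n) + nA x * nA (t n .- y)) ----> 0 * nA y + nA x * 0"
  by (intro tendsto_intros l converges_nrm[OF assms(2)])
 hence lim: "(%n. nA (s n .- x) * nA (t n) + nA x * nA (t n .- y)) ----> 0" by simp
 have "(%n. nA (s n ** t n .- x ** y)) ----> 0"
  by (rule tendsto_sandwich[OF _ _ tendsto_const lim]) (use le c nrm_nonneg in "auto intro!: always_eventually")
 thus ?thesis using c by (simp add: converges_def)
qed

lemma converges_Suc:
 "converges s x ==> converges (%n. s (Suc n)) x" unfolding converges_def using LIMSEQ_Suc by fastforce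

text \<open>Telescoping bounds the distance of two terms by an increment of \<open>t\<close>, which
  is Cauchy. It serves the square root iteration and, later, the coordinatewise limits behind
  completeness of the ultrapower.\<close>

lemma converges_mono_bound: assumes s: "!!n. s n .: A" and t: "convergent t"
  and le: "!!n. nA (s (Suc n) .- s n) <= t (Suc n) - t n" obtains x where "converges s x"
proof -
 have le2: "nA (s (n + k) .- s n) <= t (n + k) - t n" for n k proof (induction k)
  case 0 thus ?case using s by (simp add: minus_eq r_neg)
 next
  case (Suc k)
  thus ?case using nrm_diff_trans[of "s (Suc (n + k))" "s (n + k)" "s n"] le[of "n + k"] s by simp
 qed
 have "\<exists>N. \<forall>m\<ge>N. \<forall>n\<ge>N. nA (s m .- s n) < e" if e: "e > 0" for e proof -
  have "Cauchy t" using t by (simp add: Cauchy_convergent_iff)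
  then obtain N where N: "!!m n. m >= N ==> n >= N ==> \<bar>t m - t n\<bar> < e"
   using e unfolding Cauchy_def dist_real_def by meson
  have *: "nA (s m .- s n) < e" if "n >= N" "m >= n" for m n using le2[of n "m - n"] N[of m n] that by simp
  have "nA (s m .- s n) < e" if "n >= N" "m >= N" for m n
   using *[of n m] *[of m n] that s nrm_diff_commute[of "s m" "s n"] by (cases "m <= n") auto
  thus ?thesis by auto
 qed
 from complete[OF s this] obtain x where "x .: A" "(%n. nA (s n .- x)) ----> 0" by auto
 thus ?thesis using s that by (simp add: converges_def)
qed

section \<open>Square roots, complementary elements and absolute values\<close>

definition self_adjoint :: "'a => bool" where "self_adjoint x <-> x .: A & sA x = x"

definition commutes :: "'a => 'a => bool" where "commutes x y <-> x ** y = y ** x"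

lemma one_minus_square: assumes "s .: A" "k .: A" "s = (1/2) *. (k .+ s ** s)"
 shows "(\<one> .- s) ** (\<one> .- s) = \<one> .- k"
proof -
 have "s .+ s = 2 *. s" using assms(1) by (rule sm_twice)
 also have "... = 2 *. ((1/2) *. (k .+ s ** s))" using assms(3) by simp
 also have "... = k .+ s ** s" using assms(1,2) by simp
 finally have *: "s ** s = \<ominus> k .+ (s .+ s)" using assms(1,2) by algebra
 have "(\<one> .- s) ** (\<one> .- s) = \<one> .- s .- s .+ s ** s" using assms(1) by (simp add: ring_nf)
 also have "... = \<one> .- k" unfolding * using assms(1,2) by algebra
 finally show ?thesis .
qed

text \<open>The square root of \<open>1 - k\<close> is \<open>1 - s\<close> for the limit \<open>s\<close> of \<open>y \<mapsto> (k + y\<^sup>2) / 2\<close>; the same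
  iteration started with the real number 1 in place of \<open>k\<close> majorises it.\<close>

lemma ex_sqrt_one_minus: assumes k: "self_adjoint k" and k1: "nA k <= 1"
 obtains s where "self_adjoint s" "nA s <= 1" "(\<one> .- s) ** (\<one> .- s) = \<one> .- k"
  "!!x. x .: A ==> commutes x k ==> commutes x s"
proof -
 define y where "y = rec_nat \<zero> (%n y. (1/2) *. (k .+ y ** y))"
 define t where "t = rec_nat (0::real) (%n t. (1 + t\<^sup>2) / 2)"
 have y_simps: "y 0 = \<zero>" "!!n. y (Suc n) = (1/2) *. (k .+ y n ** y n)" by (simp_all add: y_def)
 have t_simps: "t 0 = 0" "!!n. t (Suc n) = (1 + (t n)\<^sup>2) / 2" by (simp_all add: t_def)
 have kc [simp]: "k .: A" and ks: "sA k = k" using k by (auto simp: self_adjoint_def)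
 have yc [simp]: "y n .: A" for n by (induction n) (auto simp: y_simps)
 have t01: "0 <= t n & t n <= 1" for n by (induction n) (auto simp: t_simps power_le_one)
 have yt: "nA (y n) <= t n" for n proof (induction n)
  case (Suc n)
  have "nA (k .+ y n ** y n) <= 1 + t n * t n"
   using nrm_triangle[of k "y n ** y n"] k1 nrm_mult_le[OF _ _ Suc Suc] by simp
  thus ?case by (simp add: y_simps t_simps nrm_smult power2_eq_square)
 qed (simp add: y_simps t_simps)
 have dif: "nA (y (Suc n) .- y n) <= t (Suc n) - t n" for n proof (induction n)
  case 0
  show ?case using k1 by (simp add: y_simps t_simps nrm_smult minus_eq)
 next
  case (Suc n)
  let ?a = "y (Suc n)" and ?b = "y n"
  have "y (Suc (Suc n)) .- ?a = (1/2) *. ((k .+ ?a ** ?a) .- (k .+ ?b ** ?b))"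
   by (subst sm_diff_r) (auto simp flip: y_simps)
  also have "(k .+ ?a ** ?a) .- (k .+ ?b ** ?b) = (?a .- ?b) ** ?a .+ ?b ** (?a .- ?b)"
   using kc yc[of "Suc n"] yc[of n] by algebra
  finally have "nA (y (Suc (Suc n)) .- ?a)
    <= (1/2) * (nA ((?a .- ?b) ** ?a) + nA (?b ** (?a .- ?b)))"
   using nrm_triangle[of "(?a .- ?b) ** ?a" "?b ** (?a .- ?b)"] by (simp add: nrm_smult)
  also have "... <= (1/2) * ((t (Suc n) - t n) * t (Suc n) + t n * (t (Suc n) - t n))"
   by (intro mult_left_mono add_mono nrm_mult_le yt Suc) auto
  also have "... = t (Suc (Suc n)) - t (Suc n)"
   unfolding t_simps(2)[of "Suc n"] t_simps(2)[of n] by (simp add: field_simps power2_eq_square)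
  finally show ?case .
 qed
 have "incseq t" by (rule incseq_SucI) (use dif nrm_nonneg in "meson yc diff_ge_0_iff_ge minus_closed order_trans")
 hence "convergent t" using t01 by (meson incseq_convergent convergentI)
 then obtain s where s: "converges y s" using converges_mono_bound[of y t] dif by auto
 hence sc [simp]: "s .: A" by (simp add: converges_def)
 have "converges (%n. y (Suc n)) ((1/2) *. (k .+ s ** s))"
  unfolding y_simps by (intro converges_smult converges_add converges_mult converges_const s) simp
 with converges_Suc[OF s] have seq: "s = (1/2) *. (k .+ s ** s)" using converges_unique by blast
 have "sA (y n) = y n" for n by (induction n) (simp_all add: y_simps star_smult star_add star_mult ks)
 with converges_star[OF s] s have "sA s = s" using converges_unique by (metis (no_types, lifting) ext)
 moreover have "nA s <= 1" by (rule LIMSEQ_le_const2[OF converges_nrm[OF s]]) (use yt t01 in "meson order_trans")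
 moreover have "commutes x s" if x: "x .: A" and xk: "commutes x k" for x proof -
  have xy: "x ** y n = y n ** x" for n proof (induction n)
   case (Suc n)
   have "x ** (y n ** y n) = (y n ** y n) ** x" using Suc x by (metis m_assoc yc)
   thus ?case using x xk Suc by (simp add: y_simps commutes_def r_distr l_distr)
  qed (use x in "simp add: y_simps")
  have "converges (%n. x ** y n) (x ** s)" "converges (%n. x ** y n) (s ** x)"
   using converges_mult[OF converges_const[OF x] s] converges_mult[OF s converges_const[OF x]] by (simp_all add: xy)
  thus ?thesis unfolding commutes_def using converges_unique by blast
 qed
 ultimately show ?thesis using that[of s] one_minus_square[OF sc kc seq] by (auto simp: self_adjoint_def)
qed

text \<open>The element \<open>u = a + i b\<close> satisfies u* u = c, so its norm squared is at
  most c by the C*-identity, and \<open>a\<close> is its real part. In this way algebraic identities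
  give norm bounds in place of spectral arguments.\<close>

lemma commuting_circle: assumes a: "self_adjoint a" and b: "self_adjoint b" and ab: "commutes a b"
  and eq: "a ** a .+ b ** b = complex_of_real c *. \<one>" and c: "c >= 0" shows "(nA a)\<^sup>2 <= c"
proof -
 have ac [simp]: "a .: A" "b .: A" and st: "sA a = a" "sA b = b" and ab': "b ** a = a ** b"
  using a b ab by (auto simp: self_adjoint_def commutes_def)
 define u where "u = a .+ \<i> *. b"
 define v where "v = a .+ (- \<i>) *. b"
 have uc [simp]: "u .: A" "v .: A" by (simp_all add: u_def v_def)
 have us: "sA u = v" by (simp add: u_def v_def star_add star_smult st)
 have "v ** u = a ** a .+ (\<i> *. (a ** b) .+ ((- \<i>) *. (a ** b) .+ b ** b))"
  by (simp add: u_def v_def l_distr r_distr ab' sm_add_r a_ac)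
 also have "... = a ** a .+ b ** b" by (simp add: sm_uminus_l r_neg2)
 finally have "(nA u)\<^sup>2 = nA (complex_of_real c *. \<one>)" using cstar_identity[of u] us eq by simp
 also have "... <= c" using nrm_one_le c by (simp add: nrm_smult mult_left_le)
 finally have u2: "(nA u)\<^sup>2 <= c" .
 have "u .+ v = 2 *. a" proof -
  have "u .+ v = a .+ a .+ (\<i> *. b .+ (- \<i>) *. b)" by (simp add: u_def v_def a_ac)
  thus ?thesis by (simp add: sm_uminus_l r_neg sm_twice)
 qed
 hence "2 * nA a = nA (u .+ v)" by (simp add: nrm_smult)
 also have "... <= 2 * nA u" using nrm_triangle[of u v] us nrm_star[of u] by simp
 finally have au: "nA a <= nA u" by simp
 show ?thesis using u2 power_mono[OF au, of 2] nrm_nonneg[of a] by simp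
qed

text \<open>Take the square root of 1 - y^2; together with \<open>y\<close> it lies on the unit
  circle, which bounds its norm. Whatever commutes with \<open>y\<close> commutes with y^2, so the
  commutation clause is inherited from the square root.\<close>

lemma ex_complementary: assumes y: "self_adjoint y" and y1: "nA y <= 1"
 obtains v where "self_adjoint v" "v ** v = \<one> .- y ** y"
  "!!x. x .: A ==> commutes x y ==> commutes x v" "nA v <= 1"
proof -
 have yc [simp]: "y .: A" and ys: "sA y = y" using y by (auto simp: self_adjoint_def)
 have yy: "self_adjoint (y ** y)" by (simp add: self_adjoint_def star_mult ys)
 have "nA (y ** y) <= 1" using nrm_mult_le[of y y 1 1] y1 by simp
 then obtain s where s: "self_adjoint s" "(\<one> .- s) ** (\<one> .- s) = \<one> .- y ** y"
  and com: "!!x. x .: A ==> commutes x (y ** y) ==> commutes x s" using ex_sqrt_one_minus[OF yy] by metis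
 have sc [simp]: "s .: A" using s by (simp add: self_adjoint_def)
 define v where "v = \<one> .- s"
 have v: "self_adjoint v" using s by (simp add: v_def self_adjoint_def star_diff)
 have vc [simp]: "v .: A" by (simp add: v_def)
 have vcom: "commutes x v" if x: "x .: A" and xy: "commutes x y" for x proof -
  have "x ** (y ** y) = (y ** y) ** x" using x xy unfolding commutes_def by (metis m_assoc yc)
  hence "commutes x s" using com[OF x] by (simp add: commutes_def)
  thus ?thesis using x by (simp add: commutes_def v_def r_minus l_minus minus_eq r_distr l_distr)
 qed
 have "commutes v y" using vcom[of y] by (simp add: commutes_def)
 moreover have "v ** v .+ y ** y = complex_of_real 1 *. \<one>" using s(2) by (simp add: v_def minus_eq a_assoc l_neg)
 ultimately have "(nA v)\<^sup>2 <= 1" using commuting_circle[OF v y] by simp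
 hence "nA v <= 1" by (rule square_le_1_imp)
 thus ?thesis using that[of v] v vcom s(2) by (auto simp: v_def)
qed

text \<open>With q^2 = 1 - w^2, the square root of 1 - q^2 is the absolute value of
  \<open>w\<close>. The bound on \<open>\<one> .- m\<close> is kept because it makes a square root
  of \<open>m\<close> itself available, by taking \<open>k = \<one> .- m\<close> in
  \<open>ex_sqrt_one_minus\<close>.\<close>

lemma ex_abs: assumes w: "self_adjoint w" and w1: "nA w <= 1"
 obtains m where "self_adjoint m" "m ** m = w ** w" "nA (\<one> .- m) <= 1"
  "!!x. x .: A ==> commutes x w ==> commutes x m"
proof -
 have wc [simp]: "w .: A" using w by (auto simp: self_adjoint_def)
 obtain q where q: "self_adjoint q" "q ** q = \<one> .- w ** w" "nA q <= 1"
  and qcom: "!!x. x .: A ==> commutes x w ==> commutes x q" using ex_complementary[OF w w1] by metis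
 obtain v s where s: "self_adjoint s" "nA s <= 1" "(\<one> .- s) ** (\<one> .- s) = \<one> .- q ** q"
  and scom: "!!x. x .: A ==> commutes x (q ** q) ==> commutes x s" proof -
  have qc: "q .: A" "sA q = q" using q by (auto simp: self_adjoint_def)
  have "self_adjoint (q ** q)" using qc by (simp add: self_adjoint_def star_mult)
  moreover have "nA (q ** q) <= 1" using nrm_mult_le[of q q 1 1] q(3) qc by simp
  ultimately show ?thesis using ex_sqrt_one_minus[of "q ** q"] that by metis
 qed
 have sc [simp]: "s .: A" "sA s = s" using s by (auto simp: self_adjoint_def)
 have qc [simp]: "q .: A" using q by (auto simp: self_adjoint_def)
 have "self_adjoint (\<one> .- s)" by (simp add: self_adjoint_def star_diff)
 moreover have "(\<one> .- s) ** (\<one> .- s) = w ** w" unfolding s(3) q(2) using wc by algebra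
 moreover have "\<one> .- (\<one> .- s) = s" using sc(1) by algebra
 moreover have "commutes x (\<one> .- s)" if x: "x .: A" and xw: "commutes x w" for x proof -
  have "x ** (q ** q) = (q ** q) ** x" using x qcom[OF x xw] unfolding commutes_def by (metis m_assoc qc)
  hence "commutes x s" using scom[OF x] by (simp add: commutes_def)
  thus ?thesis using x by (simp add: commutes_def r_minus l_minus minus_eq r_distr l_distr)
 qed
 ultimately show ?thesis using that[of "\<one> .- s"] s(2) by auto
qed

section \<open>Closures, subalgebras and generated subalgebras\<close>

definition cs_closure :: "'a set => 'a set"
 where "cs_closure V = {x \<in> carrier A. \<forall>e>0. \<exists>v\<in>V. nA (x .- v) < e}"

lemma cs_closure_converges: assumes V: "V <= carrier A"
 shows "x : cs_closure V <-> (\<exists>s. (\<forall>n. s n : V) & converges s x)"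
proof
 assume x: "x : cs_closure V"
 hence xc: "x .: A" by (simp add: cs_closure_def)
 have "\<forall>n. \<exists>v\<in>V. nA (x .- v) < 1 / Suc n" using x by (auto simp: cs_closure_def)
 then obtain s where s: "!!n. s n : V" "!!n. nA (x .- s n) < 1 / Suc n" by metis
 have sc: "!!n. s n .: A" using s V by blast
 have "(%n. nA (s n .- x)) ----> 0" by (rule tendsto_sandwich[OF _ _ tendsto_const LIMSEQ_Suc[OF lim_1_over_n]])
   (use s(2) sc xc nrm_nonneg nrm_diff_commute[OF _ xc] in
    \<open>auto intro!: always_eventually simp: less_imp_le\<close>)
 thus "\<exists>s. (\<forall>n. s n : V) & converges s x" using s sc xc by (auto simp: converges_def)
next
 assume "\<exists>s. (\<forall>n. s n : V) & converges s x"
 then obtain s where s: "!!n. s n : V" "converges s x" by auto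
 have c: "x .: A" "!!n. s n .: A" using s(2) by (auto simp: converges_def)
 show "x : cs_closure V" unfolding cs_closure_def proof (intro CollectI conjI allI impI c)
  fix e :: real assume "e > 0"
  hence "eventually (%n. nA (s n .- x) < e) sequentially"
   using s(2) by (intro order_tendstoD) (auto simp: converges_def)
  then obtain n where "nA (s n .- x) < e" by (auto simp: eventually_sequentially)
  thus "\<exists>v\<in>V. nA (x .- v) < e" using s(1)[of n] c nrm_diff_commute by metis
 qed
qed

lemma cs_closure_limit: assumes "V <= carrier A" "!!n. s n : V" "converges s x" shows "x : cs_closure V"
 using assms cs_closure_converges[of V x] by blast

lemma cs_closure_superset: "V <= carrier A ==> V <= cs_closure V"
 by (auto simp: cs_closure_def minus_eq r_neg subset_iff intro!: bexI)

lemma unital_cstar_subalgebraI: assumes "B <= carrier A" "\<one> : B" "!!x y. x : B ==> y : B ==> x .+ y : B"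
  "!!x y. x : B ==> y : B ==> x ** y : B" "!!c x. x : B ==> c *. x : B"
  "!!x. x : B ==> sA x : B" "!!s x. (!!n. s n : B) ==> converges s x ==> x : B" shows "unital_cstar_subalgebra B A"
 unfolding unital_cstar_subalgebra_def
proof (intro conjI allI ballI impI)
 show "subring B A" proof (rule subringI)
  show "\<ominus> h : B" if "h : B" for h
   using assms(5)[OF that, of "-1"] that assms(1) by (simp add: minus_sm subset_iff)
 qed (use assms in auto)
 show "x : B" if "x .: A" "(\<forall>n. s n : B) & (%n. nA (s n .- x)) ----> 0" for s x
  using that assms(1) by (intro assms(7)[of s x]) (auto simp: converges_def)
qed (use assms in auto)

lemma unital_cstar_subalgebraD: assumes "unital_cstar_subalgebra B A"
 shows "B <= carrier A" "\<one> : B" "\<zero> : B" "!!x y. x : B ==> y : B ==> x .+ y : B"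
  "!!x y. x : B ==> y : B ==> x ** y : B" "!!c x. x : B ==> c *. x : B"
  "!!x. x : B ==> sA x : B" "!!s x. (!!n. s n : B) ==> converges s x ==> x : B"
  "!!x. x : B ==> \<ominus> x : B" "!!x y. x : B ==> y : B ==> x .- y : B"
proof -
 have r: "subring B A" using assms by (simp add: unital_cstar_subalgebra_def)
 note r' = subringE[OF r]
 show "B <= carrier A" "\<one> : B" "\<zero> : B" "!!x y. x : B ==> y : B ==> x .+ y : B"
  "!!x y. x : B ==> y : B ==> x ** y : B" "!!x. x : B ==> \<ominus> x : B"
  "!!x y. x : B ==> y : B ==> x .- y : B" using r' by (auto simp: minus_eq)
 show "!!c x. x : B ==> c *. x : B" "!!x. x : B ==> sA x : B"
  "!!s x. (!!n. s n : B) ==> converges s x ==> x : B"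
  using assms unfolding unital_cstar_subalgebra_def converges_def by blast+
qed

lemma unital_cstar_subalgebra_carrier: "unital_cstar_subalgebra (carrier A) A"
 by (rule unital_cstar_subalgebraI) (auto simp: converges_def)

lemma unital_cstar_subalgebra_closure:
 assumes V: "V <= carrier A" "\<one> : V" "!!x y. x : V ==> y : V ==> x .+ y : V"
  "!!x y. x : V ==> y : V ==> x ** y : V" "!!c x. x : V ==> c *. x : V"
  "!!x. x : V ==> sA x : V" shows "unital_cstar_subalgebra (cs_closure V) A"
proof (rule unital_cstar_subalgebraI)
 note cc = cs_closure_converges[OF V(1)]
 show "cs_closure V <= carrier A" by (auto simp: cs_closure_def)
 show "\<one> : cs_closure V" using cs_closure_superset V by blast
 show "x .+ y : cs_closure V" "x ** y : cs_closure V" if xy: "x : cs_closure V" "y : cs_closure V" for x y proof -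
  obtain s t where st: "!!n. s n : V" "converges s x" "!!n. t n : V" "converges t y" using xy[unfolded cc] by metis
  show "x .+ y : cs_closure V" by (rule cs_closure_limit[OF V(1) _ converges_add[OF st(2,4)]]) (intro V(3) st)
  show "x ** y : cs_closure V" by (rule cs_closure_limit[OF V(1) _ converges_mult[OF st(2,4)]]) (intro V(4) st)
 qed
 show "c *. x : cs_closure V" "sA x : cs_closure V" if x: "x : cs_closure V" for c x proof -
  obtain s where st: "!!n. s n : V" "converges s x" using x[unfolded cc] by metis
  show "c *. x : cs_closure V" by (rule cs_closure_limit[OF V(1) _ converges_smult[OF st(2)]]) (intro V(5) st)
  show "sA x : cs_closure V" by (rule cs_closure_limit[OF V(1) _ converges_star[OF st(2)]]) (intro V(6) st)
 qed
 show "x : cs_closure V" if s: "!!n. s n : cs_closure V" "converges s x" for s x unfolding cs_closure_def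
 proof (intro CollectI conjI allI impI)
  show xc: "x .: A" using s(2) by (simp add: converges_def)
  fix e :: real assume e: "e > 0"
  have "eventually (%n. nA (s n .- x) < e/2) sequentially"
   using s(2) e by (intro order_tendstoD) (auto simp: converges_def)
  then obtain n where n: "nA (s n .- x) < e/2" by (auto simp: eventually_sequentially)
  have sc: "s n .: A" using s(2) by (simp add: converges_def)
  obtain v where v: "v : V" "nA (s n .- v) < e/2"
   using s(1)[of n] e by (auto simp: cs_closure_def dest!: spec[of _ "e/2"])
  hence "nA (x .- v) < e" using nrm_diff_trans[of x "s n" v] n xc sc V nrm_diff_commute[of x "s n"] by auto
  thus "\<exists>v\<in>V. nA (x .- v) < e" using v by auto
 qed
qed

end

context cstar_algebra
begin

lemma cstar_generated_subalgebra: assumes "S <= carrier A" shows "unital_cstar_subalgebra (cstar_generated A S) A"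
proof (rule unital_cstar_subalgebraI)
 show "cstar_generated A S <= carrier A"
  using unital_cstar_subalgebra_carrier assms by (auto simp: cstar_generated_def)
 show "x : cstar_generated A S" if "!!n. s n : cstar_generated A S" "converges s x" for s x
  using that unfolding cstar_generated_def by (blast intro: unital_cstar_subalgebraD(8))
qed (auto simp: cstar_generated_def dest: unital_cstar_subalgebraD)

lemma cstar_generated_superset: "S <= cstar_generated A S" by (auto simp: cstar_generated_def)

lemma cstar_generated_least:
 "unital_cstar_subalgebra B A ==> S <= B ==> cstar_generated A S <= B" by (auto simp: cstar_generated_def)

abbreviation restr :: "'a set => 'a cstar" where "restr B == A\<lparr>carrier := B\<rparr>"

text \<open>Shrinking the carrier leaves sums, products, adjoints and norms untouched, but negation
  in a ring record is defined through the carrier. Hence agreement of negation and subtraction has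
  to be proved before completeness can be transferred.\<close>

lemma assumes "unital_cstar_subalgebra B A" shows restr_cstar_algebra: "cstar_algebra (restr B)"
  and restr_minus: "!!x. x : B ==> \<ominus>\<^bsub>restr B\<^esub> x = \<ominus> x"
  and restr_diff: "!!x y. x : B ==> y : B ==> x .-@(restr B) y = x .- y"
proof -
 note D' = unital_cstar_subalgebraD[OF assms]
 note D = D'(1-7,9,10)
 have Bc [simp]: "!!x. x : B ==> x .: A" using D(1) by blast
 have ag: "abelian_group (restr B)" proof (rule abelian_groupI)
  show "\<exists>y\<in>carrier (restr B). y .+@(restr B) x = 0@(restr B)" if "x .: (restr B)" for x
   using that D(8)[of x] by (intro bexI[of _ "\<ominus> x"]) (auto simp: l_neg)
 qed (use D in "simp_all add: a_ac")
 have rg: "ring (restr B)" proof (rule ringI[OF ag])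
  show "monoid (restr B)" by (rule monoidI) (use D in "simp_all add: m_assoc")
 qed (use D in "simp_all add: l_distr r_distr")
 interpret R: ring "restr B" by (rule rg)
 show m: "\<ominus>\<^bsub>restr B\<^esub> x = \<ominus> x" if "x : B" for x
  using R.minus_equality[of "\<ominus> x" x] D(8)[OF that] that by (simp add: l_neg)
 thus d: "x .-@(restr B) y = x .- y" if "x : B" "y : B" for x y using that by (simp add: minus_eq a_minus_def)
 have md: "Module.module complex_ring (restr B)"
  by (rule moduleI) (use D ag sm_add_l sm_add_r cring_from_type_algebra in auto)
 show "cstar_algebra (restr B)" proof (intro cstar_algebra.intro rg md cstar_algebra_axioms.intro)
  fix s :: "nat => 'a"
  assume s: "!!n. s n .: (restr B)" and
   c: "!!e. e > 0 ==> \<exists>N. \<forall>m\<ge>N. \<forall>n\<ge>N. nrm (restr B) (s m .-@(restr B) s n) < e"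
  have "\<exists>x\<in>carrier A. (%n. nA (s n .- x)) ----> 0" using s c d by (intro complete) auto
  then obtain x where x: "converges s x" using s by (auto simp: converges_def)
  hence "x : B" using s D'(8)[of s x] by simp
  thus "\<exists>x\<in>carrier (restr B). (%n. nrm (restr B) (s n .-@(restr B) x)) ----> 0"
   using x s d by (auto simp: converges_def intro!: bexI[of _ x])
 qed (use D star_add star_smult star_mult nrm_nonneg nrm_eq_0_iff nrm_triangle nrm_smult nrm_mult
    cstar_identity in auto)
qed

lemma restr_subalgebra: assumes B: "unital_cstar_subalgebra B A" and C: "unital_cstar_subalgebra C A" and "C <= B"
 shows "unital_cstar_subalgebra C (restr B)"
proof -
 interpret R: cstar_algebra "restr B" by (rule restr_cstar_algebra[OF B])
 note D = unital_cstar_subalgebraD[OF C] and DB = unital_cstar_subalgebraD[OF B]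
 show ?thesis proof (rule R.unital_cstar_subalgebraI)
  show "x : C" if "!!n. s n : C" "R.converges s x" for s x
   by (rule D(8)[of s]) (use that DB(1) D(1) \<open>C <= B\<close> in
    \<open>auto simp: converges_def R.converges_def restr_diff[OF B] subset_iff\<close>)
 qed (use D(1-7) DB(1-7) \<open>C <= B\<close> in auto)
qed

lemma restr_subalgebra_imp: assumes B: "unital_cstar_subalgebra B A" and C: "unital_cstar_subalgebra C (restr B)"
 shows "unital_cstar_subalgebra C A" "C <= B"
proof -
 interpret R: cstar_algebra "restr B" by (rule restr_cstar_algebra[OF B])
 note D = R.unital_cstar_subalgebraD[OF C] and DB = unital_cstar_subalgebraD[OF B]
 show CB: "C <= B" using D(1) by simp
 have lim: "x : C" if s: "!!n. s n : C" "converges s x" for s x proof (rule D(8)[OF s(1)])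
  have sB: "s n : B" for n using s(1) CB by blast
  hence "x : B" by (rule DB(8)[OF _ s(2)])
  thus "R.converges s x" using s(2) sB by (auto simp: converges_def R.converges_def restr_diff[OF B])
 qed
 show "unital_cstar_subalgebra C A" proof (rule unital_cstar_subalgebraI)
  show "x : C" if "!!n. s n : C" "converges s x" for s x by (rule lim[OF that])
 qed (use D(1-7) DB(1-7) CB in auto)
qed

lemma restr_generated: assumes B: "unital_cstar_subalgebra B A" and S: "S <= B"
 shows "cstar_generated (restr B) S = cstar_generated A S"
proof
 interpret R: cstar_algebra "restr B" by (rule restr_cstar_algebra[OF B])
 have SA: "S <= carrier A" using S unital_cstar_subalgebraD(1)[OF B] by blast
 show "cstar_generated (restr B) S <= cstar_generated A S"
  using R.cstar_generated_least restr_subalgebra[OF B cstar_generated_subalgebra[OF SA]]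
   cstar_generated_least[OF B S] cstar_generated_superset by metis
 show "cstar_generated A S <= cstar_generated (restr B) S"
  using cstar_generated_least restr_subalgebra_imp(1)[OF B] R.cstar_generated_subalgebra[of S] S
   R.cstar_generated_superset by simp
qed

end

section \<open>Homomorphisms of C*-algebras: contractivity and isometry\<close>

locale cstar_hom_pair = A: cstar_algebra A + B: cstar_algebra B
 for A :: "'a cstar" (structure) and B :: "'b cstar" +
 fixes f :: "'a => 'b" assumes hom: "f : cstar_hom A B"
begin

lemma hom_simps [simp]:
 "x .: A ==> f x .: B"
 "x .: A ==> y .: A ==> f (x .+@A y) = f x .+@B f y"
 "x .: A ==> y .: A ==> f (x **@A y) = f x **@B f y"
 "x .: A ==> f (c *.@A x) = c *.@B f x"
 "x .: A ==> f (sA x) = star B (f x)"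
 "f 1@A = 1@B" using hom by (auto simp: cstar_hom_def ring_hom_def)

lemma hom_zero [simp]: "f 0@A = 0@B" using hom_simps(4)[of "0@A" 0] by (simp del: hom_simps(4))

lemma hom_diff [simp]: "x .: A ==> y .: A ==> f (x .-@A y) = f x .-@B f y" by (simp add: A.diff_sm B.diff_sm)

lemma hom_self_adjoint: "A.self_adjoint x ==> B.self_adjoint (f x)"
 unfolding A.self_adjoint_def B.self_adjoint_def by (metis hom_simps(1,5))

lemma hom_commutes:
 "x .: A ==> y .: A ==> A.commutes x y ==> B.commutes (f x) (f y)"
 unfolding A.commutes_def B.commutes_def by (metis hom_simps(3))

text \<open>Normalising \<open>x\<close> and completing \<open>y = x\<^sup>*x\<close> to \<open>y\<^sup>2 + v\<^sup>2 = 1\<close> exhibits \<open>f y\<close> as the real part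
  of a unitary.\<close>

lemma hom_contractive: assumes x: "x .: A" shows "nrm B (f x) <= nA x"
proof (cases "nA x = 0")
 case True thus ?thesis using x A.nrm_eq_0_iff by simp
next
 case False
 define r where "r = nA x"
 have r: "r > 0" using False A.nrm_nonneg[OF x] by (simp add: r_def)
 define x' where "x' = complex_of_real (1 / r) *.@A x"
 have x' [simp]: "x' .: A" and n1: "nA x' = 1"
  using x r by (simp_all add: x'_def A.nrm_smult norm_divide) (simp add: r_def)
 define y where "y = sA x' **@A x'"
 have yc [simp]: "y .: A" and y: "A.self_adjoint y" and y1: "nA y <= 1"
  using n1 by (simp_all add: y_def A.self_adjoint_def A.star_mult A.cstar_identity)
 obtain v where v: "A.self_adjoint v" "v **@A v = 1@A .-@A y **@A y" "A.commutes y v"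
  using A.ex_complementary[OF y y1] yc by (metis A.commutes_def)
 have vc [simp]: "v .: A" using v by (simp add: A.self_adjoint_def)
 have "y **@A y .+@A v **@A v = 1@A" unfolding v(2) using yc A.one_closed by algebra
 hence "f y **@B f y .+@B f v **@B f v = complex_of_real 1 *.@B 1@B" by (simp flip: hom_simps)
 hence "(nrm B (f y))\<^sup>2 <= 1" by (intro B.commuting_circle[OF hom_self_adjoint[OF y] hom_self_adjoint[OF v(1)]])
   (auto intro: hom_commutes v)
 hence "nrm B (f y) <= 1" by (rule square_le_1_imp)
 hence "(nrm B (f x'))\<^sup>2 <= 1" by (simp add: y_def flip: B.cstar_identity)
 hence "nrm B (f x') <= 1" by (rule square_le_1_imp)
 thus ?thesis using r x by (simp add: x'_def B.nrm_smult norm_divide r_def field_simps)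
qed

text \<open>If \<open>f\<close> decreased the norm of \<open>y = x\<^sup>*x\<close>, it would kill the positive part of \<open>y\<^sup>2 - d\<close> for
  some \<open>d < \<parallel>y\<^sup>2\<parallel>\<close>; by injectivity \<open>d - y\<^sup>2\<close> would be a square, forcing \<open>\<parallel>y\<parallel>\<^sup>2 \<le> d\<close>.\<close>

lemma inj_isometric_aux: assumes inj: "inj_on f (carrier A)" and proper: "!!a b. a .: B ==> b .: B ==>
   star B a **@B a .+@B star B b **@B b = 0@B ==> a = 0@B"
  and y: "A.self_adjoint y" and y1: "nA y = 1" and d: "0 < d" "d < 1" shows "(nrm B (f y))\<^sup>2 > d"
proof (rule ccontr)
 assume "\<not> ?thesis"
 hence fd: "(nrm B (f y))\<^sup>2 <= d" by simp
 have yc [simp]: "y .: A" and ys [simp]: "sA y = y" using y by (auto simp: A.self_adjoint_def)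
 define K where "K = y **@A y"
 have Kc [simp]: "K .: A" and Ks [simp]: "sA K = K" by (simp_all add: K_def A.star_mult)
 define dd where "dd = complex_of_real d *.@A 1@A"
 have dc [simp]: "dd .: A" and ds [simp]: "sA dd = dd" by (simp_all add: dd_def A.star_smult)
 \<comment> \<open>\<open>K\<close> and \<open>dd\<close> both have norm at most 1, so halving their
   difference puts \<open>w\<close> into the unit ball, where \<open>ex_abs\<close> applies.\<close>
 define w where "w = (1/2) *.@A (K .-@A dd)"
 have wc [simp]: "w .: A" and w: "A.self_adjoint w"
  by (simp_all add: w_def A.self_adjoint_def A.star_smult A.star_diff)
 have "nA dd <= 1" using A.nrm_one_le d mult_mono[of d 1 "nA 1@A" 1] A.nrm_nonneg by (simp add: dd_def A.nrm_smult)
 moreover have "nA K <= 1" using A.nrm_mult_le[of y y 1 1] y1 by (simp add: K_def)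
 ultimately have w1: "nA w <= 1" using A.nrm_triangle_diff[of K dd] by (simp add: w_def A.nrm_smult)
 obtain m where m: "A.self_adjoint m" "m **@A m = w **@A w" "nA (1@A .-@A m) <= 1"
  and mcom: "!!x. x .: A ==> A.commutes x w ==> A.commutes x m" using A.ex_abs[OF w w1] by metis
 have mc [simp]: "m .: A" and ms [simp]: "sA m = m" using m by (auto simp: A.self_adjoint_def)
 have "A.self_adjoint (1@A .-@A m)" by (simp add: A.self_adjoint_def A.star_diff)
 then obtain s where s: "A.self_adjoint s"
   "(1@A .-@A s) **@A (1@A .-@A s) = 1@A .-@A (1@A .-@A m)"
  and scom: "!!x. x .: A ==> A.commutes x (1@A .-@A m) ==> A.commutes x s" using A.ex_sqrt_one_minus m(3) by metis
 have sc [simp]: "s .: A" "sA s = s" using s by (auto simp: A.self_adjoint_def)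
 define v where "v = 1@A .-@A s"
 have vc [simp]: "v .: A" and vs [simp]: "sA v = v" by (simp_all add: v_def A.star_diff)
 have vv: "v **@A v = m" unfolding v_def s(2) using mc A.one_closed by algebra
 have vcom: "A.commutes x v" if x: "x .: A" and xm: "A.commutes x m" for x proof -
  have "A.commutes x s" using scom[OF x] x xm
   by (simp add: A.commutes_def A.r_minus A.l_minus A.minus_eq A.r_distr A.l_distr)
  thus ?thesis using x by (simp add: A.commutes_def v_def A.r_minus A.l_minus A.minus_eq A.r_distr A.l_distr)
 qed
 have mw: "w **@A m = m **@A w" using mcom[of w] by (simp add: A.commutes_def)
 \<comment> \<open>Here \<open>m\<close> is the absolute value of \<open>w\<close>, so
   \<open>p\<close> is twice the positive part of \<open>w\<close>. Since m^2 = w^2 and the two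
   commute, p m = p w.\<close>
 define p where "p = m .+@A w"
 have pc [simp]: "p .: A" by (simp add: p_def)
 have ps [simp]: "sA p = p" using w by (simp add: p_def A.star_add A.self_adjoint_def)
 have pmw: "p **@A m = p **@A w" using m(2) mw by (simp add: p_def A.l_distr A.a_comm)
 \<comment> \<open>The assumed bound on \<open>f y\<close> makes 1 - f(K)/d a square in the target;
   after rescaling, t^2 = - f w. Then p m = p w says that the squares of \<open>f v **@B f p\<close>
   and \<open>t **@B f p\<close> add up to zero, so \<open>proper\<close> kills both.\<close>
 obtain t0 where t0: "B.self_adjoint t0" "t0 **@B t0 = 1@B .-@B complex_of_real (1/d) *.@B f K" proof -
  define y' where "y' = complex_of_real (1 / sqrt d) *.@B f y"
  have "B.self_adjoint (f y)" using hom_self_adjoint[OF y] .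
  hence y': "B.self_adjoint y'" by (simp add: y'_def B.self_adjoint_def B.star_smult)
  have "nrm B (f y) <= sqrt d" using fd real_le_rsqrt by blast
  hence "nrm B y' <= 1" using d by (simp add: y'_def B.nrm_smult norm_divide)
  then obtain t where "B.self_adjoint t" "t **@B t = 1@B .-@B y' **@B y'" using B.ex_complementary[OF y'] by metis
  moreover have "y' **@B y' = complex_of_real (1/d) *.@B f K" using d by (simp add: y'_def K_def flip: of_real_mult)
  ultimately show ?thesis using that by auto
 qed
 have t0c [simp]: "t0 .: B" "star B t0 = t0" using t0 by (auto simp: B.self_adjoint_def)
 define t where "t = complex_of_real (sqrt (d/2)) *.@B t0"
 have tc [simp]: "t .: B" "star B t = t" by (simp_all add: t_def B.star_smult)
 have tt: "t **@B t = (-1) *.@B f w" proof -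
  have "t **@B t = complex_of_real (d/2) *.@B (t0 **@B t0)" using d by (simp add: t_def flip: of_real_mult)
  thus ?thesis using d by (simp add: t0(2) w_def dd_def B.diff_sm A.diff_sm B.sm_add_r B.a_comm)
 qed
 have eq: "f p **@B f m **@B f p = f p **@B f w **@B f p" using arg_cong[OF pmw, of f] by simp
 have vp: "f v **@B f p = 0@B" and tp: "t **@B f p = 0@B" proof -
  have fs: "star B (f p) = f p" "star B (f v) = f v" by (simp_all flip: hom_simps(5))
  have "star B (f v **@B f p) **@B (f v **@B f p) = f p **@B f m **@B f p"
   by (simp add: B.star_mult fs B.m_assoc flip: vv)
  moreover have "star B (t **@B f p) **@B (t **@B f p) = f p **@B (t **@B t) **@B f p"
   by (simp add: B.star_mult fs B.m_assoc)
  moreover have "f p **@B (t **@B t) **@B f p = \<ominus>\<^bsub>B\<^esub> (f p **@B f w **@B f p)"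
   by (simp add: tt B.minus_sm)
  ultimately have z: "star B (f v **@B f p) **@B (f v **@B f p) .+@B
    star B (t **@B f p) **@B (t **@B f p) = 0@B" using eq by (simp add: B.r_neg)
  show "f v **@B f p = 0@B" by (rule proper[OF _ _ z]) simp_all
  show "t **@B f p = 0@B" by (rule proper[of _ "f v **@B f p"]) (use z in "simp_all add: B.a_comm")
 qed
 have "f (m **@A p) = f v **@B (f v **@B f p)" by (simp add: B.m_assoc flip: vv)
 hence "f (m **@A p) = f 0@A" using vp by (simp del: hom_simps(3))
 hence mp: "m **@A p = 0@A" by (rule inj_onD[OF inj]) simp_all
 have "f ((-1) *.@A (w **@A p)) = (t **@B t) **@B f p" by (simp add: tt)
 also have "... = f 0@A" using tp by (simp add: B.m_assoc)
 finally have "(-1) *.@A (w **@A p) = 0@A" by (rule inj_onD[OF inj]) simp_all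
 hence "(-1) *.@A ((-1) *.@A (w **@A p)) = 0@A" by (simp only: A.sm_zero)
 hence "w **@A p = 0@A" by simp
 moreover have "sA p **@A p = m **@A p .+@A w **@A p" unfolding ps by (subst (1) p_def) (simp add: A.l_distr)
 ultimately have "sA p **@A p = 0@A" using mp by simp
 hence "p = 0@A" using A.cstar_identity[OF pc] A.nrm_eq_0_iff[OF pc] by simp
 hence "\<ominus>\<^bsub>A\<^esub> w = v **@A v" unfolding vv p_def using A.minus_equality[of m w] by simp
 hence "2 *.@A (v **@A v) = 2 *.@A (\<ominus>\<^bsub>A\<^esub> w)" by simp
 also have "... = dd .-@A K" by (simp add: w_def A.minus_sm A.diff_sm A.sm_add_r A.a_comm)
 finally have "2 *.@A (v **@A v) = dd .-@A K" .
 hence eq2: "y **@A y .+@A 2 *.@A (v **@A v) = dd" unfolding K_def[symmetric] using Kc dc by algebra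
 \<comment> \<open>The positive part \<open>p\<close> vanishes, so y^2 + 2 v^2 = d. Thus
   \<open>y\<close> and the rescaled \<open>v'\<close> lie on a circle of squared radius
   \<open>d\<close>, which contradicts the norm 1 of \<open>y\<close>.\<close>
 define v' where "v' = complex_of_real (sqrt 2) *.@A v"
 have "A.commutes y w"
  by (simp add: A.commutes_def w_def dd_def K_def A.minus_eq A.r_distr A.l_distr A.m_assoc A.r_minus A.l_minus)
 hence "A.commutes y v'" using mcom[of y] vcom[of y] by (simp add: v'_def A.commutes_def)
 moreover have "A.self_adjoint v'" by (simp add: v'_def A.self_adjoint_def A.star_smult)
 moreover have "v' **@A v' = 2 *.@A (v **@A v)" by (simp add: v'_def flip: of_real_mult)
 ultimately have "(nA y)\<^sup>2 <= d" using eq2 d by (intro A.commuting_circle[OF y]) (auto simp: dd_def)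
 thus False using y1 d by simp
qed

lemma inj_isometric: assumes inj: "inj_on f (carrier A)" and proper: "!!a b. a .: B ==> b .: B ==>
   star B a **@B a .+@B star B b **@B b = 0@B ==> a = 0@B" and x: "x .: A" shows "nrm B (f x) = nA x"
proof (rule antisym[OF hom_contractive[OF x]], cases "nA x = 0")
 case True thus "nA x <= nrm B (f x)" using x B.nrm_nonneg by simp
next
 case False
 define r where "r = nA x"
 have r: "r > 0" using False A.nrm_nonneg[OF x] by (simp add: r_def)
 define y where "y = complex_of_real (1 / r\<^sup>2) *.@A (sA x **@A x)"
 have yc [simp]: "y .: A" and y: "A.self_adjoint y" and y1: "nA y = 1"
  using x r by (simp_all add: y_def A.self_adjoint_def A.star_mult A.star_smult A.nrm_smult
    A.cstar_identity norm_divide norm_power r_def)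
 have "1 <= (nrm B (f y))\<^sup>2"
  by (rule dense_le_bounded[of 0]) (use inj_isometric_aux[OF inj proper y y1] in "auto simp: less_imp_le")
 hence "1 <= nrm B (f y)" using B.nrm_nonneg[of "f y"] by (metis hom_simps(1) one_power2 power2_le_imp_le yc)
 also have "nrm B (f y) = (nrm B (f x))\<^sup>2 / r\<^sup>2"
  using x r by (simp add: y_def B.nrm_smult norm_divide norm_power B.cstar_identity)
 finally have "r\<^sup>2 <= (nrm B (f x))\<^sup>2" using r by (simp add: field_simps)
 thus "nA x <= nrm B (f x)" unfolding r_def by (rule power2_le_imp_le) (use x B.nrm_nonneg in simp)
qed

end

text \<open>A discriminant argument with a complex parameter. It is stated for bare numbers so as to
  serve states, Hilbert spaces and the approximate minimisers in \<open>Riesz\<close>; when d = 0 a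
  large multiple of the conjugate of b forces b = 0.\<close>

lemma quadratic_Cauchy_Schwarz:
 fixes b :: complex assumes nonneg: "!!c. 0 <= a + 2 * Re (c * b) + (cmod c)\<^sup>2 * d" and d: "0 <= d"
 shows "(cmod b)\<^sup>2 <= a * d"
proof (cases "d = 0")
 case False
 have "0 <= a + 2 * Re ((- cnj b / complex_of_real d) * b) + (cmod (- cnj b / complex_of_real d))\<^sup>2 * d"
  by (rule nonneg)
 also have "(- cnj b / complex_of_real d) * b = complex_of_real (- (cmod b)\<^sup>2 / d)"
  using complex_norm_square[of b] by (simp add: mult.commute)
 finally have "0 <= a - (cmod b)\<^sup>2 / d"
  using False d by (simp add: norm_divide power_divide power2_eq_square field_simps)
 thus ?thesis using False d by (simp add: field_simps)
next
 case True
 have *: "0 <= a - 2 * t * (cmod b)\<^sup>2" for t :: real proof -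
  have "Re ((- complex_of_real t * cnj b) * b) = - t * (cmod b)\<^sup>2"
   unfolding cmod_power2 by (simp add: power2_eq_square algebra_simps)
  from nonneg[of "- complex_of_real t * cnj b", unfolded True mult_zero_right add_0_right this]
  show ?thesis by simp
 qed
 have "b = 0" proof (rule ccontr)
  assume "b ~= 0"
  thus False using *[of "(a + 1) / (cmod b)\<^sup>2"] *[of 0] by (simp add: field_simps)
 qed
 thus ?thesis using True by simp
qed

subsection \<open>States\<close>

locale cstar_state = cstar_algebra +
 fixes \<rho> :: "'a => complex" assumes state: "state A \<rho>"
begin

lemma \<rho>_add [simp]: "x .: A ==> y .: A ==> \<rho> (x .+ y) = \<rho> x + \<rho> y"
 and \<rho>_smult [simp]: "x .: A ==> \<rho> (c *. x) = c * \<rho> x"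
 and \<rho>_pos: "x .: A ==> \<rho> (sA x ** x) : \<real>\<^sub>\<ge>\<^sub>0"
 and \<rho>_one [simp]: "\<rho> \<one> = 1" using state by (auto simp: state_def)

lemma \<rho>_zero [simp]: "\<rho> \<zero> = 0" using \<rho>_smult[of "\<zero>" 0] by (simp del: \<rho>_smult)

lemma \<rho>_diff [simp]: "x .: A ==> y .: A ==> \<rho> (x .- y) = \<rho> x - \<rho> y" by (simp add: diff_sm)

lemma \<rho>_minus [simp]: "x .: A ==> \<rho> (\<ominus> x) = - \<rho> x" by (simp add: minus_sm)

lemma \<rho>_pos_Im: "x .: A ==> Im (\<rho> (sA x ** x)) = 0"
 and \<rho>_pos_Re: "x .: A ==> Re (\<rho> (sA x ** x)) >= 0" using \<rho>_pos[of x] by (auto simp: nonneg_Reals_def)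

text \<open>Positivity on (c 1 + x)* (c 1 + x) makes the mixed terms real for every scalar c; c = 1
  and c = i determine imaginary and real part.\<close>

lemma \<rho>_star: assumes x: "x .: A" shows "\<rho> (sA x) = cnj (\<rho> x)"
proof -
 have *: "Im (c * \<rho> (sA x) + cnj c * \<rho> x) = 0" for c proof -
  have "sA (c *. \<one> .+ x) ** (c *. \<one> .+ x)
    = (cnj c * c) *. \<one> .+ (cnj c *. x .+ (c *. sA x .+ sA x ** x))"
   using x by (simp add: star_add star_smult l_distr r_distr sm_add_r a_ac mult.commute[of c])
  hence "\<rho> (sA (c *. \<one> .+ x) ** (c *. \<one> .+ x))
    = cnj c * c + (cnj c * \<rho> x + (c * \<rho> (sA x) + \<rho> (sA x ** x)))" using x by simp
  thus ?thesis using \<rho>_pos_Im[of "c *. \<one> .+ x"] \<rho>_pos_Im[OF x] x by simp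
 qed
 show ?thesis using *[of 1] *[of \<i>] by (intro complex_eqI) auto
qed

definition ip :: "'a => 'a => complex" where "ip x y = \<rho> (sA y ** x)"

abbreviation sn :: "'a => real" where "sn == gns_seminorm A \<rho>"

lemma ip_add_l: "x .: A ==> x' .: A ==> y .: A ==> ip (x .+ x') y = ip x y + ip x' y"
 and ip_add_r: "x .: A ==> x' .: A ==> y .: A ==> ip y (x .+ x') = ip y x + ip y x'"
 and ip_smult_l: "x .: A ==> y .: A ==> ip (c *. x) y = c * ip x y"
 and ip_smult_r: "x .: A ==> y .: A ==> ip x (c *. y) = cnj c * ip x y"
 and ip_diff_l: "x .: A ==> x' .: A ==> y .: A ==> ip (x .- x') y = ip x y - ip x' y"
 and ip_diff_r: "x .: A ==> x' .: A ==> y .: A ==> ip y (x .- x') = ip y x - ip y x'"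
 by (simp_all add: ip_def r_distr l_distr star_add star_smult star_diff diff_sm sm_add_r)

lemma ip_commute: "x .: A ==> y .: A ==> ip x y = cnj (ip y x)"
 unfolding ip_def by (subst \<rho>_star[symmetric]) (auto simp: star_mult)

lemma sn_nonneg [simp]: "x .: A ==> 0 <= sn x" by (simp add: gns_seminorm_def \<rho>_pos_Re)

lemma ip_self: "x .: A ==> ip x x = complex_of_real ((sn x)\<^sup>2)"
 by (simp add: ip_def gns_seminorm_def \<rho>_pos_Re \<rho>_pos_Im complex_eq_iff)

lemma sn_sq: "x .: A ==> (sn x)\<^sup>2 = Re (ip x x)" by (simp add: ip_self)

lemma sn_zero [simp]: "sn \<zero> = 0" by (simp add: gns_seminorm_def)

lemma sn_add_sq: assumes "x .: A" "y .: A"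
 shows "(sn (x .+ y))\<^sup>2 = (sn x)\<^sup>2 + 2 * Re (ip x y) + (sn y)\<^sup>2"
 using assms ip_commute[of y x] by (simp add: sn_sq ip_add_l ip_add_r)

lemma sn_smult: "x .: A ==> sn (c *. x) = cmod c * sn x"
proof -
 assume x: "x .: A"
 have "ip (c *. x) (c *. x) = complex_of_real ((cmod c)\<^sup>2) * ip x x"
  using x complex_norm_square[of c] by (simp add: ip_smult_l ip_smult_r mult_ac)
 hence "(sn (c *. x))\<^sup>2 = (cmod c * sn x)\<^sup>2" using x by (simp add: sn_sq power_mult_distrib)
 thus ?thesis using x by (simp add: power2_eq_iff_nonneg)
qed

lemma Cauchy_Schwarz: assumes x: "x .: A" and y: "y .: A" shows "cmod (ip x y) <= sn x * sn y"
proof -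
 have sq: "(cmod (ip x y))\<^sup>2 <= (sn x)\<^sup>2 * (sn y)\<^sup>2" proof (rule quadratic_Cauchy_Schwarz)
  fix c
  have "0 <= (sn (x .+ cnj c *. y))\<^sup>2" by simp
  also have "... = (sn x)\<^sup>2 + 2 * Re (c * ip x y) + (cmod c)\<^sup>2 * (sn y)\<^sup>2"
   using x y by (simp add: sn_add_sq ip_smult_r sn_smult power_mult_distrib)
  finally show "0 <= (sn x)\<^sup>2 + 2 * Re (c * ip x y) + (cmod c)\<^sup>2 * (sn y)\<^sup>2" .
 qed simp
 show ?thesis by (rule power2_le_imp_le) (use sq x y in "auto simp: power_mult_distrib")
qed

lemma sn_triangle: assumes x: "x .: A" and y: "y .: A" shows "sn (x .+ y) <= sn x + sn y"
proof (rule power2_le_imp_le)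
 have "Re (ip x y) <= sn x * sn y" using Cauchy_Schwarz[OF x y] complex_Re_le_cmod order_trans by blast
 thus "(sn (x .+ y))\<^sup>2 <= (sn x + sn y)\<^sup>2" using x y by (simp add: sn_add_sq power2_sum)
qed (use x y in simp)

lemma sn_minus [simp]: "x .: A ==> sn (\<ominus> x) = sn x" by (simp add: minus_sm sn_smult)

lemma sn_diff_commute: "x .: A ==> y .: A ==> sn (x .- y) = sn (y .- x)"
proof -
 assume xy: "x .: A" "y .: A"
 hence "x .- y = \<ominus> (y .- x)" by algebra
 thus ?thesis using xy by simp
qed

lemma sn_diff_trans: assumes "x .: A" "y .: A" "w .: A" shows "sn (x .- w) <= sn (x .- y) + sn (y .- w)"
 using sn_triangle[of "x .- y" "y .- w"] diff_trans[of x y w] assms by simp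

text \<open>After normalising \<open>x\<close>, the element 1 - x* x is the square of a self-adjoint
  \<open>v\<close>, so the state is nonnegative on y* (1 - x* x) y, being its value on (v y)* (v
  y).\<close>

lemma sn_mult_le: assumes x: "x .: A" and y: "y .: A" shows "sn (x ** y) <= nA x * sn y"
proof (cases "nA x = 0")
 case True thus ?thesis using x y by (simp add: nrm_eq_0_iff)
next
 case False
 define r where "r = nA x"
 have r: "r > 0" using False nrm_nonneg[OF x] by (simp add: r_def)
 define x' where "x' = complex_of_real (1 / r) *. x"
 have x' [simp]: "x' .: A" and n1: "nA x' = 1"
  using x r by (simp_all add: x'_def nrm_smult norm_divide) (simp add: r_def)
 define k where "k = sA x' ** x'"
 have k: "self_adjoint k" and k1: "nA k <= 1" and kc [simp]: "k .: A"
  using n1 by (simp_all add: k_def self_adjoint_def star_mult cstar_identity)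
 obtain s where s: "self_adjoint s" "(\<one> .- s) ** (\<one> .- s) = \<one> .- k"
  using ex_sqrt_one_minus[OF k k1] by metis
 define v where "v = \<one> .- s"
 have vc [simp]: "v .: A" "sA v = v" using s(1) by (auto simp: v_def self_adjoint_def star_diff)
 have vv: "v ** v = \<one> .- k" using s(2) by (simp add: v_def)
 have "ip (v ** y) (v ** y) = \<rho> (sA y ** (v ** v) ** y)" using y by (simp add: ip_def star_mult m_assoc)
 also have "... = ip y y - ip (x' ** y) (x' ** y)"
  using y by (simp add: vv k_def ip_def star_mult m_assoc diff_sm l_distr r_distr)
 finally have "(sn (x' ** y))\<^sup>2 <= (sn y)\<^sup>2"
  using y sn_sq[of "v ** y"] zero_le_power2[of "sn (v ** y)"] by (simp add: sn_sq)
 hence "sn (x' ** y) <= sn y" by (rule power2_le_imp_le) (use y in simp)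
 thus ?thesis using r x y by (simp add: x'_def sn_smult norm_divide r_def field_simps)
qed

lemma sn_one [simp]: "sn \<one> = 1" by (simp add: gns_seminorm_def)

lemma sn_le_nrm: "x .: A ==> sn x <= nA x" using sn_mult_le[of x "\<one>"] by simp

lemma \<rho>_le_nrm: "x .: A ==> cmod (\<rho> x) <= nA x"
 using Cauchy_Schwarz[of x "\<one>"] sn_le_nrm[of x] by (simp add: ip_def)

lemma converges_\<rho>: "converges s x ==> (%n. \<rho> (s n)) ----> \<rho> x"
proof -
 assume s: "converges s x"
 have "cmod (\<rho> (s n) - \<rho> x) <= nA (s n .- x)" for n
  using \<rho>_le_nrm[of "s n .- x"] s by (simp add: converges_def)
 moreover have l: "(%n. nA (s n .- x)) ----> 0" using s by (simp add: converges_def)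
 ultimately have "(%n. cmod (\<rho> (s n) - \<rho> x)) ----> 0"
  by (intro tendsto_sandwich[OF _ _ tendsto_const l]) auto
 hence "(%n. \<rho> (s n) - \<rho> x) ----> 0" by (rule tendsto_norm_zero_cancel)
 thus ?thesis by (simp add: LIM_zero_iff)
qed

lemma restr_state: assumes B: "unital_cstar_subalgebra B A" shows "state (A\<lparr>carrier := B\<rparr>) \<rho>"
 using unital_cstar_subalgebraD(1-7)[OF B] \<rho>_pos by (auto simp: state_def subset_iff)

end

subsection \<open>Hilbert spaces\<close>

lemma square_le_mult_cancel: "a * a <= c * a ==> 0 <= a ==> 0 <= c ==> a <= (c::real)"
 by (cases "a = 0") (auto simp: mult_le_cancel_right)

context hilbert_space
begin

lemma sm_closed [simp, intro]: "x .: H ==> c *. x .: H" by (rule smult_closed) auto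

lemma sm_add_l: "x .: H ==> (c + d) *. x = c *. x .+ d *. x" using smult_l_distr[of c d x] by simp

lemma sm_add_r: "x .: H ==> y .: H ==> c *. (x .+ y) = c *. x .+ c *. y" using smult_r_distr[of c x y] by simp

lemma sm_sm [simp]: "x .: H ==> c *. (d *. x) = (c * d) *. x" using smult_assoc1[of c d x] by simp

lemma sm_one [simp]: "x .: H ==> 1 *. x = x" using smult_one[of x] by simp

lemma sm_zero [simp]: "x .: H ==> 0 *. x = \<zero>" "c *. \<zero> = \<zero>"
 using smult_l_null[of x] smult_r_null[of c] by simp_all

lemma minus_sm: "x .: H ==> \<ominus> x = (-1) *. x" using smult_l_minus[of 1 x] by simp

lemma diff_sm: "x .: H ==> y .: H ==> x .- y = x .+ (-1) *. y" by (simp add: minus_sm a_minus_def)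

lemma diff_eq_zero_iff: "x .: H ==> y .: H ==> x .- y = \<zero> <-> x = y"
 by (metis M.r_neg M.minus_equality M.minus_minus a_minus_def M.a_inv_closed)

abbreviation inn :: "'h => 'h => complex" where "inn == hinner H"

abbreviation hn :: "'h => real" where "hn == hnorm H"

lemma inn_add_r: "x .: H ==> y .: H ==> z .: H ==> inn z (x .+ y) = inn z x + inn z y"
 using hinner_add[of x y z] hinner_commute[of z] by simp

lemma inn_smult_r: "x .: H ==> y .: H ==> inn x (c *. y) = cnj c * inn x y"
 using hinner_smult[of y x c] hinner_commute[of x] by simp

lemma inn_diff_l: "x .: H ==> y .: H ==> z .: H ==> inn (x .- y) z = inn x z - inn y z"
 and inn_diff_r: "x .: H ==> y .: H ==> z .: H ==> inn z (x .- y) = inn z x - inn z y"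
 by (simp_all add: diff_sm hinner_add hinner_smult inn_add_r inn_smult_r)

lemma inn_zero [simp]: "x .: H ==> inn \<zero> x = 0" "x .: H ==> inn x \<zero> = 0"
 using hinner_smult[of "\<zero>" x 0] inn_smult_r[of x "\<zero>" 0] by simp_all

lemmas inn_simps = hinner_add hinner_smult inn_add_r inn_smult_r inn_diff_l inn_diff_r

lemma inn_self: "x .: H ==> inn x x = complex_of_real ((hn x)\<^sup>2)"
 using hinner_nonneg[of x] by (auto simp: hnorm_def nonneg_Reals_def complex_eq_iff)

lemma hn_sq: "x .: H ==> (hn x)\<^sup>2 = Re (inn x x)" by (simp add: inn_self)

lemma hn_nonneg [simp]: "x .: H ==> 0 <= hn x" using hinner_nonneg[of x] by (auto simp: hnorm_def nonneg_Reals_def)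

lemma hn_eq_0_iff: "x .: H ==> hn x = 0 <-> x = \<zero>" using hinner_eq_0_iff[of x] inn_self[of x] by simp

lemma hn_zero [simp]: "hn \<zero> = 0" by (simp add: hn_eq_0_iff)

lemma hn_add_sq: assumes "x .: H" "y .: H"
 shows "(hn (x .+ y))\<^sup>2 = (hn x)\<^sup>2 + 2 * Re (inn x y) + (hn y)\<^sup>2"
 using assms hinner_commute[of y x] by (simp add: hn_sq inn_simps)

lemma hn_smult: "x .: H ==> hn (c *. x) = cmod c * hn x"
proof -
 assume x: "x .: H"
 have "inn (c *. x) (c *. x) = complex_of_real ((cmod c)\<^sup>2) * inn x x"
  using x complex_norm_square[of c] by (simp add: inn_simps mult_ac)
 hence "(hn (c *. x))\<^sup>2 = (cmod c * hn x)\<^sup>2" using x by (simp add: hn_sq power_mult_distrib)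
 thus ?thesis using x by (simp add: power2_eq_iff_nonneg)
qed

lemma hn_minus [simp]: "x .: H ==> hn (\<ominus> x) = hn x" by (simp add: minus_sm hn_smult)

lemma hCauchy_Schwarz: assumes x: "x .: H" and y: "y .: H" shows "cmod (inn x y) <= hn x * hn y"
proof -
 have sq: "(cmod (inn x y))\<^sup>2 <= (hn x)\<^sup>2 * (hn y)\<^sup>2" proof (rule quadratic_Cauchy_Schwarz)
  fix c
  have "0 <= (hn (x .+ cnj c *. y))\<^sup>2" by simp
  also have "... = (hn x)\<^sup>2 + 2 * Re (c * inn x y) + (cmod c)\<^sup>2 * (hn y)\<^sup>2"
   using x y by (simp add: hn_add_sq inn_smult_r hn_smult power_mult_distrib)
  finally show "0 <= (hn x)\<^sup>2 + 2 * Re (c * inn x y) + (cmod c)\<^sup>2 * (hn y)\<^sup>2" .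
 qed simp
 show ?thesis by (rule power2_le_imp_le) (use sq x y in "auto simp: power_mult_distrib")
qed

lemma hn_triangle: assumes x: "x .: H" and y: "y .: H" shows "hn (x .+ y) <= hn x + hn y"
proof (rule power2_le_imp_le)
 have "Re (inn x y) <= hn x * hn y" using hCauchy_Schwarz[OF x y] complex_Re_le_cmod order_trans by blast
 thus "(hn (x .+ y))\<^sup>2 <= (hn x + hn y)\<^sup>2" using x y by (simp add: hn_add_sq power2_sum)
qed (use x y in simp)

lemma hn_diff_commute: "x .: H ==> y .: H ==> hn (x .- y) = hn (y .- x)"
 by (rule power2_eq_imp_eq) (simp_all add: hn_sq inn_diff_l inn_diff_r algebra_simps)

lemma hn_diff_trans: assumes "x .: H" "y .: H" "w .: H" shows "hn (x .- w) <= hn (x .- y) + hn (y .- w)"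
proof -
 have "x .- w = (x .- y) .+ (y .- w)"
  using assms by (metis (no_types, lifting) M.a_assoc M.a_inv_closed M.l_neg M.minus_closed M.l_zero a_minus_def)
 thus ?thesis using hn_triangle[of "x .- y" "y .- w"] assms by simp
qed

lemma inner_eqI: assumes x: "x .: H" and y: "y .: H" and eq: "!!z. z .: H ==> inn x z = inn y z" shows "x = y"
proof -
 have "inn (x .- y) (x .- y) = 0" using x y eq by (simp add: inn_diff_l)
 hence "x .- y = \<zero>" using x y hinner_eq_0_iff by simp
 thus ?thesis using x y diff_eq_zero_iff by blast
qed

lemma inner_eqI': assumes x: "x .: H" and y: "y .: H" and eq: "!!z. z .: H ==> inn z x = inn z y" shows "x = y"
 using assms by (intro inner_eqI[OF x y]) (metis hinner_commute)

lemma diff_zero [simp]: "x .: H ==> x .- \<zero> = x" by (rule inner_eqI) (simp_all add: inn_diff_l)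

section \<open>Convergence of vectors, closed subspaces and representing vectors\<close>

definition hconv :: "(nat => 'h) => 'h => bool"
 where "hconv s x <-> (\<forall>n. s n .: H) & x .: H & (%n. hn (s n .- x)) ----> 0"

lemma hconv_inn_l: assumes "hconv s x" and y: "y .: H" shows "(%n. inn (s n) y) ----> inn x y"
proof -
 have c: "!!n. s n .: H" "x .: H" and l: "(%n. hn (s n .- x)) ----> 0" using assms by (auto simp: hconv_def)
 have l': "(%n. hn (s n .- x) * hn y) ----> 0" using tendsto_mult_left_zero[OF l] .
 have le: "cmod (inn (s n) y - inn x y) <= hn (s n .- x) * hn y" for n
  using hCauchy_Schwarz[of "s n .- x" y] c y by (simp add: inn_diff_l)
 have "(%n. cmod (inn (s n) y - inn x y)) ----> 0"
  by (rule tendsto_sandwich[OF _ _ tendsto_const l']) (use le in auto)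
 hence "(%n. inn (s n) y - inn x y) ----> 0" by (rule tendsto_norm_zero_cancel)
 thus ?thesis by (simp add: LIM_zero_iff)
qed

lemma hconv_inn_r: assumes s: "hconv s x" and y: "y .: H" shows "(%n. inn y (s n)) ----> inn y x"
proof -
 have c: "!!n. s n .: H" "x .: H" using s by (auto simp: hconv_def)
 have "(%n. cnj (inn (s n) y)) ----> cnj (inn x y)" using hconv_inn_l[OF s y] by (rule tendsto_cnj)
 thus ?thesis using c y by (simp add: hinner_commute[of y])
qed

lemma hconv_hn: assumes "hconv s x" shows "(%n. hn (s n)) ----> hn x"
proof -
 have c: "!!n. s n .: H" "x .: H" and l: "(%n. hn (s n .- x)) ----> 0" using assms by (auto simp: hconv_def)
 have le: "\<bar>hn (s n) - hn x\<bar> <= hn (s n .- x)" for n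
  using hn_diff_trans[of "s n" x "\<zero>"] hn_diff_trans[of x "s n" "\<zero>"] c
   hn_diff_commute[of x "s n"] by (simp add: abs_le_iff)
 have "(%n. \<bar>hn (s n) - hn x\<bar>) ----> 0" by (rule tendsto_sandwich[OF _ _ tendsto_const l]) (use le in auto)
 hence "(%n. hn (s n) - hn x) ----> 0" by (rule tendsto_rabs_zero_cancel)
 thus ?thesis by (simp add: LIM_zero_iff)
qed

lemma hconv_unique: "hconv s x ==> hconv s y ==> x = y"
proof -
 assume s: "hconv s x" "hconv s y"
 hence "x .: H" "y .: H" by (auto simp: hconv_def)
 thus "x = y" using LIMSEQ_unique[OF hconv_inn_l[OF s(1)] hconv_inn_l[OF s(2)]] by (intro inner_eqI) auto
qed

definition closed_subspace :: "'h set => bool" where "closed_subspace K <-> K <= carrier H & \<zero> : K &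
  (\<forall>x\<in>K. \<forall>y\<in>K. x .+ y : K) & (\<forall>c. \<forall>x\<in>K. c *. x : K) &
  (\<forall>s x. (\<forall>n. s n : K) & hconv s x --> x : K)"

lemma closed_subspace_carrier: "closed_subspace (carrier H)" by (auto simp: closed_subspace_def hconv_def)

text \<open>The representing vector minimises \<open>\<parallel>x\<parallel>\<^sup>2 - 2 Re (f x)\<close>; for an approximate minimiser the first
  variation is small, which also makes a minimising sequence Cauchy.\<close>

lemma Riesz: assumes K: "closed_subspace K" and add: "!!x y. x : K ==> y : K ==> f (x .+ y) = f x + f y"
  and smult: "!!c x. x : K ==> f (c *. x) = c * f x" and bound: "!!x. x : K ==> cmod (f x) <= C * hn x"
 obtains y where "y : K" "!!x. x : K ==> f x = inn x y"
proof -
 have Kc [simp]: "x .: H" if "x : K" for x using that K by (auto simp: closed_subspace_def)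
 have Kop [simp]: "!!x y. x : K ==> y : K ==> x .+ y : K" "!!c x. x : K ==> c *. x : K" "\<zero> : K"
  using K by (auto simp: closed_subspace_def)
 have Kd [simp]: "x .- y : K" if "x : K" "y : K" for x y using that by (simp add: diff_sm)
 define F where "F x = (hn x)\<^sup>2 - 2 * Re (f x)" for x
 have F_ge: "F x >= - C\<^sup>2" if "x : K" for x proof -
  have "Re (f x) <= C * hn x" using bound[OF that] complex_Re_le_cmod order_trans by blast
  moreover have "(hn x)\<^sup>2 - 2 * (C * hn x) = (hn x - C)\<^sup>2 - C\<^sup>2"
   by (simp add: power2_eq_square algebra_simps)
  ultimately show ?thesis using zero_le_power2[of "hn x - C"] unfolding F_def by linarith
 qed
 hence bdd: "bdd_below (F ` K)" by (auto intro!: bdd_belowI)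
 define d where "d = Inf (F ` K)"
 have dF: "d <= F x" if "x : K" for x unfolding d_def using bdd that by (auto intro: cInf_lower)
 have "\<exists>x\<in>K. F x < d + 1 / Suc n" for n proof -
  have "F ` K ~= {}" using Kop(3) by blast
  hence "\<exists>v\<in>F ` K. v < d + 1 / Suc n" by (rule cInf_lessD) (simp add: d_def)
  thus ?thesis by blast
 qed
 then obtain s where s [simp]: "!!n. s n : K" and sF: "!!n. F (s n) < d + 1 / Suc n" by metis
 define q where "q n = sqrt (1 / Suc n)" for n
 have q0: "q ----> 0" unfolding q_def using tendsto_real_sqrt[OF LIMSEQ_Suc[OF lim_1_over_n]] by simp
 have var: "cmod (inn x (s n) - f x) <= q n * hn x" if x: "x : K" for x n proof -
  have "(cmod (inn x (s n) - f x))\<^sup>2 <= (1 / Suc n) * (hn x)\<^sup>2" proof (rule quadratic_Cauchy_Schwarz)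
   fix c
   have "F (c *. x .+ s n) = (hn (c *. x))\<^sup>2 + 2 * Re (c * inn x (s n)) + (hn (s n))\<^sup>2
     - 2 * Re (c * f x) - 2 * Re (f (s n))" using x by (simp add: F_def hn_add_sq hinner_smult add smult)
   also have "... = F (s n) + 2 * Re (c * (inn x (s n) - f x)) + (cmod c)\<^sup>2 * (hn x)\<^sup>2"
    using x by (simp add: F_def hn_smult power_mult_distrib algebra_simps)
   finally show "0 <= 1 / Suc n + 2 * Re (c * (inn x (s n) - f x)) + (cmod c)\<^sup>2 * (hn x)\<^sup>2"
    using dF[of "c *. x .+ s n"] sF[of n] x by simp
  qed simp
  hence "cmod (inn x (s n) - f x) <= sqrt ((1 / Suc n) * (hn x)\<^sup>2)" using real_le_rsqrt by blast
  thus ?thesis using x unfolding q_def by (simp only: real_sqrt_mult real_sqrt_abs abs_of_nonneg hn_nonneg Kc)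
 qed
 have cau: "hn (s m .- s n) <= q m + q n" for m n proof -
  let ?x = "s m .- s n"
  have "(hn ?x)\<^sup>2 = cmod (inn ?x ?x)" by (simp add: inn_self norm_power)
  also have "inn ?x ?x = (inn ?x (s m) - f ?x) - (inn ?x (s n) - f ?x)" by (simp add: inn_diff_r)
  also have "cmod ... <= q m * hn ?x + q n * hn ?x"
   by (rule order_trans[OF norm_triangle_ineq4 add_mono]) (auto intro: var)
  finally have le: "hn ?x * hn ?x <= (q m + q n) * hn ?x" by (simp add: power2_eq_square algebra_simps)
  show ?thesis proof (cases "hn ?x = 0")
   case False
   hence "hn ?x > 0" by (simp add: less_le)
   thus ?thesis using le by simp
  qed (simp add: q_def)
 qed
 have "\<exists>N. \<forall>m\<ge>N. \<forall>n\<ge>N. hn (s m .- s n) < e" if e: "e > 0" for e proof -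
  have "eventually (%n. q n < e/2) sequentially" using q0 e by (intro order_tendstoD) auto
  then obtain N where N: "!!n. n >= N ==> q n < e/2" by (auto simp: eventually_sequentially)
  have "hn (s m .- s n) < e" if "m >= N" "n >= N" for m n using cau[of m n] N[OF that(1)] N[OF that(2)] by simp
  thus ?thesis by blast
 qed
 then obtain y where y: "y .: H" "(%n. hn (s n .- y)) ----> 0" using hilbert_complete[of s] s Kc by metis
 hence sy: "hconv s y" by (simp add: hconv_def)
 hence yK: "y : K" using K s unfolding closed_subspace_def by blast
 have rep: "f x = inn x y" if x: "x : K" for x proof -
  have l: "(%n. q n * hn x) ----> 0" using tendsto_mult_left_zero[OF q0] .
  have "(%n. cmod (inn x (s n) - f x)) ----> 0"
   by (rule tendsto_sandwich[OF _ _ tendsto_const l]) (use var[OF x] in auto)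
  hence "(%n. inn x (s n) - f x) ----> 0" by (rule tendsto_norm_zero_cancel)
  hence "(%n. inn x (s n)) ----> f x" by (simp add: LIM_zero_iff)
  thus ?thesis by (rule LIMSEQ_unique[OF _ hconv_inn_r[OF sy Kc[OF x]]])
 qed
 show ?thesis by (rule that[OF yK rep])
qed

subsection \<open>Bounded operators\<close>

abbreviation BO :: "('h => 'h) cstar" where "BO == BH H"

lemma B_apply [simp]:
 "x .: H ==> (S **@BO T) x = S (T x)"
 "x .: H ==> (S .+@BO T) x = S x .+ T x"
 "x .: H ==> (c *.@BO T) x = c *. T x"
 "x .: H ==> 1@BO x = x"
 "x .: H ==> 0@BO x = \<zero>" by (simp_all add: BH_def compose_def)

lemma B_carrier: "carrier BO = bounded_operators H" by (simp add: BH_def)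

lemma B_closed [simp]: "T .: BO ==> x .: H ==> T x .: H" by (auto simp: B_carrier bounded_operators_def)

lemma B_add: "T .: BO ==> x .: H ==> y .: H ==> T (x .+ y) = T x .+ T y"
 and B_smult: "T .: BO ==> x .: H ==> T (c *. x) = c *. T x" by (auto simp: B_carrier bounded_operators_def)

lemma B_diff: "T .: BO ==> x .: H ==> y .: H ==> T (x .- y) = T x .- T y" by (simp add: diff_sm B_add B_smult)

lemma B_zero [simp]: "T .: BO ==> T \<zero> = \<zero>" using B_smult[of T "\<zero>" 0] by simp

lemma B_ext: "T .: BO ==> T : extensional (carrier H)" unfolding B_carrier bounded_operators_def PiE_def by blast

lemma B_eqI: assumes "S .: BO" "T .: BO" "!!x. x .: H ==> S x = T x" shows "S = T"
 using assms(3) by (rule extensionalityI[OF B_ext[OF assms(1)] B_ext[OF assms(2)]])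

lemma B_intro: assumes "!!x. x .: H ==> T x .: H"
  "!!x y. x .: H ==> y .: H ==> T (x .+ y) = T x .+ T y"
  "!!c x. x .: H ==> T (c *. x) = c *. T x"
  "!!x. x .: H ==> hn (T x) <= K * hn x" shows "restrict T (carrier H) .: BO"
 using assms unfolding B_carrier bounded_operators_def by (auto intro!: exI[of _ K])

lemma B_nrm: "nrm BO T = (SUP x\<in>{x \<in> carrier H. hn x <= 1}. hn (T x))" by (simp add: BH_def)

lemma B_bound: assumes T: "T .: BO" obtains K where "K >= 0" "!!x. x .: H ==> hn (T x) <= K * hn x"
proof -
 obtain K where K: "!!x. x .: H ==> hn (T x) <= K * hn x" using T unfolding B_carrier bounded_operators_def by blast
 have "hn (T x) <= max K 0 * hn x" if "x .: H" for x
  using K[OF that] mult_right_mono[of K "max K 0" "hn x"] that by fastforce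
 thus ?thesis using that[of "max K 0"] by simp
qed

lemma B_nrm_bdd: assumes T: "T .: BO" shows "bdd_above ((%x. hn (T x)) ` {x \<in> carrier H. hn x <= 1})"
proof -
 obtain K where K: "K >= 0" "!!x. x .: H ==> hn (T x) <= K * hn x" using B_bound[OF T] by blast
 have "hn (T x) <= K" if "x .: H" "hn x <= 1" for x using K(2)[OF that(1)] mult_left_mono[OF that(2) K(1)] by simp
 thus ?thesis by (auto intro!: bdd_aboveI)
qed

lemma B_nrm_nonneg: "T .: BO ==> 0 <= nrm BO T"
 unfolding B_nrm by (rule cSUP_upper2[OF B_nrm_bdd, of _ "\<zero>"]) auto

lemma B_nrm_apply: assumes T: "T .: BO" and x: "x .: H" shows "hn (T x) <= nrm BO T * hn x"
proof (cases "hn x = 0")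
 case True
 thus ?thesis using T x by (simp add: hn_eq_0_iff)
next
 case False
 hence p: "hn x > 0" using x by (simp add: less_le)
 let ?y = "complex_of_real (1 / hn x) *. x"
 have y: "?y .: H" "hn ?y = 1" using x p by (simp_all add: hn_smult norm_divide)
 have "hn (T ?y) <= nrm BO T" unfolding B_nrm by (rule cSUP_upper[OF _ B_nrm_bdd[OF T]]) (use y in simp)
 thus ?thesis using T x p by (simp add: B_smult hn_smult norm_divide field_simps)
qed

lemma B_nrm_le: assumes T: "T .: BO" and K: "K >= 0" "!!x. x .: H ==> hn (T x) <= K * hn x" shows "nrm BO T <= K"
 unfolding B_nrm
proof (rule cSUP_least)
 show "{x \<in> carrier H. hn x <= 1} ~= {}" by (auto intro!: exI[of _ "\<zero>"])
 show "hn (T x) <= K" if "x : {x \<in> carrier H. hn x <= 1}" for x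
  using K(2)[of x] mult_left_mono[of "hn x" 1 K] that K(1) by simp
qed

lemma B_nrm_le_inn: assumes T: "T .: BO" and K: "K >= 0"
  "!!x y. x .: H ==> y .: H ==> cmod (inn (T x) y) <= K * hn x * hn y" shows "nrm BO T <= K"
proof (rule B_nrm_le[OF T K(1)])
 fix x assume x: "x .: H"
 have "hn (T x) * hn (T x) <= (K * hn x) * hn (T x)"
  using K(2)[of x "T x"] T x by (simp add: inn_self norm_mult power2_eq_square)
 thus "hn (T x) <= K * hn x" by (rule square_le_mult_cancel) (use T x K(1) in auto)
qed

lemma B_adjoint: assumes T: "T .: BO"
 obtains S where "S .: BO" "!!x y. x .: H ==> y .: H ==> inn (T x) y = inn x (S y)"
proof -
 have "\<exists>z\<in>carrier H. \<forall>x\<in>carrier H. inn (T x) y = inn x z" if y: "y .: H" for y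
 proof (rule Riesz[OF closed_subspace_carrier, of "%x. inn (T x) y" "nrm BO T * hn y"])
  show "cmod (inn (T x) y) <= nrm BO T * hn y * hn x" if x: "x .: H" for x proof -
   have "cmod (inn (T x) y) <= hn (T x) * hn y" using T x y by (intro hCauchy_Schwarz) auto
   also have "... <= (nrm BO T * hn x) * hn y" using B_nrm_apply[OF T x] y by (intro mult_right_mono) auto
   finally show ?thesis by (simp add: mult_ac)
  qed
 qed (use T y in "auto simp: B_add B_smult inn_simps")
 then obtain S where S: "!!y. y .: H ==> S y .: H"
   "!!x y. x .: H ==> y .: H ==> inn (T x) y = inn x (S y)" by metis
 have "restrict S (carrier H) .: BO" proof (rule B_intro)
  show "S (x .+ y) = S x .+ S y" if "x .: H" "y .: H" for x y
   by (rule inner_eqI') (use that S(1) T in "simp_all flip: S(2) add: inn_simps")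
  show "S (c *. x) = c *. S x" if "x .: H" for c x
   by (rule inner_eqI') (use that S(1) T in "simp_all flip: S(2) add: inn_simps")
  show "hn (S x) <= nrm BO T * hn x" if x: "x .: H" for x proof -
   have "(hn (S x))\<^sup>2 = cmod (inn (T (S x)) x)" using x S by (simp add: inn_self norm_power)
   also have "... <= hn (T (S x)) * hn x" using T x S(1) by (intro hCauchy_Schwarz) auto
   also have "... <= (nrm BO T * hn (S x)) * hn x" using B_nrm_apply[OF T] x S(1) by (intro mult_right_mono) auto
   finally have "hn (S x) * hn (S x) <= (nrm BO T * hn x) * hn (S x)" by (simp add: power2_eq_square mult_ac)
   thus ?thesis by (rule square_le_mult_cancel) (use x S(1)[OF x] B_nrm_nonneg[OF T] in auto)
  qed
 qed (rule S)
 thus ?thesis using that[of "restrict S (carrier H)"] S by simp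
qed

lemma assumes T: "T .: BO" shows B_star_closed: "star BO T .: BO"
  and B_star: "!!x y. x .: H ==> y .: H ==> inn (T x) y = inn x (star BO T y)"
proof -
 let ?Q = "%S. S : bounded_operators H &
    (\<forall>x\<in>carrier H. \<forall>y\<in>carrier H. hinner H (T x) y = hinner H x (S y))"
 obtain S where S: "?Q S" using B_adjoint[OF T] unfolding B_carrier by metis
 have "S' = S" if "?Q S'" for S' proof (rule B_eqI)
  show "S' x = S x" if x: "x .: H" for x
   using \<open>?Q S'\<close> S x by (intro inner_eqI') (auto simp flip: B_carrier)
 qed (use S \<open>?Q S'\<close> in "auto simp: B_carrier")
 hence "?Q (THE S. ?Q S)" by (rule theI[of ?Q, OF S])
 moreover have "star BO T = (THE S. ?Q S)" by (simp add: BH_def)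
 ultimately show "star BO T .: BO"
  "!!x y. x .: H ==> y .: H ==> inn (T x) y = inn x (star BO T y)" by (auto simp: B_carrier)
qed

lemma B_star': "T .: BO ==> x .: H ==> y .: H ==> inn (star BO T x) y = inn x (T y)"
 using B_star[of T y x] B_star_closed[of T] hinner_commute[of "star BO T x" y]
  hinner_commute[of x "T y"] by simp

lemma B_starI: assumes "T .: BO" "S .: BO"
  "!!x y. x .: H ==> y .: H ==> inn (T x) y = inn x (S y)" shows "star BO T = S"
proof (rule B_eqI)
 show "star BO T x = S x" if "x .: H" for x
  by (rule inner_eqI') (use that assms(1,2) B_star_closed[of T] in "simp_all flip: B_star assms(3)")
qed (rule B_star_closed[OF assms(1)] assms(2))+

end

context hilbert_space
begin

lemma hconv_const: "x .: H ==> hconv (%_. x) x" by (simp add: hconv_def a_minus_def M.r_neg)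

lemma hconv_add: assumes "hconv s x" "hconv t y" shows "hconv (%n. s n .+ t n) (x .+ y)"
proof -
 have c: "!!n. s n .: H" "x .: H" "!!n. t n .: H" "y .: H"
  and l: "(%n. hn (s n .- x)) ----> 0" "(%n. hn (t n .- y)) ----> 0" using assms by (auto simp: hconv_def)
 have eq: "s n .+ t n .- (x .+ y) = (s n .- x) .+ (t n .- y)" for n
  by (rule inner_eqI) (use c in "simp_all add: inn_simps")
 have le: "hn (s n .+ t n .- (x .+ y)) <= hn (s n .- x) + hn (t n .- y)" for n
  unfolding eq by (rule hn_triangle) (use c in auto)
 have l': "(%n. hn (s n .- x) + hn (t n .- y)) ----> 0" using tendsto_add[OF l] by simp
 have "(%n. hn (s n .+ t n .- (x .+ y))) ----> 0"
  by (rule tendsto_sandwich[OF _ _ tendsto_const l']) (use le c in auto)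
 thus ?thesis using c by (simp add: hconv_def)
qed

lemma hconv_smult: assumes "hconv s x" shows "hconv (%n. c *. s n) (c *. x)"
proof -
 have c: "!!n. s n .: H" "x .: H" and l: "(%n. hn (s n .- x)) ----> 0" using assms by (auto simp: hconv_def)
 have eq: "c *. s n .- c *. x = c *. (s n .- x)" for n
  by (rule inner_eqI) (use c in "simp_all add: inn_simps algebra_simps")
 have "(%n. hn (c *. s n .- c *. x)) = (%n. cmod c * hn (s n .- x))" unfolding eq using c by (simp add: hn_smult)
 also have "... ----> 0" using tendsto_mult_right_zero[OF l] .
 finally show ?thesis using c by (simp add: hconv_def)
qed

lemma hconv_B: assumes T: "T .: BO" and s: "hconv s x" shows "hconv (%n. T (s n)) (T x)"
proof -
 have c: "!!n. s n .: H" "x .: H" and l: "(%n. hn (s n .- x)) ----> 0" using s by (auto simp: hconv_def)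
 have le: "hn (T (s n) .- T x) <= nrm BO T * hn (s n .- x)" for n
  using B_nrm_apply[OF T, of "s n .- x"] c T by (simp add: B_diff)
 have "(%n. hn (T (s n) .- T x)) ----> 0"
  by (rule tendsto_sandwich[OF _ _ tendsto_const tendsto_mult_right_zero[OF l, of "nrm BO T"]]) (use le c T in auto)
 thus ?thesis using c T by (simp add: hconv_def)
qed

lemma hconv_Cauchy: assumes s: "!!n. s n .: H"
  and c: "!!e. e > 0 ==> \<exists>N. \<forall>m\<ge>N. \<forall>n\<ge>N. hn (s m .- s n) < e"
 obtains x where "hconv s x" using hilbert_complete[of s] assms that unfolding hconv_def by metis

lemma B_one_closed: "1@BO .: BO" using B_intro[of "%x. x" 1] by (simp add: BH_def)

lemma B_zero_closed: "0@BO .: BO" using B_intro[of "%x. \<zero>" 0] by (simp add: BH_def)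

lemma B_mult_closed: assumes S: "S .: BO" and T: "T .: BO" shows "S **@BO T .: BO"
proof -
 have "restrict (%x. S (T x)) (carrier H) .: BO" proof (rule B_intro)
  show "hn (S (T x)) <= (nrm BO S * nrm BO T) * hn x" if x: "x .: H" for x
   using B_nrm_apply[OF S, of "T x"] mult_left_mono[OF B_nrm_apply[OF T x] B_nrm_nonneg[OF S]] T x
   by (simp add: mult.assoc)
 qed (use S T in "auto simp: B_add B_smult")
 moreover have "S **@BO T = restrict (%x. S (T x)) (carrier H)" by (simp add: BH_def compose_def)
 ultimately show ?thesis by simp
qed

lemma B_add_closed: assumes S: "S .: BO" and T: "T .: BO" shows "S .+@BO T .: BO"
proof -
 have "restrict (%x. S x .+ T x) (carrier H) .: BO" proof (rule B_intro)
  show "hn (S x .+ T x) <= (nrm BO S + nrm BO T) * hn x" if x: "x .: H" for x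
   using B_nrm_apply[OF S x] B_nrm_apply[OF T x] hn_triangle[of "S x" "T x"] S T x by (simp add: distrib_right)
 qed (use S T in "auto simp: B_add B_smult sm_add_r M.a_ac")
 thus ?thesis by (simp add: BH_def)
qed

lemma B_smult_closed: assumes T: "T .: BO" shows "c *.@BO T .: BO"
proof -
 have "restrict (%x. c *. T x) (carrier H) .: BO" proof (rule B_intro)
  show "hn (c *. T x) <= (cmod c * nrm BO T) * hn x" if x: "x .: H" for x
   using mult_left_mono[OF B_nrm_apply[OF T x], of "cmod c"] T x by (simp add: hn_smult mult.assoc)
 qed (use T in "auto simp: B_add B_smult sm_add_r mult.commute")
 thus ?thesis by (simp add: BH_def)
qed

lemmas B_ops = B_one_closed B_zero_closed B_mult_closed B_add_closed B_smult_closed B_star_closed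

section \<open>The bounded operators as a C*-algebra\<close>

lemma B_abelian_group: "abelian_group BO"
proof (rule abelian_groupI)
 show "\<exists>S\<in>carrier BO. S .+@BO T = 0@BO" if T: "T .: BO" for T
 proof (intro bexI[of _ "(-1) *.@BO T"] B_eqI)
  show "((-1) *.@BO T .+@BO T) x = 0@BO x" if "x .: H" for x using T that by (simp add: M.l_neg flip: minus_sm)
 qed (use T in "simp_all add: B_ops")
qed (auto intro!: B_eqI B_ops simp: M.a_ac)

lemma B_minus_apply: assumes T: "T .: BO" and x: "x .: H" shows "(\<ominus>\<^bsub>BO\<^esub> T) x = \<ominus> T x"
proof -
 interpret B: abelian_group BO by (rule B_abelian_group)
 have "(-1) *.@BO T .+@BO T = 0@BO" by (rule B_eqI) (use T in "simp_all add: B_ops M.l_neg flip: minus_sm")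
 hence "\<ominus>\<^bsub>BO\<^esub> T = (-1) *.@BO T"
  using B.minus_equality[of "(-1) *.@BO T" T] T by (simp add: B_ops)
 thus ?thesis using T x by (simp add: minus_sm)
qed

lemma B_diff_apply [simp]:
 "S .: BO ==> T .: BO ==> x .: H ==> (S .-@BO T) x = S x .- T x" by (simp add: a_minus_def B_minus_apply)

lemma B_complete: assumes s: "!!n. s n .: BO"
  and c: "!!e. e > 0 ==> \<exists>N. \<forall>m\<ge>N. \<forall>n\<ge>N. nrm BO (s m .-@BO s n) < e"
 shows "\<exists>T\<in>carrier BO. (%n. nrm BO (s n .-@BO T)) ----> 0"
proof -
 interpret B: abelian_group BO by (rule B_abelian_group)
 have dif: "hn (s m x .- s n x) <= nrm BO (s m .-@BO s n) * hn x" if "x .: H" for m n x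
  using B_nrm_apply[of "s m .-@BO s n" x] s that by simp
 have "\<exists>y. hconv (%n. s n x) y" if x: "x .: H" for x proof (rule hconv_Cauchy[of "%n. s n x"])
  show "\<exists>N. \<forall>m\<ge>N. \<forall>n\<ge>N. hn (s m x .- s n x) < e" if e: "e > 0" for e proof -
   have p: "0 < e / (1 + hn x)" using e x by (simp add: add_pos_nonneg)
   obtain N where N: "\<forall>m\<ge>N. \<forall>n\<ge>N. nrm BO (s m .-@BO s n) < e / (1 + hn x)" using c[OF p] by blast
   have "hn (s m x .- s n x) < e" if mn: "m >= N" "n >= N" for m n proof -
    have "hn (s m x .- s n x) <= e / (1 + hn x) * hn x"
     using dif[OF x, of m n] N mn x mult_right_mono[of "nrm BO (s m .-@BO s n)" "e / (1 + hn x)" "hn x"]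
     by (meson hn_nonneg less_imp_le order_trans)
    also have "... < e / (1 + hn x) * (1 + hn x)" using p by (intro mult_strict_left_mono) auto
    also have "1 + hn x ~= 0" using hn_nonneg[OF x] by linarith
    hence "e / (1 + hn x) * (1 + hn x) = e" by simp
    finally show ?thesis .
   qed
   thus ?thesis by blast
  qed
 qed (use s x in auto)
 then obtain T where T: "!!x. x .: H ==> hconv (%n. s n x) (T x)" by metis
 obtain N0 where N0: "!!m n. m >= N0 ==> n >= N0 ==> nrm BO (s m .-@BO s n) < 1" using c[of 1] by auto
 define K where "K = 1 + nrm BO (s N0)"
 have Tc: "T x .: H" if "x .: H" for x using T[OF that] by (simp add: hconv_def)
 have lim_dif: "hn (s n x .- T x) <= e * hn x"
  if x: "x .: H" and n: "!!m. m >= M ==> nrm BO (s n .-@BO s m) <= e" for x n M e proof -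
  have sx: "s n x .: H" using s x by simp
  have "hconv (%m. s n x .+ (-1) *. s m x) (s n x .+ (-1) *. T x)" by (intro hconv_add hconv_smult hconv_const T x sx)
  hence "(%m. hn (s n x .- s m x)) ----> hn (s n x .- T x)" using hconv_hn s x Tc by (force simp: diff_sm)
  thus ?thesis proof (rule LIMSEQ_le_const2)
   show "\<exists>N. \<forall>m\<ge>N. hn (s n x .- s m x) <= e * hn x"
    using dif[OF x, of n] n x mult_right_mono[OF n hn_nonneg[OF x]] by (meson order_trans)
  qed
 qed
 have "restrict T (carrier H) .: BO" proof (rule B_intro)
  show "T (x .+ y) = T x .+ T y" if xy: "x .: H" "y .: H" for x y proof -
   have "hconv (%n. s n (x .+ y)) (T x .+ T y)" using hconv_add[OF T[OF xy(1)] T[OF xy(2)]] s xy by (simp add: B_add)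
   thus ?thesis using hconv_unique T[of "x .+ y"] xy by blast
  qed
  show "T (c *. x) = c *. T x" if x: "x .: H" for c x proof -
   have "hconv (%n. s n (c *. x)) (c *. T x)" using hconv_smult[OF T[OF x]] s x by (simp add: B_smult)
   thus ?thesis using hconv_unique T[of "c *. x"] x by blast
  qed
  show "hn (T x) <= K * hn x" if x: "x .: H" for x proof -
   have "hn (s N0 x .- T x) <= 1 * hn x" by (rule lim_dif[OF x, of N0]) (use N0 in "auto simp: less_imp_le")
   moreover have "hn (T x) <= hn (T x .- s N0 x) + hn (s N0 x)"
    using hn_diff_trans[of "T x" "s N0 x" "\<zero>"] s x Tc by simp
   ultimately show ?thesis using B_nrm_apply[OF s x, of N0] hn_diff_commute[of "T x" "s N0 x"] s x Tc
    by (simp add: K_def distrib_right)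
  qed
 qed (rule Tc)
 moreover have "(%n. nrm BO (s n .-@BO restrict T (carrier H))) ----> 0" proof (rule LIMSEQ_I)
  fix r :: real assume r: "r > 0"
  then obtain N where N: "!!m n. m >= N ==> n >= N ==> nrm BO (s m .-@BO s n) < r/2" using c[of "r/2"] by auto
  have "norm (nrm BO (s n .-@BO restrict T (carrier H)) - 0) < r" if n: "n >= N" for n proof -
   have cl: "s n .-@BO restrict T (carrier H) .: BO" using s calculation by simp
   have "nrm BO (s n .-@BO restrict T (carrier H)) <= r/2" proof (rule B_nrm_le[OF cl])
    fix x assume x: "x .: H"
    have "hn (s n x .- T x) <= r/2 * hn x" by (rule lim_dif[OF x, of N]) (use N n in "auto simp: less_imp_le")
    thus "hn ((s n .-@BO restrict T (carrier H)) x) <= r/2 * hn x" using s calculation x by simp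
   qed (use r in simp)
   thus ?thesis using r B_nrm_nonneg[OF cl] by simp
  qed
  thus "\<exists>N. \<forall>n\<ge>N. norm (nrm BO (s n .-@BO restrict T (carrier H)) - 0) < r" by blast
 qed
 ultimately show ?thesis by blast
qed

lemma BH_cstar_algebra: "cstar_algebra BO"
proof -
 note ops [simp] = B_ops
 have rg: "ring BO" proof (rule ringI[OF B_abelian_group])
  show "monoid BO" by (rule monoidI) (auto intro!: B_eqI simp: B_closed)
 qed (auto intro!: B_eqI simp: B_add)
 have md: "Module.module complex_ring BO"
  by (rule moduleI) (auto intro!: B_eqI cring_from_type_algebra B_abelian_group simp: sm_add_l sm_add_r)
 have mult_le: "nrm BO (S **@BO T) <= nrm BO S * nrm BO T" if S: "S .: BO" and T: "T .: BO" for S T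
 proof (rule B_nrm_le)
  show "hn ((S **@BO T) x) <= nrm BO S * nrm BO T * hn x" if x: "x .: H" for x
   using B_nrm_apply[OF S, of "T x"] mult_left_mono[OF B_nrm_apply[OF T x] B_nrm_nonneg[OF S]] T x
   by (simp add: mult.assoc)
 qed (use S T B_nrm_nonneg in auto)
 have star_le: "nrm BO (star BO T) <= nrm BO T" if T: "T .: BO" for T proof (rule B_nrm_le_inn)
  fix x y assume x: "x .: H" and y: "y .: H"
  have "cmod (inn (star BO T x) y) <= hn x * hn (T y)" using hCauchy_Schwarz[of x "T y"] T x y by (simp add: B_star')
  also have "... <= hn x * (nrm BO T * hn y)" using B_nrm_apply[OF T y] x by (intro mult_left_mono) auto
  finally show "cmod (inn (star BO T x) y) <= nrm BO T * hn x * hn y" by (simp add: mult_ac)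
 qed (use T B_nrm_nonneg in auto)
 show ?thesis proof (intro cstar_algebra.intro rg md cstar_algebra_axioms.intro)
  show ss: "star BO (star BO T) = T" if "T .: BO" for T by (rule B_starI) (use that in "auto simp: B_star'")
  show "star BO (S .+@BO T) = star BO S .+@BO star BO T" if "S .: BO" "T .: BO" for S T
   by (rule B_starI) (use that in "auto simp: inn_simps simp flip: B_star")
  show "star BO (c *.@BO T) = cnj c *.@BO star BO T" if "T .: BO" for T c
   by (rule B_starI) (use that in "auto simp: inn_simps simp flip: B_star")
  show "star BO (S **@BO T) = star BO T **@BO star BO S" if "S .: BO" "T .: BO" for S T
   by (rule B_starI) (use that in "auto simp flip: B_star")
  show "nrm BO T = 0 <-> T = 0@BO" if T: "T .: BO" for T proof
   assume n: "nrm BO T = 0"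
   show "T = 0@BO" proof (rule B_eqI)
    show "T x = 0@BO x" if x: "x .: H" for x
     using B_nrm_apply[OF T x] n T x by (simp add: hn_eq_0_iff order.antisym flip: hn_eq_0_iff)
   qed (use T in auto)
  next
   assume "T = 0@BO"
   thus "nrm BO T = 0" using B_nrm_le[of "0@BO" 0] B_nrm_nonneg[of "0@BO"] by simp
  qed
  show "nrm BO (S .+@BO T) <= nrm BO S + nrm BO T" if S: "S .: BO" and T: "T .: BO" for S T proof (rule B_nrm_le)
   show "hn ((S .+@BO T) x) <= (nrm BO S + nrm BO T) * hn x" if x: "x .: H" for x
    using B_nrm_apply[OF S x] B_nrm_apply[OF T x] hn_triangle[of "S x" "T x"] S T x by (simp add: distrib_right)
  qed (use S T B_nrm_nonneg in auto)
  have smult_le: "nrm BO (c *.@BO T) <= cmod c * nrm BO T" if T: "T .: BO" for T c proof (rule B_nrm_le)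
   show "hn ((c *.@BO T) x) <= cmod c * nrm BO T * hn x" if x: "x .: H" for x
    using mult_left_mono[OF B_nrm_apply[OF T x], of "cmod c"] T x by (simp add: hn_smult mult.assoc)
  qed (use T B_nrm_nonneg in auto)
  show "nrm BO (c *.@BO T) = cmod c * nrm BO T" if T: "T .: BO" for T c
  proof (rule antisym[OF smult_le[OF T]], cases "c = 0")
   case True
   thus "cmod c * nrm BO T <= nrm BO (c *.@BO T)" using T B_nrm_nonneg by simp
  next
   case False
   have "T = inverse c *.@BO (c *.@BO T)" by (rule B_eqI) (use T False in auto)
   hence "nrm BO T <= cmod (inverse c) * nrm BO (c *.@BO T)" using smult_le[of "c *.@BO T" "inverse c"] T by simp
   thus "cmod c * nrm BO T <= nrm BO (c *.@BO T)" using False by (simp add: norm_divide field_simps)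
  qed
  show "nrm BO (star BO T **@BO T) = (nrm BO T)\<^sup>2" if T: "T .: BO" for T proof (rule antisym)
   have "nrm BO (star BO T **@BO T) <= nrm BO (star BO T) * nrm BO T" using T by (intro mult_le) auto
   also have "... <= nrm BO T * nrm BO T" using star_le[OF T] T B_nrm_nonneg by (intro mult_right_mono) auto
   finally show "nrm BO (star BO T **@BO T) <= (nrm BO T)\<^sup>2" by (simp add: power2_eq_square)
   have "nrm BO T <= sqrt (nrm BO (star BO T **@BO T))" (is "_ <= sqrt ?r") proof (rule B_nrm_le[OF T])
    show r0: "0 <= sqrt ?r" using T B_nrm_nonneg by simp
    fix x assume x: "x .: H"
    have "(hn (T x))\<^sup>2 = cmod (inn ((star BO T **@BO T) x) x)"
     using T x by (simp add: B_star' inn_self norm_power)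
    also have "... <= hn ((star BO T **@BO T) x) * hn x" using T x by (intro hCauchy_Schwarz) (auto intro!: B_closed)
    also have "... <= (?r * hn x) * hn x"
     using B_nrm_apply[of "star BO T **@BO T" x] T x by (intro mult_right_mono) auto
    also have "... = (sqrt ?r * hn x)\<^sup>2" using T B_nrm_nonneg by (simp add: power2_eq_square power_mult_distrib)
    finally show "hn (T x) <= sqrt ?r * hn x" by (rule power2_le_imp_le) (use r0 x in auto)
   qed
   hence "(nrm BO T)\<^sup>2 <= (sqrt ?r)\<^sup>2" using T B_nrm_nonneg by (intro power_mono) auto
   thus "(nrm BO T)\<^sup>2 <= ?r" using T B_nrm_nonneg by simp
  qed
 qed (use mult_le B_nrm_nonneg B_complete in "auto intro!: B_eqI simp: B_smult")
qed

end

sublocale hilbert_space \<subseteq> B: cstar_algebra "BH H"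
 by (rule BH_cstar_algebra)

context hilbert_space
begin

text \<open>Evaluated in the vector state of \<open>x\<close>, the sum is the squared length of
  \<open>S x\<close> plus that of \<open>T x\<close>. This is the condition on the target under
  which an injective homomorphism is isometric.\<close>

lemma B_proper: assumes "S .: BO" "T .: BO"
  "star BO S **@BO S .+@BO star BO T **@BO T = 0@BO" shows "S = 0@BO"
proof (rule B_eqI)
 fix x assume x: "x .: H"
 have "inn ((star BO S **@BO S .+@BO star BO T **@BO T) x) x = complex_of_real ((hn (S x))\<^sup>2 + (hn (T x))\<^sup>2)"
  using assms(1,2) x by (simp add: hinner_add B_star' inn_self)
 hence "(hn (S x))\<^sup>2 + (hn (T x))\<^sup>2 = 0" using assms(3) x by (simp del: of_real_add of_real_power)
 hence "hn (S x) = 0" by (simp add: sum_power2_eq_zero_iff)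
 thus "S x = 0@BO x" using assms x by (simp add: hn_eq_0_iff)
qed (use assms in auto)

definition orth :: "'h set => 'h set" where "orth S = {x \<in> carrier H. \<forall>s\<in>S. inn x s = 0}"

lemma closed_subspace_orth: assumes S: "S <= carrier H" shows "closed_subspace (orth S)"
proof -
 have Sc [simp]: "s .: H" if "s : S" for s using that S by blast
 have lim: "x : orth S" if s: "\<forall>n. s n : orth S" "hconv s x" for s x proof -
  have "inn x y = 0" if y: "y : S" for y
   using hconv_inn_l[OF s(2) Sc[OF y]] s(1) y LIMSEQ_unique[OF _ tendsto_const] by (simp add: orth_def)
  thus ?thesis using s(2) by (simp add: orth_def hconv_def)
 qed
 show ?thesis unfolding closed_subspace_def proof (intro conjI allI impI ballI)
  show "x : orth S" if "(\<forall>n. s n : orth S) & hconv s x" for s x using that by (intro lim) auto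
 qed (auto simp: orth_def hinner_add hinner_smult)
qed

text \<open>The image of \<open>x\<close> is the vector representing the functional given by
  \<open>x\<close> on the subspace; uniqueness of representing vectors makes the assignment linear,
  idempotent and self-adjoint.\<close>

lemma ex_projection: assumes K: "closed_subspace K"
 obtains P where "P .: BO" "P **@BO P = P" "star BO P = P" "!!x. x .: H ==> P x : K"
  "!!x. x : K ==> P x = x"
proof -
 have Kc [simp]: "x .: H" if "x : K" for x using that K by (auto simp: closed_subspace_def)
 have Kop: "!!x y. x : K ==> y : K ==> x .+ y : K" "!!c x. x : K ==> c *. x : K"
  using K by (auto simp: closed_subspace_def)
 have "\<exists>y\<in>K. \<forall>k\<in>K. inn k x = inn k y" if x: "x .: H" for x
 proof (rule Riesz[OF K, of "%k. inn k x" "hn x"])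
  show "cmod (inn k x) <= hn x * hn k" if "k : K" for k
   using hCauchy_Schwarz[of k x] that x by (simp add: mult.commute)
 qed (use x in "auto simp: inn_simps")
 then obtain p where p: "!!x. x .: H ==> p x : K"
   "!!x k. x .: H ==> k : K ==> inn k x = inn k (p x)" by metis
 have uniq: "y = y'" if "y : K" "y' : K" "!!k. k : K ==> inn k y = inn k y'" for y y' proof -
  have d: "y .- y' : K" using that Kop by (simp add: diff_sm)
  hence "inn (y .- y') (y .- y') = 0" using that by (simp add: inn_diff_r)
  thus ?thesis using d that by (simp add: hinner_eq_0_iff diff_eq_zero_iff)
 qed
 have pc [simp]: "p x .: H" if "x .: H" for x using p(1)[OF that] by simp
 define P where "P = restrict p (carrier H)"
 have PB: "P .: BO" unfolding P_def proof (rule B_intro)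
  show "p (x .+ y) = p x .+ p y" if "x .: H" "y .: H" for x y
   by (rule uniq) (use that p Kop in "simp_all add: inn_simps flip: p(2)")
  show "p (c *. x) = c *. p x" if "x .: H" for c x
   by (rule uniq) (use that p Kop in "simp_all add: inn_simps flip: p(2)")
  show "hn (p x) <= 1 * hn x" if x: "x .: H" for x proof -
   have "hn (p x) * hn (p x) = cmod (inn (p x) (p x))" using x by (simp add: inn_self norm_mult power2_eq_square)
   also have "inn (p x) (p x) = inn (p x) x" using x p by (intro p(2)[symmetric]) auto
   also have "cmod (inn (p x) x) <= hn x * hn (p x)" using hCauchy_Schwarz[of "p x" x] x by (simp add: mult.commute)
   finally have "hn (p x) <= hn x" by (rule square_le_mult_cancel) (use x in auto)
   thus ?thesis by simp
  qed
 qed (rule pc)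
 have PK: "P x = x" if "x : K" for x by (rule uniq) (use that p in "simp_all add: P_def flip: p(2)")
 have PxK: "P x : K" if "x .: H" for x using p(1)[OF that] that by (simp add: P_def)
 have "P **@BO P = P" by (rule B_eqI) (simp_all add: PB B_mult_closed PK PxK)
 moreover have "star BO P = P" proof (rule B_starI[OF PB PB])
  fix x y assume xy: "x .: H" "y .: H"
  have "inn (p x) y = inn (p x) (p y)" using p xy by (intro p(2)) auto
  also have "... = cnj (inn (p y) (p x))" using xy by (intro hinner_commute) auto
  also have "inn (p y) (p x) = inn (p y) x" using p xy by (intro p(2)[symmetric]) auto
  also have "cnj (inn (p y) x) = inn x (p y)" using xy by (intro hinner_commute[symmetric]) auto
  finally show "inn (P x) y = inn x (P y)" using xy by (simp add: P_def)
 qed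
 ultimately show ?thesis by (intro that[of P] PB PK PxK)
qed

end

subsection \<open>The GNS representation\<close>

lemma LIMSEQ_squeeze_0:
 fixes f g :: "nat => real" assumes "g ----> 0" "!!n. 0 <= f n" "!!n. f n <= g n" shows "f ----> 0"
 by (rule tendsto_sandwich[OF _ _ tendsto_const assms(1)]) (use assms in auto)

context cstar_state
begin

abbreviation "Cau == gns_Cauchy A \<rho>"
abbreviation "grel == gns_rel A \<rho>"
abbreviation cls :: "(nat => 'a) => (nat => 'a) set" where "cls s == grel `` {s}"
abbreviation "HH == L2 A \<rho>"
abbreviation "BB == BH HH"
abbreviation "hat x == cls (%_. x)"
abbreviation "\<pi> == gns_rep A \<rho>"

lemma Cau_carrier [simp]: "s : Cau ==> s n .: A" by (simp add: gns_Cauchy_def)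

lemma CauI: assumes "!!n. s n .: A"
  and "!!e. e > 0 ==> \<exists>N. \<forall>m\<ge>N. \<forall>n\<ge>N. sn (s m .- s n) < e" shows "s : Cau"
 unfolding gns_Cauchy_def using assms by blast

lemma CauD: "s : Cau ==> e > 0 ==> \<exists>N. \<forall>m\<ge>N. \<forall>n\<ge>N. sn (s m .- s n) < e"
 unfolding gns_Cauchy_def by blast

lemma sn_le_diff: assumes "x .: A" "y .: A" shows "sn x <= sn y + sn (x .- y)"
 using sn_diff_trans[of x y "\<zero>"] assms by (simp add: minus_eq)

lemma sn_abs_diff: assumes "x .: A" "y .: A" shows "\<bar>sn x - sn y\<bar> <= sn (x .- y)"
 using sn_le_diff[of x y] sn_le_diff[of y x] assms sn_diff_commute[of x y] by (simp add: abs_le_iff)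

lemma Cau_sn_convergent: assumes s: "s : Cau" shows "convergent (%n. sn (s n))"
proof -
 have "Cauchy (%n. sn (s n))" unfolding Cauchy_def dist_real_def proof (intro allI impI)
  fix e :: real assume "e > 0"
  then obtain N where N: "\<forall>m\<ge>N. \<forall>n\<ge>N. sn (s m .- s n) < e" using CauD[OF s] by blast
  have "\<bar>sn (s m) - sn (s n)\<bar> < e" if "m >= N" "n >= N" for m n
   using sn_abs_diff[of "s m" "s n"] N that s by (meson Cau_carrier order_le_less_trans)
  thus "\<exists>M. \<forall>m\<ge>M. \<forall>n\<ge>M. \<bar>sn (s m) - sn (s n)\<bar> < e" by blast
 qed
 thus ?thesis by (simp add: Cauchy_convergent_iff)
qed

lemma Cau_bounded: assumes s: "s : Cau" obtains K where "K > 0" "!!n. sn (s n) <= K"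
proof -
 have "Bseq (%n. sn (s n))" using Cau_sn_convergent[OF s] by (rule convergent_imp_Bseq)
 then obtain K where K: "K > 0" "\<forall>n. norm (sn (s n)) <= K" by (rule BseqE)
 have le: "sn (s n) <= K" for n using K(2) by (auto simp: abs_le_iff)
 show ?thesis by (rule that[OF K(1) le])
qed

lemma Cau_const: "x .: A ==> (%_. x) : Cau" by (simp add: gns_Cauchy_def minus_eq r_neg del: Cau_carrier)

lemma Cau_linear: assumes s: "s : Cau" and t: "t : Cau" shows "(%n. s n .+ t n) : Cau"
proof (rule CauI)
 fix e :: real assume "e > 0"
 then obtain M N where M: "\<forall>m\<ge>M. \<forall>n\<ge>M. sn (s m .- s n) < e/2" and N: "\<forall>m\<ge>N. \<forall>n\<ge>N. sn (t m .- t n) < e/2"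
  using CauD[OF s, of "e/2"] CauD[OF t, of "e/2"] by auto
 have "sn ((s m .+ t m) .- (s n .+ t n)) < e" if mn: "m >= max M N" "n >= max M N" for m n proof -
  have "(s m .+ t m) .- (s n .+ t n) = (s m .- s n) .+ (t m .- t n)"
   using Cau_carrier[OF s] Cau_carrier[OF t] by algebra
  hence "sn ((s m .+ t m) .- (s n .+ t n)) <= sn (s m .- s n) + sn (t m .- t n)" using s t sn_triangle by simp
  also have "... < e/2 + e/2" using M N mn by (intro add_strict_mono) auto
  finally show ?thesis by simp
 qed
 thus "\<exists>K. \<forall>m\<ge>K. \<forall>n\<ge>K. sn ((s m .+ t m) .- (s n .+ t n)) < e" by blast
qed (use s t in simp)

lemma Cau_bounded_map: assumes s: "s : Cau" and f: "!!x. x .: A ==> f x .: A"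
  and le: "!!x y. x .: A ==> y .: A ==> sn (f x .- f y) <= K * sn (x .- y)" shows "(%n. f (s n)) : Cau"
proof (rule CauI)
 fix e :: real assume "e > 0"
 hence p: "e / (1 + \<bar>K\<bar>) > 0" by simp
 obtain N where N: "\<forall>m\<ge>N. \<forall>n\<ge>N. sn (s m .- s n) < e / (1 + \<bar>K\<bar>)" using CauD[OF s p] by blast
 have "sn (f (s m) .- f (s n)) < e" if mn: "m >= N" "n >= N" for m n proof -
  have "sn (f (s m) .- f (s n)) <= K * sn (s m .- s n)" using s by (intro le) auto
  also have "... <= (1 + \<bar>K\<bar>) * sn (s m .- s n)" using s by (intro mult_right_mono) auto
  also have "... < (1 + \<bar>K\<bar>) * (e / (1 + \<bar>K\<bar>))" using N mn by (intro mult_strict_left_mono) auto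
  also have "... = e" by (simp add: add_pos_nonneg)
  finally show ?thesis .
 qed
 thus "\<exists>N. \<forall>m\<ge>N. \<forall>n\<ge>N. sn (f (s m) .- f (s n)) < e" by blast
qed (use s f in simp)

lemma Cau_smult: "s : Cau ==> (%n. c *. s n) : Cau"
 by (rule Cau_bounded_map[where K = "cmod c"]) (simp_all add: sn_smult flip: sm_diff_r)

lemma r_minus_distr:
 "x .: A ==> y .: A ==> w .: A ==> x ** (y .- w) = x ** y .- x ** w" by (simp add: minus_eq r_distr r_minus)

lemma Cau_mult: "x .: A ==> s : Cau ==> (%n. x ** s n) : Cau"
 by (rule Cau_bounded_map[where K = "nA x"]) (simp_all add: sn_mult_le flip: r_minus_distr)

lemma grel_iff: "(s, t) : grel <-> s : Cau & t : Cau & (%n. sn (s n .- t n)) ----> 0" by (simp add: gns_rel_def)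

section \<open>The completion as a Hilbert space\<close>

lemma equiv_grel: "equiv Cau grel"
proof (rule equivI)
 show "grel <= Cau \<times> Cau" by (auto simp: grel_iff)
 show "refl_on Cau grel" by (rule refl_onI) (auto simp: grel_iff minus_eq r_neg)
 show "sym grel" by (rule symI) (use sn_diff_commute in "auto simp: grel_iff")
 show "trans grel" proof (rule transI)
  fix s t u assume "(s, t) : grel" "(t, u) : grel"
  hence c: "s : Cau" "t : Cau" "u : Cau" and l: "(%n. sn (s n .- t n) + sn (t n .- u n)) ----> 0"
   using tendsto_add[of "%n. sn (s n .- t n)" 0 sequentially "%n. sn (t n .- u n)" 0] by (auto simp: grel_iff)
  have "(%n. sn (s n .- u n)) ----> 0" by (rule LIMSEQ_squeeze_0[OF l]) (use c in "simp_all add: sn_diff_trans")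
  thus "(s, u) : grel" using c by (simp add: grel_iff)
 qed
qed

lemma cls_eq_iff: "s : Cau ==> t : Cau ==> cls s = cls t <-> (%n. sn (s n .- t n)) ----> 0"
 using eq_equiv_class_iff[OF equiv_grel, of s t] by (simp add: grel_iff)

lemma H_carrier: "carrier HH = cls ` Cau" by (auto simp: L2_def quotient_def)

lemma cls_carrier [simp]: "s : Cau ==> cls s .: HH" by (auto simp: H_carrier)

lemma cls_self: "s : Cau ==> s : cls s" using equiv_class_self[OF equiv_grel] .

lemma H_cases: assumes "U .: HH" obtains s where "s : Cau" "U = cls s" using assms by (auto simp: H_carrier)

lemma H_zero: "0@HH = cls (%_. \<zero>)" by (simp add: L2_def)

lemma H_add: assumes "s : Cau" "t : Cau" shows "cls s .+@HH cls t = cls (%n. s n .+ t n)"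
proof -
 have "congruent2 grel grel (%s t. cls (%n. s n .+ t n))" proof (rule congruent2I'; goal_cases)
  case (1 s s' t t')
  hence c [simp]: "s : Cau" "s' : Cau" "t : Cau" "t' : Cau" and l: "(%n. sn (s n .- s' n) + sn (t n .- t' n)) ----> 0"
   using tendsto_add[of "%n. sn (s n .- s' n)" 0 sequentially "%n. sn (t n .- t' n)" 0] by (auto simp: grel_iff)
  have eq: "(s n .+ t n) .- (s' n .+ t' n) = (s n .- s' n) .+ (t n .- t' n)" for n
   using Cau_carrier[OF c(1), of n] Cau_carrier[OF c(2), of n] Cau_carrier[OF c(3), of n] Cau_carrier[OF c(4), of n]
   by algebra
  have "(%n. sn ((s n .+ t n) .- (s' n .+ t' n))) ----> 0"
   by (rule LIMSEQ_squeeze_0[OF l]) (simp_all add: eq sn_triangle)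
  thus ?case by (subst cls_eq_iff) (simp_all add: Cau_linear)
 qed
 hence "(\<Union>s\<in>cls s. \<Union>t\<in>cls t. cls (%n. s n .+ t n)) = cls (%n. s n .+ t n)"
  by (rule UN_equiv_class2[OF equiv_grel equiv_grel]) (use assms in auto)
 thus ?thesis by (simp add: L2_def)
qed

text \<open>A map that is Lipschitz for the seminorm respects null sequences. Scalar multiplication
  and left multiplication by an algebra element are both instances.\<close>

lemma congruent_map: assumes f: "!!x. x .: A ==> f x .: A"
  and le: "!!x y. x .: A ==> y .: A ==> sn (f x .- f y) <= K * sn (x .- y)" and s: "s : Cau"
 shows "(\<Union>s\<in>cls s. cls (%n. f (s n))) = cls (%n. f (s n))"
proof (rule UN_equiv_class[OF equiv_grel _ s])
 show "congruent grel (%s. cls (%n. f (s n)))" proof (rule congruentI)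
  fix s t assume "(s, t) : grel"
  hence c [simp]: "s : Cau" "t : Cau" and l: "(%n. sn (s n .- t n)) ----> 0" by (auto simp: grel_iff)
  have "(%n. sn (f (s n) .- f (t n))) ----> 0"
   by (rule LIMSEQ_squeeze_0[OF tendsto_mult_right_zero[OF l, of K]]) (use le f in simp_all)
  thus "cls (%n. f (s n)) = cls (%n. f (t n))" by (subst cls_eq_iff) (auto intro: Cau_bounded_map f le)
 qed
qed

lemma H_smult: "s : Cau ==> c *.@HH cls s = cls (%n. c *. s n)"
 using congruent_map[of "%x. c *. x" "cmod c" s] by (simp add: L2_def sn_smult flip: sm_diff_r)

lemma \<pi>_cls: "x .: A ==> s : Cau ==> \<pi> x (cls s) = cls (%n. x ** s n)"
 using congruent_map[of "%y. x ** y" "nA x" s] by (simp add: gns_rep_def sn_mult_le flip: r_minus_distr)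

lemma ip_diff_le: assumes "x .: A" "y .: A" "x' .: A" "y' .: A"
 shows "cmod (ip x y - ip x' y') <= sn (x .- x') * sn y + sn x' * sn (y .- y')"
proof -
 have "ip x y - ip x' y' = ip (x .- x') y + ip x' (y .- y')" using assms by (simp add: ip_diff_l ip_diff_r)
 also have "cmod ... <= sn (x .- x') * sn y + sn x' * sn (y .- y')"
  by (rule order_trans[OF norm_triangle_ineq add_mono]) (use assms in "auto intro: Cauchy_Schwarz")
 finally show ?thesis .
qed

lemma ip_convergent: assumes s: "s : Cau" and t: "t : Cau" shows "convergent (%n. ip (s n) (t n))"
proof -
 obtain K where K: "K > 0" "!!n. sn (s n) <= K" using Cau_bounded[OF s] by blast
 obtain L where L: "L > 0" "!!n. sn (t n) <= L" using Cau_bounded[OF t] by blast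
 have "Cauchy (%n. ip (s n) (t n))" unfolding Cauchy_def dist_norm proof (intro allI impI)
  fix e :: real assume e: "e > 0"
  have "e / (2 * L) > 0" "e / (2 * K) > 0" using e K L by auto
  then obtain M N where M: "\<forall>m\<ge>M. \<forall>n\<ge>M. sn (s m .- s n) < e / (2 * L)"
   and N: "\<forall>m\<ge>N. \<forall>n\<ge>N. sn (t m .- t n) < e / (2 * K)" using CauD[OF s] CauD[OF t] by metis
  have "cmod (ip (s m) (t m) - ip (s n) (t n)) < e" if mn: "m >= max M N" "n >= max M N" for m n proof -
   have "cmod (ip (s m) (t m) - ip (s n) (t n)) <= sn (s m .- s n) * sn (t m) + sn (s n) * sn (t m .- t n)"
    using s t by (intro ip_diff_le) auto
   also have "... <= sn (s m .- s n) * L + K * sn (t m .- t n)"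
    using s t K L by (intro add_mono mult_left_mono mult_right_mono) auto
   also have "... < e / (2 * L) * L + K * (e / (2 * K))"
    using M N mn K L by (intro add_strict_mono mult_strict_left_mono mult_strict_right_mono) auto
   also have "... = e" using K(1) L(1) by (simp add: field_simps)
   finally show ?thesis .
  qed
  thus "\<exists>M. \<forall>m\<ge>M. \<forall>n\<ge>M. cmod (ip (s m) (t m) - ip (s n) (t n)) < e" by blast
 qed
 thus ?thesis by (simp add: Cauchy_convergent_iff)
qed

lemma ip_rel: assumes s: "(s, s') : grel" and t: "(t, t') : grel" and l: "(%n. ip (s n) (t n)) ----> l"
 shows "(%n. ip (s' n) (t' n)) ----> l"
proof -
 have c: "s : Cau" "t : Cau" "s' : Cau" "t' : Cau" and ls: "(%n. sn (s n .- s' n)) ----> 0"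
  and lt: "(%n. sn (t n .- t' n)) ----> 0" using s t by (auto simp: grel_iff)
 obtain K where K: "K > 0" "!!n. sn (s' n) <= K" using Cau_bounded[OF c(3)] by blast
 obtain L where L: "L > 0" "!!n. sn (t n) <= L" using Cau_bounded[OF c(2)] by blast
 have lim: "(%n. sn (s n .- s' n) * L + K * sn (t n .- t' n)) ----> 0"
  using tendsto_add[OF tendsto_mult_left_zero[OF ls, of L] tendsto_mult_right_zero[OF lt, of K]] by simp
 have "(%n. cmod (ip (s n) (t n) - ip (s' n) (t' n))) ----> 0" proof (rule LIMSEQ_squeeze_0[OF lim])
  fix n
  have "cmod (ip (s n) (t n) - ip (s' n) (t' n)) <= sn (s n .- s' n) * sn (t n) + sn (s' n) * sn (t n .- t' n)"
   using c by (intro ip_diff_le) auto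
  also have "... <= sn (s n .- s' n) * L + K * sn (t n .- t' n)"
   using c K L by (intro add_mono mult_left_mono mult_right_mono) auto
  finally show "cmod (ip (s n) (t n) - ip (s' n) (t' n)) <= sn (s n .- s' n) * L + K * sn (t n .- t' n)" .
 qed simp
 hence "(%n. ip (s n) (t n) - ip (s' n) (t' n)) ----> 0" by (rule tendsto_norm_zero_cancel)
 from tendsto_diff[OF l this] show ?thesis by simp
qed

lemma H_inner: assumes s: "s : Cau" and t: "t : Cau" shows "(%n. ip (s n) (t n)) ----> hinner HH (cls s) (cls t)"
proof -
 obtain l where l: "(%n. ip (s n) (t n)) ----> l" using ip_convergent[OF s t] by (auto simp: convergent_def)
 have "hinner HH (cls s) (cls t) = (THE l. \<exists>s\<in>cls s. \<exists>t\<in>cls t. (%n. ip (s n) (t n)) ----> l)"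
  by (simp add: L2_def ip_def)
 also have "... = l" proof (rule the_equality)
  show "\<exists>s\<in>cls s. \<exists>t\<in>cls t. (%n. ip (s n) (t n)) ----> l" using l cls_self s t by blast
  fix l' assume "\<exists>s\<in>cls s. \<exists>t\<in>cls t. (%n. ip (s n) (t n)) ----> l'"
  then obtain s' t' where "(s, s') : grel" "(t, t') : grel" "(%n. ip (s' n) (t' n)) ----> l'" by auto
  thus "l' = l" using ip_rel[OF _ _ l] LIMSEQ_unique by blast
 qed
 finally show ?thesis using l by simp
qed

lemma H_norm: assumes s: "s : Cau" shows "(%n. sn (s n)) ----> hnorm HH (cls s)"
proof -
 have "(%n. sqrt (Re (ip (s n) (s n)))) ----> hnorm HH (cls s)"
  unfolding hnorm_def by (intro tendsto_real_sqrt tendsto_Re H_inner s)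
 thus ?thesis by (simp add: ip_def gns_seminorm_def)
qed

lemma H_abelian_group: "abelian_group HH"
proof (rule abelian_groupI)
 fix U V W assume "U .: HH" "V .: HH" "W .: HH"
 then obtain s t u where c [simp]: "s : Cau" "t : Cau" "u : Cau" and UV: "U = cls s" "V = cls t" "W = cls u"
  by (metis H_cases)
 show "U .+@HH V .+@HH W = U .+@HH (V .+@HH W)" unfolding UV by (simp add: H_add Cau_linear a_assoc)
next
 fix U V assume "U .: HH" "V .: HH"
 then obtain s t where c [simp]: "s : Cau" "t : Cau" and UV: "U = cls s" "V = cls t" by (metis H_cases)
 show "U .+@HH V .: HH" "U .+@HH V = V .+@HH U" unfolding UV by (simp_all add: H_add Cau_linear a_comm)
next
 fix U assume "U .: HH"
 then obtain s where c [simp]: "s : Cau" and UV: "U = cls s" by (metis H_cases)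
 show "0@HH .+@HH U = U" unfolding UV by (simp add: H_zero H_add Cau_const)
 show "\<exists>V\<in>carrier HH. V .+@HH U = 0@HH" unfolding UV using Cau_smult[OF c, of "-1"]
  by (intro bexI[of _ "cls (%n. (-1) *. s n)"]) (simp_all add: H_zero H_add l_neg flip: minus_sm)
qed (simp add: H_zero Cau_const)

lemma H_minus: assumes s: "s : Cau" and t: "t : Cau" shows "cls s .-@HH cls t = cls (%n. s n .- t n)"
proof -
 interpret H: abelian_group HH by (rule H_abelian_group)
 note t' = Cau_smult[OF t, of "-1"]
 have "cls (%n. (-1) *. t n) .+@HH cls t = 0@HH" using t' t by (simp add: H_zero H_add l_neg flip: minus_sm)
 hence "\<ominus>\<^bsub>HH\<^esub> cls t = cls (%n. (-1) *. t n)" using H.minus_equality t t' by auto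
 thus ?thesis using s t t' by (simp add: a_minus_def H_add minus_sm)
qed

lemma Cau_diff: "s : Cau ==> t : Cau ==> (%n. s n .- t n) : Cau"
 using Cau_linear[OF _ Cau_smult[of t "-1"], of s] by (simp add: diff_sm)

lemma H_module: "Module.module complex_ring HH"
proof (rule moduleI)
 fix c d U V assume "U .: HH" "V .: HH"
 then obtain s t where c [simp]: "s : Cau" "t : Cau" and UV: "U = cls s" "V = cls t" by (metis H_cases)
 show "c *.@HH (U .+@HH V) = c *.@HH U .+@HH c *.@HH V"
  unfolding UV by (simp add: H_add H_smult Cau_linear Cau_smult sm_add_r)
next
 fix c d U assume "U .: HH"
 then obtain s where c [simp]: "s : Cau" and UV: "U = cls s" by (metis H_cases)
 show "c *.@HH U .: HH" "(c .+@complex_ring d) *.@HH U = c *.@HH U .+@HH d *.@HH U"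
  "(c **@complex_ring d) *.@HH U = c *.@HH (d *.@HH U)" "1@complex_ring *.@HH U = U"
  unfolding UV by (simp_all add: H_add H_smult Cau_linear Cau_smult sm_add_l)
qed (auto intro: H_abelian_group cring_from_type_algebra)

lemma H_inner_eq:
 "s : Cau ==> t : Cau ==> (%n. ip (s n) (t n)) ----> l ==> hinner HH (cls s) (cls t) = l"
 using H_inner LIMSEQ_unique by blast

lemma H_norm_limit_le: assumes s: "s : Cau" and le: "!!n. n >= N ==> sn (s n) <= c" shows "hnorm HH (cls s) <= c"
 using LIMSEQ_le_const2[OF H_norm[OF s]] le by blast

lemma H_diff_triangle: assumes "s : Cau" "t : Cau" "u : Cau"
 shows "hnorm HH (cls s .-@HH cls u) <= hnorm HH (cls s .-@HH cls t) + hnorm HH (cls t .-@HH cls u)"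
 unfolding H_minus[OF assms(1,3)] H_minus[OF assms(1,2)] H_minus[OF assms(2,3)]
 by (rule LIMSEQ_le[OF H_norm tendsto_add[OF H_norm H_norm]])
  (use assms Cau_diff sn_diff_trans in auto)

lemma H_norm_hat: "x .: A ==> hnorm HH (hat x) = sn x"
 using H_norm[OF Cau_const[of x]] by (simp add: LIMSEQ_const_iff)

lemma H_diff_hat: "x .: A ==> y .: A ==> hat x .-@HH hat y = hat (x .- y)" by (simp add: H_minus Cau_const)

lemma Cau_dense: assumes s: "s : Cau" and e: "e > 0"
 shows "\<exists>N. \<forall>n\<ge>N. hnorm HH (cls s .-@HH hat (s n)) <= e"
proof -
 obtain N where N: "\<forall>m\<ge>N. \<forall>n\<ge>N. sn (s m .- s n) < e" using CauD[OF s e] by blast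
 have "hnorm HH (cls s .-@HH hat (s n)) <= e" if n: "n >= N" for n
  unfolding H_minus[OF s Cau_const[OF Cau_carrier[OF s]]]
  by (rule H_norm_limit_le[of _ N]) (use N n Cau_diff[OF s Cau_const[OF Cau_carrier[OF s]]] in "auto simp: less_imp_le")
 thus ?thesis by blast
qed

lemma H_hilbert_space: "hilbert_space HH"
proof (intro hilbert_space.intro H_module hilbert_space_axioms.intro)
 fix U V W assume "U .: HH" "V .: HH" "W .: HH"
 then obtain s t u where c [simp]: "s : Cau" "t : Cau" "u : Cau" and UV: "U = cls s" "V = cls t" "W = cls u"
  by (metis H_cases)
 show "hinner HH (U .+@HH V) W = hinner HH U W + hinner HH V W" unfolding UV H_add[OF c(1,2)]
  by (rule H_inner_eq) (auto simp: ip_add_l Cau_linear intro!: tendsto_add H_inner)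
next
 fix c U V assume "U .: HH" "V .: HH"
 then obtain s t where c [simp]: "s : Cau" "t : Cau" and UV: "U = cls s" "V = cls t" by (metis H_cases)
 show "hinner HH (c *.@HH U) V = c * hinner HH U V" unfolding UV H_smult[OF c(1)]
  by (rule H_inner_eq) (auto simp: ip_smult_l Cau_smult intro!: tendsto_intros H_inner)
 have "(%n. cnj (ip (t n) (s n))) ----> cnj (hinner HH V U)" unfolding UV by (intro tendsto_cnj H_inner) auto
 thus "hinner HH U V = cnj (hinner HH V U)" unfolding UV by (intro H_inner_eq) (auto simp: ip_commute[of "s _"])
next
 fix U assume "U .: HH"
 then obtain s where c [simp]: "s : Cau" and UV: "U = cls s" by (metis H_cases)
 have l: "(%n. complex_of_real ((sn (s n))\<^sup>2)) ----> complex_of_real ((hnorm HH U)\<^sup>2)"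
  unfolding UV by (intro tendsto_of_real tendsto_power H_norm c)
 hence eq: "hinner HH U U = complex_of_real ((hnorm HH U)\<^sup>2)"
  unfolding UV by (intro H_inner_eq) (auto simp: ip_self)
 thus "hinner HH U U : \<real>\<^sub>\<ge>\<^sub>0" by (simp add: nonneg_Reals_def flip: of_real_power)
 have "hinner HH U U = 0 <-> hnorm HH U = 0" by (simp add: eq)
 also have "... <-> (%n. sn (s n)) ----> 0" using H_norm[OF c] LIMSEQ_unique unfolding UV by metis
 also have "... <-> U = 0@HH" unfolding UV H_zero by (subst cls_eq_iff) (auto simp: Cau_const minus_eq)
 finally show "hinner HH U U = 0 <-> U = 0@HH" .
next
 fix U :: "nat => (nat => 'a) set"
 assume U: "!!n. U n .: HH"
  and cau: "!!e. e > 0 ==> \<exists>N. \<forall>m\<ge>N. \<forall>n\<ge>N. hnorm HH (U m .-@HH U n) < e"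
 have "\<exists>s. s : Cau & U n = cls s" for n using U by (metis H_cases)
 then obtain s where s [simp]: "!!n. s n : Cau" and Us: "!!n. U n = cls (s n)" by metis
 \<comment> \<open>Completeness by a diagonal choice: each \<open>U n\<close> is replaced by a
   single algebra element within 1/(n+1). These elements form a Cauchy sequence themselves, and its
   class is the limit.\<close>
 have "\<exists>x\<in>carrier A. hnorm HH (U n .-@HH hat x) <= 1 / Suc n" for n
  using Cau_dense[OF s[of n], of "1 / Suc n"] unfolding Us by (metis Cau_carrier s order_refl of_nat_0_less_iff zero_less_Suc zero_less_divide_1_iff)
 then obtain t where t [simp]: "!!n. t n .: A" and Ut: "!!n. hnorm HH (U n .-@HH hat (t n)) <= 1 / Suc n" by metis
 have sym: "hnorm HH (hat x .-@HH cls v) = hnorm HH (cls v .-@HH hat x)" if "x .: A" "v : Cau" for x v proof -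
  have "(%n. sn (v n .- x)) ----> hnorm HH (hat x .-@HH cls v)"
   using H_norm[OF Cau_diff[OF Cau_const[OF that(1)] that(2)]] that by (simp add: H_minus Cau_const sn_diff_commute)
  moreover have "(%n. sn (v n .- x)) ----> hnorm HH (cls v .-@HH hat x)"
   using H_norm[OF Cau_diff[OF that(2) Cau_const[OF that(1)]]] that by (simp add: H_minus Cau_const)
  ultimately show ?thesis by (rule LIMSEQ_unique)
 qed
 have small: "\<exists>N. \<forall>n\<ge>N. 1 / real (Suc n) < e" if "e > 0" for e :: real
  using LIMSEQ_Suc[OF lim_1_over_n] that order_tendstoD(2)[of _ 0 sequentially e]
  by (auto simp: eventually_sequentially)
 have tC: "t : Cau" proof (rule CauI)
  fix e :: real assume e: "e > 0"
  obtain M where M: "\<forall>n\<ge>M. 1 / real (Suc n) < e/3" using small[of "e/3"] e by auto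
  obtain N where N: "\<forall>m\<ge>N. \<forall>n\<ge>N. hnorm HH (U m .-@HH U n) < e/3" using cau[of "e/3"] e by auto
  have "sn (t m .- t n) < e" if mn: "m >= max M N" "n >= max M N" for m n proof -
   have "sn (t m .- t n) = hnorm HH (hat (t m) .-@HH hat (t n))" by (simp add: H_diff_hat H_norm_hat)
   also have "... <= hnorm HH (hat (t m) .-@HH U m) + hnorm HH (U m .-@HH hat (t n))"
    unfolding Us by (rule H_diff_triangle) (auto simp: Cau_const)
   also have "hnorm HH (U m .-@HH hat (t n)) <= hnorm HH (U m .-@HH U n) + hnorm HH (U n .-@HH hat (t n))"
    unfolding Us by (rule H_diff_triangle) (auto simp: Cau_const)
   also have "hnorm HH (hat (t m) .-@HH U m) = hnorm HH (U m .-@HH hat (t m))" unfolding Us by (rule sym) auto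
   finally have le: "sn (t m .- t n) <= hnorm HH (U m .-@HH hat (t m))
    + (hnorm HH (U m .-@HH U n) + hnorm HH (U n .-@HH hat (t n)))" by simp
   have "1 / real (Suc m) < e/3" "1 / real (Suc n) < e/3" "hnorm HH (U m .-@HH U n) < e/3" using M N mn by auto
   thus ?thesis using le Ut[of m] Ut[of n] by linarith
  qed
  thus "\<exists>N. \<forall>m\<ge>N. \<forall>n\<ge>N. sn (t m .- t n) < e" by blast
 qed simp
 show "\<exists>V\<in>carrier HH. (%n. hnorm HH (U n .-@HH V)) ----> 0" proof (intro bexI[of _ "cls t"] LIMSEQ_I)
  fix e :: real assume e: "e > 0"
  obtain M where M: "\<forall>n\<ge>M. 1 / real (Suc n) < e/2" using small[of "e/2"] e by auto
  obtain N where N: "\<forall>n\<ge>N. hnorm HH (cls t .-@HH hat (t n)) <= e/2" using Cau_dense[OF tC, of "e/2"] e by auto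
  have "norm (hnorm HH (U n .-@HH cls t) - 0) < e" if n: "n >= max M N" for n proof -
   have "hnorm HH (U n .-@HH cls t) <= hnorm HH (U n .-@HH hat (t n)) + hnorm HH (hat (t n) .-@HH cls t)"
    unfolding Us by (rule H_diff_triangle) (auto simp: Cau_const tC)
   also have "hnorm HH (hat (t n) .-@HH cls t) = hnorm HH (cls t .-@HH hat (t n))" by (rule sym) (auto simp: tC)
   finally have le: "hnorm HH (U n .-@HH cls t)
    <= hnorm HH (U n .-@HH hat (t n)) + hnorm HH (cls t .-@HH hat (t n))" by simp
   have "1 / real (Suc n) < e/2" "hnorm HH (cls t .-@HH hat (t n)) <= e/2" using M N n by auto
   hence "hnorm HH (U n .-@HH cls t) < e" using le Ut[of n] by linarith
   moreover have "hnorm HH (U n .-@HH cls t) >= 0" unfolding Us H_minus[OF s tC]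
    by (rule LIMSEQ_le_const[OF H_norm]) (auto simp: tC intro: Cau_diff)
   ultimately show ?thesis by simp
  qed
  thus "\<exists>N. \<forall>n\<ge>N. norm (hnorm HH (U n .-@HH cls t) - 0) < e" by blast
 qed (simp add: tC)
qed

end

sublocale cstar_state \<subseteq> H: hilbert_space "L2 A \<rho>"
 by (rule H_hilbert_space)

context cstar_state
begin

section \<open>The representation on the completion\<close>

lemma \<pi>_closed: assumes x: "x .: A" shows "\<pi> x .: BB"
proof -
 let ?f = "%U. \<Union>s\<in>U. cls (%n. x ** s n)"
 have f: "?f (cls s) = cls (%n. x ** s n)" if "s : Cau" for s
  using \<pi>_cls[OF x that] that by (simp add: gns_rep_def)
 have "restrict ?f (carrier HH) .: BB" proof (rule H.B_intro)
  fix U V assume "U .: HH" "V .: HH"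
  then obtain s t where c [simp]: "s : Cau" "t : Cau" and UV: "U = cls s" "V = cls t" by (metis H_cases)
  show "?f (U .+@HH V) = ?f U .+@HH ?f V" unfolding UV H_add[OF c] f[OF c(1)] f[OF c(2)] f[OF Cau_linear[OF c]]
   by (simp add: H_add Cau_mult x r_distr)
 next
  fix c U assume "U .: HH"
  then obtain s where c [simp]: "s : Cau" and UV: "U = cls s" by (metis H_cases)
  show "?f U .: HH" unfolding UV f[OF c] by (simp add: Cau_mult x)
  show "?f (c *.@HH U) = c *.@HH ?f U" unfolding UV H_smult[OF c] f[OF c] f[OF Cau_smult[OF c]]
   by (simp add: H_smult Cau_mult x)
  show "hnorm HH (?f U) <= nA x * hnorm HH U" unfolding UV f[OF c]
   by (rule LIMSEQ_le[OF H_norm tendsto_mult[OF tendsto_const H_norm]])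
    (use x in "auto intro: Cau_mult simp: sn_mult_le")
 qed
 thus ?thesis by (simp add: gns_rep_def)
qed

lemma \<pi>_hom: "\<pi> : cstar_hom A BB"
proof -
 note [simp] = \<pi>_closed H.B_ops \<pi>_cls Cau_mult Cau_linear Cau_smult
 have eqI: "S = T" if "S .: BB" "T .: BB" "!!s. s : Cau ==> S (cls s) = T (cls s)" for S T
  using that by (intro H.B_eqI) (auto elim!: H_cases)
 show ?thesis unfolding cstar_hom_def proof (intro CollectI conjI ring_hom_memI allI ballI)
  show "\<pi> (x ** y) = \<pi> x **@BB \<pi> y" if "x .: A" "y .: A" for x y
   by (rule eqI) (use that in "simp_all add: m_assoc")
  show "\<pi> (x .+ y) = \<pi> x .+@BB \<pi> y" if "x .: A" "y .: A" for x y
   by (rule eqI) (use that in "simp_all add: H_add l_distr")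
  show "\<pi> \<one> = 1@BB" by (rule eqI) simp_all
  show "\<pi> (c *. x) = c *.@BB \<pi> x" if "x .: A" for c x by (rule eqI) (use that in "simp_all add: H_smult")
  show "\<pi> (sA x) = star BB (\<pi> x)" if x: "x .: A" for x proof (rule H.B_starI[symmetric])
   fix U V assume "U .: HH" "V .: HH"
   then obtain s t where c [simp]: "s : Cau" "t : Cau" and UV: "U = cls s" "V = cls t" by (metis H_cases)
   have "(%n. ip (x ** s n) (t n)) ----> hinner HH U (\<pi> (sA x) V)"
    using H_inner[OF c(1) Cau_mult[OF star_closed[OF x] c(2)]] x unfolding UV by (simp add: ip_def star_mult m_assoc)
   thus "hinner HH (\<pi> x U) V = hinner HH U (\<pi> (sA x) V)"
    unfolding UV \<pi>_cls[OF x c(1)] using x by (intro H_inner_eq) auto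
  qed (use x in simp_all)
 qed simp
qed

lemma hat_closed [simp]: "x .: A ==> hat x .: HH" by (simp add: Cau_const)

lemma inn_hat: "x .: A ==> y .: A ==> hinner HH (hat x) (hat y) = ip x y" by (rule H_inner_eq) (auto simp: Cau_const)

lemma \<pi>_hat: "x .: A ==> y .: A ==> \<pi> x (hat y) = hat (x ** y)" by (simp add: \<pi>_cls Cau_const)

lemma hat_add: "x .: A ==> y .: A ==> hat (x .+ y) = hat x .+@HH hat y" by (simp add: H_add Cau_const)

lemma hat_smult: "x .: A ==> hat (c *. x) = c *.@HH hat x" by (simp add: H_smult Cau_const)

lemma hat_dense: assumes "U .: HH" "e > 0" obtains x where "x .: A" "hnorm HH (U .-@HH hat x) <= e"
proof -
 obtain s where s: "s : Cau" "U = cls s" using H_cases[OF assms(1)] .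
 then obtain N where "hnorm HH (U .-@HH hat (s N)) <= e" using Cau_dense[OF s(1) assms(2)] by blast
 thus ?thesis using that[of "s N"] s by simp
qed

end

sublocale cstar_state \<subseteq> GNS: cstar_hom_pair A "BH (L2 A \<rho>)" "gns_rep A \<rho>"
 by unfold_locales (rule \<pi>_hom)

subsection \<open>Ultrafilters and ultrapowers\<close>

text \<open>Zorn's lemma gives a minimal proper filter below \<open>F\<close>: the infimum of a
  chain is generated by its members and stays proper. If such a filter does not reject P, meeting it
  with P keeps it proper, so by minimality it already contains P.\<close>

lemma ex_ultrafilter_le:
 fixes F :: "'i filter" assumes F: "F ~= bot"
 obtains \<omega> where "\<omega> <= F" "\<omega> ~= bot" "!!P. eventually P \<omega> | eventually (%i. \<not> P i) \<omega>"
proof -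
 let ?A = "{G. G <= F & G ~= bot}" and ?P = "%G G'. G' <= (G :: 'i filter)"
 have "\<exists>m\<in>?A. \<forall>a\<in>?A. ?P m a --> a = m" proof (rule predicate_Zorn)
  show "partial_order_on ?A (relation_of ?P ?A)" by (rule partial_order_on_relation_ofI) auto
  fix C assume C: "C : Chains (relation_of ?P ?A)"
  have CA: "C <= ?A" using C by (auto simp: Chains_def relation_of_def)
  show "\<exists>u\<in>?A. \<forall>a\<in>C. ?P a u" proof (cases "C = {}")
   case True thus ?thesis using F by auto
  next
   case False
   have "eventually (%_. False) (Inf C) <-> (\<exists>b\<in>C. eventually (%_. False) b)"
   proof (rule eventually_Inf_base[OF False])
    fix G G' assume "G : C" "G' : C"
    hence "G <= G' | G' <= G" using C by (auto simp: Chains_def relation_of_def)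
    thus "\<exists>x\<in>C. x <= inf G G'" using \<open>G : C\<close> \<open>G' : C\<close> by (metis inf.orderE inf_commute order_refl)
   qed
   hence "Inf C ~= bot" using CA trivial_limit_def by blast
   moreover obtain G where "G : C" using False by blast
   hence "Inf C <= F" using CA by (intro Inf_lower2[of G]) auto
   ultimately show ?thesis by (intro bexI[of _ "Inf C"]) (auto intro: Inf_lower)
  qed
 qed
 then obtain \<omega> where w: "\<omega> <= F" "\<omega> ~= bot" and max: "!!G. G <= \<omega> ==> G ~= bot ==> G = \<omega>"
  by (smt (verit) mem_Collect_eq order_trans)
 have "eventually P \<omega> | eventually (%i. \<not> P i) \<omega>" for P proof (rule disjCI)
  assume n: "\<not> eventually (%i. \<not> P i) \<omega>"
  have ev: "eventually P (inf \<omega> (principal {i. P i}))" by (simp add: eventually_inf_principal)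
  have "inf \<omega> (principal {i. P i}) ~= bot" using n by (simp add: trivial_limit_def eventually_inf_principal)
  hence "inf \<omega> (principal {i. P i}) = \<omega>" by (intro max) auto
  with ev show "eventually P \<omega>" by simp
 qed
 thus ?thesis using that w by blast
qed

lemma UN_eq_const: assumes "x : S" "!!y. y : S ==> f y = c" shows "(\<Union>y\<in>S. f y) = c" using assms by blast

locale ultra =
 fixes \<omega> :: "'i filter" assumes nontriv [simp]: "\<omega> ~= bot"
  and ultra: "eventually P \<omega> | eventually (%i. \<not> P i) \<omega>"
begin

lemma ulim_real:
 fixes f :: "'i => real" assumes b: "!!i. \<bar>f i\<bar> <= K" obtains l where "(f ---> l) \<omega>"
proof -
 \<comment> \<open>The limit is the supremum of the lower bounds that hold along the ultrafilter.
   Any value above it fails to be such a bound, so by the ultrafilter property f is eventually below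
   that value.\<close>
 let ?S = "{t. eventually (%i. t <= f i) \<omega>}"
 have ne: "- K : ?S" using b by (auto intro!: always_eventually simp: abs_le_iff minus_le_iff)
 have le: "t <= K" if "t : ?S" for t proof -
  have "eventually (%i. t <= f i) \<omega>" using that by simp
  then obtain i where "t <= f i" using eventually_happens'[OF nontriv] by blast
  thus ?thesis using b[of i] by linarith
 qed
 hence bdd: "bdd_above ?S" by (auto intro!: bdd_aboveI)
 have "(f ---> Sup ?S) \<omega>" proof (rule order_tendstoI)
  fix a assume "a < Sup ?S"
  then obtain t where "t : ?S" "a < t" using less_cSupE[of a ?S] ne by blast
  thus "eventually (%i. a < f i) \<omega>" by (auto elim!: eventually_mono)
 next
  fix a assume a: "Sup ?S < a"
  hence "a \<notin> ?S" using cSup_upper[OF _ bdd] by fastforce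
  thus "eventually (%i. f i < a) \<omega>" using ultra[of "%i. a <= f i"] by (auto simp: not_le)
 qed
 thus ?thesis using that by blast
qed

lemma ulim_complex:
 fixes f :: "'i => complex" assumes b: "!!i. cmod (f i) <= K" obtains l where "(f ---> l) \<omega>"
proof -
 obtain x where x: "((%i. Re (f i)) ---> x) \<omega>"
  by (rule ulim_real[of "%i. Re (f i)" K]) (use b abs_Re_le_cmod order_trans in blast)
 obtain y where y: "((%i. Im (f i)) ---> y) \<omega>"
  by (rule ulim_real[of "%i. Im (f i)" K]) (use b abs_Im_le_cmod order_trans in blast)
 have "((%i. Complex (Re (f i)) (Im (f i))) ---> Complex x y) \<omega>" by (rule tendsto_Complex[OF x y])
 thus ?thesis using that by simp
qed

lemma ulim_squeeze_0:
 fixes f g :: "'i => real" assumes "(g ---> 0) \<omega>" "!!n. 0 <= f n" "!!n. f n <= g n" shows "(f ---> 0) \<omega>"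
 by (rule tendsto_sandwich[OF _ _ tendsto_const assms(1)]) (use assms in auto)

end

section \<open>The ultrapower as a C*-algebra\<close>

locale cstar_ultra = cstar_algebra A + ultra \<omega> for A :: "'a cstar" (structure) and \<omega> :: "'i filter"
begin

abbreviation "LL == carrier (linf A :: ('i => 'a) cstar)"
abbreviation "UU == ultrapower A \<omega>"
abbreviation "uc == ultra_class A \<omega>"

lemma LL_iff: "a : LL <-> (\<forall>i. a i .: A) & (\<exists>K. \<forall>i. nA (a i) <= K)"
 by (auto simp: linf_def bdd_above_def)

lemma LL_I: "(!!i. a i .: A) ==> (!!i. nA (a i) <= K) ==> a : LL" unfolding LL_iff by blast

lemma LL_carrier: "a : LL ==> a i .: A" by (simp add: LL_iff)

lemma LL_bound: assumes "a : LL" obtains K where "K >= 0" "!!i. nA (a i) <= K"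
proof -
 obtain K where K: "\<forall>i. nA (a i) <= K" using assms unfolding LL_iff by blast
 show ?thesis by (rule that[of "max K 0"]) (use K in "auto simp: le_max_iff_disj")
qed

lemma LL_const: "x .: A ==> (%_. x) : LL" by (rule LL_I) auto

lemma LL_add: assumes "a : LL" "b : LL" shows "(%i. a i .+ b i) : LL"
proof -
 obtain K L where "!!i. nA (a i) <= K" "!!i. nA (b i) <= L" using LL_bound assms by metis
 hence "nA (a i .+ b i) <= K + L" for i
  using nrm_triangle[OF LL_carrier[OF assms(1)] LL_carrier[OF assms(2)], of i i] by (meson add_mono order_trans)
 thus ?thesis using LL_carrier[OF assms(1)] LL_carrier[OF assms(2)] by (intro LL_I) auto
qed

lemma LL_mult: assumes "a : LL" "b : LL" shows "(%i. a i ** b i) : LL"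
proof -
 obtain K L where "!!i. nA (a i) <= K" "!!i. nA (b i) <= L" using LL_bound assms by metis
 hence "nA (a i ** b i) <= K * L" for i by (intro nrm_mult_le LL_carrier assms)
 thus ?thesis using LL_carrier[OF assms(1)] LL_carrier[OF assms(2)] by (intro LL_I) auto
qed

lemma LL_smult: assumes "a : LL" shows "(%i. c *. a i) : LL"
proof -
 obtain K where "!!i. nA (a i) <= K" using LL_bound assms by metis
 thus ?thesis using LL_carrier[OF assms] by (intro LL_I[of _ "cmod c * K"]) (auto simp: nrm_smult mult_left_mono)
qed

lemma LL_star: assumes "a : LL" shows "(%i. sA (a i)) : LL"
proof -
 obtain K where "!!i. nA (a i) <= K" using LL_bound assms by metis
 thus ?thesis using LL_carrier[OF assms] by (intro LL_I[of _ K]) auto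
qed

lemma LL_diff: assumes "a : LL" "b : LL" shows "(%i. a i .- b i) : LL"
 using LL_add[OF assms(1) LL_smult[OF assms(2), of "-1"]] LL_carrier[OF assms(1)] LL_carrier[OF assms(2)]
 by (simp add: diff_sm)

lemma linf_simps [simp]:
 "a **@(linf A) b = (%i. a i ** b i)" "a .+@(linf A) b = (%i. a i .+ b i)"
 "1@(linf A) = (%i. \<one>)" "0@(linf A) = (%i. \<zero>)"
 "c *.@(linf A) a = (%i. c *. a i)" "star (linf A) a = (%i. sA (a i))"
 "nrm (linf A) a = (SUP i. nA (a i))" by (simp_all add: linf_def)

lemma linf_ring: "ring (linf A :: ('i => 'a) cstar)"
proof (rule ringI)
 show "abelian_group (linf A :: ('i => 'a) cstar)" proof (rule abelian_groupI)
  show "\<exists>b\<in>LL. b .+@(linf A) a = 0@(linf A)" if a: "a : LL" for a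
   by (rule bexI[OF _ LL_smult[OF a, of "-1"]])
    (simp add: LL_carrier[OF a] l_neg flip: minus_sm)
 qed (simp_all add: LL_add LL_const LL_carrier a_ac)
 show "monoid (linf A :: ('i => 'a) cstar)" by (rule monoidI) (simp_all add: LL_mult LL_const LL_carrier m_assoc)
qed (simp_all add: LL_carrier l_distr r_distr)

lemma null_iff: "a : null_ideal A \<omega> <-> a : LL & ((%i. nA (a i)) ---> 0) \<omega>"
 by (simp add: null_ideal_def)

lemma null_minus: "a : LL ==> \<ominus>\<^bsub>linf A\<^esub> a = (%i. \<ominus> a i)"
proof -
 assume a: "a : LL"
 interpret R: ring "linf A :: ('i => 'a) cstar" by (rule linf_ring)
 have "(%i. \<ominus> a i) : LL" using LL_smult[OF a, of "-1"] LL_carrier[OF a] by (simp add: minus_sm)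
 thus ?thesis by (intro R.minus_equality) (simp_all add: a l_neg LL_carrier[OF a])
qed

lemma null_ideal_ideal: "ideal (null_ideal A \<omega>) (linf A)"
proof (rule idealI[OF linf_ring])
 interpret R: ring "linf A :: ('i => 'a) cstar" by (rule linf_ring)
 show "subgroup (null_ideal A \<omega>) (add_monoid (linf A))" proof (rule R.add.subgroupI)
  show "null_ideal A \<omega> <= LL" by (auto simp: null_iff)
  show "null_ideal A \<omega> ~= {}" using null_iff[of "%_. \<zero>"] LL_const[of "\<zero>"] by (auto simp del: null_iff)
  show "\<ominus>\<^bsub>linf A\<^esub> a : null_ideal A \<omega>" if "a : null_ideal A \<omega>" for a proof -
   have a: "a : LL" "((%i. nA (a i)) ---> 0) \<omega>" using that by (auto simp: null_iff)
   hence "(%i. \<ominus> a i) : LL" using LL_smult[OF a(1), of "-1"] LL_carrier[OF a(1)] by (simp add: minus_sm)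
   thus ?thesis using a LL_carrier[OF a(1)] by (simp add: null_iff null_minus)
  qed
  show "a .+@(linf A) b : null_ideal A \<omega>" if "a : null_ideal A \<omega>" "b : null_ideal A \<omega>" for a b
  proof -
   have a: "a : LL" "b : LL" "((%i. nA (a i)) ---> 0) \<omega>" "((%i. nA (b i)) ---> 0) \<omega>"
    using that by (auto simp: null_iff)
   have l: "((%i. nA (a i) + nA (b i)) ---> 0) \<omega>" using tendsto_add[OF a(3,4)] by simp
   have "((%i. nA (a i .+ b i)) ---> 0) \<omega>"
    by (rule ulim_squeeze_0[OF l]) (simp_all add: nrm_nonneg nrm_triangle LL_carrier a)
   thus ?thesis using LL_add a by (simp add: null_iff)
  qed
 qed
next
 fix a x assume "a : null_ideal A \<omega>" and x: "x : LL"
 hence a: "a : LL" "((%i. nA (a i)) ---> 0) \<omega>" by (auto simp: null_iff)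
 obtain K where K: "K >= 0" "!!i. nA (x i) <= K" using LL_bound[OF x] by metis
 note c = LL_carrier[OF a(1)] LL_carrier[OF x]
 have "((%i. nA (x i ** a i)) ---> 0) \<omega>"
  by (rule ulim_squeeze_0[OF tendsto_mult_right_zero[OF a(2), of K]]) (auto intro!: nrm_nonneg nrm_mult_le c K)
 thus "x **@(linf A) a : null_ideal A \<omega>" using LL_mult[OF x a(1)] by (simp add: null_iff)
 have "((%i. nA (a i ** x i)) ---> 0) \<omega>"
  by (rule ulim_squeeze_0[OF tendsto_mult_left_zero[OF a(2), of K]]) (auto intro!: nrm_nonneg nrm_mult_le c K)
 thus "a **@(linf A) x : null_ideal A \<omega>" using LL_mult[OF a(1) x] by (simp add: null_iff)
qed

lemma mem_uc: assumes a: "a : LL" shows "b : uc a <-> b : LL & ((%i. nA (b i .- a i)) ---> 0) \<omega>"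
proof -
 have "b : uc a <-> (\<exists>j\<in>null_ideal A \<omega>. b = (%i. j i .+ a i))"
  by (auto simp: ultra_class_def a_r_coset_def')
 also have "... <-> b : LL & ((%i. nA (b i .- a i)) ---> 0) \<omega>" proof
  assume "\<exists>j\<in>null_ideal A \<omega>. b = (%i. j i .+ a i)"
  then obtain j where j: "j : LL" "((%i. nA (j i)) ---> 0) \<omega>" "b = (%i. j i .+ a i)" by (auto simp: null_iff)
  have "j i .+ a i .- a i = j i" for i using LL_carrier[OF j(1), of i] LL_carrier[OF a, of i] by algebra
  thus "b : LL & ((%i. nA (b i .- a i)) ---> 0) \<omega>" using j a by (simp add: LL_add)
 next
  assume b: "b : LL & ((%i. nA (b i .- a i)) ---> 0) \<omega>"
  have "b = (%i. (b i .- a i) .+ a i)" proof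
   fix i
   have "b i .: A" using b LL_carrier by blast
   thus "b i = (b i .- a i) .+ a i" using LL_carrier[OF a, of i] by algebra
  qed
  moreover have "(%i. b i .- a i) : null_ideal A \<omega>" using b a by (simp add: null_iff LL_diff)
  ultimately show "\<exists>j\<in>null_ideal A \<omega>. b = (%i. j i .+ a i)" by (rule bexI)
 qed
 finally show ?thesis .
qed

lemma uc_self: "a : LL ==> a : uc a" by (simp add: mem_uc minus_eq r_neg LL_carrier)

lemma uc_eq_iff: assumes a: "a : LL" and b: "b : LL" shows "uc a = uc b <-> ((%i. nA (a i .- b i)) ---> 0) \<omega>"
proof
 assume "uc a = uc b"
 hence "a : uc b" using uc_self[OF a] by simp
 thus "((%i. nA (a i .- b i)) ---> 0) \<omega>" using b by (simp add: mem_uc)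
next
 interpret I: ideal "null_ideal A \<omega>" "linf A" by (rule null_ideal_ideal)
 assume "((%i. nA (a i .- b i)) ---> 0) \<omega>"
 hence "a : uc b" using a b by (simp add: mem_uc)
 thus "uc a = uc b" unfolding ultra_class_def using b by (intro I.a_repr_independence[symmetric] I.a_subgroup)
qed

lemma X_carrier: "carrier UU = uc ` LL"
 by (auto simp: ultrapower_def cstar_quot_def FactRing_def A_RCOSETS_def RCOSETS_def
   ultra_class_def a_r_coset_def)

lemma uc_closed [simp]: "a : LL ==> uc a .: UU" by (simp add: X_carrier)

lemma X_cases: assumes "U .: UU" obtains a where "a : LL" "U = uc a" using assms by (auto simp: X_carrier)

lemma X_mult: "a : LL ==> b : LL ==> uc a **@UU uc b = uc (%i. a i ** b i)"
proof -
 interpret I: ideal "null_ideal A \<omega>" "linf A" by (rule null_ideal_ideal)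
 assume "a : LL" "b : LL"
 thus ?thesis using I.rcoset_mult_add[of a b]
  by (simp add: ultrapower_def cstar_quot_def FactRing_simps ultra_class_def)
qed

lemma X_add: "a : LL ==> b : LL ==> uc a .+@UU uc b = uc (%i. a i .+ b i)"
proof -
 interpret I: ideal "null_ideal A \<omega>" "linf A" by (rule null_ideal_ideal)
 assume "a : LL" "b : LL"
 thus ?thesis using I.a_rcos_sum[of a b] by (simp add: ultrapower_def cstar_quot_def FactRing_simps ultra_class_def)
qed

lemma X_one: "1@UU = uc (%_. \<one>)" by (simp add: ultrapower_def cstar_quot_def FactRing_def ultra_class_def)

lemma X_zero: "0@UU = uc (%_. \<zero>)"
proof -
 interpret I: ideal "null_ideal A \<omega>" "linf A" by (rule null_ideal_ideal)
 have "(%_. \<zero>) : null_ideal A \<omega>" by (simp add: null_iff LL_const)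
 hence "null_ideal A \<omega> = uc (%_. \<zero>)" using I.a_rcos_const by (simp add: ultra_class_def)
 thus ?thesis by (simp add: ultrapower_def cstar_quot_def FactRing_def)
qed

lemma X_smult: assumes a: "a : LL" shows "c *.@UU uc a = uc (%i. c *. a i)"
proof -
 have "uc (%i. c *. b i) = uc (%i. c *. a i)" if "b : uc a" for b proof -
  have b: "b : LL" "((%i. nA (b i .- a i)) ---> 0) \<omega>" using that a by (auto simp: mem_uc)
  have "((%i. cmod c * nA (b i .- a i)) ---> 0) \<omega>" using tendsto_mult_right_zero[OF b(2)] .
  hence "((%i. nA (c *. b i .- c *. a i)) ---> 0) \<omega>"
   using LL_carrier[OF a] LL_carrier[OF b(1)] by (simp add: nrm_smult flip: sm_diff_r)
  thus ?thesis using a b by (subst uc_eq_iff) (auto intro: LL_smult)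
 qed
 from UN_eq_const[OF uc_self[OF a] this] show ?thesis by (simp add: ultrapower_def cstar_quot_def ultra_class_def)
qed

lemma X_star: assumes a: "a : LL" shows "star UU (uc a) = uc (%i. sA (a i))"
proof -
 have "uc (%i. sA (b i)) = uc (%i. sA (a i))" if "b : uc a" for b proof -
  have b: "b : LL" "((%i. nA (b i .- a i)) ---> 0) \<omega>" using that a by (auto simp: mem_uc)
  hence "((%i. nA (sA (b i) .- sA (a i))) ---> 0) \<omega>"
   using LL_carrier[OF a] LL_carrier[OF b(1)] by (simp flip: star_diff)
  thus ?thesis using a b by (subst uc_eq_iff) (auto intro: LL_star)
 qed
 from UN_eq_const[OF uc_self[OF a] this] show ?thesis by (simp add: ultrapower_def cstar_quot_def ultra_class_def)
qed

lemma LL_bdd: "a : LL ==> bdd_above (range (%i. nA (a i)))" by (meson LL_bound bdd_aboveI2)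

text \<open>Coordinates of norm at least \<open>r\<close> are replaced by zero. They are negligible
  along the ultrafilter, so the class is unchanged, while the new representative is bounded in every
  coordinate.\<close>

lemma uc_truncate: assumes a: "a : LL" and l: "((%i. nA (a i)) ---> l) \<omega>" and r: "l < r"
 obtains b where "b : uc a" "!!i. nA (b i) <= r"
proof -
 have "l >= 0" by (rule tendsto_lowerbound[OF l]) (use LL_carrier[OF a] nrm_nonneg in "auto intro!: always_eventually")
 define b where "b i = (if nA (a i) < r then a i else \<zero>)" for i
 have bL: "b : LL" by (rule LL_I[of _ r]) (use LL_carrier[OF a] \<open>l >= 0\<close> r in "auto simp: b_def")
 have "eventually (%i. nA (a i) < r) \<omega>" using l r by (rule order_tendstoD)
 hence "eventually (%i. nA (b i .- a i) = 0) \<omega>"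
  by eventually_elim (use LL_carrier[OF a] in "simp add: b_def minus_eq r_neg")
 hence "((%i. nA (b i .- a i)) ---> 0) \<omega>" by (rule tendsto_eventually)
 hence "b : uc a" using a bL by (simp add: mem_uc)
 moreover have "nA (b i) <= r" for i using \<open>l >= 0\<close> r by (simp add: b_def)
 ultimately show ?thesis using that by blast
qed

text \<open>The quotient norm is an infimum over representatives. Truncated representatives push it
  down to the limit of the norms, and a null perturbation cannot bring a representative below that
  limit. Norm identities in the ultrapower thereby reduce to coordinates.\<close>

lemma uc_nrm_lim: assumes a: "a : LL" shows "((%i. nA (a i)) ---> nrm UU (uc a)) \<omega>"
proof -
 obtain K where "!!i. nA (a i) <= K" using LL_bound[OF a] by metis
 hence bd: "\<bar>nA (a i)\<bar> <= K" for i using nrm_nonneg LL_carrier[OF a] by simp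
 obtain l where l: "((%i. nA (a i)) ---> l) \<omega>" by (rule ulim_real[OF bd])
 have lb: "l <= (SUP i. nA (b i))" if "b : uc a" for b proof -
  have b: "b : LL" "((%i. nA (b i .- a i)) ---> 0) \<omega>" using that a by (auto simp: mem_uc)
  have "((%i. nA (a i) - nA (b i .- a i)) ---> l) \<omega>" using tendsto_diff[OF l b(2)] by simp
  thus ?thesis proof (rule tendsto_upperbound)
   show "eventually (%i. nA (a i) - nA (b i .- a i) <= (SUP i. nA (b i))) \<omega>"
   proof (rule always_eventually, rule allI)
    fix i
    have "nA (a i) <= nA (b i) + nA (b i .- a i)"
     using nrm_le_diff[of "a i" "b i"] LL_carrier[OF a] LL_carrier[OF b(1)] nrm_diff_commute by simp
    moreover have "nA (b i) <= (SUP i. nA (b i))" by (rule cSUP_upper[OF _ LL_bdd[OF b(1)]]) simp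
    ultimately show "nA (a i) - nA (b i .- a i) <= (SUP i. nA (b i))" by linarith
   qed
  qed simp
 qed
 have "(INF b\<in>uc a. SUP i. nA (b i)) = l" proof (rule antisym)
  show "(INF b\<in>uc a. SUP i. nA (b i)) <= l" proof (rule field_le_epsilon)
   fix e :: real assume "e > 0"
   then obtain b where b: "b : uc a" "!!i. nA (b i) <= l + e" using uc_truncate[OF a l, of "l + e"] by auto
   have "(INF b\<in>uc a. SUP i. nA (b i)) <= (SUP i. nA (b i))"
    by (rule cINF_lower[OF _ b(1)]) (use lb in "auto intro!: bdd_belowI")
   also have "... <= l + e" by (rule cSUP_least) (use b(2) in auto)
   finally show "(INF b\<in>uc a. SUP i. nA (b i)) <= l + e" .
  qed
  show "l <= (INF b\<in>uc a. SUP i. nA (b i))" by (rule cINF_greatest) (use uc_self[OF a] lb in auto)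
 qed
 hence "nrm UU (uc a) = l" by (simp add: ultrapower_def cstar_quot_def)
 thus ?thesis using l by simp
qed

lemma uc_nrm_eq: "a : LL ==> ((%i. nA (a i)) ---> l) \<omega> ==> nrm UU (uc a) = l"
 using tendsto_unique[OF nontriv uc_nrm_lim] by blast

lemma uc_nrm_le: "a : LL ==> (!!i. nA (a i) <= K) ==> nrm UU (uc a) <= K"
 by (rule tendsto_upperbound[OF uc_nrm_lim]) (auto intro!: always_eventually)

lemma X_abelian_group: "abelian_group UU"
proof (rule abelian_groupI)
 fix U V W assume "U .: UU" "V .: UU" "W .: UU"
 then obtain a b c where c: "a : LL" "b : LL" "c : LL" and UV: "U = uc a" "V = uc b" "W = uc c" by (metis X_cases)
 show "U .+@UU V .+@UU W = U .+@UU (V .+@UU W)" unfolding UV by (simp add: X_add c LL_add a_assoc LL_carrier)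
next
 fix U V assume "U .: UU" "V .: UU"
 then obtain a b where c: "a : LL" "b : LL" and UV: "U = uc a" "V = uc b" by (metis X_cases)
 show "U .+@UU V .: UU" "U .+@UU V = V .+@UU U" unfolding UV by (simp_all add: X_add c LL_add a_comm LL_carrier)
next
 fix U assume "U .: UU"
 then obtain a where c: "a : LL" and UV: "U = uc a" by (metis X_cases)
 show "0@UU .+@UU U = U" unfolding UV by (simp add: X_zero X_add LL_const c LL_carrier)
 show "\<exists>V\<in>carrier UU. V .+@UU U = 0@UU" unfolding UV using LL_smult[OF c, of "-1"]
  by (intro bexI[of _ "uc (%n. (-1) *. a n)"]) (simp_all add: X_zero X_add c LL_carrier l_neg flip: minus_sm)
qed (simp add: X_zero LL_const)

lemma X_diff: assumes a: "a : LL" and b: "b : LL" shows "uc a .-@UU uc b = uc (%i. a i .- b i)"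
proof -
 interpret R: abelian_group UU by (rule X_abelian_group)
 note b' = LL_smult[OF b, of "-1"]
 have "uc (%n. (-1) *. b n) .+@UU uc b = 0@UU" using b' b by (simp add: X_zero X_add l_neg LL_carrier flip: minus_sm)
 hence "\<ominus>\<^bsub>UU\<^esub> uc b = uc (%n. (-1) *. b n)"
  using R.minus_equality[of "uc (%n. (-1) *. b n)" "uc b"] b b' by simp
 thus ?thesis using a b b' by (simp add: a_minus_def[of UU] X_add diff_sm LL_carrier)
qed

lemma X_ring: "ring UU"
proof (rule ringI[OF X_abelian_group])
 show "monoid UU" proof (rule monoidI)
  fix U V W assume "U .: UU" "V .: UU" "W .: UU"
  then obtain a b c where c: "a : LL" "b : LL" "c : LL" and UV: "U = uc a" "V = uc b" "W = uc c" by (metis X_cases)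
  show "U **@UU V **@UU W = U **@UU (V **@UU W)" unfolding UV by (simp add: X_mult c LL_mult m_assoc LL_carrier)
 next
  fix U V assume "U .: UU" "V .: UU"
  then obtain a b where c: "a : LL" "b : LL" and UV: "U = uc a" "V = uc b" by (metis X_cases)
  show "U **@UU V .: UU" unfolding UV by (simp add: X_mult c LL_mult)
 next
  fix U assume "U .: UU"
  then obtain a where c: "a : LL" and UV: "U = uc a" by (metis X_cases)
  show "1@UU **@UU U = U" "U **@UU 1@UU = U" unfolding UV by (simp_all add: X_one X_mult LL_const c LL_carrier)
 qed (simp add: X_one LL_const)
next
 fix U V W assume "U .: UU" "V .: UU" "W .: UU"
 then obtain a b c where c: "a : LL" "b : LL" "c : LL" and UV: "U = uc a" "V = uc b" "W = uc c" by (metis X_cases)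
 show "(U .+@UU V) **@UU W = U **@UU W .+@UU V **@UU W"
  "W **@UU (U .+@UU V) = W **@UU U .+@UU W **@UU V"
  unfolding UV by (simp_all add: X_add X_mult c LL_mult LL_add l_distr r_distr LL_carrier)
qed

lemma X_module: "Module.module complex_ring UU"
proof (rule moduleI)
 fix c d U V assume "U .: UU" "V .: UU"
 then obtain a b where ab: "a : LL" "b : LL" and UV: "U = uc a" "V = uc b" by (metis X_cases)
 show "c *.@UU (U .+@UU V) = c *.@UU U .+@UU c *.@UU V"
  unfolding UV by (simp add: X_add X_smult ab LL_add LL_smult sm_add_r LL_carrier)
next
 fix c d U assume "U .: UU"
 then obtain a where a: "a : LL" and UV: "U = uc a" by (metis X_cases)
 show "c *.@UU U .: UU" "(c .+@complex_ring d) *.@UU U = c *.@UU U .+@UU d *.@UU U"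
  "(c **@complex_ring d) *.@UU U = c *.@UU (d *.@UU U)" "1@complex_ring *.@UU U = U"
  unfolding UV by (simp_all add: X_add X_smult a LL_add LL_smult sm_add_l LL_carrier)
qed (auto intro: X_abelian_group cring_from_type_algebra)

text \<open>A Cauchy sequence in the quotient has a subsequence that lifts to a sequence whose coordinates
  are uniformly Cauchy; completeness of \<open>A\<close> is then used in each coordinate.\<close>

lemma X_complete: assumes U: "!!n. U n .: UU"
  and cau: "!!e. e > 0 ==> \<exists>N. \<forall>m\<ge>N. \<forall>n\<ge>N. nrm UU (U m .-@UU U n) < e"
 shows "\<exists>V\<in>carrier UU. (%n. nrm UU (U n .-@UU V)) ----> 0"
proof -
 define p :: "nat => real" where "p k = (1/2) ^ k" for k
 have p0: "p k > 0" for k by (simp add: p_def)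
 obtain r0 where r0: "!!k m n. m >= r0 k ==> n >= r0 k ==> nrm UU (U m .-@UU U n) < p k" using cau[OF p0] by metis
 define r where "r k = (\<Sum>j\<le>k. r0 j)" for k
 have rr: "r0 k <= r k" "r k <= r (Suc k)" for k unfolding r_def by (auto intro: member_le_sum)
 have rdist: "nrm UU (U (r (Suc k)) .-@UU U (r k)) < p k" for k using r0 rr order_trans by blast
 have "\<exists>f. \<forall>k. (f k : LL & uc (f k) = U (r k)) & (\<forall>i. nA (f (Suc k) i .- f k i) <= p k)"
 proof (rule dependent_nat_choice)
  show "\<exists>a. a : LL & uc a = U (r 0)" using U by (metis X_cases)
  fix a k assume a: "a : LL & uc a = U (r k)"
  obtain b where b: "b : LL" "U (r (Suc k)) = uc b" using U by (metis X_cases)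
  define d where "d i = b i .- a i" for i
  have dL: "d : LL" using LL_diff a b by (simp add: d_def[abs_def])
  have "nrm UU (uc d) < p k" using rdist[of k] X_diff[OF b(1), of a] a b by (simp add: d_def[abs_def])
  then obtain d' where d': "d' : uc d" "!!i. nA (d' i) <= p k" using uc_truncate[OF dL uc_nrm_lim[OF dL]] by blast
  hence d'L: "d' : LL" "((%i. nA (d' i .- d i)) ---> 0) \<omega>" using dL by (auto simp: mem_uc)
  note c = LL_carrier[OF conjunct1[OF a]] LL_carrier[OF b(1)] LL_carrier[OF d'L(1)]
  have "d' i .- d i = (a i .+ d' i) .- b i" for i unfolding d_def using c(1)[of i] c(2)[of i] c(3)[of i] by algebra
  hence "uc (%i. a i .+ d' i) = uc b" using a b d'L by (subst uc_eq_iff) (auto intro: LL_add)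
  moreover have "a i .+ d' i .- a i = d' i" for i using c(1)[of i] c(3)[of i] by algebra
  ultimately show "\<exists>y. (y : LL & uc y = U (r (Suc k))) & (\<forall>i. nA (y i .- a i) <= p k)"
   using a b d' d'L by (intro exI[of _ "%i. a i .+ d' i"]) (auto intro: LL_add)
 qed
 then obtain f where f: "!!k. f k : LL" "!!k. uc (f k) = U (r k)" "!!k i. nA (f (Suc k) i .- f k i) <= p k" by metis
 \<comment> \<open>The increments of \<open>t\<close> are exactly \<open>p k\<close>, so the
   geometric bound on the lifted differences is the majorant that
   \<open>converges_mono_bound\<close> asks for in each coordinate.\<close>
 define t where "t k = 2 - 2 * p k" for k
 have p_lim: "p ----> 0" unfolding p_def[abs_def] by (rule LIMSEQ_power_zero) simp
 have t_lim: "t ----> 2" unfolding t_def[abs_def]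
  using tendsto_diff[OF tendsto_const tendsto_mult_right_zero[OF p_lim, of 2], of 2] by simp
 have tS: "t (Suc k) - t k = p k" for k by (simp add: t_def p_def)
 have fc: "f k i .: A" for k i using LL_carrier[OF f(1)] .
 have "\<exists>x. converges (%k. f k i) x" for i
  by (rule converges_mono_bound[of "%k. f k i" t]) (use t_lim f(3) fc tS in "auto simp: convergent_def")
 then obtain b where b: "!!i. converges (%k. f k i) (b i)" by metis
 have bc: "b i .: A" for i using b[of i] by (simp add: converges_def)
 have step: "nA (f (k + j) i .- f k i) <= 2 * p k - 2 * p (k + j)" for k j i proof (induction j)
  case 0 show ?case using fc by (simp add: minus_eq r_neg)
 next
  case (Suc j)
  have "nA (f (k + Suc j) i .- f k i) <= nA (f (Suc (k + j)) i .- f (k + j) i) + nA (f (k + j) i .- f k i)"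
   using nrm_diff_trans fc by simp
  also have "... <= p (k + j) + (2 * p k - 2 * p (k + j))" using f(3) Suc by (intro add_mono) auto
  also have "... = 2 * p k - 2 * p (k + Suc j)" by (simp add: p_def)
  finally show ?case .
 qed
 have bf: "nA (b i .- f k i) <= 2 * p k" for i k proof -
  have "converges (%j. f j i .+ \<ominus> (f k i)) (b i .+ \<ominus> (f k i))"
   by (rule converges_add[OF b converges_const]) (simp add: fc)
  hence "(%j. nA (f j i .- f k i)) ----> nA (b i .- f k i)" using converges_nrm by (simp add: minus_eq)
  thus ?thesis proof (rule LIMSEQ_le_const2)
   have "nA (f j i .- f k i) <= 2 * p k" if "j >= k" for j using step[of k "j - k" i] that p0[of j] by simp
   thus "\<exists>N. \<forall>j\<ge>N. nA (f j i .- f k i) <= 2 * p k" by blast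
  qed
 qed
 obtain K where K: "!!i. nA (f 0 i) <= K" using LL_bound[OF f(1)[of 0]] by metis
 have bL: "b : LL" by (rule LL_I[OF bc, where K = "K + 2 * p 0"])
   (use nrm_le_diff[OF bc fc] K bf in "meson add_mono order_trans")
 have sub: "nrm UU (U (r k) .-@UU uc b) <= 2 * p k" for k unfolding f(2)[symmetric] X_diff[OF f(1) bL]
  by (rule uc_nrm_le) (use bf bc fc nrm_diff_commute f(1) bL in "auto intro: LL_diff")
 have tri: "nrm UU (V .-@UU W) <= nrm UU (V .-@UU V') + nrm UU (V' .-@UU W)"
  if "V .: UU" "V' .: UU" "W .: UU" for V V' W proof -
  obtain x y z where xyz: "x : LL" "y : LL" "z : LL" "V = uc x" "V' = uc y" "W = uc z"
   using \<open>V .: UU\<close> \<open>V' .: UU\<close> \<open>W .: UU\<close> by (metis X_cases)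
  show ?thesis unfolding xyz(4-6) X_diff[OF xyz(1,3)] X_diff[OF xyz(1,2)] X_diff[OF xyz(2,3)]
   by (rule tendsto_le[OF nontriv tendsto_add[OF uc_nrm_lim uc_nrm_lim] uc_nrm_lim])
    (use xyz LL_carrier in "auto intro!: LL_diff always_eventually nrm_diff_trans")
 qed
 have "(%n. nrm UU (U n .-@UU uc b)) ----> 0" proof (rule LIMSEQ_I)
  fix e :: real assume e: "e > 0"
  obtain k where k: "p k < e/3" using order_tendstoD(2)[OF p_lim, of "e/3"] e by (auto simp: eventually_sequentially)
  have "norm (nrm UU (U n .-@UU uc b) - 0) < e" if n: "n >= r k" for n proof -
   have "nrm UU (U n .-@UU uc b) <= nrm UU (U n .-@UU U (r k)) + nrm UU (U (r k) .-@UU uc b)"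
    using U bL by (intro tri) auto
   moreover have "nrm UU (U n .-@UU U (r k)) < p k" using r0 n rr(1)[of k] by simp
   moreover obtain x where "x : LL" "U n = uc x" using U by (metis X_cases)
   hence "nrm UU (U n .-@UU uc b) >= 0" using X_diff[OF _ bL] LL_diff[OF _ bL] bc
    by (auto intro!: tendsto_lowerbound[OF uc_nrm_lim] always_eventually nrm_nonneg LL_carrier)
   ultimately show ?thesis using sub[of k] k by simp
  qed
  thus "\<exists>N. \<forall>n\<ge>N. norm (nrm UU (U n .-@UU uc b) - 0) < e" by blast
 qed
 thus ?thesis using bL by (intro bexI[of _ "uc b"]) auto
qed

lemma X_cstar_algebra: "cstar_algebra UU"
proof (intro cstar_algebra.intro X_ring X_module cstar_algebra_axioms.intro)
 fix U V c assume "U .: UU" "V .: UU"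
 then obtain a b where ab: "a : LL" "b : LL" and UV: "U = uc a" "V = uc b" by (metis X_cases)
 note [simp] = X_add X_mult X_smult X_star ab LL_add LL_mult LL_smult LL_star LL_carrier
 show "c *.@UU U **@UU V = c *.@UU (U **@UU V)" "U **@UU (c *.@UU V) = c *.@UU (U **@UU V)"
  "star UU (U .+@UU V) = star UU U .+@UU star UU V"
  "star UU (U **@UU V) = star UU V **@UU star UU U" unfolding UV by (simp_all add: star_add star_mult)
 show "nrm UU (U .+@UU V) <= nrm UU U + nrm UU V" unfolding UV X_add[OF ab]
  by (rule tendsto_le[OF nontriv tendsto_add[OF uc_nrm_lim uc_nrm_lim] uc_nrm_lim])
   (auto intro!: always_eventually nrm_triangle)
 show "nrm UU (U **@UU V) <= nrm UU U * nrm UU V" unfolding UV X_mult[OF ab]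
  by (rule tendsto_le[OF nontriv tendsto_mult[OF uc_nrm_lim uc_nrm_lim] uc_nrm_lim])
   (auto intro!: always_eventually nrm_mult)
next
 fix U c assume "U .: UU"
 then obtain a where a: "a : LL" and U: "U = uc a" by (metis X_cases)
 note [simp] = X_add X_mult X_smult X_star a LL_add LL_mult LL_smult LL_star LL_carrier
 show "star UU U .: UU" "star UU (star UU U) = U" "star UU (c *.@UU U) = cnj c *.@UU star UU U"
  unfolding U by (simp_all add: star_smult)
 show "0 <= nrm UU U"
  unfolding U by (rule tendsto_lowerbound[OF uc_nrm_lim]) (auto intro!: always_eventually nrm_nonneg)
 show "nrm UU (c *.@UU U) = cmod c * nrm UU U" unfolding U X_smult[OF a]
  by (rule uc_nrm_eq) (auto simp: nrm_smult intro!: tendsto_mult_left uc_nrm_lim)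
 show "nrm UU (star UU U **@UU U) = (nrm UU U)\<^sup>2" unfolding U X_star[OF a] X_mult[OF LL_star[OF a] a]
  by (rule uc_nrm_eq) (auto simp: cstar_identity intro!: tendsto_power uc_nrm_lim)
 have "nrm UU U = 0 <-> ((%i. nA (a i)) ---> 0) \<omega>"
  using uc_nrm_lim[OF a] uc_nrm_eq[OF a, of 0] unfolding U by auto
 also have "... <-> U = 0@UU" unfolding U X_zero by (subst uc_eq_iff) (auto simp: LL_const minus_eq)
 finally show "nrm UU U = 0 <-> U = 0@UU" .
qed (rule X_complete)

end

sublocale cstar_ultra \<subseteq> U: cstar_algebra "ultrapower A \<omega>"
 by (rule X_cstar_algebra)

context cstar_ultra
begin

lemma diag_hom: "(%x. uc (%_. x)) : cstar_hom A UU" unfolding cstar_hom_def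
 by (auto intro!: ring_hom_memI simp: X_mult X_add X_one X_smult X_star LL_const)

lemma diag_inj: "inj_on (%x. uc (%_. x)) (carrier A)"
proof (rule inj_onI)
 fix x y assume xy: "x .: A" "y .: A" "uc (%_. x) = uc (%_. y)"
 hence "((%i::'i. nA (x .- y)) ---> 0) \<omega>" using uc_eq_iff[OF LL_const LL_const, of x y] by simp
 hence "nA (x .- y) = 0" by (simp add: tendsto_const_iff)
 thus "x = y" using xy by (simp add: nrm_diff_0_iff)
qed

lemma ultra_subalgebra_iff:
 "U : ultra_subalgebra A \<omega> B <-> (\<exists>a. a : LL & (\<forall>i. a i : B) & U = uc a)"
 by (auto simp: ultra_subalgebra_def)

text \<open>For closedness, a limit \<open>a\<close> of families in \<open>B\<close> is approximated coordinatewise within twice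
  its distance to \<open>B\<close>; that distance tends to zero along the ultrafilter.\<close>

lemma ultra_subalgebra_subalgebra: assumes B: "unital_cstar_subalgebra B A"
 shows "unital_cstar_subalgebra (ultra_subalgebra A \<omega> B) UU"
proof (rule U.unital_cstar_subalgebraI)
 note D = unital_cstar_subalgebraD[OF B]
 note iff = ultra_subalgebra_iff
 show "ultra_subalgebra A \<omega> B <= carrier UU" by (auto simp: iff)
 show "1@UU : ultra_subalgebra A \<omega> B"
  unfolding iff X_one by (rule exI[of _ "%_. \<one>"]) (simp add: LL_const D(2))
 show "U .+@UU V : ultra_subalgebra A \<omega> B" "U **@UU V : ultra_subalgebra A \<omega> B"
  if UV: "U : ultra_subalgebra A \<omega> B" "V : ultra_subalgebra A \<omega> B" for U V proof -
  obtain a b where ab: "a : LL" "!!i. a i : B" "U = uc a" "b : LL" "!!i. b i : B" "V = uc b"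
   using UV unfolding iff by blast
  show "U .+@UU V : ultra_subalgebra A \<omega> B"
   unfolding iff using ab by (intro exI[of _ "%i. a i .+ b i"]) (simp add: X_add LL_add D(4))
  show "U **@UU V : ultra_subalgebra A \<omega> B"
   unfolding iff using ab by (intro exI[of _ "%i. a i ** b i"]) (simp add: X_mult LL_mult D(5))
 qed
 show "c *.@UU U : ultra_subalgebra A \<omega> B" "star UU U : ultra_subalgebra A \<omega> B"
  if U: "U : ultra_subalgebra A \<omega> B" for U c proof -
  obtain a where ab: "a : LL" "!!i. a i : B" "U = uc a" using U unfolding iff by blast
  show "c *.@UU U : ultra_subalgebra A \<omega> B"
   unfolding iff using ab by (intro exI[of _ "%i. c *. a i"]) (simp add: X_smult LL_smult D(6))
  show "star UU U : ultra_subalgebra A \<omega> B"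
   unfolding iff using ab by (intro exI[of _ "%i. sA (a i)"]) (simp add: X_star LL_star D(7))
 qed
 show "U : ultra_subalgebra A \<omega> B" if s: "!!n. s n : ultra_subalgebra A \<omega> B" "U.converges s U" for s U
 proof -
  have "U .: UU" using s(2) by (simp add: U.converges_def)
  then obtain a where a: "a : LL" "U = uc a" by (rule X_cases)
  define dist where "dist i = (INF y\<in>B. nA (a i .- y))" for i
  note ac = LL_carrier[OF a(1)]
  have Bc: "y .: A" if "y : B" for y using that D(1) by blast
  have bdd: "bdd_below ((%y. nA (a i .- y)) ` B)" for i by (rule bdd_belowI2[of _ 0]) (use ac Bc nrm_nonneg in auto)
  have dist_le: "dist i <= nA (a i .- y)" if "y : B" for i y unfolding dist_def by (rule cINF_lower[OF bdd that])
  have dist_nonneg: "0 <= dist i" for i unfolding dist_def by (rule cINF_greatest) (use D(2) ac Bc nrm_nonneg in auto)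
  have "\<exists>y\<in>B. nA (a i .- y) <= 2 * dist i" for i proof (cases "dist i = 0")
   case True
   have "\<exists>y\<in>B. nA (a i .- y) < e" if "e > 0" for e
    using cINF_less_iff[OF _ bdd, of i e] D(2) True that by (auto simp: dist_def)
   hence "a i : cs_closure B" using ac by (simp add: cs_closure_def)
   then obtain t where t: "\<forall>n. t n : B" "converges t (a i)" using cs_closure_converges[OF D(1)] by blast
   have "a i : B" by (rule D(8)[OF _ t(2)]) (use t(1) in blast)
   thus ?thesis using ac True by (intro bexI[of _ "a i"]) (auto simp: minus_eq r_neg)
  next
   case False
   hence "dist i < 2 * dist i" using dist_nonneg[of i] by simp
   moreover have "B ~= {}" using D(2) by blast
   ultimately obtain y where "y : B" "nA (a i .- y) < 2 * dist i"
    using cINF_less_iff[OF _ bdd, of i "2 * dist i"] unfolding dist_def by blast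
   thus ?thesis by (intro bexI[of _ y]) auto
  qed
  then obtain b where b: "!!i. b i : B" "!!i. nA (a i .- b i) <= 2 * dist i" by metis
  obtain K where K: "!!i. nA (a i) <= K" using LL_bound[OF a(1)] by metis
  have bL: "b : LL" proof (rule LL_I)
   show "b i .: A" for i using b Bc by blast
   show "nA (b i) <= 3 * K" for i proof -
    have "dist i <= nA (a i)" using dist_le[OF D(3)] ac by (simp add: minus_eq)
    thus ?thesis using nrm_le_diff[of "b i" "a i"] nrm_diff_commute[of "a i" "b i"] b(2)[of i] ac Bc[OF b(1)] K[of i]
     by simp
   qed
  qed
  have "(dist ---> 0) \<omega>" proof (rule order_tendstoI)
   fix e :: real assume "0 < e"
   hence "eventually (%n. nrm UU (s n .-@UU U) < e) sequentially"
    using s(2) by (intro order_tendstoD) (auto simp: U.converges_def)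
   then obtain n where n: "nrm UU (s n .-@UU U) < e" by (auto simp: eventually_sequentially)
   obtain y where y: "y : LL" "!!i. y i : B" "s n = uc y" using s(1)[of n] unfolding iff by blast
   have "((%i. nA (y i .- a i)) ---> nrm UU (s n .-@UU U)) \<omega>"
    unfolding y(3) a(2) X_diff[OF y(1) a(1)] by (rule uc_nrm_lim[OF LL_diff[OF y(1) a(1)]])
   hence "eventually (%i. nA (y i .- a i) < e) \<omega>" using n by (rule order_tendstoD)
   thus "eventually (%i. dist i < e) \<omega>" proof eventually_elim
    case (elim i)
    thus ?case using dist_le[OF y(2), of i i] nrm_diff_commute[OF ac[of i] Bc[OF y(2)[of i]]] by simp
   qed
  qed (use dist_nonneg in "auto intro!: always_eventually intro: less_le_trans")
  hence l: "((%i. 2 * dist i) ---> 0) \<omega>" by (rule tendsto_mult_right_zero)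
  have "((%i. nA (a i .- b i)) ---> 0) \<omega>" by (rule ulim_squeeze_0[OF l]) (use b ac Bc nrm_nonneg in auto)
  hence "U = uc b" using uc_eq_iff[OF a(1) bL] a(2) by simp
  thus ?thesis unfolding iff using bL b(1) by blast
 qed
qed

end

section \<open>Homomorphisms and states on ultrapowers\<close>

locale ultra_hom = cstar_hom_pair A B f + ultra \<omega>
 for A :: "'a cstar" (structure) and B :: "'b cstar" and f and \<omega> :: "'i filter"

sublocale ultra_hom \<subseteq> UA: cstar_ultra A \<omega>
 by (intro cstar_ultra.intro A.cstar_algebra_axioms ultra_axioms)
sublocale ultra_hom \<subseteq> UB: cstar_ultra B \<omega>
 by (intro cstar_ultra.intro B.cstar_algebra_axioms ultra_axioms)

context ultra_hom
begin

text \<open>The coordinatewise extension of \<open>f\<close>, evaluated on a chosen representative;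
  since \<open>f\<close> is contractive, the resulting class does not depend on the choice.\<close>

definition umap :: "('i => 'a) set => ('i => 'b) set"
 where "umap U = ultra_class B \<omega> (%i. f ((SOME a. a : UA.LL & U = UA.uc a) i))"

lemma LL_map: "a : UA.LL ==> (%i. f (a i)) : UB.LL"
proof -
 assume a: "a : UA.LL"
 then obtain K where "!!i. nA (a i) <= K" using UA.LL_bound by metis
 hence "nrm B (f (a i)) <= K" for i using hom_contractive[OF UA.LL_carrier[OF a]] order_trans by blast
 thus ?thesis using UA.LL_carrier[OF a] by (intro UB.LL_I) auto
qed

lemma umap_uc: assumes a: "a : UA.LL" shows "umap (UA.uc a) = UB.uc (%i. f (a i))"
proof -
 define b where "b = (SOME b. b : UA.LL & UA.uc a = UA.uc b)"
 have b: "b : UA.LL" "UA.uc a = UA.uc b" using someI[of "%b. b : UA.LL & UA.uc a = UA.uc b" a] a by (auto simp: b_def)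
 note c = UA.LL_carrier[OF a] UA.LL_carrier[OF b(1)]
 have l: "((%i. nA (b i .-@A a i)) ---> 0) \<omega>" using b UA.uc_eq_iff[OF b(1) a] by simp
 have "((%i. nrm B (f (b i) .-@B f (a i))) ---> 0) \<omega>"
  by (rule ulim_squeeze_0[OF l]) (use c hom_contractive[OF A.minus_closed[OF c(2,1)]] in "simp_all add: B.nrm_nonneg")
 thus ?thesis unfolding umap_def b_def[symmetric] using UB.uc_eq_iff[OF LL_map[OF b(1)] LL_map[OF a]] by simp
qed

lemma umap_hom: "umap : cstar_hom UA.UU UB.UU" unfolding cstar_hom_def
proof (intro CollectI conjI allI ballI ring_hom_memI)
 fix U V assume "U .: UA.UU" "V .: UA.UU"
 then obtain a b where ab: "a : UA.LL" "b : UA.LL" "U = UA.uc a" "V = UA.uc b" by (metis UA.X_cases)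
 note [simp] = UA.LL_carrier[OF ab(1)] UA.LL_carrier[OF ab(2)] ab(1,2) LL_map umap_uc
 show "umap (U **@(UA.UU) V) = umap U **@(UB.UU) umap V"
  unfolding ab(3,4) by (simp add: UA.X_mult UB.X_mult UA.LL_mult)
 show "umap (U .+@(UA.UU) V) = umap U .+@(UB.UU) umap V" unfolding ab(3,4) by (simp add: UA.X_add UB.X_add UA.LL_add)
next
 fix U c assume "U .: UA.UU"
 then obtain a where ab: "a : UA.LL" "U = UA.uc a" by (metis UA.X_cases)
 note [simp] = UA.LL_carrier[OF ab(1)] ab(1) LL_map umap_uc
 show "umap U .: UB.UU" unfolding ab(2) by simp
 show "umap (c *.@(UA.UU) U) = c *.@(UB.UU) umap U" unfolding ab(2) by (simp add: UA.X_smult UB.X_smult UA.LL_smult)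
 show "umap (star UA.UU U) = star UB.UU (umap U)" unfolding ab(2) by (simp add: UA.X_star UB.X_star UA.LL_star)
next
 show "umap 1@(UA.UU) = 1@(UB.UU)" by (simp add: UA.X_one UB.X_one umap_uc UA.LL_const)
qed

lemma umap_isometric: assumes iso: "!!x. x .: A ==> nrm B (f x) = nA x" and U: "U .: UA.UU"
 shows "nrm UB.UU (umap U) = nrm UA.UU U"
proof -
 obtain a where a: "a : UA.LL" "U = UA.uc a" using U by (metis UA.X_cases)
 have "((%i. nrm B (f (a i))) ---> nrm UA.UU U) \<omega>"
  using UA.uc_nrm_lim[OF a(1)] a(2) iso UA.LL_carrier[OF a(1)] by simp
 thus ?thesis unfolding a(2) umap_uc[OF a(1)] by (intro UB.uc_nrm_eq LL_map a) simp
qed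

end

sublocale ultra_hom \<subseteq> UM: cstar_hom_pair "ultrapower A \<omega>" "ultrapower B \<omega>" umap
 by unfold_locales (rule umap_hom)

locale state_ultra = cstar_state A \<rho> + ultra \<omega>
 for A :: "'a cstar" (structure) and \<rho> and \<omega> :: "'i filter"

sublocale state_ultra \<subseteq> cstar_ultra A \<omega>
 by (intro cstar_ultra.intro cstar_algebra_axioms ultra_axioms)

context state_ultra
begin

abbreviation "\<rho>\<^sub>\<omega> == ultra_state \<rho> \<omega>"

lemma ultra_state_lim: assumes a: "a : LL" shows "((%i. \<rho> (a i)) ---> \<rho>\<^sub>\<omega> (uc a)) \<omega>"
proof -
 obtain K where K: "!!i. nA (a i) <= K" using LL_bound[OF a] by metis
 have bd: "cmod (\<rho> (a i)) <= K" for i using \<rho>_le_nrm[OF LL_carrier[OF a]] K order_trans by blast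
 obtain l where l: "((%i. \<rho> (a i)) ---> l) \<omega>" by (rule ulim_complex[OF bd])
 have "\<rho>\<^sub>\<omega> (uc a) = l" unfolding ultra_state_def proof (rule the_equality)
  show "\<exists>a\<in>uc a. ((%i. \<rho> (a i)) ---> l) \<omega>" using l uc_self[OF a] by blast
  fix l' assume "\<exists>a\<in>uc a. ((%i. \<rho> (a i)) ---> l') \<omega>"
  then obtain b where b: "b : LL" "((%i. nA (b i .- a i)) ---> 0) \<omega>" "((%i. \<rho> (b i)) ---> l') \<omega>"
   using mem_uc[OF a] by blast
  note c = LL_carrier[OF a] LL_carrier[OF b(1)]
  have "((%i. cmod (\<rho> (b i) - \<rho> (a i))) ---> 0) \<omega>"
   by (rule ulim_squeeze_0[OF b(2)]) (use \<rho>_le_nrm[OF minus_closed[OF c(2,1)]] c in simp_all)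
  hence "((%i. \<rho> (b i) - \<rho> (a i)) ---> 0) \<omega>" by (rule tendsto_norm_zero_cancel)
  from tendsto_add[OF this l] have "((%i. \<rho> (b i)) ---> l) \<omega>" by simp
  thus "l' = l" using b(3) tendsto_unique[OF nontriv] by blast
 qed
 thus ?thesis using l by simp
qed

lemma ultra_state_eq: "a : LL ==> ((%i. \<rho> (a i)) ---> l) \<omega> ==> \<rho>\<^sub>\<omega> (uc a) = l"
 using tendsto_unique[OF nontriv ultra_state_lim] by blast

lemma ultra_state_state: "state UU \<rho>\<^sub>\<omega>" unfolding state_def
proof (intro conjI ballI allI)
 fix U V assume "U .: UU" "V .: UU"
 then obtain a b where ab: "a : LL" "b : LL" and UV: "U = uc a" "V = uc b" by (metis X_cases)
 show "\<rho>\<^sub>\<omega> (U .+@UU V) = \<rho>\<^sub>\<omega> U + \<rho>\<^sub>\<omega> V"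
  unfolding UV X_add[OF ab]
  by (rule ultra_state_eq) (auto simp: LL_add ab LL_carrier intro!: tendsto_add ultra_state_lim)
next
 fix U c assume "U .: UU"
 then obtain a where a: "a : LL" and U: "U = uc a" by (metis X_cases)
 show "\<rho>\<^sub>\<omega> (c *.@UU U) = c * \<rho>\<^sub>\<omega> U" unfolding U X_smult[OF a]
  by (rule ultra_state_eq) (auto simp: LL_smult a LL_carrier intro!: tendsto_mult_left ultra_state_lim)
 have sa: "(%i. sA (a i) ** a i) : LL" by (intro LL_mult LL_star a)
 have l: "((%i. \<rho> (sA (a i) ** a i)) ---> \<rho>\<^sub>\<omega> (star UU U **@UU U)) \<omega>"
  unfolding U X_star[OF a] X_mult[OF LL_star[OF a] a] by (rule ultra_state_lim[OF sa])
 have "0 <= Re (\<rho>\<^sub>\<omega> (star UU U **@UU U))" by (rule tendsto_lowerbound[OF tendsto_Re[OF l]])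
   (auto intro!: always_eventually \<rho>_pos_Re LL_carrier a)
 moreover have "((%i. Im (\<rho> (sA (a i) ** a i))) ---> 0) \<omega>" using \<rho>_pos_Im LL_carrier[OF a] by simp
 hence "Im (\<rho>\<^sub>\<omega> (star UU U **@UU U)) = 0" using tendsto_unique[OF nontriv tendsto_Im[OF l]] by blast
 ultimately show "\<rho>\<^sub>\<omega> (star UU U **@UU U) : \<real>\<^sub>\<ge>\<^sub>0"
  by (auto simp: nonneg_Reals_def complex_eq_iff intro!: image_eqI[of _ _ "Re (\<rho>\<^sub>\<omega> (star UU U **@UU U))"])
next
 show "\<rho>\<^sub>\<omega> 1@UU = 1" unfolding X_one by (rule ultra_state_eq) (auto simp: LL_const)
qed

lemma ultra_state_diag: "x .: A ==> \<rho>\<^sub>\<omega> (uc (%_. x)) = \<rho> x"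
 by (rule ultra_state_eq) (auto simp: LL_const)

end

sublocale state_ultra \<subseteq> US: cstar_state "ultrapower A \<omega>" "ultra_state \<rho> \<omega>"
 by unfold_locales (rule ultra_state_state)

lemma (in hilbert_space) vector_state: assumes v: "v .: H" "hn v = 1" shows "cstar_state BO (%T. inn (T v) v)"
proof unfold_locales
 show "state BO (%T. inn (T v) v)" unfolding state_def proof (intro conjI ballI allI)
  show "inn ((star BO T **@BO T) v) v : \<real>\<^sub>\<ge>\<^sub>0" if T: "T .: BO" for T
   using T v hinner_nonneg[of "T v"] by (simp add: B_star')
 qed (use v in "auto simp: hinner_add hinner_smult inn_self")
qed

subsection \<open>Reduced words in a free product\<close>

locale free_pair = cstar_state A \<rho> for A :: "'a cstar" (structure) and \<rho> +
 fixes S :: "bool => 'a set" assumes S_sub: "S k <= carrier A" and S_one: "\<one> : S k"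
  and S_add: "x : S k ==> y : S k ==> x .+ y : S k" and S_mult: "x : S k ==> y : S k ==> x ** y : S k"
  and S_smult: "x : S k ==> c *. x : S k" and S_star: "x : S k ==> sA x : S k" and free: "free_family A \<rho> S"
  and gen: "cstar_generated A (S True \<union> S False) = carrier A"
begin

lemma S_carrier [simp]: "x : S k ==> x .: A" using S_sub by blast

text \<open>Alternating products of centred letters. The two booleans are the sides of the first and
  of the last letter and the number is the length. Words are kept as algebra elements with this
  data, so that products can be recombined by plain ring arithmetic.\<close>

inductive wd :: "bool => bool => nat => 'a => bool" where
 wd_letter: "x : S k ==> \<rho> x = 0 ==> wd k k 1 x"
| wd_Cons: "x : S k ==> \<rho> x = 0 ==> wd (\<not> k) e L y ==> wd k e (Suc L) (x ** y)"

lemma wd_carrier [simp]: "wd k e L y ==> y .: A" by (induction rule: wd.induct) auto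

lemma wd_pos: "wd k e L y ==> L > 0" by (induction rule: wd.induct) auto

lemma wd_list:
 "wd k e L y ==> \<exists>w. w ~= [] & fst (hd w) = k & distinct_adj (map fst w) &
  (\<forall>(k, x)\<in>set w. x : S k & \<rho> x = 0) & foldr (%x y. x ** y) (map snd w) \<one> = y"
proof (induction rule: wd.induct)
 case (wd_letter x k)
 thus ?case by (intro exI[of _ "[(k, x)]"]) auto
next
 case (wd_Cons x k e L y)
 then obtain w where w: "w ~= []" "fst (hd w) = (\<not> k)" "distinct_adj (map fst w)"
  "\<forall>(k, x)\<in>set w. x : S k & \<rho> x = 0" "foldr (%x y. x ** y) (map snd w) \<one> = y" by blast
 thus ?case using wd_Cons(1,2) by (intro exI[of _ "(k, x) # w"]) (cases w; auto)
qed

lemma wd_\<rho>: "wd k e L y ==> \<rho> y = 0" using wd_list[of k e L y] free unfolding free_family_def by blast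

lemma wd_append:
 "wd k e L y ==> wd (\<not> e) f M y' ==> wd k f (L + M) (y ** y')"
proof (induction rule: wd.induct)
 case (wd_letter x k)
 thus ?case using wd.wd_Cons[of x k f M y'] by simp
next
 case (wd_Cons x k e L y)
 thus ?case using wd.wd_Cons[of x k f "L + M" "y ** y'"] by (simp add: m_assoc)
qed

lemma S_star_\<rho>: "x : S k ==> \<rho> x = 0 ==> sA x : S k & \<rho> (sA x) = 0" by (simp add: S_star \<rho>_star)

lemma wd_star: "wd k e L y ==> wd e k L (sA y)"
proof (induction rule: wd.induct)
 case (wd_letter x k)
 thus ?case using S_star_\<rho> by (intro wd.wd_letter) auto
next
 case (wd_Cons x k e L y)
 have "wd (\<not> \<not> k) k 1 (sA x)" using wd.wd_letter[of "sA x" k] S_star_\<rho>[OF wd_Cons(1,2)] by simp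
 hence "wd e k (L + 1) (sA y ** sA x)" by (rule wd_append[OF wd_Cons(4)])
 thus ?case using wd_Cons by (simp add: star_mult)
qed

lemma wd_smult: "wd k e L y ==> wd k e L (c *. y)"
proof (induction rule: wd.induct)
 case (wd_letter x k)
 thus ?case by (intro wd.wd_letter) (auto simp: S_smult)
next
 case (wd_Cons x k e L y)
 hence "wd k e (Suc L) ((c *. x) ** y)" by (intro wd.wd_Cons) (auto simp: S_smult)
 thus ?case using wd_Cons by simp
qed

lemma wd_left: assumes "wd k e L y" "L >= 2"
 obtains x y' where "x : S k" "\<rho> x = 0" "wd (\<not> k) e (L - 1) y'" "y = x ** y'"
 using assms by (cases rule: wd.cases) auto

lemma wd_right: assumes y: "wd k e L y" and L: "L >= 2"
 obtains x y' where "x : S e" "\<rho> x = 0" "wd k (\<not> e) (L - 1) y'" "y = y' ** x"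
proof -
 obtain x y' where x: "x : S e" "\<rho> x = 0" and y': "wd (\<not> e) k (L - 1) y'" "sA y = x ** y'"
  using wd_left[OF wd_star[OF y] L] by blast
 have "y = sA y' ** sA x" using y'(2) wd_carrier[OF y] wd_carrier[OF y'(1)] S_carrier[OF x(1)]
  by (metis star_mult star_star)
 thus ?thesis using that[of "sA x" "sA y'"] S_star_\<rho>[OF x] wd_star[OF y'(1)] by blast
qed

lemma wd_single: "wd k e L y ==> L = 1 ==> e = k & y : S k & \<rho> y = 0"
 by (cases rule: wd.cases) (auto dest: wd_pos)

definition cen :: "'a => 'a" where "cen x = x .- \<rho> x *. \<one>"

lemma S_diff: "x : S k ==> y : S k ==> x .- y : S k"
 using S_add[OF _ S_smult[of y k "-1"], of x] by (simp add: diff_sm)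

lemma cen_S: "x : S k ==> cen x : S k" by (simp add: cen_def S_diff S_smult S_one)

lemma cen_\<rho>: "x .: A ==> \<rho> (cen x) = 0" by (simp add: cen_def)

lemma cen_closed [simp]: "x .: A ==> cen x .: A" by (simp add: cen_def)

lemma cen_split: "x .: A ==> x = \<rho> x *. \<one> .+ cen x"
proof -
 assume x: "x .: A"
 have "\<rho> x *. \<one> .: A" by simp
 with x have "x = \<rho> x *. \<one> .+ (x .- \<rho> x *. \<one>)" by algebra
 thus ?thesis by (simp add: cen_def)
qed

lemma wd_cen: "x : S k ==> wd k k 1 (cen x)" by (intro wd_letter cen_S cen_\<rho>) auto

text \<open>The basic move of the word computations: a merged letter is replaced by its mean, which
  shortens the word, and its centred part, which keeps the word reduced.\<close>

lemma mult_split: assumes "x .: A" "u .: A" "w .: A" shows "u ** (x ** w) = \<rho> x *. (u ** w) .+ u ** (cen x ** w)"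
proof -
 have "u ** (x ** w) = u ** ((\<rho> x *. \<one> .+ cen x) ** w)" using cen_split[OF assms(1)] by simp
 thus ?thesis using assms by (simp add: l_distr r_distr)
qed

text \<open>Induction on the shorter word. If the first letters are on different sides, the product
  of the adjoint with the longer word is reduced. Otherwise they merge: the mean leaves a pair with
  the same difference of lengths, the centred part leaves a reduced word.\<close>

lemma wd_orth:
 "wd k e L x ==> wd k' e' M y ==> L < M ==> \<rho> (sA x ** y) = 0"
proof (induction arbitrary: k' e' M y rule: wd.induct)
 case (wd_letter x k)
 have sx: "wd k k 1 (sA x)" using wd_star[OF wd.wd_letter[OF wd_letter(1,2)]] .
 show ?case proof (cases "k' = k")
  case False
  thus ?thesis using wd_\<rho>[OF wd_append[OF sx, of e' M y]] wd_letter(3) by (cases k'; cases k) auto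
 next
  case True
  have M: "M >= 2" using wd_letter(4) by simp
  have "wd k e' M y" using wd_letter(3) True by simp
  from this M obtain x1 y' where y: "x1 : S k" "\<rho> x1 = 0" "wd (\<not> k) e' (M - 1) y'" "y = x1 ** y'"
   by (rule wd_left)
  have m: "sA x ** x1 : S k" using wd_letter y S_star S_mult by blast
  have "sA x ** y = \<one> ** ((sA x ** x1) ** y')" using wd_letter y by (simp add: m_assoc)
  also have "... = \<rho> (sA x ** x1) *. (\<one> ** y') .+ \<one> ** (cen (sA x ** x1) ** y')"
   using wd_letter y by (intro mult_split) auto
  finally show ?thesis using wd_\<rho>[OF y(3)] wd_\<rho>[OF wd_append[OF wd_cen[OF m] y(3)]] m y(3) by simp
 qed
next
 case (wd_Cons x k e L y0)
 have sx: "wd e k (Suc L) (sA (x ** y0))" using wd_star[OF wd.wd_Cons[OF wd_Cons(1-3)]] .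
 show ?case proof (cases "k' = k")
  case False
  thus ?thesis using wd_\<rho>[OF wd_append[OF sx, of e' M y]] wd_Cons(5) by (cases k'; cases k) auto
 next
  case True
  have M: "M >= 2" using wd_Cons(6) by simp
  have "wd k e' M y" using wd_Cons(5) True by simp
  from this M obtain x1 y' where y: "x1 : S k" "\<rho> x1 = 0" "wd (\<not> k) e' (M - 1) y'" "y = x1 ** y'"
   by (rule wd_left)
  have m: "sA x ** x1 : S k" using wd_Cons y S_star S_mult by blast
  have "sA (x ** y0) ** y = sA y0 ** ((sA x ** x1) ** y')" using wd_Cons y by (simp add: m_assoc star_mult)
  also have "... = \<rho> (sA x ** x1) *. (sA y0 ** y') .+ sA y0 ** (cen (sA x ** x1) ** y')"
   using wd_Cons y by (intro mult_split) auto
  moreover have "\<rho> (sA y0 ** y') = 0" using wd_Cons(4)[OF y(3)] wd_Cons(6) by simp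
  moreover have "wd (\<not> \<not> k) e' (1 + (M - 1)) (cen (sA x ** x1) ** y')"
   using wd_append[OF wd_cen[OF m] y(3)] by simp
  hence "\<rho> (sA y0 ** (cen (sA x ** x1) ** y')) = 0"
   using wd_\<rho>[OF wd_append[OF wd_star[OF wd_Cons(3)]]] by blast
  ultimately show ?thesis using m y(3) wd_Cons(3) by simp
 qed
qed

section \<open>The span of the reduced words and its density\<close>

inductive wsum :: "'a => bool" where
 wsum_zero: "wsum \<zero>"
| wsum_add: "wd k e L y ==> wsum s ==> wsum (y .+ s)"

lemma wsum_carrier [simp]: "wsum s ==> s .: A" by (induction rule: wsum.induct) auto

lemma wsum_\<rho>: "wsum s ==> \<rho> s = 0" by (induction rule: wsum.induct) (auto simp: wd_\<rho>)

lemma wsum_plus: "wsum s ==> wsum t ==> wsum (s .+ t)"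
 by (induction rule: wsum.induct) (auto simp: a_assoc wsum.wsum_add)

lemma wsum_smult: "wsum s ==> wsum (c *. s)"
 by (induction rule: wsum.induct) (auto simp: sm_add_r wsum_zero intro: wsum.wsum_add wd_smult)

lemma wsum_star: "wsum s ==> wsum (sA s)"
 by (induction rule: wsum.induct) (auto simp: star_add wsum_zero intro: wsum.wsum_add wd_star)

lemma wsum_wd: "wd k e L y ==> wsum y" using wsum_add[OF _ wsum_zero, of k e L y] by simp

definition wspan :: "'a set" where "wspan = {c *. \<one> .+ s |c s. wsum s}"

lemma wspanI: "wsum s ==> c *. \<one> .+ s : wspan" by (auto simp: wspan_def)

lemma wspan_wsum: "wsum s ==> s : wspan" using wspanI[of s 0] by simp

lemma wspan_carrier: "x : wspan ==> x .: A" by (auto simp: wspan_def)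

lemma wspan_add: assumes "x : wspan" "y : wspan" shows "x .+ y : wspan"
proof -
 obtain c s d t where s: "x = c *. \<one> .+ s" "y = d *. \<one> .+ t" "wsum s" "wsum t"
  using assms by (auto simp: wspan_def)
 hence "x .+ y = (c + d) *. \<one> .+ (s .+ t)" by (simp add: sm_add_l a_ac)
 thus ?thesis using wspanI wsum_plus s by metis
qed

lemma wspan_smult: assumes "x : wspan" shows "d *. x : wspan"
proof -
 obtain c s where s: "x = c *. \<one> .+ s" "wsum s" using assms by (auto simp: wspan_def)
 hence "d *. x = (d * c) *. \<one> .+ d *. s" by (simp add: sm_add_r)
 thus ?thesis using wspanI wsum_smult s by metis
qed

lemma wspan_star: assumes "x : wspan" shows "sA x : wspan"
proof -
 obtain c s where s: "x = c *. \<one> .+ s" "wsum s" using assms by (auto simp: wspan_def)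
 hence "sA x = cnj c *. \<one> .+ sA s" by (simp add: star_add star_smult)
 thus ?thesis using wspanI wsum_star s by metis
qed

lemma wspan_S: assumes x: "x : S k" shows "x : wspan"
proof -
 have "x = \<rho> x *. \<one> .+ cen x" using x by (intro cen_split) simp
 thus ?thesis using wspanI[OF wsum_wd[OF wd_cen[OF x]], of "\<rho> x"] by simp
qed

text \<open>Only the junction matters: the letter either prolongs the word or merges with its first
  letter, and then the mean gives the tail while the centred part gives a word of the old length.
  This makes \<open>wspan\<close> an algebra.\<close>

lemma wspan_letter_word: assumes a: "a : S k" "\<rho> a = 0" and y: "wd k' e L y" shows "a ** y : wspan"
proof (cases "k' = k")
 case False
 hence "k' = (\<not> k)" by auto
 thus ?thesis using wspan_wsum[OF wsum_wd[OF wd.wd_Cons[OF a]]] y by simp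
next
 case True
 show ?thesis proof (cases "L = 1")
  case True
  hence "y : S k" using wd_single[OF y] \<open>k' = k\<close> by simp
  thus ?thesis using wspan_S S_mult a by blast
 next
  case False
  hence L: "L >= 2" using wd_pos[OF y] by simp
  have "wd k e L y" using y \<open>k' = k\<close> by simp
  from this L obtain x1 y' where y': "x1 : S k" "\<rho> x1 = 0" "wd (\<not> k) e (L - 1) y'" "y = x1 ** y'"
   by (rule wd_left)
  have m: "a ** x1 : S k" using a y' S_mult by blast
  have "a ** y = \<one> ** ((a ** x1) ** y')" using a y' by (simp add: m_assoc)
  also have "... = \<rho> (a ** x1) *. (\<one> ** y') .+ \<one> ** (cen (a ** x1) ** y')"
   using a y' by (intro mult_split) auto
  also have "... = \<rho> (a ** x1) *. y' .+ cen (a ** x1) ** y'" using a y' by simp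
  also have "... : wspan"
   by (intro wspan_add wspan_smult wspan_wsum wsum_wd[OF y'(3)] wsum_wd[OF wd_append[OF wd_cen[OF m] y'(3)]])
  finally show ?thesis .
 qed
qed

lemma wspan_letter_mult: assumes a: "a : S k" "\<rho> a = 0" and x: "x : wspan" shows "a ** x : wspan"
proof -
 obtain c s where s: "x = c *. \<one> .+ s" "wsum s" using x by (auto simp: wspan_def)
 have "a ** s : wspan" using s(2) proof (induction rule: wsum.induct)
  case wsum_zero
  thus ?case using a wspan_wsum[OF wsum.wsum_zero] by simp
 next
  case (wsum_add k e L y s)
  thus ?case using a wspan_add[OF wspan_letter_word[OF a wsum_add(1)]] by (simp add: r_distr)
 qed
 moreover have "a ** x = c *. a .+ a ** s" using s a by (simp add: r_distr)
 ultimately show ?thesis using wspan_add wspan_smult wspan_S a by metis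
qed

lemma wspan_word_mult: "wd k e L y ==> x : wspan ==> y ** x : wspan"
proof (induction rule: wd.induct)
 case (wd_letter y k)
 thus ?case by (intro wspan_letter_mult)
next
 case (wd_Cons y0 k e L y)
 thus ?case using wspan_letter_mult[OF wd_Cons(1,2)] by (simp add: m_assoc wspan_carrier)
qed

lemma wspan_mult: assumes x: "x : wspan" and y: "y : wspan" shows "x ** y : wspan"
proof -
 obtain c s where s: "x = c *. \<one> .+ s" "wsum s" using x by (auto simp: wspan_def)
 have yc: "y .: A" using wspan_carrier[OF y] .
 have "s ** y : wspan" using s(2) proof (induction rule: wsum.induct)
  case wsum_zero
  thus ?case using yc wspan_wsum[OF wsum.wsum_zero] by simp
 next
  case (wsum_add k e L w s)
  thus ?case using yc wspan_add[OF wspan_word_mult[OF wsum_add(1) y]] by (simp add: l_distr)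
 qed
 moreover have "x ** y = c *. y .+ s ** y" using s yc by (simp add: l_distr)
 ultimately show ?thesis using wspan_add wspan_smult y by metis
qed

lemma wspan_dense: "cs_closure wspan = carrier A"
proof
 show "cs_closure wspan <= carrier A" by (auto simp: cs_closure_def)
 have sub: "wspan <= carrier A" using wspan_carrier by blast
 have "unital_cstar_subalgebra (cs_closure wspan) A"
  by (rule unital_cstar_subalgebra_closure[OF sub wspan_S[OF S_one]])
   (auto intro: wspan_add wspan_mult wspan_smult wspan_star)
 moreover have "S True \<union> S False <= cs_closure wspan" using wspan_S cs_closure_superset[OF sub] by blast
 ultimately show "carrier A <= cs_closure wspan" using cstar_generated_least gen by metis
qed

text \<open>An approximant c 1 + s need not be centred, but \<open>\<rho>\<close> of the error is
  -c, so the modulus of c is at most the norm of the error. Dropping the scalar costs at most a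
  second e/2.\<close>

lemma centred_approx: assumes x: "x .: A" "\<rho> x = 0" and e: "e > 0" obtains s where "wsum s" "nA (x .- s) < e"
proof -
 have "x : cs_closure wspan" using x(1) wspan_dense by simp
 then obtain v where v: "v : wspan" "nA (x .- v) < e/2" using e by (auto simp: cs_closure_def dest!: spec[of _ "e/2"])
 obtain c s where s: "v = c *. \<one> .+ s" "wsum s" using v by (auto simp: wspan_def)
 have sc: "s .: A" using s by simp
 have "\<rho> (x .- v) = - c" using x s wsum_\<rho>[OF s(2)] by simp
 hence "cmod c <= nA (x .- v)" using \<rho>_le_nrm[of "x .- v"] x s by simp
 hence "nA (c *. \<one>) < e/2" using v(2) nrm_one_le mult_left_mono[of "nA \<one>" 1 "cmod c"]
  by (simp add: nrm_smult)
 moreover have "x .- s = (x .- v) .+ c *. \<one>" proof -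
  have "c *. \<one> .: A" by simp
  thus ?thesis unfolding s(1) using x(1) sc by algebra
 qed
 hence "nA (x .- s) <= nA (x .- v) + nA (c *. \<one>)" using nrm_triangle x v wspan_carrier by simp
 ultimately have "nA (x .- s) < e" using v(2) by simp
 thus ?thesis using that s(2) by blast
qed

text \<open>The elements whose compression to the words starting in \<open>S False\<close> vanishes.
  It contains the reduced words that begin and end in \<open>S True\<close>. The description by
  pairings makes it stable under linear combinations and adjoints, and no expansion into words has
  to be carried along.\<close>

definition W11 :: "'a set"
 where "W11 = {y \<in> carrier A. \<forall>e L k e' L' k'. wd False e L k & wd False e' L' k' -->
  \<rho> (sA k' ** (y ** k)) = 0}"

lemma W11_word: assumes y: "wd True True L y" shows "y : W11" unfolding W11_def
proof (intro CollectI conjI allI impI)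
 fix e M k e' M' k' assume k: "wd False e M k & wd False e' M' k'"
 have "wd True e (L + M) (y ** k)" using wd_append[OF y, of e M k] k by simp
 hence "wd e' e (M' + (L + M)) (sA k' ** (y ** k))"
  using wd_append[OF wd_star[of False e' M' k'], of e "L + M" "y ** k"] k by simp
 thus "\<rho> (sA k' ** (y ** k)) = 0" by (rule wd_\<rho>)
qed (use y in simp)

lemma W11_carrier [simp]: "y : W11 ==> y .: A" by (simp add: W11_def)

lemma W11D: "y : W11 ==> wd False e L k ==> wd False e' L' k' ==> \<rho> (sA k' ** (y ** k)) = 0"
 unfolding W11_def by blast

lemma W11_add: "x : W11 ==> y : W11 ==> x .+ y : W11" unfolding W11_def by (auto simp: l_distr r_distr)

lemma W11_smult: "y : W11 ==> c *. y : W11" unfolding W11_def by auto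

lemma W11_zero: "\<zero> : W11" unfolding W11_def
proof (intro CollectI conjI allI impI)
 fix e M k e' M' k' assume "wd False e M k & wd False e' M' k'"
 hence "k .: A" "k' .: A" by auto
 thus "\<rho> (sA k' ** (\<zero> ** k)) = 0" by simp
qed simp

lemma W11_star: assumes y: "y : W11" shows "sA y : W11" unfolding W11_def
proof (intro CollectI conjI allI impI)
 fix e M k e' M' k' assume k: "wd False e M k & wd False e' M' k'"
 have c: "k .: A" "k' .: A" "y .: A" using k W11_carrier[OF y] by auto
 have "\<rho> (sA k ** (y ** k')) = 0" using W11D[OF y] k by blast
 hence "\<rho> (sA (sA k ** (y ** k'))) = 0" using c by (simp add: \<rho>_star)
 thus "\<rho> (sA k' ** (sA y ** k)) = 0" using c by (simp add: star_mult m_assoc)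
qed (use W11_carrier[OF y] in simp)

end

subsection \<open>Conjugating reduced words into \<open>W11\<close>\<close>

text \<open>The centraliser hypotheses are encoded as \<open>conj_z\<close>, \<open>conj_a\<close>
  and \<open>conj_c\<close>: conjugation by such a letter preserves the state on the side to which
  the letter belongs.\<close>

locale free_unitaries = free_pair A \<rho> S for A :: "'a cstar" (structure) and \<rho> S +
 fixes z a b c :: 'a assumes z_S: "z : S True" and abc_S: "a : S False" "b : S False" "c : S False"
  and unit: "!!u. u : {z, a, b, c} ==> sA u ** u = \<one> & u ** sA u = \<one>"
  and \<rho>_letters: "\<rho> z = 0" "\<rho> a = 0" "\<rho> b = 0" "\<rho> c = 0" "\<rho> (sA c ** b) = 0" "\<rho> (sA c ** a) = 0"
  and conj_z: "!!y. y : S True ==> \<rho> (sA z ** (y ** z)) = \<rho> y"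
   "!!y. y : S True ==> \<rho> (z ** (y ** sA z)) = \<rho> y"
  and conj_a: "!!y. y : S False ==> \<rho> (sA a ** (y ** a)) = \<rho> y"
  and conj_c: "!!y. y : S False ==> \<rho> (sA c ** (y ** c)) = \<rho> y"
   "!!y. y : S False ==> \<rho> (c ** (y ** sA c)) = \<rho> y"
begin

lemma zabc_carrier [simp]: "z .: A" "a .: A" "b .: A" "c .: A" using z_S abc_S by auto

lemma unit_simps [simp]:
 "sA z ** z = \<one>" "z ** sA z = \<one>" "sA a ** a = \<one>" "a ** sA a = \<one>"
 "sA b ** b = \<one>" "b ** sA b = \<one>" "sA c ** c = \<one>" "c ** sA c = \<one>" using unit by auto

text \<open>The infinite word \<open>c z\<^sup>* a z c z\<^sup>* a z \<dots>\<close>, cut off at length \<open>4 p\<close> and followed by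
  \<open>b z\<^sup>* a z\<close>; \<open>R r p\<close> drops the first \<open>r\<close> letters.\<close>

definition lt :: "nat => 'a"
 where "lt r = (if r mod 4 = 0 then c else if r mod 4 = 1 then sA z else if r mod 4 = 2 then a else z)"

definition blk :: 'a where "blk = b ** (sA z ** (a ** z))"

definition R :: "nat => nat => 'a" where "R r p = foldr (%x y. x ** y) (map lt [r..<4*p]) blk"

lemma mod4_cases: "(r::nat) mod 4 = 0 | r mod 4 = 1 | r mod 4 = 2 | r mod 4 = 3"
proof -
 have "r mod 4 < 4" by simp
 thus ?thesis by linarith
qed

lemma odd_mod4: "odd r <-> r mod 4 = 1 | r mod 4 = (3::nat)" using even_even_mod_4_iff[of r] mod4_cases[of r] by auto

lemma add2_mod4: "(r + 2) mod 4 = (r mod 4 + 2) mod (4::nat)" by (rule mod_add_left_eq[symmetric])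

lemma lt_S: "lt r : S (odd r)"
proof -
 have "sA z : S True" using z_S S_star by blast
 thus ?thesis using z_S abc_S mod4_cases[of r] by (auto simp: lt_def odd_mod4)
qed

lemma lt_carrier [simp]: "lt r .: A" by (rule S_carrier[OF lt_S])

lemma lt_\<rho>: "\<rho> (lt r) = 0" by (simp add: lt_def \<rho>_letters \<rho>_star)

lemma lt_unit [simp]: "sA (lt r) ** lt r = \<one>" "lt r ** sA (lt r) = \<one>" by (simp_all add: lt_def)

lemma lt_conj: "y : S (odd r) ==> \<rho> (sA (lt r) ** (y ** lt r)) = \<rho> y"
 using conj_z conj_a conj_c mod4_cases[of r] by (auto simp: lt_def odd_mod4)

lemma blk_wd: "wd False True 4 blk" and rest_wd: "wd True True 3 (sA z ** (a ** z))"
proof -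
 have z1: "wd True True 1 (sA z)" using wd_star[OF wd_letter[OF z_S \<rho>_letters(1)]] .
 have "wd False True 2 (a ** z)"
  using wd_Cons[OF abc_S(1) \<rho>_letters(2), of True 1 z] wd_letter[OF z_S \<rho>_letters(1)] by (simp add: numeral_2_eq_2)
 thus r: "wd True True 3 (sA z ** (a ** z))"
  using wd_append[OF z1, of True 2 "a ** z"] by (simp add: eval_nat_numeral)
 show "wd False True 4 blk"
  using wd_Cons[OF abc_S(2) \<rho>_letters(3), of True 3] r by (simp add: blk_def eval_nat_numeral)
qed

lemma blk_carrier [simp]: "blk .: A" by (simp add: blk_def)

lemma R_step: "r < 4 * p ==> R r p = lt r ** R (Suc r) p" by (simp add: R_def upt_conv_Cons)

lemma R_end: "4 * p <= r ==> R r p = blk" by (simp add: R_def)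

lemma R_wd: "r <= 4 * p ==> wd (odd r) True (4 * p - r + 4) (R r p)"
proof (induction "4 * p - r" arbitrary: r)
 case 0
 hence "r = 4 * p" by simp
 thus ?case using blk_wd R_end[of p r] by simp
next
 case (Suc m)
 hence r: "r < 4 * p" by simp
 have "wd (odd (Suc r)) True (4 * p - Suc r + 4) (R (Suc r) p)" using Suc by (intro Suc(1)) auto
 hence "wd (odd r) True (Suc (4 * p - Suc r + 4)) (lt r ** R (Suc r) p)" by (intro wd_Cons lt_S lt_\<rho>) simp
 moreover have "Suc (4 * p - Suc r + 4) = 4 * p - r + 4" using r by simp
 ultimately show ?case unfolding R_step[OF r] by (simp only:)
qed

lemma R_carrier [simp]: "R r p .: A" using R_wd[of r p] R_end[of p r] wd_carrier by (cases "r <= 4 * p") auto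

definition far :: "nat => nat => nat => bool"
 where "far K p q <-> K <= p & K <= q & (p = q | K <= p - q | K <= q - p)"

lemma far_mono: "K <= K' ==> far K' p q ==> far K p q" by (auto simp: far_def)

lemma far_commute: "far K p q <-> far K q p" by (auto simp: far_def)

definition ev :: "(nat => nat => 'a) => bool" where "ev T <-> (\<exists>K. \<forall>p q. far K p q --> T p q : W11)"

lemma ev_I: "(!!p q. far K p q ==> T p q : W11) ==> ev T" unfolding ev_def by blast

lemma ev_combine: assumes "ev T1" "ev T2" "!!p q. far K p q ==> T p q = d *. T1 p q .+ T2 p q" shows "ev T"
proof -
 obtain K1 K2 where K: "!!p q. far K1 p q ==> T1 p q : W11" "!!p q. far K2 p q ==> T2 p q : W11"
  using assms(1,2) unfolding ev_def by metis
 show ?thesis proof (rule ev_I[of "max K (max K1 K2)"])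
  fix p q assume f: "far (max K (max K1 K2)) p q"
  have "far K p q" "far K1 p q" "far K2 p q" using f by (auto intro: far_mono[rotated])
  thus "T p q : W11" using assms(3) K W11_add W11_smult by metis
 qed
qed

lemma ev_zero_combine: assumes "ev T2" "!!p q. far K p q ==> T p q = 0 *. T1 p q .+ T2 p q" "!!p q. T1 p q .: A"
 shows "ev T"
proof (rule ev_combine[OF _ assms(1)])
 show "ev (%p q. \<zero>)" by (rule ev_I) (rule W11_zero)
 show "T p q = 1 *. \<zero> .+ T2 p q" if "far K p q" for p q using assms(2)[OF that] assms(3) by simp
qed

lemma ev_star: assumes "ev T" "!!p q. T' p q = sA (T q p)" shows "ev T'"
proof -
 obtain K where K: "!!p q. far K p q ==> T p q : W11" using assms(1) unfolding ev_def by blast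
 show ?thesis by (rule ev_I[of K]) (use assms(2) K W11_star far_commute in auto)
qed

lemma ev_word: "(!!p q. far K p q ==> wd True True (L p q) (T p q)) ==> ev T"
 by (rule ev_I[of K]) (use W11_word in blast)

lemma far_le: "far (Suc (r + s)) p q ==> r < 4 * p & s < 4 * q & r < p & s < q" by (auto simp: far_def)

text \<open>Letters at positions congruent mod 4 are the same unitary, so in the product of an
  adjoint tail with a tail they cancel in pairs.\<close>

lemma peel: assumes "r mod 4 = s mod 4" "r + m <= 4 * p" "s + m <= 4 * q"
 shows "sA (R r p) ** R s q = sA (R (r + m) p) ** R (s + m) q" using assms
proof (induction m arbitrary: r s)
 case (Suc m)
 have lt: "lt r = lt s" using Suc(2) by (simp add: lt_def)
 have "sA (R r p) ** R s q = sA (R (Suc r) p) ** ((sA (lt s) ** lt s) ** R (Suc s) q)"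
  using Suc(3,4) lt by (simp add: R_step star_mult m_assoc del: lt_unit)
 also have "... = sA (R (Suc r) p) ** R (Suc s) q" by simp
 also have "... = sA (R (Suc r + m) p) ** R (Suc s + m) q" proof (rule Suc(1))
  show "Suc r mod 4 = Suc s mod 4" using Suc(2) by (simp add: mod_Suc)
 qed (use Suc(3,4) in auto)
 finally show ?case by simp
qed simp

text \<open>One word ends with \<open>b\<close> where the other one still continues with
  \<open>c\<close>. The merged letter b* c is centred because the state vanishes on c* b, so
  cancellation stops and the product is a reduced word from \<open>S True\<close> to
  \<open>S True\<close>.\<close>

lemma blk_R: assumes s: "s mod 4 = 0" "s < 4 * q" shows "sA blk ** R s q : W11"
proof -
 have "lt s = c" using s by (simp add: lt_def)
 let ?w = "sA z ** (a ** z)"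
 have m: "sA b ** c : S False" using abc_S S_mult S_star by blast
 have "\<rho> (sA (sA c ** b)) = 0" using \<rho>_letters(5) by (subst \<rho>_star) auto
 hence m0: "\<rho> (sA b ** c) = 0" by (simp add: star_mult)
 have w: "wd True True 3 (star A ?w)" using wd_star[OF rest_wd] .
 have "even s" using s odd_mod4[of s] by simp
 have r: "wd (\<not> False) True (4 * q - Suc s + 4) (R (Suc s) q)" using R_wd[of "Suc s" q] s \<open>even s\<close> by simp
 have "wd (\<not> True) True (Suc (4 * q - Suc s + 4)) ((sA b ** c) ** R (Suc s) q)" using wd_Cons[OF m m0 r] by simp
 from wd_append[OF w this]
 have "star A ?w ** ((sA b ** c) ** R (Suc s) q) : W11" by (rule W11_word)
 moreover have "sA blk ** R s q = star A ?w ** ((sA b ** c) ** R (Suc s) q)"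
  using s \<open>lt s = c\<close> by (simp add: R_step blk_def star_mult m_assoc)
 ultimately show ?thesis by simp
qed

text \<open>With equal phases the product is peeled until the shorter remainder is reduced to its
  final block. Unequal remainders mean that the other factor is still inside the periodic part,
  which is the situation of \<open>blk_R\<close>; adjoints exchange the roles.\<close>

lemma R_R_shift: assumes "r mod 4 = s mod 4" "r <= 4 * p" "s <= 4 * q" "4 * p + s ~= 4 * q + r"
 shows "sA (R r p) ** R s q : W11"
proof -
 have *: "sA (R r p) ** R s q : W11"
  if r: "r mod 4 = s mod 4" "r <= 4 * p" "s <= 4 * q" "4 * p + s < 4 * q + r" for r s p q proof -
  let ?m = "4 * p - r"
  have "sA (R r p) ** R s q = sA (R (r + ?m) p) ** R (s + ?m) q" by (rule peel) (use r in auto)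
  moreover have "R (r + ?m) p = blk" using r by (intro R_end) auto
  moreover have "sA blk ** R (s + ?m) q : W11" proof (rule blk_R)
   show "(s + ?m) mod 4 = 0" using mod_add_cong[OF r(1) refl, of ?m] r(2) by simp
  qed (use r in auto)
  ultimately show ?thesis by simp
 qed
 show ?thesis proof (cases "4 * p + s < 4 * q + r")
  case True thus ?thesis using * assms by blast
 next
  case False
  hence "sA (R s q) ** R r p : W11" using assms by (intro *) auto
  hence "sA (sA (R s q) ** R r p) : W11" by (rule W11_star)
  thus ?thesis by (simp add: star_mult)
 qed
qed

lemma far_shift: assumes "r ~= s" "far (Suc (r + s)) p q" shows "4 * p + s ~= 4 * q + r"
 using assms by (auto simp: far_def)

text \<open>The phase difference mod 4 decides. If it is odd, the product is already reduced. If it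
  is zero, \<open>R_R_shift\<close> applies. If it is two at even positions, a and c merge into a
  centred letter. If it is two at odd positions, the mean of the merged letter leads one step
  further to the even case and its centred part is a reduced word.\<close>

lemma R_R_ev: assumes rs: "r ~= s" shows "ev (%p q. sA (R r p) ** R s q)"
proof -
 have split: "sA (R r p) ** R s q = sA (R (Suc r) p) ** ((sA (lt r) ** lt s) ** R (Suc s) q)"
  if "r < 4 * p" "s < 4 * q" for r s p q using that by (simp add: R_step star_mult m_assoc)
 have even2: "ev (%p q. sA (R r p) ** R s q)" if r: "even r" "(r + 2) mod 4 = s mod 4" for r s
 proof (rule ev_word[of "Suc (r + s)"])
  fix p q assume "far (Suc (r + s)) p q"
  hence pq: "r < 4 * p" "s < 4 * q" using far_le by blast+
  have es: "even s" using r mod4_cases[of r] mod4_cases[of s] odd_mod4[of r] odd_mod4[of s]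
   unfolding add2_mod4[of r] by auto
  let ?x = "sA (lt r) ** lt s"
  have x: "?x : S False" using lt_S[of r] lt_S[of s] r es S_star S_mult by simp
  have "\<rho> (sA (sA c ** a)) = 0" using \<rho>_letters(6) by (subst \<rho>_star) auto
  hence "\<rho> (sA a ** c) = 0" by (simp add: star_mult)
  moreover have "r mod 4 = 0 & s mod 4 = 2 | r mod 4 = 2 & s mod 4 = 0"
   using r mod4_cases[of r] mod4_cases[of s] odd_mod4[of r] odd_mod4[of s] unfolding add2_mod4[of r] by auto
  ultimately have x0: "\<rho> ?x = 0" using \<rho>_letters(6) by (auto simp: lt_def)
  have R1: "wd True True (4 * q - Suc s + 4) (R (Suc s) q)" using R_wd[of "Suc s" q] pq es by simp
  have R2: "wd True True (4 * p - Suc r + 4) (sA (R (Suc r) p))" using wd_star[OF R_wd[of "Suc r" p]] pq r by simp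
  have "wd (\<not> True) True (Suc (4 * q - Suc s + 4)) (?x ** R (Suc s) q)"
   unfolding not_True_eq_False by (rule wd_Cons[OF x x0]) (use R1 in simp)
  from wd_append[OF R2 this] show "wd True True (4 * p - Suc r + 4 + Suc (4 * q - Suc s + 4)) (sA (R r p) ** R s q)"
   using split[OF pq] by simp
 qed
 show ?thesis proof (cases "odd r = odd s")
  case False
  show ?thesis proof (rule ev_word[of "Suc (r + s)"])
   fix p q assume "far (Suc (r + s)) p q"
   hence pq: "r < 4 * p" "s < 4 * q" using far_le by blast+
   have "wd True (odd r) (4 * p - r + 4) (sA (R r p))" using wd_star[OF R_wd[of r p]] pq by simp
   moreover have "wd (\<not> odd r) True (4 * q - s + 4) (R s q)" using R_wd[of s q] pq False by simp
   ultimately show "wd True True (4 * p - r + 4 + (4 * q - s + 4)) (sA (R r p) ** R s q)" by (rule wd_append)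
  qed
 next
  case True
  hence "r mod 4 = s mod 4 | (r + 2) mod 4 = s mod 4"
   using mod4_cases[of r] mod4_cases[of s] unfolding odd_mod4 add2_mod4[of r] by auto
  then consider "r mod 4 = s mod 4" | "even r" "(r + 2) mod 4 = s mod 4" | "odd r" "(r + 2) mod 4 = s mod 4" by blast
  thus ?thesis proof cases
   case 1
   show ?thesis proof (rule ev_I[of "Suc (r + s)"])
    fix p q assume f: "far (Suc (r + s)) p q"
    hence pq: "r < 4 * p" "s < 4 * q" using far_le by blast+
    show "sA (R r p) ** R s q : W11" by (rule R_R_shift[OF 1]) (use pq far_shift[OF rs f] in auto)
   qed
  next
   case 2 thus ?thesis by (rule even2)
  next
   case 3
   have os: "odd s" using 3 mod4_cases[of r] mod4_cases[of s] unfolding odd_mod4 add2_mod4[of r] by auto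
   let ?x = "sA (lt r) ** lt s"
   have x: "?x : S True" using lt_S[of r] lt_S[of s] 3 os S_star S_mult by simp
   have e1: "ev (%p q. sA (R (Suc r) p) ** R (Suc s) q)" proof (rule even2)
    show "(Suc r + 2) mod 4 = Suc s mod 4" using 3 by (simp add: mod_Suc)
   qed (use 3 in simp)
   have e2: "ev (%p q. sA (R (Suc r) p) ** (cen ?x ** R (Suc s) q))" proof (rule ev_word[of "Suc (r + s)"])
    fix p q assume "far (Suc (r + s)) p q"
    hence pq: "r < 4 * p" "s < 4 * q" using far_le by blast+
    have R1: "wd (\<not> True) True (4 * q - Suc s + 4) (R (Suc s) q)" using R_wd[of "Suc s" q] pq os by simp
    have R2: "wd True False (4 * p - Suc r + 4) (sA (R (Suc r) p))" using wd_star[OF R_wd[of "Suc r" p]] pq 3 by simp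
    have "wd (\<not> False) True (1 + (4 * q - Suc s + 4)) (cen ?x ** R (Suc s) q)"
     using wd_append[OF wd_cen[OF x] R1] by simp
    from wd_append[OF R2 this]
    show "wd True True (4 * p - Suc r + 4 + (1 + (4 * q - Suc s + 4))) (sA (R (Suc r) p) ** (cen ?x ** R (Suc s) q))" .
   qed
   show ?thesis proof (rule ev_combine[OF e1 e2])
    fix p q assume "far (Suc (r + s)) p q"
    hence pq: "r < 4 * p" "s < 4 * q" using far_le by blast+
    show "sA (R r p) ** R s q = \<rho> ?x *. (sA (R (Suc r) p) ** R (Suc s) q)
      .+ sA (R (Suc r) p) ** (cen ?x ** R (Suc s) q)" unfolding split[OF pq] by (rule mult_split) auto
   qed
  qed
 qed
qed

text \<open>What is left of the product of the adjoint of \<open>v p\<close>, an element and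
  \<open>v q\<close> after r letters of the left tail and s letters of the right tail have been used
  up.\<close>

definition T :: "nat => 'a => nat => nat => nat => 'a" where "T r y s p q = sA (R r p) ** (y ** R s q)"

lemma T_star: "y .: A ==> T r y s p q = sA (T s (sA y) r q p)" by (simp add: T_def star_mult m_assoc)

lemma T_star_ev: assumes "y .: A" "ev (T s (sA y) r)" shows "ev (T r y s)"
 by (rule ev_star[OF assms(2)]) (rule T_star[OF assms(1)])

lemma T_word_ev: assumes y: "wd k e L y" and "k ~= odd r" "e ~= odd s" shows "ev (T r y s)"
proof (rule ev_word[of "Suc (r + s)"])
 fix p q assume "far (Suc (r + s)) p q"
 hence pq: "r < 4 * p" "s < 4 * q" using far_le by blast+
 have R1: "wd (\<not> e) True (4 * q - s + 4) (R s q)" using R_wd[of s q] pq assms(3) by simp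
 have R2: "wd True (\<not> k) (4 * p - r + 4) (sA (R r p))" using wd_star[OF R_wd[of r p]] pq assms(2) by simp
 have "wd (\<not> \<not> k) True (L + (4 * q - s + 4)) (y ** R s q)" using wd_append[OF y R1] by simp
 from wd_append[OF R2 this]
 show "wd True True (4 * p - r + 4 + (L + (4 * q - s + 4))) (T r y s p q)" by (simp add: T_def)
qed

lemma T_right: assumes "x .: A" "y .: A" "s < 4 * q"
 shows "T r (y ** x) s p q = \<rho> (x ** lt s) *. T r y (Suc s) p q .+ T r (y ** cen (x ** lt s)) (Suc s) p q"
proof -
 have "T r (y ** x) s p q = (sA (R r p) ** y) ** ((x ** lt s) ** R (Suc s) q)"
  using assms by (simp add: T_def R_step m_assoc)
 also have "... = \<rho> (x ** lt s) *. ((sA (R r p) ** y) ** R (Suc s) q)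
   .+ (sA (R r p) ** y) ** (cen (x ** lt s) ** R (Suc s) q)" using assms by (intro mult_split) auto
 finally show ?thesis using assms by (simp add: T_def m_assoc)
qed

lemma T_left: assumes "x .: A" "y .: A" "r < 4 * p" shows "T r (x ** y) s p q
  = \<rho> (sA (lt r) ** x) *. T (Suc r) y s p q .+ T (Suc r) (cen (sA (lt r) ** x) ** y) s p q"
proof -
 have "T r (x ** y) s p q = sA (R (Suc r) p) ** ((sA (lt r) ** x) ** (y ** R s q))"
  using assms by (simp add: T_def R_step star_mult m_assoc)
 also have "... = \<rho> (sA (lt r) ** x) *. (sA (R (Suc r) p) ** (y ** R s q))
   .+ sA (R (Suc r) p) ** (cen (sA (lt r) ** x) ** (y ** R s q))" using assms by (intro mult_split) auto
 finally show ?thesis using assms by (simp add: T_def m_assoc)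
qed

lemma T_one_ev: "r ~= s ==> ev (T r \<one> s)" using R_R_ev[of r s] by (simp add: T_def[abs_def])

text \<open>The left end of \<open>y\<close> meets a letter of the other side and stays fixed, so
  letters are consumed from the right only. Each mean moves \<open>s\<close> up by one while
  \<open>y\<close> loses a letter, and each centred part is reduced. When \<open>y\<close> is used
  up the tails start at r and s + L, which differ by assumption.\<close>

lemma T_right_ev:
 "wd k e L y ==> k ~= odd r ==> r ~= s + L ==> ev (T r y s)"
proof (induction L arbitrary: e y s)
 case 0
 thus ?case using wd_pos by blast
next
 case (Suc L)
 show ?case proof (cases "e = odd s")
  case False
  thus ?thesis using T_word_ev Suc by blast
 next
  case True
  show ?thesis proof (cases "L = 0")
   case L: True
   hence y: "e = k" "y : S k" using wd_single Suc(2) by auto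
   have m: "y ** lt s : S k" using y True lt_S[of s] S_mult by auto
   show ?thesis proof (rule ev_combine[where K = "Suc s"])
    show "ev (T r \<one> (Suc s))" using Suc(4) L by (intro T_one_ev) simp
    show "ev (T r (cen (y ** lt s)) (Suc s))" by (rule T_word_ev[OF wd_cen[OF m] Suc(3)]) (use y True in auto)
    fix p q assume "far (Suc s) p q"
    hence "s < 4 * q" by (auto simp: far_def)
    thus "T r y s p q = \<rho> (y ** lt s) *. T r \<one> (Suc s) p q .+ T r (cen (y ** lt s)) (Suc s) p q"
     using T_right[of y "\<one>" s q r p] y by simp
   qed
  next
   case L: False
   have "Suc L >= 2" using L by simp
   with Suc(2) obtain x y' where y: "x : S e" "\<rho> x = 0" "wd k (\<not> e) (Suc L - 1) y'" "y = y' ** x"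
    by (rule wd_right)
   have y': "wd k (\<not> e) L y'" using y(3) by simp
   have m: "x ** lt s : S e" using y(1) True lt_S[of s] S_mult by simp
   show ?thesis proof (rule ev_combine[where K = "Suc s"])
    show "ev (T r y' (Suc s))" by (rule Suc(1)[OF y' Suc(3)]) (use Suc(4) in simp)
    have "wd k e (L + 1) (y' ** cen (x ** lt s))" by (rule wd_append[OF y']) (use wd_cen[OF m] in simp)
    thus "ev (T r (y' ** cen (x ** lt s)) (Suc s))" by (rule T_word_ev[OF _ Suc(3)]) (use True in auto)
    fix p q assume "far (Suc s) p q"
    hence "s < 4 * q" by (auto simp: far_def)
    thus "T r y s p q = \<rho> (x ** lt s) *. T r y' (Suc s) p q .+ T r (y' ** cen (x ** lt s)) (Suc s) p q"
     using T_right[of x y' s q r p] y by simp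
   qed
  qed
 qed
qed

lemma T_left_ev: assumes y: "wd k e L y" and "e ~= odd s" "s ~= r + L" shows "ev (T r y s)"
 by (rule T_star_ev[OF wd_carrier[OF y] T_right_ev[OF wd_star[OF y]]]) (use assms in auto)

text \<open>A letter is removed on the side with the smaller index. Hence once the remaining letters are consumed
  from one side only, the two indices cannot meet, which would leave the identity.\<close>

lemma T_ev:
 "wd k e L y ==> r = 0 | k = odd r ==> s = 0 | e = odd s ==> ev (T r y s)"
proof (induction L arbitrary: k e y r s rule: less_induct)
 case (less L)
 have L0: "L > 0" using wd_pos less(2) by blast
 consider (a) "k ~= odd r" | (b) "e ~= odd s" | (c) "k = odd r" "e = odd s" "L = 1" | (d) "k = odd r" "e = odd s" "L >= 2"
  using L0 by fastforce
 thus ?case proof cases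
  \<comment> \<open>Here the left end is not aligned with the tail, so the side condition leaves
    only \<open>r = 0\<close>. As L is positive, r cannot equal s + L. The next case is the mirror
    image.\<close>
  case a
  thus ?thesis using less L0 by (intro T_right_ev[OF less(2)]) auto
 next
  case b
  thus ?thesis using less L0 by (intro T_left_ev[OF less(2)]) auto
 next
  case c
  hence y: "y : S (odd r)" "odd s = odd r" "\<rho> y = 0" using wd_single[OF less(2)] by auto
  let ?x = "sA (lt r) ** (y ** lt s)"
  have x: "?x : S (odd r)" using y lt_S[of r] lt_S[of s] S_star S_mult by simp
  have w: "ev (%p q. sA (R (Suc r) p) ** (cen ?x ** R (Suc s) q))"
   using T_word_ev[OF wd_cen[OF x], of "Suc r" "Suc s"] y(2) by (simp add: T_def[abs_def])
  have eq: "T r y s p q = \<rho> ?x *. (sA (R (Suc r) p) ** R (Suc s) q)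
    .+ sA (R (Suc r) p) ** (cen ?x ** R (Suc s) q)" if "far (Suc (r + s)) p q" for p q proof -
   have pq: "r < 4 * p" "s < 4 * q" using far_le that by blast+
   have yc: "y .: A" using y by simp
   have "T r y s p q = sA (R (Suc r) p) ** (?x ** R (Suc s) q)"
    using pq yc by (simp add: T_def R_step star_mult m_assoc)
   also have "... = \<rho> ?x *. (sA (R (Suc r) p) ** R (Suc s) q)
    .+ sA (R (Suc r) p) ** (cen ?x ** R (Suc s) q)" using yc by (intro mult_split) auto
   finally show ?thesis .
  qed
  show ?thesis proof (cases "r = s")
   \<comment> \<open>For equal positions the two tails would multiply to 1 when p = q. Their
     coefficient vanishes: conjugation by the letter preserves the state, and \<open>y\<close> is
     centred.\<close>
   case True
   hence "\<rho> ?x = 0" using lt_conj[OF y(1)] y(3) by simp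
   thus ?thesis using ev_zero_combine[OF w, of "Suc (r + s)" "T r y s" "%p q. sA (R (Suc r) p) ** R (Suc s) q"] eq by simp
  next
   case False
   thus ?thesis using ev_combine[OF R_R_ev[of "Suc r" "Suc s"] w, of "Suc (r + s)" "T r y s" "\<rho> ?x"] eq by simp
  qed
 next
  case d
  have le: "ev (T r y s)" if w: "wd k e L y" "k = odd r" "e = odd s" "r <= s" for k e y r s proof -
   from w(1) d(3) obtain x y' where y: "x : S k" "\<rho> x = 0" "wd (\<not> k) e (L - 1) y'" "y = x ** y'"
    by (rule wd_left)
   have m: "sA (lt r) ** x : S k" using y(1) w(2) lt_S[of r] S_mult S_star by simp
   show ?thesis proof (rule ev_combine[where K = "Suc r"])
    show "ev (T (Suc r) y' s)" by (rule less(1)[OF _ y(3)]) (use d L0 w in auto)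
    show "ev (T (Suc r) (cen (sA (lt r) ** x) ** y') s)"
     by (rule T_right_ev[OF wd_append[OF wd_cen[OF m] y(3)]]) (use w d L0 in auto)
    fix p q assume "far (Suc r) p q"
    hence "r < 4 * p" by (auto simp: far_def)
    thus "T r y s p q = \<rho> (sA (lt r) ** x) *. T (Suc r) y' s p q
      .+ T (Suc r) (cen (sA (lt r) ** x) ** y') s p q" using T_left[of x y' r p s q] y by simp
   qed
  qed
  show ?thesis proof (cases "r <= s")
   case True thus ?thesis using le less(2) d by blast
  next
   case False
   thus ?thesis by (intro T_star_ev[OF wd_carrier[OF less(2)] le[OF wd_star[OF less(2)] d(2,1)]]) simp
  qed
 qed
qed

abbreviation v :: "nat => 'a" where "v p == R 0 p"

lemma wsum_ev: "wsum s ==> ev (T 0 s 0)"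
proof (induction rule: wsum.induct)
 case wsum_zero
 show ?case by (rule ev_I[of 0]) (simp add: T_def W11_zero)
next
 case (wsum_add k e L y s)
 show ?case by (rule ev_combine[OF T_ev[OF wsum_add(1), of 0 0] wsum_add(3), of 0 _ 1])
   (use wsum_add in "auto simp: T_def l_distr r_distr")
qed

lemma wsum_conj_W11: assumes "finite F" "!!s. s : F ==> wsum s"
 obtains K where "!!s p q. s : F ==> far K p q ==> sA (v p) ** (s ** v q) : W11"
proof -
 have "\<exists>K. \<forall>s\<in>F. \<forall>p q. far K p q --> sA (v p) ** (s ** v q) : W11" using assms
 proof (induction F)
  case (insert x F)
  then obtain K where K: "\<forall>s\<in>F. \<forall>p q. far K p q --> sA (v p) ** (s ** v q) : W11" by auto
  obtain K' where K': "!!p q. far K' p q ==> sA (v p) ** (x ** v q) : W11"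
   using wsum_ev[of x] insert(4) unfolding ev_def T_def by auto
  have "sA (v p) ** (s ** v q) : W11" if "s : insert x F" "far (max K K') p q" for s p q proof -
   have "far K p q" "far K' p q" using that(2) by (auto intro: far_mono[rotated])
   thus ?thesis using K K' that(1) by blast
  qed
  thus ?case by blast
 qed simp
 thus ?thesis using that by blast
qed

lemma v_v_W11: "p ~= q ==> sA (v p) ** v q : W11" by (rule R_R_shift) auto

lemma R_unitary: "sA (R r p) ** R r p = \<one> & R r p ** sA (R r p) = \<one>"
proof -
 have mu: "sA (x ** y) ** (x ** y) = \<one> & (x ** y) ** sA (x ** y) = \<one>"
  if xy: "x .: A" "y .: A" "sA x ** x = \<one>" "x ** sA x = \<one>"
   "sA y ** y = \<one>" "y ** sA y = \<one>" for x y proof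
  have "sA (x ** y) ** (x ** y) = sA y ** ((sA x ** x) ** y)" using xy(1,2) by (simp add: star_mult m_assoc)
  thus "sA (x ** y) ** (x ** y) = \<one>" using xy by simp
  have "(x ** y) ** sA (x ** y) = x ** ((y ** sA y) ** sA x)" using xy(1,2) by (simp add: star_mult m_assoc)
  thus "(x ** y) ** sA (x ** y) = \<one>" using xy by simp
 qed
 have blk: "sA blk ** blk = \<one> & blk ** sA blk = \<one>"
  unfolding blk_def using mu[of a z] mu[of "sA z" "a ** z"] mu[of b "sA z ** (a ** z)"] by simp
 show ?thesis proof (induction "4 * p - r" arbitrary: r)
  case 0
  thus ?case using blk R_end[of p r] by simp
 next
  case (Suc m)
  thus ?case using mu[of "lt r" "R (Suc r) p"] R_step[of r p] by simp
 qed
qed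

end

subsection \<open>Finite sums and rows of orthogonal projections\<close>

context cstar_algebra
begin

definition lsum :: "('x => 'a) => 'x list => 'a" where "lsum f xs = foldr (%x s. f x .+ s) xs \<zero>"

lemma lsum_simps [simp]: "lsum f [] = \<zero>" "lsum f (x # xs) = f x .+ lsum f xs" by (simp_all add: lsum_def)

lemma lsum_closed: "(!!x. x : set xs ==> f x .: A) ==> lsum f xs .: A" by (induction xs) auto

lemma lsum_cong: "(!!x. x : set xs ==> f x = g x) ==> lsum f xs = lsum g xs" by (induction xs) auto

lemma lsum_add:
 "(!!x. x : set xs ==> f x .: A) ==> (!!x. x : set xs ==> g x .: A) ==>
  lsum (%x. f x .+ g x) xs = lsum f xs .+ lsum g xs"
proof (induction xs)
 case (Cons x xs)
 hence "lsum f xs .: A" "lsum g xs .: A" by (auto intro: lsum_closed)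
 thus ?case using Cons by (simp add: a_ac)
qed simp

lemma lsum_smult:
 "(!!x. x : set xs ==> f x .: A) ==> lsum (%x. c *. f x) xs = c *. lsum f xs"
 by (induction xs) (auto simp: sm_add_r lsum_closed)

lemma lsum_mult_l:
 "(!!x. x : set xs ==> f x .: A) ==> y .: A ==>
  y ** lsum f xs = lsum (%x. y ** f x) xs" by (induction xs) (auto simp: r_distr lsum_closed)

lemma lsum_mult_r:
 "(!!x. x : set xs ==> f x .: A) ==> y .: A ==>
  lsum f xs ** y = lsum (%x. f x ** y) xs" by (induction xs) (auto simp: l_distr lsum_closed)

lemma lsum_star:
 "(!!x. x : set xs ==> f x .: A) ==> sA (lsum f xs) = lsum (%x. sA (f x)) xs"
 by (induction xs) (auto simp: star_add lsum_closed)

lemma nrm_lsum_le: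
 "(!!x. x : set xs ==> f x .: A) ==> nA (lsum f xs) <= (\<Sum>x\<leftarrow>xs. nA (f x))"
proof (induction xs)
 case (Cons x xs)
 hence "nA (lsum f (x # xs)) <= nA (f x) + nA (lsum f xs)" by (simp add: nrm_triangle lsum_closed)
 thus ?case using Cons by fastforce
qed simp

lemma nrm_lsum_bound: assumes "!!x. x : set xs ==> f x .: A" "!!x. x : set xs ==> nA (f x) <= K"
 shows "nA (lsum f xs) <= real (length xs) * K"
proof -
 have "nA (lsum f xs) <= (\<Sum>x\<leftarrow>xs. nA (f x))" by (rule nrm_lsum_le) (use assms in blast)
 also have "... <= (\<Sum>x\<leftarrow>xs. K)" by (rule sum_list_mono) (use assms in blast)
 finally show ?thesis by (simp add: sum_list_triv)
qed

lemma lsum_subalgebra: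
 "unital_cstar_subalgebra B A ==> (!!x. x : set xs ==> f x : B) ==> lsum f xs : B"
 by (induction xs) (auto simp: unital_cstar_subalgebraD(3,4))

definition proj :: "'a => bool" where "proj p <-> p .: A & p ** p = p & sA p = p"

lemma projD: "proj p ==> p .: A" "proj p ==> p ** p = p" "proj p ==> sA p = p" by (simp_all add: proj_def)

lemma proj_absorb: "proj p ==> x .: A ==> p ** (p ** x) = p ** x" by (metis m_assoc projD(1,2))

lemma proj_compl: "proj p ==> proj (\<one> .- p)"
 by (simp add: proj_def star_add star_minus minus_eq l_distr r_distr l_minus r_minus minus_add a_ac r_neg r_neg2)

lemma proj_nrm: "proj p ==> nA p <= 1"
proof (cases "nA p = 0")
 case False
 assume "proj p"
 hence "(nA p)\<^sup>2 = nA p" using cstar_identity[of p] by (simp add: proj_def)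
 thus ?thesis using False by (simp add: power2_eq_square)
qed auto

lemma proj_le: assumes p: "proj p" and q: "proj q" and pq: "q ** p = p" shows "cstar_le A p q"
proof -
 have "sA (q ** p) = sA p" using pq by simp
 hence qp: "p ** q = p" using p q by (simp add: star_mult proj_def)
 have "sA (q .- p) ** (q .- p) = q .- p .- p .+ p"
  using p q pq qp by (simp add: proj_def star_add star_minus minus_eq l_distr r_distr l_minus r_minus minus_add a_ac)
 also have "... = q .- p" using projD(1)[OF p] projD(1)[OF q] by algebra
 finally show ?thesis using projD(1)[OF p] projD(1)[OF q] unfolding cstar_le_def by (intro bexI[of _ "q .- p"]) auto
qed

lemma proj_conj: assumes p: "proj p" and u: "u .: A" "sA u ** u = \<one>" shows "proj (u ** p ** sA u)"
proof -
 note c = projD(1)[OF p] u(1)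
 have "(u ** p ** sA u) ** (u ** p ** sA u) = u ** (p ** ((sA u ** u) ** (p ** sA u)))" using c by (simp add: m_assoc)
 also have "... = u ** p ** sA u" using c u(2) proj_absorb[OF p] by (simp add: m_assoc)
 finally show ?thesis using c projD(3)[OF p] by (simp add: proj_def star_mult m_assoc)
qed

text \<open>For mutually orthogonal projections the cross terms of \<open>(\<Sum>p\<^sub>i T\<^sub>i)\<^sup>*(\<Sum>p\<^sub>i T\<^sub>i)\<close> vanish.\<close>

lemma row_square: assumes "distinct xs" "!!i. i : set xs ==> proj (p i)" "!!i. i : set xs ==> T i .: A"
  "!!i j. i : set xs ==> j : set xs ==> i ~= j ==> p i ** p j = \<zero>"
 shows "sA (lsum (%i. p i ** T i) xs) ** lsum (%i. p i ** T i) xs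
  = lsum (%i. sA (T i) ** (p i ** T i)) xs" using assms
proof (induction xs)
 case (Cons x xs)
 let ?W = "lsum (%i. p i ** T i) xs"
 have c: "!!i. i : set (x # xs) ==> p i .: A" "!!i. i : set (x # xs) ==> T i .: A"
  using Cons(3,4) by (auto simp: proj_def)
 have W: "?W .: A" by (rule lsum_closed) (use c in auto)
 have "p x ** ?W = lsum (%i. p x ** (p i ** T i)) xs" by (rule lsum_mult_l) (use c in auto)
 also have "... = lsum (%i. 0 *. \<zero>) xs" proof (rule lsum_cong)
  fix i assume i: "i : set xs"
  hence "p x ** (p i ** T i) = (p x ** p i) ** T i" using c by (simp add: m_assoc)
  also have "p x ** p i = \<zero>" using Cons(2,5) i by auto
  finally show "p x ** (p i ** T i) = 0 *. \<zero>" using c i by simp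
 qed
 also have "... = \<zero>" by (subst lsum_smult) (auto simp: lsum_closed)
 finally have pW: "p x ** ?W = \<zero>" .
 have px: "p x .: A" "sA (p x) = p x" "T x .: A" using Cons(3)[of x] c by (auto simp: proj_def)
 have "sA (p x ** ?W) = \<zero>" using pW by simp
 hence Wp: "star A ?W ** p x = \<zero>" using px W by (simp add: star_mult)
 have "sA (p x ** T x) ** ?W = sA (T x) ** (p x ** ?W)" using px W by (simp add: star_mult m_assoc)
 hence c1: "sA (p x ** T x) ** ?W = \<zero>" using pW px by simp
 have "star A ?W ** (p x ** T x) = (star A ?W ** p x) ** T x" using px W by (simp add: m_assoc)
 hence c2: "star A ?W ** (p x ** T x) = \<zero>" using Wp px by simp
 have "sA (p x ** T x) ** (p x ** T x) = sA (T x) ** (p x ** T x)"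
  using px proj_absorb[OF Cons(3)[of x]] by (simp add: star_mult m_assoc)
 moreover have "star A ?W ** ?W = lsum (%i. sA (T i) ** (p i ** T i)) xs" using Cons by (intro Cons(1)) auto
 moreover have "lsum (%i. sA (T i) ** (p i ** T i)) xs .: A" by (rule lsum_closed) (use c in auto)
 ultimately show ?case using px W c1 c2 by (simp add: star_add l_distr r_distr)
qed simp

text \<open>Only the diagonal terms survive in the square of the row, each of norm at most 1. The
  gain from n to the square root of n is what makes the normalised sums of cells almost
  isometric.\<close>

lemma row_nrm: assumes "distinct xs" "!!i. i : set xs ==> proj (p i)" "!!i. i : set xs ==> T i .: A"
  "!!i j. i : set xs ==> j : set xs ==> i ~= j ==> p i ** p j = \<zero>" and T: "!!i. i : set xs ==> nA (T i) <= 1"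
 shows "nA (lsum (%i. p i ** T i) xs) <= sqrt (real (length xs))"
proof -
 have c: "p i .: A" if "i : set xs" for i using assms(2)[OF that] by (simp add: proj_def)
 have W: "lsum (%i. p i ** T i) xs .: A" by (rule lsum_closed) (use c assms(3) in auto)
 have "(nA (lsum (%i. p i ** T i) xs))\<^sup>2 = nA (lsum (%i. sA (T i) ** (p i ** T i)) xs)"
  using cstar_identity[OF W] row_square[OF assms(1-4)] by simp
 also have "... <= real (length xs) * (1 * (1 * 1))"
  by (rule nrm_lsum_bound) (use c assms proj_nrm in "auto intro!: nrm_mult_le[of _ _ 1 1, simplified]")
 finally show ?thesis by (simp add: real_le_rsqrt)
qed

end

subsection \<open>The projections of the PHP property\<close>

context free_pair
begin

lemma inn_hat_zero_wspan: assumes x: "x .: HH" and one: "hinner HH x (hat \<one>) = 0"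
  and word: "!!k e L y. wd k e L y ==> hinner HH x (hat y) = 0" and y: "y : wspan" shows "hinner HH x (hat y) = 0"
proof -
 obtain c s where s: "y = c *. \<one> .+ s" "wsum s" using y by (auto simp: wspan_def)
 have "hinner HH x (hat s) = 0" using s(2) proof (induction rule: wsum.induct)
  case wsum_zero
  thus ?case using x H.inn_zero(2)[OF x] by (simp add: H_zero)
 next
  case (wsum_add k e L w s)
  thus ?case using word x by (simp add: hat_add H.inn_add_r)
 qed
 thus ?thesis using s x one by (simp add: hat_add hat_smult H.inn_add_r H.inn_smult_r)
qed

text \<open>The span of 1 and the reduced words is dense in norm, hence its image is dense in the
  completion, and orthogonality to a dense set forces a vector to vanish.\<close>

lemma words_total: assumes x: "x .: HH" and one: "hinner HH x (hat \<one>) = 0"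
  and word: "!!k e L y. wd k e L y ==> hinner HH x (hat y) = 0" shows "x = 0@HH"
proof -
 have hat0: "hinner HH x (hat y) = 0" if y: "y .: A" for y proof -
  have "cmod (hinner HH x (hat y)) <= 0 + e" if e: "e > 0" for e proof -
   have p: "e / (1 + H.hn x) > 0" using e H.hn_nonneg[OF x] by (simp add: add_pos_nonneg)
   have "y : cs_closure wspan" using y wspan_dense by simp
   then obtain v where v: "v : wspan" "nA (y .- v) < e / (1 + H.hn x)" using p unfolding cs_closure_def by blast
   have vc: "v .: A" using wspan_carrier[OF v(1)] .
   have "y = (y .- v) .+ v" using y vc by algebra
   hence "hinner HH x (hat y) = hinner HH x (hat (y .- v)) + hinner HH x (hat v)"
    using hat_add[of "y .- v" v] H.inn_add_r[of "hat (y .- v)" "hat v" x] x y vc by simp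
   hence "cmod (hinner HH x (hat y)) = cmod (hinner HH x (hat (y .- v)))"
    using inn_hat_zero_wspan[OF x one word v(1)] by simp
   also have "... <= H.hn x * sn (y .- v)"
    using H.hCauchy_Schwarz[OF x hat_closed[of "y .- v"]] y vc H_norm_hat[of "y .- v"] by simp
   also have "... <= H.hn x * nA (y .- v)"
    using sn_le_nrm[of "y .- v"] y vc H.hn_nonneg[OF x] by (intro mult_left_mono) auto
   also have "... <= H.hn x * (e / (1 + H.hn x))" using v(2) H.hn_nonneg[OF x] by (intro mult_left_mono) auto
   also have "... <= e" using e H.hn_nonneg[OF x] by (simp add: field_simps)
   finally show ?thesis by simp
  qed
  hence "cmod (hinner HH x (hat y)) <= 0" by (rule field_le_epsilon)
  thus ?thesis by simp
 qed
 have "H.hn x <= 0 + e" if e: "e > 0" for e proof -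
  obtain y where y: "y .: A" "H.hn (x .-@HH hat y) <= e" using hat_dense[OF x e] .
  have "H.hn x * H.hn x = cmod (hinner HH x (x .-@HH hat y))"
   using x y hat0[OF y(1)] by (simp add: H.inn_diff_r H.inn_self norm_mult power2_eq_square)
  also have "... <= H.hn x * e"
   using H.hCauchy_Schwarz[of x "x .-@HH hat y"] x y mult_left_mono[OF y(2), of "H.hn x"] by simp
  finally have "H.hn x * H.hn x <= e * H.hn x" by (simp add: mult.commute)
  hence "H.hn x <= e" by (rule square_le_mult_cancel) (use x e in auto)
  thus ?thesis by simp
 qed
 hence "H.hn x <= 0" by (rule field_le_epsilon)
 thus ?thesis using x H.hn_eq_0_iff[OF x] H.hn_nonneg[OF x] by simp
qed

section \<open>The projections attached to the words starting in \<open>S False\<close>\<close>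

definition S2 :: "(nat => 'a) set set" where "S2 = {hat k |k e L. wd False e L k}"

lemma S2_carrier: "S2 <= carrier HH" by (auto simp: S2_def)

text \<open>The projection onto the vectors orthogonal to all words starting in
  \<open>S False\<close>; its complement \<open>N0\<close> is the projection N of the
  overview.\<close>

definition E0 :: "(nat => 'a) set => (nat => 'a) set" where "E0 = (SOME P. P .: BB & P **@BB P = P & star BB P = P &
  (\<forall>x\<in>carrier HH. P x : H.orth S2) & (\<forall>x\<in>H.orth S2. P x = x))"

lemma E0: "E0 .: BB" "H.B.proj E0" "!!x. x .: HH ==> E0 x : H.orth S2"
  "!!x. x : H.orth S2 ==> E0 x = x"
proof -
 let ?Q = "%P. P .: BB & P **@BB P = P & star BB P = P &
  (\<forall>x\<in>carrier HH. P x : H.orth S2) & (\<forall>x\<in>H.orth S2. P x = x)"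
 have "\<exists>P. ?Q P" by (rule H.ex_projection[OF H.closed_subspace_orth[OF S2_carrier]]) blast
 hence "?Q E0" unfolding E0_def by (rule someI_ex)
 thus "E0 .: BB" "H.B.proj E0" "!!x. x .: HH ==> E0 x : H.orth S2"
  "!!x. x : H.orth S2 ==> E0 x = x" by (auto simp: H.B.proj_def)
qed

lemma E0_apply_closed [simp]: "x .: HH ==> E0 x .: HH" by (rule H.B_closed[OF E0(1)])

lemma E0_sym: "x .: HH ==> y .: HH ==> hinner HH (E0 x) y = hinner HH x (E0 y)"
 using H.B_star[OF E0(1), of x y] E0(2) by (simp add: H.B.proj_def)

lemma orthD: "x : H.orth S2 ==> wd False e L k ==> hinner HH x (hat k) = 0" unfolding H.orth_def S2_def by blast

lemma orthI:
 "x .: HH ==> (!!e L k. wd False e L k ==> hinner HH x (hat k) = 0) ==> x : H.orth S2"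
 unfolding H.orth_def S2_def by blast

lemma hat_orth: "y .: A ==> (!!e L k. wd False e L k ==> \<rho> (sA k ** y) = 0) ==> hat y : H.orth S2"
 by (rule orthI) (simp_all add: inn_hat ip_def)

definition N0 :: "(nat => 'a) set => (nat => 'a) set" where "N0 = 1@BB .-@BB E0"

lemma N0_proj: "H.B.proj N0" unfolding N0_def by (rule H.B.proj_compl[OF E0(2)])

lemma N0_closed [simp]: "N0 .: BB" and E0_closed [simp]: "E0 .: BB"
 using N0_proj E0(1) by (simp_all add: H.B.proj_def)

lemma N0_apply: "x .: HH ==> N0 x = x .-@HH E0 x" by (simp add: N0_def)

lemma N0_kill: "x : H.orth S2 ==> N0 x = 0@HH"
proof -
 assume x: "x : H.orth S2"
 hence "x .: HH" by (simp add: H.orth_def)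
 thus ?thesis using E0(4)[OF x] by (simp add: N0_apply H.diff_eq_zero_iff)
qed

text \<open>The image of the range of \<open>N0\<close> under \<open>\<pi> y\<close> is tested
  against a word k starting in \<open>S False\<close>: the adjoint moves to k, and y* k is
  orthogonal to all such words, so \<open>N0\<close> annihilates it.\<close>

lemma N0_W11: assumes y: "y : W11" shows "N0 **@BB (\<pi> y **@BB N0) = 0@BB"
proof (rule H.B_eqI)
 have yc [simp]: "y .: A" using y by simp
 fix x assume x: "x .: HH"
 have "\<pi> y (N0 x) : H.orth S2" proof (rule orthI)
  fix e L k assume k: "wd False e L k"
  hence kc: "k .: A" by simp
  have w: "hat (sA y ** k) : H.orth S2" by (rule hat_orth) (use W11D[OF W11_star[OF y] k] kc in simp_all)
  have "hinner HH (\<pi> y (N0 x)) (hat k) = hinner HH (N0 x) (hat (sA y ** k))"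
   using H.B_star[OF \<pi>_closed[OF yc], of "N0 x" "hat k"] x kc by (simp add: \<pi>_hat flip: GNS.hom_simps(5))
  also have "... = hinner HH x (N0 (hat (sA y ** k)))"
   using H.B_star[OF N0_closed, of x "hat (sA y ** k)"] x kc N0_proj by (simp add: H.B.proj_def)
  also have "... = 0" using N0_kill[OF w] x by simp
  finally show "hinner HH (\<pi> y (N0 x)) (hat k) = 0" .
 qed (use x in "simp add: \<pi>_closed H.B_closed")
 thus "(N0 **@BB (\<pi> y **@BB N0)) x = 0@BB x" using N0_kill x by simp
qed (use y in "simp_all add: \<pi>_closed H.B_ops")

text \<open>A vector in the range of \<open>E0\<close> that is orthogonal to the words starting in \<open>S True\<close> and to 1
  vanishes; this avoids describing the range of \<open>E0\<close> as a closed span.\<close>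

lemma E0_letter: assumes t: "t : S False" "\<rho> t = 0" shows "E0 **@BB (\<pi> t **@BB E0) = 0@BB"
proof (rule H.B_eqI)
 have tc [simp]: "t .: A" using t by simp
 fix x assume x: "x .: HH"
 have st: "sA t : S False" "\<rho> (sA t) = 0" using S_star_\<rho>[OF t] by auto
 let ?w = "E0 (\<pi> t (E0 x))"
 have c: "\<pi> t (E0 x) .: HH" using x by (simp add: \<pi>_closed H.B_closed)
 have key: "hinner HH ?w (hat k) = 0" if k: "k .: A" "hat k : H.orth S2" "wd False e L (sA t ** k)" for k e L proof -
  have "hinner HH ?w (hat k) = hinner HH (\<pi> t (E0 x)) (hat k)" using E0_sym[OF c, of "hat k"] E0(4)[OF k(2)] k(1) by simp
  also have "... = hinner HH (E0 x) (hat (sA t ** k))"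
   using H.B_star[OF \<pi>_closed[OF tc], of "E0 x" "hat k"] x k by (simp add: \<pi>_hat flip: GNS.hom_simps(5))
  also have "... = 0" using orthD[OF E0(3)[OF x] k(3)] .
  finally show ?thesis .
 qed
 have "?w = 0@HH" proof (rule words_total)
  show "?w .: HH" using c by simp
  show "hinner HH ?w (hat \<one>) = 0" proof (rule key)
   show "hat \<one> : H.orth S2" by (rule hat_orth) (auto simp: wd_\<rho> wd_star dest: wd_star)
   show "wd False False 1 (sA t ** \<one>)" using wd_letter[OF st] by simp
  qed simp
  fix k e L y assume y: "wd k e L y"
  show "hinner HH ?w (hat y) = 0" proof (cases k)
   case False
   thus ?thesis using orthD[OF E0(3)[OF c]] y by simp
  next
   case True
   show ?thesis proof (rule key)
    show "hat y : H.orth S2" proof (rule hat_orth)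
     fix e' L' k' assume k': "wd False e' L' k'"
     have "wd (\<not> False) e L y" using y True by simp
     from wd_append[OF wd_star[OF k'] this] show "\<rho> (sA k' ** y) = 0" by (rule wd_\<rho>)
    qed (use y in simp)
    show "wd False e (Suc L) (sA t ** y)" by (rule wd_Cons[OF st]) (use y True in simp)
   qed (use y in simp)
  qed
 qed
 thus "(E0 **@BB (\<pi> t **@BB E0)) x = 0@BB x" using x by simp
qed (use t in "simp_all add: \<pi>_closed H.B_ops")

end

context free_unitaries
begin

text \<open>For a word k starting in \<open>S False\<close> the product of the adjoint of
  \<open>G\<close> with k is y* z* a* z k, again a reduced word starting in \<open>S False\<close>.
  Hence \<open>\<pi> G\<close> preserves the orthogonal complement of these words.\<close>

lemma E0_invariant: assumes y: "y : S False" "\<rho> y = 0"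
 defines "G == sA z ** (a ** (z ** y))" shows "E0 **@BB (\<pi> G **@BB E0) = \<pi> G **@BB E0"
proof (rule H.B_eqI)
 have Gc [simp]: "G .: A" using y by (simp add: G_def)
 fix x assume x: "x .: HH"
 have "\<pi> G (E0 x) : H.orth S2" proof (rule orthI)
  fix e L k assume k: "wd False e L k"
  hence kc: "k .: A" by simp
  have zt: "sA z : S True" "\<rho> (sA z) = 0" using S_star_\<rho>[OF z_S \<rho>_letters(1)] by auto
  have sa: "sA a : S False" "\<rho> (sA a) = 0" using S_star_\<rho>[OF abc_S(1) \<rho>_letters(2)] by auto
  have sy: "sA y : S False" "\<rho> (sA y) = 0" using S_star_\<rho>[OF y] by auto
  have "wd True e (Suc L) (z ** k)" by (rule wd_Cons[OF z_S \<rho>_letters(1)]) (use k in simp)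
  hence "wd False e (Suc (Suc L)) (sA a ** (z ** k))" by (intro wd_Cons[OF sa]) simp
  hence "wd True e (Suc (Suc (Suc L))) (sA z ** (sA a ** (z ** k)))" by (intro wd_Cons[OF zt]) simp
  hence w: "wd False e (Suc (Suc (Suc (Suc L)))) (sA y ** (sA z ** (sA a ** (z ** k))))"
   by (intro wd_Cons[OF sy]) simp
  have eq: "sA G ** k = sA y ** (sA z ** (sA a ** (z ** k)))" using y kc by (simp add: G_def star_mult m_assoc)
  have "hinner HH (\<pi> G (E0 x)) (hat k) = hinner HH (E0 x) (hat (sA G ** k))"
   using H.B_star[OF \<pi>_closed[OF Gc], of "E0 x" "hat k"] x kc by (simp add: \<pi>_hat flip: GNS.hom_simps(5))
  also have "... = 0" unfolding eq using orthD[OF E0(3)[OF x] w] .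
  finally show "hinner HH (\<pi> G (E0 x)) (hat k) = 0" .
 qed (use x in "simp add: \<pi>_closed H.B_closed")
 thus "(E0 **@BB (\<pi> G **@BB E0)) x = (\<pi> G **@BB E0) x" using E0(4) x by simp
qed (use y in "simp_all add: \<pi>_closed H.B_ops G_def")

section \<open>The unitaries and projections of the cells\<close>

definition uu :: "nat => 'a" where "uu p = v p ** (c ** (sA z ** (a ** (z ** (b ** (sA c ** sA (v p)))))))"

definition Pp :: "nat => (nat => 'a) set => (nat => 'a) set"
 where "Pp p = \<pi> (v p) **@BB N0 **@BB star BB (\<pi> (v p))"

text \<open>The projection called P^+ in the PHP property. The letter \<open>c\<close> carries the
  range of \<open>E0\<close> into the range of \<open>N0\<close>, so conjugation by
  \<open>v p ** c\<close> lands below \<open>Pp p\<close>.\<close>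

definition Qp :: "nat => (nat => 'a) set => (nat => 'a) set"
 where "Qp p = \<pi> (v p ** c) **@BB E0 **@BB star BB (\<pi> (v p ** c))"

lemma \<pi>_unit: assumes "x .: A" "sA x ** x = \<one>" shows "star BB (\<pi> x) **@BB \<pi> x = 1@BB"
 using assms GNS.hom_simps(3)[of "sA x" x] by simp

lemma v_unit [simp]: "sA (v p) ** v p = \<one>" "v p ** sA (v p) = \<one>" using R_unitary by auto

lemma mult_unit: assumes xy: "x .: A" "y .: A" "sA x ** x = \<one>" "sA y ** y = \<one>"
 shows "sA (x ** y) ** (x ** y) = \<one>"
proof -
 have "sA (x ** y) ** (x ** y) = sA y ** ((sA x ** x) ** y)" using xy(1,2) by (simp add: star_mult m_assoc)
 thus ?thesis using xy by simp
qed

lemma unit_cancel [simp]: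
 "y .: A ==> sA (v p) ** (v p ** y) = y" "y .: A ==> v p ** (sA (v p) ** y) = y"
 "y .: A ==> sA z ** (z ** y) = y" "y .: A ==> z ** (sA z ** y) = y"
 "y .: A ==> sA a ** (a ** y) = y" "y .: A ==> a ** (sA a ** y) = y"
 "y .: A ==> sA b ** (b ** y) = y" "y .: A ==> b ** (sA b ** y) = y"
 "y .: A ==> sA c ** (c ** y) = y" "y .: A ==> c ** (sA c ** y) = y" by (simp_all flip: m_assoc)

lemma uu_unitary: "uu p : unitaries A" unfolding unitaries_def uu_def by (simp add: star_mult m_assoc)

lemma uu_closed [simp]: "uu p .: A" by (simp add: uu_def)

lemma Pp_proj: "H.B.proj (Pp p)"
 unfolding Pp_def by (rule H.B.proj_conj[OF N0_proj _ \<pi>_unit]) (simp_all add: \<pi>_closed)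

lemma Qp_proj: "H.B.proj (Qp p)"
 unfolding Qp_def by (rule H.B.proj_conj[OF E0(2) _ \<pi>_unit]) (simp_all add: \<pi>_closed mult_unit)

lemma PQ_closed [simp]: "Pp p .: BB" "Qp p .: BB" using H.B.projD(1)[OF Pp_proj] H.B.projD(1)[OF Qp_proj] by auto

lemma \<pi>_mult_assoc:
 "x .: A ==> y .: A ==> U .: BB ==>
  \<pi> x **@BB (\<pi> y **@BB U) = \<pi> (x ** y) **@BB U" by (simp add: H.B.m_assoc)

lemma Pp_x_Pp: assumes x: "x .: A" shows "Pp p **@BB \<pi> x **@BB Pp q
  = \<pi> (v p) **@BB (N0 **@BB (\<pi> (sA (v p) ** (x ** v q)) **@BB N0)) **@BB star BB (\<pi> (v q))"
 using x by (simp add: Pp_def H.B.m_assoc)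

lemma Pp_orth: "p ~= q ==> Pp p **@BB Pp q = 0@BB" using Pp_x_Pp[of "\<one>" p q] N0_W11[OF v_v_W11[of p q]] by simp

lemma Pp_W11_zero: assumes x: "x .: A" "sA (v p) ** (x ** v q) : W11" shows "Pp p **@BB \<pi> x **@BB Pp q = 0@BB"
 using Pp_x_Pp[OF x(1), of p q] N0_W11[OF x(2)] by simp

text \<open>A centred letter of \<open>S False\<close> compresses to zero between two copies of
  \<open>E0\<close>; applied to \<open>c\<close> this says that \<open>N0\<close> fixes the range of
  \<open>\<pi> c **@BB E0\<close>.\<close>

lemma Qp_Pp: "Pp p **@BB Qp p = Qp p"
proof -
 have "N0 **@BB (\<pi> c **@BB E0) = \<pi> c **@BB E0 .-@BB E0 **@BB (\<pi> c **@BB E0)"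
  unfolding N0_def by (simp add: \<pi>_closed H.B.minus_eq H.B.l_distr H.B.l_minus)
 also have "... = \<pi> c **@BB E0"
  using E0_letter[OF abc_S(3) \<rho>_letters(4)] by (simp add: \<pi>_closed H.B.minus_eq)
 finally have N: "N0 **@BB (\<pi> c **@BB E0) = \<pi> c **@BB E0" .
 let ?W = "star BB (\<pi> (v p ** c))"
 have "Pp p **@BB Qp p = \<pi> (v p) **@BB ((N0 **@BB (\<pi> (sA (v p) ** (v p ** c)) **@BB E0)) **@BB ?W)"
  by (simp add: Pp_def Qp_def H.B.m_assoc del: unit_cancel)
 also have "... = \<pi> (v p) **@BB ((\<pi> c **@BB E0) **@BB ?W)" using N by simp
 also have "... = Qp p" by (simp add: Qp_def H.B.m_assoc)
 finally show ?thesis .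
qed

text \<open>Both invariance properties of \<open>uu p\<close> have this form: the unitary carries a
  translate of the range of \<open>E0\<close> to a translate by \<open>v p ** c\<close> of a vector
  in that range, since z* a z y preserves it. The letter \<open>y\<close> is b in one case and b c*
  in the other.\<close>

lemma Qp_conj_aux: assumes y: "y : S False" "\<rho> y = 0" and w: "w .: A"
  "uu p ** w = v p ** (c ** (sA z ** (a ** (z ** y))))"
 shows "Qp p **@BB (\<pi> (uu p) **@BB (\<pi> w **@BB E0)) = \<pi> (uu p) **@BB (\<pi> w **@BB E0)"
proof -
 let ?G = "sA z ** (a ** (z ** y))"
 have yc: "y .: A" using y by simp
 have G: "?G .: A" using yc by simp
 have 1: "\<pi> (uu p) **@BB (\<pi> w **@BB E0) = \<pi> ((v p ** c) ** ?G) **@BB E0"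
  using \<pi>_mult_assoc[OF uu_closed w(1) E0_closed] w(2) yc by (simp add: m_assoc)
 also have "... = \<pi> (v p ** c) **@BB (\<pi> ?G **@BB E0)" using \<pi>_mult_assoc[of "v p ** c" ?G E0] G by simp
 also have "... = \<pi> (v p ** c) **@BB (E0 **@BB (\<pi> ?G **@BB E0))" using E0_invariant[OF y] by simp
 finally have 2: "\<pi> (uu p) **@BB (\<pi> w **@BB E0) = \<pi> (v p ** c) **@BB (E0 **@BB (\<pi> ?G **@BB E0))" .
 have u: "star BB (\<pi> (v p ** c)) **@BB \<pi> (v p ** c) = 1@BB" by (rule \<pi>_unit) (simp_all add: mult_unit)
 have Vc: "\<pi> (v p ** c) .: BB" by (rule \<pi>_closed) simp
 have Gc: "\<pi> ?G **@BB E0 .: BB" using \<pi>_closed[OF G] by simp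
 have "Qp p **@BB (\<pi> (v p ** c) **@BB (E0 **@BB (\<pi> ?G **@BB E0)))
  = \<pi> (v p ** c) **@BB (E0 **@BB ((star BB (\<pi> (v p ** c)) **@BB \<pi> (v p ** c)) **@BB (E0 **@BB (\<pi> ?G **@BB E0))))"
  unfolding Qp_def using Vc Gc by (simp add: H.B.m_assoc del: GNS.hom_simps(3))
 also have "... = \<pi> (v p ** c) **@BB (E0 **@BB (\<pi> ?G **@BB E0))"
  unfolding u using Gc H.B.proj_absorb[OF E0(2) Gc] by simp
 finally show ?thesis unfolding 2 .
qed

lemma Qp_uu_Qp: "Qp p **@BB (\<pi> (uu p) **@BB Qp p) = \<pi> (uu p) **@BB Qp p"
proof -
 have eq: "uu p ** (v p ** c) = v p ** (c ** (sA z ** (a ** (z ** b))))" by (simp add: uu_def m_assoc)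
 let ?W = "star BB (\<pi> (v p ** c))"
 have c: "\<pi> (v p ** c) .: BB" "\<pi> (uu p) .: BB" by (rule \<pi>_closed, simp)+
 have "Qp p **@BB (\<pi> (uu p) **@BB Qp p)
  = (Qp p **@BB (\<pi> (uu p) **@BB (\<pi> (v p ** c) **@BB E0))) **@BB ?W"
  using c by (subst (2) Qp_def) (simp add: H.B.m_assoc del: GNS.hom_simps(3))
 also have "... = (\<pi> (uu p) **@BB (\<pi> (v p ** c) **@BB E0)) **@BB ?W"
  by (subst Qp_conj_aux[OF abc_S(2) \<rho>_letters(3) _ eq]) auto
 also have "... = \<pi> (uu p) **@BB Qp p" using c by (subst Qp_def) (simp add: H.B.m_assoc del: GNS.hom_simps(3))
 finally show ?thesis .
qed

lemma compl_Pp: "1@BB .-@BB Pp p = \<pi> (v p) **@BB E0 **@BB star BB (\<pi> (v p))"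
proof -
 have c: "\<pi> (v p) .: BB" by (rule \<pi>_closed) simp
 have u: "\<pi> (v p) **@BB star BB (\<pi> (v p)) = 1@BB" using GNS.hom_simps(3)[of "v p" "sA (v p)"] by simp
 have "Pp p = \<pi> (v p) **@BB star BB (\<pi> (v p)) .-@BB \<pi> (v p) **@BB E0 **@BB star BB (\<pi> (v p))"
  unfolding Pp_def N0_def using c by (simp add: H.B.minus_eq H.B.l_distr H.B.r_distr H.B.l_minus H.B.r_minus)
 thus ?thesis unfolding u using c by (simp add: H.B.minus_eq H.B.minus_add H.B.r_neg1 H.B.r_neg2)
qed

lemma Qp_uu_compl:
 "Qp p **@BB (\<pi> (uu p) **@BB (1@BB .-@BB Pp p)) = \<pi> (uu p) **@BB (1@BB .-@BB Pp p)"
proof -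
 have eq: "uu p ** v p = v p ** (c ** (sA z ** (a ** (z ** (b ** sA c)))))" by (simp add: uu_def m_assoc)
 \<comment> \<open>The merged letter b c* is centred because it is obtained from c* b by conjugation
   with \<open>c\<close>.\<close>
 have m: "b ** sA c : S False" using abc_S S_mult S_star by blast
 have "sA c ** b : S False" using abc_S S_mult S_star by blast
 from conj_c(2)[OF this] have m0: "\<rho> (b ** sA c) = 0" using \<rho>_letters(5) by (simp add: m_assoc)
 let ?W = "star BB (\<pi> (v p))"
 have c: "\<pi> (v p) .: BB" "\<pi> (uu p) .: BB" by (rule \<pi>_closed, simp)+
 have "Qp p **@BB (\<pi> (uu p) **@BB (1@BB .-@BB Pp p))
  = (Qp p **@BB (\<pi> (uu p) **@BB (\<pi> (v p) **@BB E0))) **@BB ?W"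
  unfolding compl_Pp using c by (simp add: H.B.m_assoc)
 also have "... = (\<pi> (uu p) **@BB (\<pi> (v p) **@BB E0)) **@BB ?W" by (subst Qp_conj_aux[OF m m0 _ eq]) auto
 also have "... = \<pi> (uu p) **@BB (1@BB .-@BB Pp p)" unfolding compl_Pp using c by (simp add: H.B.m_assoc)
 finally show ?thesis .
qed

text \<open>Multiplying \<open>v p\<close> by a word that starts in \<open>S False\<close> gives a
  reduced word longer than 4 p, hence orthogonal to a word of length at most 4 p. So the adjoint of
  \<open>v p\<close> sends that word into the range of \<open>E0\<close>.\<close>

lemma Pp_word_hat: assumes y: "wd k e L y" and L: "L <= 4 * p" shows "Pp p (hat y) = 0@HH"
proof -
 have yc [simp]: "y .: A" using y by simp
 have "hat (sA (v p) ** y) : H.orth S2" proof (rule hat_orth)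
  fix e' L' k' assume k': "wd False e' L' k'"
  have "wd False e' (4 * p + 4 + L') (v p ** k')" using wd_append[OF R_wd[of 0 p], of e' L' k'] k' by simp
  hence 0: "\<rho> (sA y ** (v p ** k')) = 0" using wd_orth[OF y] L by simp
  have k'c: "k' .: A" using k' by simp
  have "sA k' ** (sA (v p) ** y) = sA (sA y ** (v p ** k'))" using k'c by (simp add: star_mult m_assoc)
  thus "\<rho> (sA k' ** (sA (v p) ** y)) = 0" using 0 k'c by (simp add: \<rho>_star)
 qed simp
 from N0_kill[OF this] show ?thesis
  using \<pi>_closed[of "v p"] by (simp add: Pp_def \<pi>_hat flip: GNS.hom_simps(5))
qed

lemma Pp_one_hat: "Pp p (hat \<one>) = 0@HH"
proof -
 have "hat (sA (v p)) : H.orth S2" proof (rule hat_orth)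
  fix e' L' k' assume k': "wd False e' L' k'"
  have "wd False e' (4 * p + 4 + L') (v p ** k')" using wd_append[OF R_wd[of 0 p], of e' L' k'] k' by simp
  hence "\<rho> (sA (v p ** k')) = 0" by (intro wd_\<rho>[OF wd_star])
  thus "\<rho> (sA k' ** sA (v p)) = 0" using k' by (simp add: star_mult)
 qed simp
 from N0_kill[OF this] show ?thesis
  using \<pi>_closed[of "v p"] by (simp add: Pp_def \<pi>_hat flip: GNS.hom_simps(5))
qed

end

text \<open>The PHP property in the GNS representation, where in addition the projections almost annihilate
  finitely many given vectors; the extra conditions are what gives selflessness.\<close>

definition (in cstar_state) PHP_data where
 "PHP_data B F \<epsilon> n u P Q <->
  (\<forall>i\<in>{1..n::nat}. u i : unitaries A & u i : B & H.B.proj (P i) & H.B.proj (Q i) &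
   P i **@BB Q i = Q i &
   Q i **@BB (\<pi> (u i) **@BB Q i) = \<pi> (u i) **@BB Q i &
   Q i **@BB (\<pi> (u i) **@BB (1@BB .-@BB P i)) = \<pi> (u i) **@BB (1@BB .-@BB P i) &
   P i (hat \<one>) = 0@HH) &
  (\<forall>i\<in>{1..n}. \<forall>j\<in>{1..n}. i ~= j --> P i **@BB P j = 0@BB) &
  (\<forall>x\<in>F. \<forall>i\<in>{1..n}. \<forall>j\<in>{1..n}. nrm BB (P i **@BB \<pi> x **@BB P j) < \<epsilon>) &
  (\<forall>x\<in>F. \<forall>i\<in>{1..n}. H.hn (P i (hat x)) < \<epsilon>)"

definition (in cstar_state) vector_PHP :: "'a set => bool"
 where "vector_PHP B <-> (\<forall>F \<epsilon> n. finite F --> (\<forall>x\<in>F. x .: A & \<rho> x = 0) --> 0 < \<epsilon> -->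
  (\<exists>u P Q. PHP_data B F \<epsilon> n u P Q))"

lemma (in cstar_state) vector_PHPD:
 assumes "vector_PHP B" "finite F" "\<forall>x\<in>F. x .: A & \<rho> x = 0" "0 < \<epsilon>"
 obtains u P Q where "PHP_data B F \<epsilon> n u P Q"
 using assms(1)[unfolded vector_PHP_def, THEN spec, THEN spec, THEN spec, THEN mp, THEN mp, THEN mp, OF assms(2-4), of n]
 by (elim exE) (rule that)

context free_unitaries
begin

lemma Pp_wsum_hat: "wsum s ==> \<exists>K. \<forall>p\<ge>K. Pp p (hat s) = 0@HH"
proof (induction rule: wsum.induct)
 case wsum_zero
 show ?case by (simp flip: H_zero)
next
 case (wsum_add k e L y s)
 then obtain K where K: "!!p. p >= K ==> Pp p (hat s) = 0@HH" by blast
 have "Pp p (hat (y .+ s)) = 0@HH" if p: "p >= K + L" for p proof -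
  have "Pp p (hat (y .+ s)) = Pp p (hat y) .+@HH Pp p (hat s)" using wsum_add(1,2) by (simp add: hat_add H.B_add)
  thus ?thesis using K[of p] Pp_word_hat[OF wsum_add(1), of p] p by simp
 qed
 thus ?case by blast
qed

text \<open>At multiples of four the tail \<open>R\<close> consists of whole blocks c (z* a z)
  followed by b (z* a z), so it is built from the three generators; downward induction runs from the
  end of the periodic part.\<close>

lemma uu_mem: assumes B: "unital_cstar_subalgebra B A" and m: "sA z ** (a ** z) : B" "b : B" "c : B" shows "uu p : B"
proof -
 note D = unital_cstar_subalgebraD[OF B]
 let ?g = "sA z ** (a ** z)"
 have R: "R (4 * j) p : B" if "j <= p" for j using that proof (induction rule: inc_induct)
  case base
  have "blk : B" unfolding blk_def by (rule D(5)[OF m(2,1)])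
  thus ?case by (simp add: R_end)
 next
  case (step j)
  have l: "lt (4 * j) = c" "lt (4 * j + 1) = sA z" "lt (4 * j + 2) = a" "lt (4 * j + 3) = z" proof -
   have "(4 * j + 1) mod 4 = 1" "(4 * j + 2) mod 4 = 2" "(4 * j + 3) mod 4 = 3" unfolding mod_mult_self4 by simp_all
   thus "lt (4 * j) = c" "lt (4 * j + 1) = sA z" "lt (4 * j + 2) = a" "lt (4 * j + 3) = z"
    unfolding lt_def by simp_all
  qed
  have "R (4 * j) p = lt (4 * j) ** (lt (4 * j + 1) ** (lt (4 * j + 2) ** (lt (4 * j + 3) ** R (4 * Suc j) p)))"
  proof -
   have "Suc (4 * j) = 4 * j + 1" "Suc (4 * j + 1) = 4 * j + 2" "Suc (4 * j + 2) = 4 * j + 3" "Suc (4 * j + 3) = 4 * Suc j"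
    by simp_all
   thus ?thesis using step(2) R_step[of "4 * j" p] R_step[of "4 * j + 1" p] R_step[of "4 * j + 2" p]
     R_step[of "4 * j + 3" p] by (simp only:)
  qed
  also have "... = c ** (?g ** R (4 * Suc j) p)" unfolding l by (simp add: m_assoc)
  finally show ?case using D(5)[OF m(3) D(5)[OF m(1) step(3)]] by simp
 qed
 have v: "v p : B" using R[of 0] by simp
 have "uu p = v p ** (c ** (?g ** (b ** (sA c ** sA (v p)))))" by (simp add: uu_def m_assoc)
 thus ?thesis by (simp only:) (intro D(5) m v D(7))
qed

theorem vector_PHP: assumes B: "unital_cstar_subalgebra B A" and m: "sA z ** (a ** z) : B" "b : B" "c : B"
 shows "vector_PHP B" unfolding vector_PHP_def
proof (intro allI impI)
 fix F :: "'a set" and \<epsilon> :: real and n :: nat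
 assume F: "finite F" "\<forall>x\<in>F. x .: A & \<rho> x = 0" and e: "0 < \<epsilon>"
 have "\<exists>s. wsum s & nA (x .- s) < \<epsilon>" if x: "x : F" for x proof -
  obtain s where "wsum s" "nA (x .- s) < \<epsilon>" by (rule centred_approx[of x \<epsilon>]) (use F x e in auto)
  thus ?thesis by blast
 qed
 then obtain s where s: "!!x. x : F ==> wsum (s x)" "!!x. x : F ==> nA (x .- s x) < \<epsilon>" by metis
 have fin: "finite (s ` F)" using F by simp
 obtain K1 where K1: "!!t p q. t : s ` F ==> far K1 p q ==> sA (v p) ** (t ** v q) : W11"
  by (rule wsum_conj_W11[OF fin]) (use s in auto)
 have "\<exists>K. \<forall>p\<ge>K. Pp p (hat (s x)) = 0@HH" if "x : F" for x using Pp_wsum_hat[OF s(1)[OF that]] .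
 then obtain k where k: "!!x p. x : F ==> k x <= p ==> Pp p (hat (s x)) = 0@HH" by metis
 \<comment> \<open>\<open>K\<close> dominates the threshold for the pairs and all thresholds for
   single vectors. Multiples of it with index from 1 on are at least \<open>K\<close> and lie at
   mutual distance at least \<open>K\<close>.\<close>
 define K where "K = Suc (K1 + (\<Sum>x\<in>F. k x))"
 have kK: "k x <= K" if "x : F" for x using member_le_sum[of x F k] F that by (simp add: K_def)
 define p where "p i = K * i" for i
 have pi: "K <= p i" if "i : {1..n}" for i using that by (simp add: p_def)
 have K0: "K > 0" by (simp add: K_def)
 have inj: "p i ~= p j" if "i ~= j" for i j using that K0 by (simp add: p_def)
 have far: "far K1 (p i) (p j)" if "i : {1..n}" "j : {1..n}" for i j proof -
  have "K <= p i - p j" if "j < i" for i j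
   using mult_le_mono2[of 1 "i - j" K] that by (simp add: p_def right_diff_distrib')
  hence "i = j | K <= p i - p j | K <= p j - p i" by (meson linorder_neqE_nat)
  moreover have "K1 <= K" by (simp add: K_def)
  ultimately show ?thesis using pi[OF that(1)] pi[OF that(2)] unfolding far_def by auto
 qed
 have small: "nrm BB (Pp (p i) **@BB \<pi> x **@BB Pp (p j)) < \<epsilon>"
  if ij: "i : {1..n}" "j : {1..n}" and x: "x : F" for i j x proof -
  have xc: "x .: A" "s x .: A" using x F s(1)[OF x] by auto
  let ?P = "Pp (p i)" and ?P' = "Pp (p j)"
  have "sA (v (p i)) ** (s x ** v (p j)) : W11" by (rule K1[OF _ far[OF ij]]) (use x in blast)
  from Pp_W11_zero[OF xc(2) this] have 0: "?P **@BB \<pi> (s x) **@BB ?P' = 0@BB" .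
  have xs: "x = (x .- s x) .+ s x" using xc by algebra
  have d: "\<pi> (x .- s x) .: BB" "\<pi> (s x) .: BB" by (rule \<pi>_closed, use xc in simp)+
  have "\<pi> x = \<pi> (x .- s x) .+@BB \<pi> (s x)" using GNS.hom_simps(2)[of "x .- s x" "s x"] xs xc by simp
  hence "?P **@BB \<pi> x **@BB ?P' = ?P **@BB \<pi> (x .- s x) **@BB ?P' .+@BB ?P **@BB \<pi> (s x) **@BB ?P'"
   using d by (simp add: H.B.l_distr H.B.r_distr del: GNS.hom_diff)
  also have "... = ?P **@BB \<pi> (x .- s x) **@BB ?P'" unfolding 0 using d by (simp del: GNS.hom_diff)
  finally have eq: "?P **@BB \<pi> x **@BB ?P' = ?P **@BB \<pi> (x .- s x) **@BB ?P'" .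
  have "nrm BB (?P **@BB \<pi> (x .- s x) **@BB ?P') <= 1 * nA (x .- s x) * 1"
   by (intro H.B.nrm_mult_le H.B.proj_nrm Pp_proj GNS.hom_contractive H.B.m_closed d PQ_closed) (use xc in simp)
  thus ?thesis unfolding eq using s(2)[OF x] by simp
 qed
 have vec: "H.hn (Pp (p i) (hat x)) < \<epsilon>" if i: "i : {1..n}" and x: "x : F" for i x proof -
  have xc: "x .: A" "s x .: A" using x F s(1)[OF x] by auto
  have "Pp (p i) (hat (s x)) = 0@HH" by (rule k[OF x]) (use kK[OF x] pi[OF i] in simp)
  moreover have "hat x = hat (x .- s x) .+@HH hat (s x)" proof -
   have "x = (x .- s x) .+ s x" using xc by algebra
   thus ?thesis using hat_add[of "x .- s x" "s x"] xc by simp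
  qed
  ultimately have "Pp (p i) (hat x) = Pp (p i) (hat (x .- s x))" using xc by (simp add: H.B_add)
  hence "H.hn (Pp (p i) (hat x)) <= nrm BB (Pp (p i)) * sn (x .- s x)"
   using H.B_nrm_apply[of "Pp (p i)" "hat (x .- s x)"] xc H_norm_hat[of "x .- s x"] by simp
  also have "... <= 1 * nA (x .- s x)" by (intro mult_mono H.B.proj_nrm Pp_proj sn_le_nrm sn_nonneg) (use xc in auto)
  finally show ?thesis using s(2)[OF x] by simp
 qed
 show "\<exists>u P Q. PHP_data B F \<epsilon> n u P Q" unfolding PHP_data_def
  by (rule exI[of _ "%i. uu (p i)"], rule exI[of _ "%i. Pp (p i)"], rule exI[of _ "%i. Qp (p i)"],
   intro conjI ballI impI uu_unitary uu_mem[OF B m] Pp_proj Qp_proj Qp_Pp Qp_uu_Qp Qp_uu_compl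
    Pp_one_hat Pp_orth inj vec small)
qed

end

text \<open>The invariance identities say that Q fixes the range of u T, hence that the projection u
  T u* is dominated by Q; the two inequalities are the cases T = Q and T = 1 - P.\<close>

lemma (in cstar_state) vector_PHP_imp_PHP:
 assumes B: "unital_cstar_subalgebra B A" and inj: "inj_on \<pi> (carrier A)" and V: "vector_PHP B"
 shows "PHP B A \<rho> HH \<pi>"
proof -
 have alg: "cstar_algebra A" by (rule cstar_algebra_axioms)
 show ?thesis unfolding PHP_def proof (intro conjI allI impI, goal_cases)
  case 1
  show ?case using alg state inj B by (simp add: cstar_inclusion_def cstar_prob_space_def)
 next
  case 2
  show ?case using H.hilbert_space_axioms \<pi>_hom inj by (simp add: faithful_representation_def)
 next
  case (3 F \<epsilon> n)
  hence F: "finite F" "\<forall>x\<in>F. x .: A & \<rho> x = 0" "0 < \<epsilon>" by auto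
  obtain u P Q where "PHP_data B F \<epsilon> n u P Q" by (rule vector_PHPD[OF V F])
  note d = this[unfolded PHP_data_def]
  note main = d[THEN conjunct1, THEN bspec] and orth = d[THEN conjunct2, THEN conjunct1, THEN bspec, THEN bspec, THEN mp]
   and small = d[THEN conjunct2, THEN conjunct2, THEN conjunct1, THEN bspec, THEN bspec, THEN bspec]
  have le: "cstar_le BB (\<pi> (u i) **@BB T **@BB star BB (\<pi> (u i))) (Q i)"
   if i: "i : {1..n}" and T: "H.B.proj T" "Q i **@BB (\<pi> (u i) **@BB T) = \<pi> (u i) **@BB T" for i T
  proof (rule H.B.proj_le)
   have u: "u i .: A" "sA (u i) ** u i = \<one>" "H.B.proj (Q i)" using main[OF i] by (auto simp: unitaries_def)
   have U: "\<pi> (u i) .: BB" by (rule \<pi>_closed[OF u(1)])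
   have UU: "star BB (\<pi> (u i)) **@BB \<pi> (u i) = 1@BB" using GNS.hom_simps(3)[of "sA (u i)" "u i"] u by simp
   show "H.B.proj (\<pi> (u i) **@BB T **@BB star BB (\<pi> (u i)))" by (rule H.B.proj_conj[OF T(1) U UU])
   show "H.B.proj (Q i)" by (rule u(3))
   have c: "T .: BB" "Q i .: BB" using T(1) u(3) by (simp_all add: H.B.proj_def)
   have "Q i **@BB (\<pi> (u i) **@BB T **@BB star BB (\<pi> (u i)))
    = (Q i **@BB (\<pi> (u i) **@BB T)) **@BB star BB (\<pi> (u i))" using c U by (simp add: H.B.m_assoc)
   thus "Q i **@BB (\<pi> (u i) **@BB T **@BB star BB (\<pi> (u i)))
    = \<pi> (u i) **@BB T **@BB star BB (\<pi> (u i))" unfolding T(2) .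
  qed
  have pr: "x : projections BB" if "H.B.proj x" for x using that by (simp add: projections_def H.B.proj_def)
  show ?case by (rule exI[of _ u], rule exI[of _ P], rule exI[of _ Q], intro conjI ballI impI)
    (use main in "auto intro!: pr H.B.proj_le le orth small H.B.proj_compl")
 qed
qed

subsection \<open>Approximately semicircular elements\<close>

context cstar_algebra
begin

text \<open>The cell \<open>P ** t\<close> is chosen so that adding its adjoint gives U + U*, an
  element of the algebra although \<open>P\<close> is not. The product of the adjoint of
  \<open>t\<close> with \<open>P ** t\<close> differs from 2 only by terms with \<open>P\<close> on
  one side of a contraction. Summed over orthogonal \<open>P\<close> such terms grow like the square
  root of their number.\<close>

lemma PHP_cell: assumes P: "proj P" and Q: "proj Q" and PQ: "P ** Q = Q"
  and U: "U .: A" "sA U ** U = \<one>" "U ** sA U = \<one>"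
  and QU: "Q ** (U ** Q) = U ** Q" "Q ** (U ** (\<one> .- P)) = U ** (\<one> .- P)"
 defines "W == U ** (\<one> .- P)"
 defines "t == W .+ sA U" shows "P ** t .+ sA (P ** t) = U .+ sA U"
  and "sA t ** (P ** t) = 2 *. \<one> .+ ((-1) *. (P ** \<one>) .+ ((-1) *. (P ** (W ** sA U)) .+
   (P ** (U ** W) .+ sA (P ** (U ** W)))))" and "nA t <= 2" "nA (W ** sA U) <= 1" "nA (U ** W) <= 1"
proof -
 note Pd = projD[OF P] and Qd = projD[OF Q]
 have Wc: "W .: A" unfolding W_def using U(1) Pd(1) by simp
 have QW: "Q ** W = W" unfolding W_def by (rule QU(2))
 have PW: "P ** W = W" using Pd(1) Qd(1) Wc PQ QW by (metis m_assoc)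
 have QUW: "Q ** (U ** W) = U ** W" using Qd(1) Wc U(1) QU(1) QW by (metis m_assoc m_closed)
 have PX: "P ** (U ** W) = U ** W" using Pd(1) Qd(1) Wc U(1) PQ QUW by (metis m_assoc m_closed)
 have W_eq: "W = U .- U ** P" unfolding W_def using U(1) Pd(1) by (simp add: minus_eq r_distr r_minus)
 have sW: "sA W = sA U .- P ** sA U" unfolding W_eq using U(1) Pd by (simp add: star_diff star_mult)
 have sWP: "sA W ** P = sA W" using arg_cong[OF PW, of "star A"] Wc Pd by (simp add: star_mult)
 have tc: "t .: A" unfolding t_def using Wc U(1) by simp
 have Pt: "P ** t = W .+ P ** sA U" unfolding t_def using Pd(1) Wc U(1) PW by (simp add: r_distr)
 have st: "sA t = sA W .+ U" unfolding t_def using Wc U(1) by (simp add: star_add star_star)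
 have "sA (P ** t) = sA W .+ U ** P" unfolding Pt using Wc U(1) Pd by (simp add: star_add star_mult star_star)
 thus "P ** t .+ sA (P ** t) = U .+ sA U"
  unfolding Pt sW unfolding W_eq using U(1) Pd(1) m_closed[OF U(1) Pd(1)] m_closed[OF Pd(1) star_closed[OF U(1)]] star_closed[OF U(1)]
  by algebra
 have cl: "sA U .: A" "sA W .: A" using U(1) Wc by simp_all
 have e0: "sA t ** (P ** t) = sA W ** W .+ (sA W ** P) ** sA U .+ (U ** W .+ U ** (P ** sA U))"
  unfolding st Pt using Wc U(1) Pd(1) cl by (simp add: l_distr r_distr m_assoc a_ac)
 have e1: "sA W ** W = \<one> .- P" proof -
  have "sA W ** W = (\<one> .- P) ** ((sA U ** U) ** (\<one> .- P))"
   unfolding W_def using U(1) Pd by (simp add: star_mult star_diff m_assoc)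
  also have "... = \<one> .- P" unfolding U(2) using projD[OF proj_compl[OF P]] by simp
  finally show ?thesis .
 qed
 have e2: "(sA W ** P) ** sA U = sA (U ** W)" unfolding sWP using U(1) Wc by (simp add: star_mult)
 have e3: "U ** (P ** sA U) = \<one> .- W ** sA U" proof -
  have "W ** sA U = \<one> .- U ** (P ** sA U)"
   unfolding W_eq using U Pd(1) cl by (simp add: minus_eq l_distr l_minus m_assoc)
  thus ?thesis using U(1) Pd(1) cl m_closed[OF U(1) m_closed[OF Pd(1) cl(1)]] by algebra
 qed
 have e4: "\<one> .- P .+ sA (U ** W) .+ (U ** W .+ (\<one> .- W ** sA U))
  = 2 *. \<one> .+ ((-1) *. P .+ ((-1) *. (W ** sA U) .+ (U ** W .+ sA (U ** W))))" proof -
  have c: "U ** W .: A" "sA (U ** W) .: A" "W ** sA U .: A" using U(1) Wc by simp_all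
  show ?thesis
   using c Pd(1) one_closed unfolding sm_twice[OF one_closed, symmetric] minus_sm[OF Pd(1), symmetric] minus_sm[OF c(3), symmetric]
   by algebra
 qed
 have "P ** (W ** sA U) = W ** sA U" using PW Pd(1) Wc cl by (simp flip: m_assoc)
 thus "sA t ** (P ** t) = 2 *. \<one> .+ ((-1) *. (P ** \<one>) .+ ((-1) *. (P ** (W ** sA U)) .+
   (P ** (U ** W) .+ sA (P ** (U ** W)))))" unfolding e0 e1 e2 e3 e4 PX using Pd(1) by simp
 have nU: "nA U <= 1" using cstar_identity[OF U(1)] U(2) nrm_one_le square_le_1_imp[of "nA U"] by simp
 have nW: "nA W <= 1" using nrm_mult_le[OF U(1) _ nU proj_nrm[OF proj_compl[OF P]]] Pd(1) by (simp add: W_def)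
 show "nA t <= 2" using nrm_triangle[OF Wc cl(1)] nW nU U(1) by (simp add: t_def)
 show "nA (W ** sA U) <= 1" using nrm_mult_le[OF Wc cl(1) nW] nU U(1) by simp
 show "nA (U ** W) <= 1" using nrm_mult_le[OF U(1) Wc nU nW] by simp
qed

lemma lsum_const: "y .: A ==> lsum (%_. y) xs = complex_of_nat (length xs) *. y"
 by (induction xs) (simp_all add: sm_add_l)

text \<open>Each cell contributes about 2, which fixes the normalisation 1/sqrt(2 n). The four
  correction rows have norm at most sqrt n each, giving the error 4 sqrt n / (2 n). For the second
  bound there are n^2 cells of size 4 times the tolerance, divided by 2 n.\<close>

lemma PHP_row: assumes dist: "distinct xs" "xs ~= []" and P: "!!i. i : set xs ==> proj (P i)"
  and orth: "!!i j. i : set xs ==> j : set xs ==> i ~= j ==> P i ** P j = \<zero>"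
  and c: "!!i. i : set xs ==> t i .: A" "!!i. i : set xs ==> V i .: A"
   "!!i. i : set xs ==> Y i .: A"
  and eq: "!!i. i : set xs ==> sA (t i) ** (P i ** t i) = 2 *. \<one> .+ ((-1) *. (P i ** \<one>) .+
   ((-1) *. (P i ** Y i) .+ (P i ** V i .+ sA (P i ** V i))))"
  and le: "!!i. i : set xs ==> nA (t i) <= 2" "!!i. i : set xs ==> nA (V i) <= 1"
   "!!i. i : set xs ==> nA (Y i) <= 1"
 defines "r == complex_of_real (1 / sqrt (2 * real (length xs)))"
 defines "l == r *. lsum (%i. P i ** t i) xs" shows "nA (sA l ** l .- \<one>) <= 2 / sqrt (length xs)"
  and "!!x \<epsilon>. x .: A ==> (!!i j. i : set xs ==> j : set xs ==> nA (P i ** x ** P j) <= \<epsilon>) ==>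
   nA (sA l ** (x ** l)) <= 2 * real (length xs) * \<epsilon>"
proof -
 let ?n = "real (length xs)"
 have n: "?n > 0" using dist(2) by simp
 have Pc: "P i .: A" "sA (P i) = P i" if "i : set xs" for i using projD[OF P[OF that]] by auto
 have rr: "cnj r * r = complex_of_real (1 / (2 * ?n))" proof -
  have "1 / sqrt (2 * ?n) * (1 / sqrt (2 * ?n)) = 1 / (2 * ?n)" using n by simp
  thus ?thesis unfolding r_def by (simp only: complex_cnj_complex_of_real flip: of_real_mult)
 qed
 let ?T = "lsum (%i. P i ** t i) xs"
 have Tc: "?T .: A" by (rule lsum_closed) (use Pc c in simp)
 have lc: "l .: A" unfolding l_def using Tc by simp
 let ?V = "lsum (%i. P i ** V i) xs" and ?Y = "lsum (%i. P i ** Y i) xs" and ?P = "lsum (%i. P i ** \<one>) xs"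
 have XY: "?V .: A" "?Y .: A" "?P .: A" by (rule lsum_closed, use Pc c in simp)+
 let ?E = "(-1) *. ?P .+ ((-1) *. ?Y .+ (?V .+ star A ?V))"
 have Ec: "?E .: A" using XY by simp
 have "star A ?T ** ?T = lsum (%i. sA (t i) ** (P i ** t i)) xs" by (rule row_square[OF dist(1) P c(1) orth])
 also have "... = lsum (%i. 2 *. \<one> .+ ((-1) *. (P i ** \<one>) .+
   ((-1) *. (P i ** Y i) .+ (P i ** V i .+ sA (P i ** V i))))) xs" by (rule lsum_cong) (rule eq)
 also have "... = complex_of_real ?n *. (2 *. \<one>) .+ ?E"
  using Pc c by (simp add: lsum_add lsum_smult lsum_star lsum_const mult.commute)
 finally have TT: "star A ?T ** ?T = complex_of_real ?n *. (2 *. \<one>) .+ ?E" .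
 have "sA l ** l = (cnj r * r) *. (star A ?T ** ?T)"
  unfolding l_def using Tc by (simp add: star_smult smult_mult_left smult_mult_right mult.commute)
 also have "... = \<one> .+ complex_of_real (1 / (2 * ?n)) *. ?E" unfolding TT rr using Ec n by (simp add: sm_add_r)
 finally have ll: "sA l ** l = \<one> .+ complex_of_real (1 / (2 * ?n)) *. ?E" .
 have "nrm A ?P <= sqrt ?n" "nrm A ?Y <= sqrt ?n" "nrm A ?V <= sqrt ?n"
  by (rule row_nrm[OF dist(1) P _ orth], use c le nrm_one_le in auto)+
 hence nE: "nrm A ?E <= sqrt ?n + (sqrt ?n + (sqrt ?n + sqrt ?n))"
  using XY by (intro order.trans[OF nrm_triangle] add_mono) (auto simp: nrm_smult)
 have lE: "sA l ** l .- \<one> = complex_of_real (1 / (2 * ?n)) *. ?E" proof -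
  have "(\<one> .+ w) .- \<one> = w" if "w .: A" for w using that by algebra
  thus ?thesis unfolding ll using sm_closed[OF Ec] by blast
 qed
 have "nA (sA l ** l .- \<one>) = 1 / (2 * ?n) * nrm A ?E" unfolding lE nrm_smult[OF Ec] norm_of_real using n by simp
 also have "... <= 1 / (2 * ?n) * (4 * sqrt ?n)" by (rule mult_left_mono) (use nE n in auto)
 also have "... = 2 / sqrt ?n" using n by (simp add: field_simps)
 finally show "nA (sA l ** l .- \<one>) <= 2 / sqrt ?n" .
 fix x \<epsilon> assume x: "x .: A" and small: "!!i j. i : set xs ==> j : set xs ==> nA (P i ** x ** P j) <= \<epsilon>"
 have cell: "nA ((sA (t i) ** P i) ** (x ** (P j ** t j))) <= 2 * \<epsilon> * 2" if ij: "i : set xs" "j : set xs" for i j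
 proof -
  have "(sA (t i) ** P i) ** (x ** (P j ** t j)) = sA (t i) ** (P i ** x ** P j) ** t j"
   using x c Pc ij by (simp add: m_assoc)
  thus ?thesis using x c Pc ij le small by (simp only:) (intro nrm_mult_le; simp)
 qed
 have "star A ?T ** (x ** ?T) = lsum (%i. sA (t i) ** P i) xs ** lsum (%j. x ** (P j ** t j)) xs" proof -
  have "star A ?T = lsum (%i. sA (P i ** t i)) xs" by (rule lsum_star) (use c Pc in simp)
  also have "... = lsum (%i. sA (t i) ** P i) xs" by (rule lsum_cong) (use c Pc in "simp add: star_mult")
  finally show ?thesis using x c Pc by (simp add: lsum_mult_l)
 qed
 also have "... = lsum (%i. lsum (%j. (sA (t i) ** P i) ** (x ** (P j ** t j))) xs) xs" proof -
  have "lsum (%i. sA (t i) ** P i) xs ** lsum (%j. x ** (P j ** t j)) xs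
   = lsum (%i. (sA (t i) ** P i) ** lsum (%j. x ** (P j ** t j)) xs) xs"
   by (rule lsum_mult_r) (use x c Pc in "simp_all add: lsum_closed")
  also have "... = lsum (%i. lsum (%j. (sA (t i) ** P i) ** (x ** (P j ** t j))) xs) xs"
   by (intro lsum_cong lsum_mult_l) (use x c Pc in simp_all)
  finally show ?thesis .
 qed
 finally have nT: "nA (star A ?T ** (x ** ?T)) <= ?n * (?n * (2 * \<epsilon> * 2))"
  using x c Pc cell by (simp only:) (intro nrm_lsum_bound lsum_closed; simp)
 have eq: "sA l ** (x ** l) = (cnj r * r) *. (star A ?T ** (x ** ?T))"
  unfolding l_def using Tc x by (simp add: star_smult smult_mult_left smult_mult_right mult.commute)
 have "nA (sA l ** (x ** l)) = 1 / (2 * ?n) * nA (star A ?T ** (x ** ?T))"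
  unfolding eq rr using Tc x n by (simp only: nrm_smult m_closed star_closed norm_of_real) simp
 also have "... <= 1 / (2 * ?n) * (?n * (?n * (2 * \<epsilon> * 2)))" by (rule mult_left_mono) (use nT n in auto)
 also have "... = 2 * ?n * \<epsilon>" using n by (simp add: field_simps)
 finally show "nA (sA l ** (x ** l)) <= 2 * ?n * \<epsilon>" .
qed

end

lemma (in hilbert_space) hn_lsum_bound:
 assumes "v .: H" "!!x. x : set xs ==> f x .: BO" "!!x. x : set xs ==> hn (f x v) <= K"
 shows "hn (B.lsum f xs v) <= real (length xs) * K" using assms
proof (induction xs)
 case (Cons x xs)
 have "B.lsum f xs .: BO" by (rule B.lsum_closed) (use Cons(3) in simp)
 hence "hn (B.lsum f (x # xs) v) <= hn (f x v) + hn (B.lsum f xs v)" using Cons(2,3) by (simp add: hn_triangle)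
 also have "... <= K + real (length xs) * K" using Cons by (intro add_mono) auto
 finally show ?case by (simp add: algebra_simps)
qed simp

context cstar_state
begin

lemma \<pi>_isometric: "inj_on \<pi> (carrier A) ==> x .: A ==> nrm BB (\<pi> x) = nA x"
 by (erule GNS.inj_isometric[OF _ H.B_proper])

text \<open>The operator \<open>l\<close> plays the part of a creation operator for a semicircular element free from \<open>A\<close>:
  asymptotically \<open>l* x l = \<rho>(x)\<close>, and \<open>l*\<close> kills the vectors coming from \<open>A\<close>.\<close>

lemma ex_approx_creation:
 assumes B: "unital_cstar_subalgebra B A" and inj: "inj_on \<pi> (carrier A)" and V: "vector_PHP B"
  and F: "finite F" "F <= carrier A" and e: "e > 0"
 obtains h l where "h : B" "sA h = h" "nA h <= 4" "l .: BB" "nrm BB l <= 2"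
  "\<pi> h = l .+@BB star BB l"
  "!!x. x : F ==> nrm BB (star BB l **@BB (\<pi> x **@BB l) .-@BB \<rho> x *.@BB 1@BB) <= e"
  "!!x. x : F ==> hnorm HH (star BB l (hat x)) <= e"
proof -
 \<comment> \<open>\<open>M\<close> bounds the state on \<open>F\<close>. The choice of n makes M
   times the isometry defect 2/sqrt n at most d/2, and the tolerance d/(4 n) makes the off-diagonal
   contribution, 2 n times the tolerance, another d/2. The cap \<open>d \<le> 1\<close> keeps the
   norm of l bounded.\<close>
 define M where "M = 1 + (\<Sum>x\<in>F. cmod (\<rho> x))"
 have M: "M >= 1" by (simp add: M_def sum_nonneg)
 have MF: "cmod (\<rho> x) <= M" if "x : F" for x
  using member_le_sum[of x F "%x. cmod (\<rho> x)"] F that by (simp add: M_def)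
 define d where "d = min e 1"
 have d: "d > 0" "d <= e" "d <= 1" using e by (auto simp: d_def)
 obtain n :: nat where n: "n > (4 * M / d)\<^sup>2" using reals_Archimedean2 by blast
 have n0: "n > 0" using n by (metis of_nat_0_less_iff order_le_less_trans zero_le_power2)
 have "4 * M / d <= sqrt n" using n real_le_rsqrt by simp
 hence sn: "2 / sqrt n <= d / (2 * M)" using M d n0 by (simp add: field_simps)
 define c where "c x = x .- \<rho> x *. \<one>" for x
 have c: "c x .: A" "\<rho> (c x) = 0" "x = \<rho> x *. \<one> .+ c x" if "x .: A" for x proof -
  show "x = \<rho> x *. \<one> .+ c x" using that sm_closed[OF one_closed, of "\<rho> x"] unfolding c_def by algebra
 qed (use that in "simp_all add: c_def")
 have F': "x .: A & \<rho> x = 0" if "x : c ` F" for x using that F(2) c by auto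
 define \<epsilon> where "\<epsilon> = d / (4 * real n)"
 have \<epsilon>: "\<epsilon> > 0" using d n0 by (simp add: \<epsilon>_def)
 obtain u P Q where "PHP_data B (c ` F) \<epsilon> n u P Q"
  by (rule vector_PHPD[OF V finite_imageI[OF F(1)] _ \<epsilon>]) (use F' in blast)
 note d' = this[unfolded PHP_data_def]
 note main = d'[THEN conjunct1, THEN bspec] and orth = d'[THEN conjunct2, THEN conjunct1, THEN bspec, THEN bspec, THEN mp]
  and small = d'[THEN conjunct2, THEN conjunct2, THEN conjunct1, THEN bspec, THEN bspec, THEN bspec]
  and vec = d'[THEN conjunct2, THEN conjunct2, THEN conjunct2, THEN bspec, THEN bspec]
 define xs where "xs = [1..<Suc n]"
 have xs: "distinct xs" "xs ~= []" "length xs = n" and set_xs: "set xs = {1..n}" using n0 by (auto simp: xs_def)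
 define U where "U i = \<pi> (u i)" for i
 define W where "W i = U i **@BB (1@BB .-@BB P i)" for i
 define t where "t i = W i .+@BB star BB (U i)" for i
 have u: "u i .: A" "u i : B" "U i .: BB" "star BB (U i) **@BB U i = 1@BB"
  "U i **@BB star BB (U i) = 1@BB" if "i : set xs" for i proof -
  have m: "u i .: A" "u i : B" "sA (u i) ** u i = \<one>" "u i ** sA (u i) = \<one>"
   using main[of i] that set_xs by (auto simp: unitaries_def)
  thus "u i .: A" "u i : B" "U i .: BB" by (simp_all add: U_def \<pi>_closed)
  show "star BB (U i) **@BB U i = 1@BB" "U i **@BB star BB (U i) = 1@BB"
   using GNS.hom_simps(3)[of "sA (u i)" "u i"] GNS.hom_simps(3)[of "u i" "sA (u i)"] m by (simp_all add: U_def)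
 qed
 have P: "H.B.proj (P i)" if "i : set xs" for i using main[of i] that set_xs by blast
 have Pc: "P i .: BB" "star BB (P i) = P i" if "i : set xs" for i using H.B.projD[OF P[OF that]] by auto
 have tc: "t i .: BB" "W i .: BB" if "i : set xs" for i using u(3)[OF that] Pc[OF that] by (simp_all add: t_def W_def)
 { fix i assume i: "i : set xs"
  have m: "H.B.proj (Q i)" "P i **@BB Q i = Q i" "Q i **@BB (U i **@BB Q i) = U i **@BB Q i"
   "Q i **@BB (U i **@BB (1@BB .-@BB P i)) = U i **@BB (1@BB .-@BB P i)"
   using main[of i] i set_xs unfolding U_def by blast+
  note H.B.PHP_cell[OF P[OF i] m(1,2) u(3-5)[OF i] m(3,4), folded W_def t_def] }
 note cell = this
 have orth': "P i **@BB P j = 0@BB" if "i : set xs" "j : set xs" "i ~= j" for i j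
  using orth that unfolding set_xs by blast
 define r where "r = complex_of_real (1 / sqrt (2 * real n))"
 have r1: "cmod r <= 1" "cnj r = r" unfolding r_def norm_of_real using n0 by (simp_all add: divide_le_eq)
 let ?T = "H.B.lsum (%i. P i **@BB t i) xs"
 define l where "l = r *.@BB ?T"
 define h where "h = r *. lsum (%i. u i .+ sA (u i)) xs"
 have Tc: "?T .: BB" by (rule H.B.lsum_closed) (use Pc tc in simp)
 have lc: "l .: BB" using Tc by (simp add: l_def)
 have U': "U i **@BB W i .: BB" "W i **@BB star BB (U i) .: BB" if "i : set xs" for i
  using u(3)[OF that] tc[OF that] by simp_all
 note row = H.B.PHP_row[where P=P and t=t and V="%i. U i **@BB W i" and Y="%i. W i **@BB star BB (U i)",
   OF xs(1,2) P orth' tc(1) U' cell(2,3,5,4), unfolded xs(3) r_def[symmetric], folded l_def]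
 have ll: "nrm BB (star BB l **@BB l .-@BB 1@BB) <= d / (2 * M)" using row(1) sn by linarith
 note BD = unital_cstar_subalgebraD[OF B]
 have hB: "h : B" unfolding h_def by (intro BD(6) lsum_subalgebra[OF B] BD(4) BD(7) u(2))
 have uc: "u i .+ sA (u i) .: A" if "i : set xs" for i using u(1)[OF that] by simp
 have ucl: "lsum (%i. u i .+ sA (u i)) xs .: A" by (rule lsum_closed) (rule uc)
 have hh: "sA h = h" proof -
  have "sA (lsum (%i. u i .+ sA (u i)) xs) = lsum (%i. sA (u i .+ sA (u i))) xs" by (rule lsum_star) (rule uc)
  also have "... = lsum (%i. u i .+ sA (u i)) xs"
   by (rule lsum_cong) (use u(1) in "simp add: star_add star_star a_comm")
  finally show ?thesis unfolding h_def using ucl r1 by (simp add: star_smult)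
 qed
 have \<pi>_lsum: "\<pi> (lsum f ys) = H.B.lsum (%i. \<pi> (f i)) ys" if "!!i. i : set ys ==> f i .: A" for f and ys :: "nat list"
  using that by (induction ys) (simp_all add: lsum_closed)
 have \<pi>h: "\<pi> h = l .+@BB star BB l" proof -
  have "\<pi> h = r *.@BB H.B.lsum (%i. \<pi> (u i .+ sA (u i))) xs"
   unfolding h_def using \<pi>_lsum[of xs "%i. u i .+ sA (u i)"] uc ucl by simp
  also have "H.B.lsum (%i. \<pi> (u i .+ sA (u i))) xs
   = H.B.lsum (%i. P i **@BB t i .+@BB star BB (P i **@BB t i)) xs"
   by (rule H.B.lsum_cong) (use u(1) cell(1) in "simp add: U_def")
  also have "... = ?T .+@BB star BB ?T" using Pc tc by (simp add: H.B.lsum_add H.B.lsum_star)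
  finally show ?thesis unfolding l_def using Tc r1 by (simp add: H.B.star_smult H.B.sm_add_r)
 qed
 have "(nrm BB l)\<^sup>2 <= 2" proof -
  have "(nrm BB l)\<^sup>2 = nrm BB (star BB l **@BB l)" using H.B.cstar_identity[OF lc] by simp
  also have "... <= nrm BB 1@BB + nrm BB (star BB l **@BB l .-@BB 1@BB)"
   by (rule H.B.nrm_le_diff) (use lc in simp_all)
  also have "... <= 1 + 1" proof -
   have "d / (2 * M) <= 1" using d M by (simp add: field_simps)
   thus ?thesis using ll H.B.nrm_one_le by linarith
  qed
  finally show ?thesis by simp
 qed
 hence l2: "nrm BB l <= 2" by (rule power2_le_imp_le[OF order.trans]) auto
 have h4: "nA h <= 4" proof -
  have hc: "h .: A" using hB BD(1) by blast
  have "nA h = nrm BB (l .+@BB star BB l)" using \<pi>_isometric[OF inj hc] \<pi>h by simp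
  also have "... <= nrm BB l + nrm BB (star BB l)" by (rule H.B.nrm_triangle) (use lc in simp_all)
  finally show ?thesis using lc l2 by simp
 qed
 have X: "nrm BB (star BB l **@BB (\<pi> x **@BB l) .-@BB \<rho> x *.@BB 1@BB) <= e" if x: "x : F" for x proof -
  have xc: "x .: A" using x F by blast
  have cx: "c x .: A" "\<pi> (c x) .: BB" using c(1)[OF xc] by (simp_all add: \<pi>_closed)
  have "\<pi> x = \<rho> x *.@BB 1@BB .+@BB \<pi> (c x)" using arg_cong[OF c(3)[OF xc], of \<pi>] cx by simp
  hence "star BB l **@BB (\<pi> x **@BB l) = \<rho> x *.@BB (star BB l **@BB l) .+@BB star BB l **@BB (\<pi> (c x) **@BB l)"
   using lc cx by (simp add: H.B.l_distr H.B.r_distr H.B.smult_mult_left H.B.smult_mult_right)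
  hence eq: "star BB l **@BB (\<pi> x **@BB l) .-@BB \<rho> x *.@BB 1@BB
   = \<rho> x *.@BB (star BB l **@BB l .-@BB 1@BB) .+@BB star BB l **@BB (\<pi> (c x) **@BB l)"
   using lc cx by (simp add: H.B.diff_sm H.B.sm_add_r H.B.a_ac)
  have "nrm BB (star BB l **@BB (\<pi> (c x) **@BB l)) <= 2 * real n * \<epsilon>"
   by (rule row(2)) (use cx(2) small x in "auto simp: set_xs intro!: less_imp_le")
  moreover have "nrm BB (\<rho> x *.@BB (star BB l **@BB l .-@BB 1@BB)) <= M * (d / (2 * M))" proof -
   have E: "star BB l **@BB l .-@BB 1@BB .: BB" using lc by simp
   show ?thesis unfolding H.B.nrm_smult[OF E]
    by (rule mult_mono[OF MF[OF x] ll _ H.B.nrm_nonneg[OF E]]) (use M in simp)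
  qed
  moreover have "M * (d / (2 * M)) + 2 * real n * \<epsilon> = d" using M n0 by (simp add: \<epsilon>_def)
  ultimately have "nrm BB (star BB l **@BB (\<pi> x **@BB l) .-@BB \<rho> x *.@BB 1@BB) <= d"
   unfolding eq using lc cx by (intro order.trans[OF H.B.nrm_triangle]) (simp_all del: GNS.hom_simps)
  thus ?thesis using d by simp
 qed
 have Y: "hnorm HH (star BB l (hat x)) <= e" if x: "x : F" for x proof -
  have xc: "x .: A" using x F by blast
  have "star BB ?T = H.B.lsum (%i. star BB (P i **@BB t i)) xs" by (rule H.B.lsum_star) (use Pc tc in simp)
  also have "... = H.B.lsum (%i. star BB (t i) **@BB P i) xs"
   by (rule H.B.lsum_cong) (use Pc tc in "simp add: H.B.star_mult")
  finally have sT: "star BB ?T = H.B.lsum (%i. star BB (t i) **@BB P i) xs" .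
  have cellv: "hnorm HH ((star BB (t i) **@BB P i) (hat x)) <= 2 * \<epsilon>" if i: "i : set xs" for i proof -
   have P1: "P i (hat \<one>) = 0@HH" using main[of i] i set_xs by blast
   have "hat x = \<rho> x *.@HH hat \<one> .+@HH hat (c x)"
    using hat_add[of "\<rho> x *. \<one>" "c x"] hat_smult[of \<one> "\<rho> x"] c[OF xc] by simp
   hence "P i (hat x) = P i (hat (c x))" using P1 Pc(1)[OF i] c(1)[OF xc] by (simp add: H.B_add H.B_smult)
   hence v: "hnorm HH (P i (hat x)) <= \<epsilon>" using vec[of "c x" i] x i set_xs by simp
   have "hnorm HH ((star BB (t i) **@BB P i) (hat x)) <= nrm BB (star BB (t i)) * hnorm HH (P i (hat x))"
    using H.B_nrm_apply[of "star BB (t i)" "P i (hat x)"] tc[OF i] Pc(1)[OF i] xc by simp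
   also have "... <= 2 * \<epsilon>" using v cell(3)[OF i] tc[OF i] Pc(1)[OF i] xc by (intro mult_mono) simp_all
   finally show ?thesis .
  qed
  have "hnorm HH (star BB ?T (hat x)) <= real (length xs) * (2 * \<epsilon>)"
   unfolding sT by (rule H.hn_lsum_bound) (use xc tc Pc in "simp_all add: cellv del: H.B_apply")
  hence T: "hnorm HH (star BB ?T (hat x)) <= d" using n0 d by (simp add: xs(3) \<epsilon>_def)
  have "star BB l (hat x) = r *.@HH star BB ?T (hat x)" unfolding l_def using Tc r1 xc by (simp add: H.B.star_smult)
  hence "hnorm HH (star BB l (hat x)) = cmod r * hnorm HH (star BB ?T (hat x))" using Tc xc by (simp add: H.hn_smult)
  also have "... <= 1 * d" using r1(1) T Tc xc by (intro mult_mono) simp_all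
  finally show ?thesis using d by simp
 qed
 show ?thesis by (rule that[OF hB hh h4 lc l2 \<pi>h X Y])
qed

end

subsection \<open>Wick words\<close>

text \<open>An abstract Fock representation of the algebra \<open>K\<close> with creation operator \<open>l\<close>. The last
  assumption says that the norm of a matrix over \<open>K\<close>, spread out by a row contraction \<open>R\<close> and a column
  contraction \<open>S*\<close>, is bounded by the norm of the matrix in the GNS representation.\<close>

locale fock = cstar_state A \<rho> for A :: "'a cstar" (structure) and \<rho> +
 fixes K :: "'a set" and l :: 'a assumes K_sub: "K <= carrier A" and K_one [simp]: "\<one> : K"
  and K_add: "x : K ==> y : K ==> x .+ y : K" and K_mult [simp]: "x : K ==> y : K ==> x ** y : K"
  and K_smult [simp]: "x : K ==> c *. x : K" and K_star [simp]: "x : K ==> sA x : K" and l_closed [simp]: "l .: A"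
  and cov: "x : K ==> sA l ** (x ** l) = \<rho> x *. \<one>"
  and vac: "y .: A ==> x : K ==> \<rho> (y ** (sA l ** x)) = 0"
  and form_bound: "[|!!I J. I : set Is ==> J : set Js ==> b I J : K;
   !!I. I : set Is ==> R I .: A; !!J. J : set Js ==> S J .: A;
   nA (lsum (%I. R I ** sA (R I)) Is) <= 1; nA (lsum (%J. S J ** sA (S J)) Js) <= 1; 0 <= M;
   !!x y. (!!J. J : set Js ==> x J : K) ==> (!!I. I : set Is ==> y I : K) ==>
    cmod (\<Sum>I\<leftarrow>Is. \<Sum>J\<leftarrow>Js. \<rho> (sA (y I) ** (b I J ** x J)))
     <= M * sqrt (\<Sum>J\<leftarrow>Js. (sn (x J))\<^sup>2) * sqrt (\<Sum>I\<leftarrow>Is. (sn (y I))\<^sup>2)|]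
   ==> nA (lsum (%I. lsum (%J. R I ** (b I J ** sA (S (J :: 'a list)))) Js) (Is :: 'a list list)) <= M"
begin

lemma K_carrier [simp]: "x : K ==> x .: A" using K_sub by blast

lemma vac_star: "y .: A ==> x : K ==> \<rho> (x ** (l ** y)) = 0"
 using vac[of "sA y" "sA x"] \<rho>_star[of "x ** (l ** y)"] by (simp add: star_mult m_assoc)

fun L :: "'a list => 'a" where
 "L [] = \<one>"
| "L (x # xs) = x ** (l ** L xs)"

fun An :: "'a list => 'a" where
 "An [] = \<one>"
| "An (x # xs) = sA l ** (x ** An xs)"

text \<open>The normally ordered form of x1 h x2 h ... xn with h = l + l*, all creations to the left
  of all annihilations. A word with n letters has degree n - 1 in h. The value at the empty list is
  zero, so that a single letter stands for itself.\<close>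

fun W :: "'a list => 'a" where
 "W [] = \<zero>"
| "W (x # xs) = x ** An xs .+ x ** (l ** W xs)"

lemma LAW_closed [simp]:
 "set xs <= K ==> L xs .: A" "set xs <= K ==> An xs .: A" "set xs <= K ==> W xs .: A" by (induction xs) auto

lemma L_append: "set xs <= K ==> set ys <= K ==> L (xs @ ys) = L xs ** L ys"
 and An_append: "set xs <= K ==> set ys <= K ==> An (xs @ ys) = An xs ** An ys"
 by (induction xs) (simp_all add: m_assoc)

lemma star_An: "set xs <= K ==> sA (An xs) = L (map (star A) (rev xs))"
proof (induction xs)
 case (Cons x xs)
 have "set (map (star A) (rev xs)) <= K" using Cons(2) by auto
 thus ?case using Cons by (simp add: star_mult L_append m_assoc)
qed simp

lemma An_L: "set xs <= K ==> An xs = sA (L (map (star A) (rev xs)))"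
 by (subst star_An[symmetric]) (auto simp: star_star)

lemma W_snoc: "set xs <= K ==> y : K ==> W (xs @ [y]) = L xs ** y .+ W xs ** (sA l ** y)"
proof (induction xs)
 case (Cons x xs)
 thus ?case by (simp add: An_append l_distr r_distr m_assoc a_ac)
qed simp

lemma star_W: "set xs <= K ==> sA (W xs) = W (map (star A) (rev xs))"
proof (induction xs)
 case (Cons x xs)
 have "set (map (star A) (rev xs)) <= K" using Cons(2) by auto
 thus ?case using Cons by (simp add: star_add star_mult star_An W_snoc m_assoc)
qed simp

lemma cov_mult: "x : K ==> y .: A ==> sA l ** (x ** (l ** y)) = \<rho> x *. y"
 using arg_cong[OF cov[of x], of "%t. t ** y"] by (simp add: m_assoc smult_mult_left)

lemma l_W: "y : K ==> set ys <= K ==> sA l ** W (y # ys) = An (y # ys) .+ \<rho> y *. W ys"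
 by (simp add: r_distr cov_mult)

text \<open>Contraction of the two neighbouring letters is the only correction in the product of words.\<close>

lemma W_mult: assumes "set xs <= K" "x : K" "y : K" "set ys <= K"
 shows "W (xs @ [x]) ** W (y # ys) = W (xs @ (x ** y) # ys) .+ \<rho> (x ** y) *. (W xs ** W ys)" using assms(1)
proof (induction xs)
 case Nil
 thus ?case using assms by (simp add: r_distr m_assoc)
next
 case (Cons u us)
 note c = assms(2-4)
 have uc: "u : K" "set us <= K" "set (us @ [x]) <= K" "set (us @ (x ** y) # ys) <= K" using Cons c by auto
 have "x ** W (y # ys) = W ((x ** y) # ys)" using c by (simp add: r_distr m_assoc)
 hence "An (us @ [x]) ** W (y # ys) = An us ** (sA l ** W ((x ** y) # ys))"
  using c uc by (simp add: An_append m_assoc)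
 also have "... = An (us @ (x ** y) # ys) .+ \<rho> (x ** y) *. (An us ** W ys)"
  unfolding l_W[OF K_mult[OF c(1,2)] c(3)]
  using c uc by (simp add: r_distr smult_mult_right An_append[of us "(x ** y) # ys"])
 finally have 1: "An (us @ [x]) ** W (y # ys) = An (us @ (x ** y) # ys) .+ \<rho> (x ** y) *. (An us ** W ys)" .
 have "W ((u # us) @ [x]) ** W (y # ys) = u ** (An (us @ [x]) ** W (y # ys)) .+ u ** (l ** (W (us @ [x]) ** W (y # ys)))"
  using uc c LAW_closed(3)[of "y # ys"] by (simp only: W.simps append_Cons) (simp add: l_distr m_assoc)
 also have "... = W ((u # us) @ (x ** y) # ys) .+ \<rho> (x ** y) *. (W (u # us) ** W ys)"
  unfolding 1 Cons(1)[OF uc(2)] using uc c by (simp add: l_distr r_distr m_assoc smult_mult_right sm_add_r a_ac)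
 finally show ?case .
qed

text \<open>Multiplication by l + l* either prolongs the word or contracts its first letter;
  subtracting the contraction gives a three-term recurrence. For letters 1 it is the recurrence of
  the Chebyshev polynomials of the second kind.\<close>

lemma W_recurrence: assumes "x : K" "y : K" "set ys <= K"
 shows "W (x # y # ys) = x ** ((l .+ sA l) ** W (y # ys)) .- \<rho> y *. (x ** W ys)"
proof -
 have c: "W (y # ys) .: A" "An (y # ys) .: A" "W ys .: A" using assms LAW_closed by auto
 have "(l .+ sA l) ** W (y # ys) = l ** W (y # ys) .+ (An (y # ys) .+ \<rho> y *. W ys)"
  unfolding l_W[OF assms(2,3), symmetric] using c(1) by (simp add: l_distr del: W.simps)
 hence "x ** ((l .+ sA l) ** W (y # ys)) = W (x # y # ys) .+ \<rho> y *. (x ** W ys)"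
  using c assms(1) by (simp add: r_distr smult_mult_right a_ac del: W.simps(2) An.simps(2)) (simp add: W.simps(2)[of x] a_ac del: W.simps(2) An.simps(2))
 moreover have "W (x # y # ys) .: A" by (rule LAW_closed) (use assms in auto)
 ultimately show ?thesis using c assms(1) by (simp add: diff_sm a_assoc del: W.simps) (simp flip: sm_add_l del: W.simps)
qed

lemma \<rho>_W: "set xs <= K ==> length xs >= 2 ==> \<rho> (W xs) = 0"
proof (cases xs rule: rev_cases)
 case (snoc ys y)
 assume a: "set xs <= K" "length xs >= 2"
 then obtain u us where u: "ys = u # us" using snoc by (cases ys) auto
 have c: "set ys <= K" "y : K" using a(1) snoc by auto
 have "\<rho> (L ys ** y) = 0" using c u vac_star[of "L us ** y" u] by (simp add: m_assoc)
 thus ?thesis unfolding snoc W_snoc[OF c] using c vac[of "W ys" y] by simp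
qed simp

lemma \<rho>_W_vector:
 "set J <= K ==> x : K ==> y .: A ==> \<rho> (y ** W (J @ [x])) = \<rho> (y ** (L J ** x))"
 using vac[of "y ** W J" x] by (simp add: W_snoc r_distr m_assoc)

end

context cstar_algebra
begin

lemma lsum_append:
 "(!!x. x : set (xs @ ys) ==> f x .: A) ==> lsum f (xs @ ys) = lsum f xs .+ lsum f ys"
 by (induction xs) (simp_all add: lsum_closed a_assoc)

lemma lsum_map: "lsum f (map g xs) = lsum (%x. f (g x)) xs" by (induction xs) simp_all

lemma lsum_zero: "lsum (%_. \<zero>) xs = \<zero>" by (induction xs) simp_all

lemma lsum_concat_map:
 "(!!x y. x : set xs ==> y : set ys ==> f (g x y) .: A) ==>
  lsum f (concat (map (%x. map (g x) ys) xs)) = lsum (%x. lsum (%y. f (g x y)) ys) xs"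
proof (induction xs)
 case (Cons x xs)
 have "f t .: A" if "t : set (map (g x) ys @ concat (map (%x. map (g x) ys) xs))" for t using that Cons(2) by auto
 hence "lsum f (map (g x) ys @ concat (map (%x. map (g x) ys) xs))
  = lsum f (map (g x) ys) .+ lsum f (concat (map (%x. map (g x) ys) xs))" by (rule lsum_append)
 thus ?case using Cons by (simp add: lsum_map)
qed simp

lemma lsum_swap:
 "(!!x y. x : set xs ==> y : set ys ==> f x y .: A) ==>
  lsum (%x. lsum (f x) ys) xs = lsum (%y. lsum (%x. f x y) xs) ys"
proof (induction xs)
 case (Cons x xs)
 thus ?case by (simp add: lsum_add lsum_closed)
qed (simp add: lsum_zero)

lemma lsum_delta:
 "distinct xs ==> e : set xs ==> g e .: A ==> lsum (%f. if e = f then g f else \<zero>) xs = g e"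
proof (induction xs)
 case (Cons x xs)
 show ?case proof (cases "e = x")
  case True
  hence "lsum (%f. if e = f then g f else \<zero>) xs = lsum (%_. \<zero>) xs" using Cons(2) by (intro lsum_cong) auto
  thus ?thesis using True Cons(4) by (simp add: lsum_zero)
 next
  case False
  thus ?thesis using Cons by simp
 qed
qed simp

lemma lsum_partition:
 "distinct ks ==> (!!x. x : set xs ==> f x .: A & key x : set ks) ==>
  lsum f xs = lsum (%k. lsum f (filter (%x. key x = k) xs)) ks"
proof (induction xs)
 case (Cons x xs)
 have c: "lsum f (filter (%x. key x = k) xs) .: A" for k by (rule lsum_closed) (use Cons(3) in auto)
 have "lsum (%k. lsum f (filter (%x. key x = k) (x # xs))) ks
  = lsum (%k. (if key x = k then f x else \<zero>) .+ lsum f (filter (%x. key x = k) xs)) ks"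
  by (rule lsum_cong) (use c in auto)
 also have "... = f x .+ lsum (%k. lsum f (filter (%x. key x = k) xs)) ks"
  using c Cons(2,3) by (simp add: lsum_add lsum_delta[where g="%_. f x"])
 finally show ?case using Cons by simp
qed (simp add: lsum_zero)

end

lemma (in cstar_state) \<rho>_lsum:
 "(!!x. x : set xs ==> f x .: A) ==> \<rho> (lsum f xs) = (\<Sum>x\<leftarrow>xs. \<rho> (f x))"
 by (induction xs) (simp_all add: lsum_closed)

context fock
begin

section \<open>Orthonormal systems of letters and the projections they generate\<close>

definition onb :: "'a list => bool" where "onb es <-> set es <= K & distinct es &
  (\<forall>e\<in>set es. \<forall>f\<in>set es. \<rho> (sA e ** f) = (if e = f then 1 else 0))"

text \<open>The completely positive map that puts one creation by a letter of \<open>es\<close>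
  around \<open>G\<close>. Its k-th iterate at 1 is the sum of the range projections of the creation
  words with k letters from \<open>es\<close>.\<close>

definition \<Phi> :: "'a list => 'a => 'a" where "\<Phi> es G = lsum (%e. (e ** l) ** (G ** sA (e ** l))) es"

lemma onbD: "onb es ==> e : set es ==> e : K" by (auto simp: onb_def)

lemma ee: "e : K ==> f : K ==> y .: A ==>
  sA (e ** l) ** ((f ** l) ** y) = \<rho> (sA e ** f) *. y"
 using cov_mult[of "sA e ** f" y] by (simp add: star_mult m_assoc)

lemma \<Phi>_closed [simp]: "onb es ==> G .: A ==> \<Phi> es G .: A"
 unfolding \<Phi>_def by (rule lsum_closed) (simp add: onbD)

lemma ee_\<Phi>: assumes es: "onb es" "e : set es" and G: "G .: A"
 shows "sA (e ** l) ** \<Phi> es G = G ** sA (e ** l)"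
proof -
 have "sA (e ** l) ** \<Phi> es G = lsum (%f. sA (e ** l) ** ((f ** l) ** (G ** sA (f ** l)))) es"
  unfolding \<Phi>_def by (rule lsum_mult_l) (use es G in "simp_all add: onbD")
 also have "... = lsum (%f. if e = f then G ** sA (f ** l) else \<zero>) es" proof (rule lsum_cong)
  fix f assume f: "f : set es"
  hence "\<rho> (sA e ** f) = (if e = f then 1 else 0)" using es by (simp add: onb_def)
  thus "sA (e ** l) ** ((f ** l) ** (G ** sA (f ** l))) = (if e = f then G ** sA (f ** l) else \<zero>)"
   using ee[OF onbD[OF es] onbD[OF es(1) f], of "G ** sA (f ** l)"] G onbD[OF es(1) f] by simp
 qed
 also have "... = G ** sA (e ** l)" by (rule lsum_delta) (use es G in "auto simp: onb_def")
 finally show ?thesis .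
qed

lemma \<Phi>_proj: assumes es: "onb es" and G: "proj G" shows "proj (\<Phi> es G)"
proof -
 note Gc = projD[OF G]
 have "\<Phi> es G ** \<Phi> es G = lsum (%e. ((e ** l) ** (G ** sA (e ** l))) ** \<Phi> es G) es"
  by (subst (1) \<Phi>_def, rule lsum_mult_r) (use es Gc in "simp_all add: onbD")
 also have "... = lsum (%e. (e ** l) ** (G ** sA (e ** l))) es" proof (rule lsum_cong)
  fix e assume e: "e : set es"
  have c: "e ** l .: A" "sA (e ** l) .: A" using onbD[OF es e] by simp_all
  have "((e ** l) ** (G ** sA (e ** l))) ** \<Phi> es G = (e ** l) ** (G ** (sA (e ** l) ** \<Phi> es G))"
   using c(1) Gc(1) star_closed[OF c(1)] \<Phi>_closed[OF es Gc(1)] by (simp add: m_assoc)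
  thus "((e ** l) ** (G ** sA (e ** l))) ** \<Phi> es G = (e ** l) ** (G ** sA (e ** l))"
   unfolding ee_\<Phi>[OF es e Gc(1)] using proj_absorb[OF G c(2)] by simp
 qed
 also have "... = \<Phi> es G" by (simp add: \<Phi>_def)
 finally have 1: "\<Phi> es G ** \<Phi> es G = \<Phi> es G" .
 have "sA (\<Phi> es G) = lsum (%e. sA ((e ** l) ** (G ** sA (e ** l)))) es"
  unfolding \<Phi>_def by (rule lsum_star) (use es Gc in "simp add: onbD")
 also have "... = \<Phi> es G"
  unfolding \<Phi>_def by (rule lsum_cong) (use es Gc in "simp add: onbD star_mult star_star m_assoc")
 finally show ?thesis using 1 es Gc by (simp add: proj_def)
qed

definition E :: "'a list => nat => 'a" where "E es k = (\<Phi> es ^^ k) \<one>"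

lemma E_proj: "onb es ==> proj (E es k)"
proof (induction k)
 case 0
 thus ?case by (simp add: E_def proj_def)
next
 case (Suc k)
 thus ?case using \<Phi>_proj[OF Suc(2), of "E es k"] by (simp add: E_def)
qed

lemma E_closed [simp]: "onb es ==> E es k .: A" using projD(1)[OF E_proj] .

lemma n_lists_K:
 "onb es ==> I : set (List.n_lists k es) ==> set I <= K" "I : set (List.n_lists k es) ==> length I = k"
 by (auto simp: set_n_lists onb_def)

lemma lsum_words: assumes es: "onb es" and G: "G .: A"
 shows "lsum (%I. L I ** (G ** sA (L I))) (List.n_lists k es) = (\<Phi> es ^^ k) G"
proof (induction k)
 case 0
 thus ?case using G by simp
next
 case (Suc k)
 let ?f = "%I. L I ** (G ** sA (L I))"
 have c: "?f I .: A" "?f (e # I) .: A" if "I : set (List.n_lists k es)" "e : set es" for I e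
  using n_lists_K(1)[OF es that(1)] onbD[OF es that(2)] G by simp_all
 have "lsum ?f (List.n_lists (Suc k) es) = lsum (%I. lsum (%e. ?f (e # I)) es) (List.n_lists k es)"
  unfolding n_lists.simps by (rule lsum_concat_map) (use c in simp)
 also have "... = lsum (%e. lsum (%I. ?f (e # I)) (List.n_lists k es)) es" by (rule lsum_swap) (use c in blast)
 also have "... = lsum (%e. (e ** l) ** (lsum ?f (List.n_lists k es) ** sA (e ** l))) es" proof (rule lsum_cong)
  fix e assume e: "e : set es"
  note eK = onbD[OF es e]
  have "lsum (%I. ?f (e # I)) (List.n_lists k es) = lsum (%I. (e ** l) ** (?f I ** sA (e ** l))) (List.n_lists k es)"
   by (rule lsum_cong) (use n_lists_K(1)[OF es] eK G in "simp add: star_mult m_assoc")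
  also have "... = (e ** l) ** lsum (%I. ?f I ** sA (e ** l)) (List.n_lists k es)"
   by (rule lsum_mult_l[symmetric]) (use c[OF _ e] eK in simp_all)
  also have "lsum (%I. ?f I ** sA (e ** l)) (List.n_lists k es) = lsum ?f (List.n_lists k es) ** sA (e ** l)"
   by (rule lsum_mult_r[symmetric]) (use c[OF _ e] eK in simp_all)
  finally show "lsum (%I. ?f (e # I)) (List.n_lists k es) = (e ** l) ** (lsum ?f (List.n_lists k es) ** sA (e ** l))" .
 qed
 finally show ?case unfolding Suc funpow.simps o_apply by (subst \<Phi>_def)
qed

text \<open>Against \<open>(u ** l) ** L us\<close> the map \<open>\<Phi>\<close> sees its argument
  only through its action on \<open>L us\<close>. There the argument acts as 1 by induction, which
  leaves the hypothesis for the first letter.\<close>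

lemma L_absorb: assumes es: "onb es" and us: "set us <= K" "!!u. u : set us ==> E es 1 ** (u ** l) = u ** l"
 shows "E es (length us) ** L us = L us" using us
proof (induction us)
 case Nil
 thus ?case by (simp add: E_def)
next
 case (Cons u us)
 let ?y = "L us"
 have c: "u : K" "?y .: A" using Cons by auto
 have \<Phi>: "\<Phi> es G ** ((u ** l) ** ?y) = lsum (%e. (e ** l) ** (G ** (\<rho> (sA e ** u) *. ?y))) es"
  if G: "G .: A" for G proof -
  have "\<Phi> es G ** ((u ** l) ** ?y) = lsum (%e. ((e ** l) ** (G ** sA (e ** l))) ** ((u ** l) ** ?y)) es"
   unfolding \<Phi>_def by (rule lsum_mult_r) (use es c G in "simp_all add: onbD")
  also have "... = lsum (%e. (e ** l) ** (G ** (\<rho> (sA e ** u) *. ?y))) es" proof (rule lsum_cong)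
   fix e assume e: "e : set es"
   have "((e ** l) ** (G ** sA (e ** l))) ** ((u ** l) ** ?y) = (e ** l) ** (G ** (sA (e ** l) ** ((u ** l) ** ?y)))"
    using onbD[OF es e] c G by (simp add: m_assoc star_mult)
   thus "((e ** l) ** (G ** sA (e ** l))) ** ((u ** l) ** ?y) = (e ** l) ** (G ** (\<rho> (sA e ** u) *. ?y))"
    unfolding ee[OF onbD[OF es e] c] .
  qed
  finally show ?thesis .
 qed
 have "E es (length us) ** ?y = ?y" using Cons by simp
 hence "lsum (%e. (e ** l) ** (E es (length us) ** (\<rho> (sA e ** u) *. ?y))) es
  = lsum (%e. (e ** l) ** (\<one> ** (\<rho> (sA e ** u) *. ?y))) es"
  by (intro lsum_cong) (use c es in "simp add: smult_mult_right")
 hence "\<Phi> es (E es (length us)) ** ((u ** l) ** ?y) = \<Phi> es \<one> ** ((u ** l) ** ?y)"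
  using \<Phi>[of "E es (length us)"] \<Phi>[of \<one>] es by simp
 also have "... = (E es 1 ** (u ** l)) ** ?y" using c es by (simp add: E_def m_assoc)
 also have "... = (u ** l) ** ?y" using Cons by simp
 finally show ?case using c by (simp add: E_def m_assoc)
qed

text \<open>Gram-Schmidt for the inner product given by the state. The remainder \<open>w\<close> of
  a new letter may be a null vector; then w l = 0 by covariance and the C*-identity, so the old
  system already absorbs that letter. This is why the conclusion speaks of \<open>u ** l\<close> and
  not of \<open>u\<close>.\<close>

lemma ex_onb: assumes "set us <= K" shows "\<exists>es. onb es & (\<forall>u\<in>set us. E es 1 ** (u ** l) = u ** l)"
 using assms
proof (induction us)
 case Nil
 show ?case by (rule exI[of _ "[]"]) (simp add: onb_def)
next
 case (Cons u us)
 then obtain es where es: "onb es" and us: "!!u. u : set us ==> E es 1 ** (u ** l) = u ** l" by auto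
 have uK: "u : K" using Cons by simp
 let ?p = "lsum (%e. \<rho> (sA e ** u) *. e) es"
 have pK: "set fs <= K ==> lsum (%e. \<rho> (sA e ** u) *. e) fs : K" for fs
  by (induction fs) (use K_smult[OF K_one, of 0] in "simp_all add: K_add")
 define w where "w = u .+ (-1) *. ?p"
 have pc: "?p : K" using pK es by (simp add: onb_def)
 have wK: "w : K" unfolding w_def by (intro K_add uK K_smult pc)
 have u_eq: "u = w .+ ?p" unfolding w_def using uK pc sm_add_l[of ?p "-1" 1] by (simp add: a_assoc)
 have E1: "E es 1 = \<Phi> es \<one>" by (simp add: E_def)
 have Ep: "E es 1 ** (u ** l) = ?p ** l" proof -
  have "E es 1 ** (u ** l) = lsum (%e. ((e ** l) ** (\<one> ** sA (e ** l))) ** (u ** l)) es"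
   unfolding E1 \<Phi>_def by (rule lsum_mult_r) (use es uK in "simp_all add: onbD")
  also have "... = lsum (%e. (\<rho> (sA e ** u) *. e) ** l) es" proof (rule lsum_cong)
   fix e assume "e : set es"
   hence e: "e : K" by (rule onbD[OF es])
   thus "((e ** l) ** (\<one> ** sA (e ** l))) ** (u ** l) = (\<rho> (sA e ** u) *. e) ** l"
    using ee[OF e uK one_closed] uK by (simp add: m_assoc smult_mult_left smult_mult_right)
  qed
  also have "... = ?p ** l" by (rule lsum_mult_r[symmetric]) (use es in "simp_all add: onbD")
  finally show ?thesis .
 qed
 have ew: "\<rho> (sA e ** w) = 0" if e: "e : set es" for e proof -
  have eK: "e : K" by (rule onbD[OF es e])
  have "sA e ** ?p = lsum (%f. sA e ** (\<rho> (sA f ** u) *. f)) es"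
   by (rule lsum_mult_l) (use es eK in "simp_all add: onbD")
  hence "\<rho> (sA e ** ?p) = (\<Sum>f\<leftarrow>es. \<rho> (sA f ** u) * \<rho> (sA e ** f))"
   using es eK onbD[OF es] by (simp add: \<rho>_lsum smult_mult_right cong: map_cong)
  also have "... = (\<Sum>f\<leftarrow>es. if f = e then \<rho> (sA f ** u) else 0)"
   using es e by (intro arg_cong[of _ _ sum_list] map_cong) (auto simp: onb_def)
  also have "... = \<rho> (sA e ** u)" using es e by (simp add: onb_def sum_list_distinct_conv_sum_set)
  finally show ?thesis unfolding w_def using uK eK pc by (simp add: r_distr smult_mult_right)
 qed
 have ip_w: "\<rho> (sA w ** w) = complex_of_real ((sn w)\<^sup>2)" using ip_self[of w] wK by (simp add: ip_def)
 show ?case proof (cases "sn w = 0")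
  case True
  have "sA (w ** l) ** (w ** l) = \<zero>" using ee[OF wK wK one_closed] wK ip_w True by simp
  hence "nA (w ** l) = 0" using cstar_identity[of "w ** l"] wK by simp
  hence "w ** l = \<zero>" using wK nrm_eq_0_iff[of "w ** l"] by simp
  hence "u ** l = ?p ** l" by (subst u_eq) (use wK pc in "simp add: l_distr")
  thus ?thesis using es us Ep by (intro exI[of _ es]) auto
 next
  case False
  define r where "r = complex_of_real (1 / sn w)"
  define f where "f = r *. w"
  have fK: "f : K" unfolding f_def by (rule K_smult[OF wK])
  have ff: "\<rho> (sA f ** f) = 1" unfolding f_def r_def using wK False
   by (simp add: star_smult smult_mult_left smult_mult_right ip_w power2_eq_square)
  have ef: "\<rho> (sA e ** f) = 0" "\<rho> (sA f ** e) = 0" if e: "e : set es" for e proof -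
   have eK: "e : K" by (rule onbD[OF es e])
   show 0: "\<rho> (sA e ** f) = 0" unfolding f_def using ew[OF e] wK eK by (simp add: smult_mult_right)
   have "sA f ** e = sA (sA e ** f)" using eK fK by (simp add: star_mult star_star)
   thus "\<rho> (sA f ** e) = 0" using 0 eK fK \<rho>_star[of "sA e ** f"] by simp
  qed
  have "f \<notin> set es" using ef(1) ff by fastforce
  hence es': "onb (f # es)" using es fK ff ef by (auto simp: onb_def)
  have E': "E (f # es) 1 = (f ** l) ** sA (f ** l) .+ E es 1" using fK es by (simp add: E_def \<Phi>_def star_closed)
  have other: "E (f # es) 1 ** (x ** l) = (\<rho> (sA f ** x) *. f) ** l .+ E es 1 ** (x ** l)" if x: "x : K" for x
  proof -
   have "((f ** l) ** sA (f ** l)) ** (x ** l) = (f ** l) ** (sA (f ** l) ** ((x ** l) ** \<one>))"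
    using fK x by (simp add: m_assoc star_closed)
   also have "... = (\<rho> (sA f ** x) *. f) ** l" unfolding ee[OF fK x one_closed]
    using fK by (simp add: smult_mult_left smult_mult_right)
   finally show ?thesis unfolding E' using fK x es by (simp add: l_distr)
  qed
  have old: "E (f # es) 1 ** (x ** l) = x ** l" if x: "x : set us" for x proof -
   have xK: "x : K" using Cons(2) x by auto
   have "sA (f ** l) ** E es 1 = \<zero>" proof -
    have "sA (f ** l) ** E es 1 = lsum (%e. sA (f ** l) ** ((e ** l) ** (\<one> ** sA (e ** l)))) es"
     unfolding E1 \<Phi>_def by (rule lsum_mult_l) (use es fK in "simp_all add: onbD")
    also have "... = lsum (%_. \<zero>) es" by (rule lsum_cong) (subst ee; use onbD[OF es] fK ef in simp)
    finally show ?thesis by (simp add: lsum_zero)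
   qed
   hence "sA (f ** l) ** (E es 1 ** (x ** l)) = \<zero>" using fK xK es by (simp flip: m_assoc)
   hence "\<rho> (sA f ** x) *. \<one> = \<zero>" unfolding us[OF x] using ee[OF fK xK one_closed] xK by simp
   hence "\<rho> (\<rho> (sA f ** x) *. \<one>) = \<rho> \<zero>" by simp
   hence "\<rho> (sA f ** x) = 0" by simp
   thus ?thesis using other[OF xK] us[OF x] xK fK by simp
  qed
  have new: "E (f # es) 1 ** (u ** l) = u ** l" proof -
   have "sA f ** ?p = lsum (%e. sA f ** (\<rho> (sA e ** u) *. e)) es"
    by (rule lsum_mult_l) (use es fK in "simp_all add: onbD")
   hence "\<rho> (sA f ** ?p) = (\<Sum>e\<leftarrow>es. 0)"
    using fK onbD[OF es] ef by (simp add: \<rho>_lsum smult_mult_right cong: map_cong)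
   hence "\<rho> (sA f ** u) = \<rho> (sA f ** w)" by (subst u_eq) (use fK wK pc in "simp add: r_distr")
   also have "... = complex_of_real (sn w)" unfolding f_def r_def
    using wK False by (simp add: star_smult smult_mult_left ip_w power2_eq_square)
   finally have "\<rho> (sA f ** u) *. f = w" unfolding f_def r_def using wK False by simp
   thus ?thesis unfolding other[OF uK] Ep using u_eq wK pc by (simp flip: l_distr)
  qed
  show ?thesis using es' old new by (intro exI[of _ "f # es"]) auto
 qed
qed

end

section \<open>Matrix entries between creation words\<close>

lemma (in cstar_algebra) lsum_mult_lsum:
 assumes "!!x. x : set xs ==> f x .: A" "!!y. y : set ys ==> g y .: A" "t .: A"
 shows "lsum f xs ** (t ** lsum g ys) = lsum (%x. lsum (%y. f x ** (t ** g y)) ys) xs"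
proof -
 have "lsum f xs ** (t ** lsum g ys) = lsum (%x. f x ** lsum (%y. t ** g y) ys) xs"
  using assms by (subst lsum_mult_l) (auto simp: lsum_closed intro!: lsum_mult_r)
 also have "... = lsum (%x. lsum (%y. f x ** (t ** g y)) ys) xs" using assms by (intro lsum_cong lsum_mult_l) auto
 finally show ?thesis .
qed

context fock
begin

text \<open>Covariance contracts the two first letters to a scalar. This repeats until the shorter
  word is exhausted, so at least one of the two remainders is empty.\<close>

lemma L_L:
 "set I <= K ==> set us <= K ==> \<exists>s. sA (L I) ** L us
  = s *. (sA (L (drop (length us) I)) ** L (drop (length I) us))"
proof (induction I arbitrary: us)
 case Nil
 thus ?case by (intro exI[of _ 1]) simp
next
 case (Cons e I)
 show ?case proof (cases us)
  case Nil
  thus ?thesis using Cons(2) by (intro exI[of _ 1]) simp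
 next
  case (Cons u vs)
  have c: "e : K" "set I <= K" "u : K" "set vs <= K" using Cons.prems Cons by auto
  obtain s where s: "sA (L I) ** L vs = s *. (sA (L (drop (length vs) I)) ** L (drop (length I) vs))"
   using Cons.IH[OF c(2,4)] by blast
  have d: "set (drop (length vs) I) <= K" "set (drop (length I) vs) <= K"
   using c set_drop_subset by (meson order.trans)+
  have "sA (L (e # I)) ** L (u # vs) = sA (L I) ** (sA (e ** l) ** ((u ** l) ** L vs))"
   using c by (simp add: star_mult m_assoc)
  also have "... = (\<rho> (sA e ** u) * s) *. (sA (L (drop (length vs) I)) ** L (drop (length I) vs))"
   unfolding ee[OF c(1,3) LAW_closed(1)[OF c(4)]] using c s d by (simp add: smult_mult_right)
  finally show ?thesis unfolding Cons by auto
 qed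
qed

lemma LcL_step: assumes "e : K" "f : K" "c : K" "set I <= K" "y .: A"
 shows "sA (L (e # I)) ** (c ** (f ** (l ** y))) = \<rho> (sA e ** (c ** f)) *. (sA (L I) ** y)"
 using ee[of e "c ** f" y] assms by (simp add: star_mult m_assoc smult_mult_right)

lemma LcL_mem: "length I = length J ==> set I <= K ==> set J <= K ==> c : K ==> sA (L I) ** (c ** L J) : K"
proof (induction I J arbitrary: c rule: list_induct2)
 case (Cons e I f J)
 hence "sA (L I) ** (\<one> ** L J) : K" by (intro Cons(2)) auto
 thus ?case using Cons LcL_step[of e f c I "L J"] by (simp del: L.simps(2) add: L.simps(2)[of f])
qed simp

text \<open>After pairwise contraction a creation or an annihilation is left over. The creation
  meets the vacuum on the left through \<open>vac_star\<close>, the annihilation meets it on the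
  right through \<open>vac\<close>.\<close>

lemma LcL_zero:
 "length I ~= length J ==> set I <= K ==> set J <= K ==> c : K ==> x : K ==> y : K ==>
  \<rho> (y ** (sA (L I) ** (c ** (L J ** x)))) = 0"
proof (induction I arbitrary: J c)
 case Nil
 then obtain f J' where J: "J = f # J'" by (cases J) auto
 show ?case using Nil vac_star[of "L J' ** x" "y ** (c ** f)"] by (simp add: J m_assoc)
next
 case (Cons e I)
 show ?case proof (cases J)
  case Nil
  have "sA (L (e # I)) = sA (L I) ** (sA l ** sA e)" using Cons(3) by (simp add: star_mult m_assoc)
  thus ?thesis using Cons Nil vac[of "y ** sA (L I)" "sA e ** (c ** x)"] by (simp add: m_assoc)
 next
  case (Cons f J')
  have "sA (L (e # I)) ** (c ** (L J ** x)) = \<rho> (sA e ** (c ** f)) *. (sA (L I) ** (\<one> ** (L J' ** x)))"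
   using LcL_step[of e f c I "L J' ** x"] Cons.prems Cons by (simp add: m_assoc)
  moreover have "\<rho> (y ** (sA (L I) ** (\<one> ** (L J' ** x)))) = 0"
   using Cons.prems Cons by (intro Cons.IH) auto
  ultimately show ?thesis using Cons.prems Cons by (simp add: smult_mult_right del: L.simps)
 qed
qed

text \<open>\<open>trm (us, c, vs)\<close> creates \<open>us\<close> after annihilating \<open>vs\<close>; a Wick word is the sum of the terms
  obtained by cutting it at each letter.\<close>

fun trm :: "'a list \<times> 'a \<times> 'a list => 'a" where
 "trm (us, c, vs) = L us ** (c ** An vs)"

fun okt :: "'a list \<times> 'a \<times> 'a list => bool" where
 "okt (us, c, vs) <-> set us <= K & c : K & set vs <= K"

text \<open>The terms that contribute between creation words of k and of n letters: they create no
  more than k letters and change the number of letters by k - n. The number of annihilated letters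
  is then at most n.\<close>

fun adm :: "nat => nat => 'a list \<times> 'a \<times> 'a list => bool" where
 "adm k n (us, c, vs) <-> length us <= k & length us + n = length vs + k"

lemma trm_closed [simp]: "okt t ==> trm t .: A" by (cases t) simp

lemma block_eq: assumes t: "set us <= K" "c : K" "set vs <= K" and IJ: "set I <= K" "set J <= K"
 defines "vs' == map (star A) (rev vs)"
 shows "\<exists>s. sA (L I) ** (trm (us, c, vs) ** L J) = s *. (sA (L (drop (length us) I)) **
  (L (drop (length I) us) ** (c ** (sA (L (drop (length J) vs')) ** L (drop (length vs) J)))))"
proof -
 have vs': "set vs' <= K" using t by (auto simp: vs'_def)
 obtain s where s: "sA (L I) ** L us = s *. (sA (L (drop (length us) I)) ** L (drop (length I) us))"
  using L_L[OF IJ(1) t(1)] by blast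
 obtain r where r: "sA (L vs') ** L J = r *. (sA (L (drop (length J) vs')) ** L (drop (length vs) J))"
  using L_L[OF vs' IJ(2)] by (auto simp: vs'_def)
 have An: "An vs = sA (L vs')" unfolding vs'_def by (rule An_L[OF t(3)])
 have d: "set (drop (length us) I) <= K" "set (drop (length I) us) <= K" "set (drop (length J) vs') <= K"
   "set (drop (length vs) J) <= K" using t IJ vs' set_drop_subset by (meson order.trans)+
 have "sA (L I) ** (trm (us, c, vs) ** L J) = (sA (L I) ** L us) ** (c ** (sA (L vs') ** L J))"
  using t IJ vs' by (simp add: An m_assoc)
 also have "... = (s * r) *. (sA (L (drop (length us) I)) ** (L (drop (length I) us) **
   (c ** (sA (L (drop (length J) vs')) ** L (drop (length vs) J)))))"
  unfolding s r using d t by (simp add: smult_mult_left smult_mult_right m_assoc mult.commute)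
 finally show ?thesis by blast
qed

lemma block_mem: assumes t: "okt t" "adm (length I) (length J) t" and IJ: "set I <= K" "set J <= K"
 shows "sA (L I) ** (trm t ** L J) : K"
proof -
 obtain us c vs where [simp]: "t = (us, c, vs)" by (cases t)
 obtain s where "sA (L I) ** (trm t ** L J) = s *. (sA (L (drop (length us) I)) ** (c ** L (drop (length vs) J)))"
  using block_eq[of us c vs I J] t IJ set_drop_subset[of "length vs" J] by auto
 moreover have "sA (L (drop (length us) I)) ** (c ** L (drop (length vs) J)) : K"
  using t IJ by (intro LcL_mem) (auto dest: in_set_dropD)
 ultimately show ?thesis by simp
qed

text \<open>Three ways to fail: too many creations leave a creation next to the left vacuum, too
  many annihilations leave an annihilation next to the right vacuum, and in the remaining case the
  uncontracted parts of \<open>I\<close> and \<open>J\<close> have different lengths.\<close>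

lemma block_zero:
 assumes t: "okt t" "\<not> adm (length I) (length J) t" and IJ: "set I <= K" "set J <= K" and xy: "x : K" "y : K"
 shows "\<rho> (y ** (sA (L I) ** (trm t ** (L J ** x)))) = 0"
proof -
 obtain us c vs where t': "t = (us, c, vs)" by (cases t)
 have tK: "set us <= K" "c : K" "set vs <= K" using t t' by auto
 define vs' where "vs' = map (star A) (rev vs)"
 have vs': "set vs' <= K" "length vs' = length vs" using tK by (auto simp: vs'_def)
 let ?I = "drop (length us) I" and ?u = "drop (length I) us" and ?v = "drop (length J) vs'" and ?J = "drop (length vs) J"
 have d: "set ?I <= K" "set ?u <= K" "set ?v <= K" "set ?J <= K"
  using tK IJ vs' set_drop_subset by (meson order.trans)+
 obtain s where "sA (L I) ** (trm t ** L J) = s *. (sA (L ?I) ** (L ?u ** (c ** (sA (L ?v) ** L ?J))))"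
  using block_eq[OF tK IJ] unfolding t' vs'_def by blast
 hence "y ** ((sA (L I) ** (trm t ** L J)) ** x)
  = s *. (y ** (sA (L ?I) ** (L ?u ** (c ** (sA (L ?v) ** (L ?J ** x))))))"
  using d tK xy by (simp add: smult_mult_left smult_mult_right m_assoc)
 moreover have "\<rho> (y ** (sA (L ?I) ** (L ?u ** (c ** (sA (L ?v) ** (L ?J ** x)))))) = 0" proof -
  consider "length us > length I" | "length us <= length I" "length vs > length J"
   | "length us <= length I" "length vs <= length J" by linarith
  thus ?thesis proof cases
   case 1
   then obtain w ws where w: "?u = w # ws" by (cases ?u) auto
   thus ?thesis using 1 d tK xy vac_star[of "L ws ** (c ** (sA (L ?v) ** (L ?J ** x)))" "y ** w"]
    by (simp add: m_assoc)
  next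
   case 2
   then obtain w ws where w: "?v = w # ws" using vs'(2) by (cases ?v) auto
   have "sA (L ?v) = sA (L ws) ** (sA l ** sA w)" unfolding w using d(3) w by (simp add: star_mult m_assoc)
   thus ?thesis using 2 d tK xy w vac[of "y ** (sA (L ?I) ** (c ** sA (L ws)))" "sA w ** x"] by (simp add: m_assoc)
  next
   case 3
   hence "length ?I ~= length ?J" using t(2) t' by auto
   from LcL_zero[OF this d(1,4) tK(2) xy] show ?thesis using 3 d tK xy vs' by simp
  qed
 qed
 ultimately show ?thesis using t IJ xy d tK by (simp add: m_assoc)
qed

definition P :: "'a set" where "P = {lsum W ws |ws. \<forall>w\<in>set ws. set w <= K}"

lemma L_orthonormal: assumes es: "onb es" shows "I : set (List.n_lists k es) ==> J : set (List.n_lists k es) ==>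
  sA (L I) ** L J = (if I = J then \<one> else \<zero>)"
proof (induction k arbitrary: I J)
 case (Suc k)
 obtain e I' f J' where [simp]: "I = e # I'" "J = f # J'" and c: "e : set es" "f : set es"
   "I' : set (List.n_lists k es)" "J' : set (List.n_lists k es)" using Suc(2,3) by auto
 note cK = onbD[OF es c(1)] onbD[OF es c(2)] n_lists_K(1)[OF es c(3)] n_lists_K(1)[OF es c(4)]
 have "sA (L I) ** L J = \<rho> (sA e ** f) *. (sA (L I') ** L J')" using cK LcL_step[of e f \<one> I' "L J'"] by simp
 moreover have "\<rho> (sA e ** f) = (if e = f then 1 else 0)" using es c by (simp add: onb_def)
 ultimately show ?case using Suc(1)[OF c(3,4)] by (simp split: if_splits)
qed simp

text \<open>The Wick words ending in \<open>x J\<close> give the same vectors as \<open>L J \<otimes> x J\<close>, which for different \<open>J\<close> are orthogonal.\<close>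

lemma word_vectors: assumes es: "onb es" and x': "\<forall>J\<in>set (List.n_lists n es). x J : K"
 defines "v == lsum (%J. W (J @ [x J])) (List.n_lists n es)" and "v' == lsum (%J. L J ** x J) (List.n_lists n es)"
 shows "v : P" "v .: A" "v' .: A" "!!z. z .: A ==> \<rho> (z ** v) = \<rho> (z ** v')"
  "!!z. z .: A ==> \<rho> (sA v ** z) = \<rho> (sA v' ** z)"
  "sn v = sqrt (\<Sum>J\<leftarrow>List.n_lists n es. (sn (x J))\<^sup>2)"
proof -
 let ?Js = "List.n_lists n es"
 note JK = n_lists_K(1)[OF es]
 have x: "x J : K" if "J : set ?Js" for J using x' that by blast
 have wK: "set (J @ [x J]) <= K" if "J : set ?Js" for J using JK[OF that] x[OF that] by simp
 have "v = lsum W (map (%J. J @ [x J]) ?Js)" by (simp add: v_def lsum_map)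
 moreover have "\<forall>w\<in>set (map (%J. J @ [x J]) ?Js). set w <= K" using wK by auto
 ultimately show "v : P" unfolding P_def by blast
 show vc: "v .: A" "v' .: A" unfolding v_def v'_def
  by (intro lsum_closed LAW_closed(3) wK m_closed LAW_closed(1) JK K_carrier x; assumption)+
 show r: "\<rho> (z ** v) = \<rho> (z ** v')" if z: "z .: A" for z proof -
  have "z ** v = lsum (%J. z ** W (J @ [x J])) ?Js" unfolding v_def by (rule lsum_mult_l) (use LAW_closed(3)[OF wK] z in auto)
  moreover have "z ** v' = lsum (%J. z ** (L J ** x J)) ?Js"
   unfolding v'_def by (rule lsum_mult_l) (use JK x z in auto)
  ultimately show ?thesis using JK x z wK
   by (simp add: \<rho>_lsum \<rho>_W_vector LAW_closed(3)[OF wK] cong: map_cong)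
 qed
 show l: "\<rho> (sA v ** z) = \<rho> (sA v' ** z)" if z: "z .: A" for z
  using r[of "sA z"] \<rho>_star[of "sA z ** v"] \<rho>_star[of "sA z ** v'"] z vc by (simp add: star_mult star_star)
 have "\<rho> (sA v' ** v') = (\<Sum>I\<leftarrow>?Js. \<Sum>J\<leftarrow>?Js. \<rho> (sA (L I ** x I) ** (\<one> ** (L J ** x J))))"
 proof -
  have c: "L J ** x J .: A" if "J : set ?Js" for J using JK[OF that] x[OF that] by simp
  have "sA v' ** v' = lsum (%I. sA (L I ** x I)) ?Js ** (\<one> ** lsum (%J. L J ** x J) ?Js)"
   unfolding v'_def using c by (simp add: lsum_star lsum_closed)
  also have "... = lsum (%I. lsum (%J. sA (L I ** x I) ** (\<one> ** (L J ** x J))) ?Js) ?Js"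
   by (rule lsum_mult_lsum) (use c in simp_all)
  finally show ?thesis using c by (simp add: \<rho>_lsum lsum_closed cong: map_cong)
 qed
 also have "... = (\<Sum>I\<leftarrow>?Js. \<Sum>J\<leftarrow>?Js. if J = I then complex_of_real ((sn (x I))\<^sup>2) else 0)"
 proof (intro arg_cong[of _ _ sum_list] map_cong refl)
  fix I J assume IJ: "I : set ?Js" "J : set ?Js"
  have "sA (L I ** x I) ** (\<one> ** (L J ** x J)) = sA (x I) ** ((sA (L I) ** L J) ** x J)"
   using JK[OF IJ(1)] JK[OF IJ(2)] x[OF IJ(1)] x[OF IJ(2)] by (simp add: star_mult m_assoc)
  thus "\<rho> (sA (L I ** x I) ** (\<one> ** (L J ** x J))) = (if J = I then complex_of_real ((sn (x I))\<^sup>2) else 0)"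
   unfolding L_orthonormal[OF es IJ] using x[OF IJ(1)] x[OF IJ(2)] ip_self[of "x I"] by (auto simp: ip_def)
 qed
 also have "... = (\<Sum>I\<leftarrow>?Js. complex_of_real ((sn (x I))\<^sup>2))"
  using distinct_n_lists[of es n] es by (intro arg_cong[of _ _ sum_list] map_cong refl)
   (simp add: sum_list_distinct_conv_sum_set onb_def)
 also have "... = complex_of_real (\<Sum>I\<leftarrow>?Js. (sn (x I))\<^sup>2)" proof -
  have "(\<Sum>I\<leftarrow>Is. complex_of_real (g I)) = complex_of_real (\<Sum>I\<leftarrow>Is. g I)" for g and Is :: "'a list list"
   by (induction Is) simp_all
  thus ?thesis .
 qed
 finally have "complex_of_real ((sn v)\<^sup>2) = complex_of_real (\<Sum>I\<leftarrow>?Js. (sn (x I))\<^sup>2)"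
  using ip_self[OF vc(1)] l[OF vc(1)] r[of "sA v'"] vc by (simp add: ip_def)
 thus "sn v = sqrt (\<Sum>J\<leftarrow>?Js. (sn (x J))\<^sup>2)" using vc(1) of_real_eq_iff by (metis real_sqrt_unique sn_nonneg)
qed

end

subsection \<open>The norm of a Wick polynomial\<close>

context fock
begin

text \<open>The entries \<open>b I J\<close> of the admissible part lie in \<open>K\<close>. Tested
  on letters, their matrix equals the pairing of the whole polynomial with Wick vectors, because
  inadmissible terms drop out and Wick vectors have the norm of their top components. So
  \<open>form_bound\<close> turns the vacuum estimate into an operator norm. The projection
  \<open>G\<close> adjusts the rows \<open>R I\<close>, whose squares sum to an iterate of
  \<open>\<Phi>\<close> at \<open>G\<close>.\<close>

lemma block_bound: assumes es: "onb es" and ts: "!!t. t : set ts ==> okt t" and M: "M >= 0"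
  and bound: "!!u v. u : P ==> v : P ==> cmod (\<rho> (sA u ** (lsum trm ts ** v))) <= M * sn v * sn u"
  and G: "proj G" "!!k. nA ((\<Phi> es ^^ k) G) <= 1"
 defines "T == %k n. lsum trm (filter (adm k n) ts)"
 shows "nA ((\<Phi> es ^^ k) G ** (T k n ** (\<Phi> es ^^ n) G)) <= M"
proof -
 let ?Is = "List.n_lists k es" and ?Js = "List.n_lists n es" and ?q = "lsum trm ts"
 note Gc = projD[OF G(1)]
 have IK: "set I <= K" "length I = k" if "I : set ?Is" for I using n_lists_K(1)[OF es that] n_lists_K(2)[OF that] .
 have JK: "set J <= K" "length J = n" if "J : set ?Js" for J using n_lists_K(1)[OF es that] n_lists_K(2)[OF that] .
 define b where "b I J = sA (L I) ** (T k n ** L J)" for I J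
 define R where "R I = L I ** G" for I
 have Tc: "T k n .: A" unfolding T_def by (rule lsum_closed) (use ts in auto)
 have qc: "?q .: A" by (rule lsum_closed) (use ts in auto)
 have b_eq: "b I J = lsum (%t. sA (L I) ** (trm t ** L J)) (filter (adm k n) ts)"
  if "I : set ?Is" "J : set ?Js" for I J proof -
  have c: "trm t .: A" if "t : set (filter (adm k n) ts)" for t using that ts by auto
  have "T k n ** L J = lsum (%t. trm t ** L J) (filter (adm k n) ts)"
   unfolding T_def by (rule lsum_mult_r) (use c JK[OF that(2)] in auto)
  thus ?thesis unfolding b_def by (simp only:) (rule lsum_mult_l, use c IK[OF that(1)] JK[OF that(2)] in auto)
 qed
 have lsumK: "lsum f xs : K" if "!!x. x : set xs ==> f x : K" for f :: "'a list \<times> 'a \<times> 'a list => 'a" and xs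
  using that by (induction xs) (use K_smult[OF K_one, of 0] in "auto intro: K_add")
 have bK: "b I J : K" if "I : set ?Is" "J : set ?Js" for I J
  unfolding b_eq[OF that] by (rule lsumK, rule block_mem) (use ts IK[OF that(1)] JK[OF that(2)] in auto)
 have RR: "lsum (%I. R I ** sA (R I)) (List.n_lists m es) = (\<Phi> es ^^ m) G" for m proof -
  have "lsum (%I. R I ** sA (R I)) (List.n_lists m es) = lsum (%I. L I ** (G ** sA (L I))) (List.n_lists m es)"
  proof (rule lsum_cong)
   fix I assume "I : set (List.n_lists m es)"
   hence c: "L I .: A" using n_lists_K(1)[OF es] by simp
   have "R I ** sA (R I) = L I ** ((G ** (G ** sA (L I))))" unfolding R_def using c Gc by (simp add: star_mult m_assoc)
   thus "R I ** sA (R I) = L I ** (G ** sA (L I))" using proj_absorb[OF G(1), of "sA (L I)"] c by simp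
  qed
  thus ?thesis using lsum_words[OF es Gc(1)] by simp
 qed
 have Rc: "R I .: A" if "I : set (List.n_lists m es)" for I m
  unfolding R_def using n_lists_K(1)[OF es that] Gc by simp
 have "nA (lsum (%I. lsum (%J. R I ** (b I J ** sA (R J))) ?Js) ?Is) <= M" proof (rule form_bound[OF bK Rc Rc _ _ M])
  show "nA (lsum (%I. R I ** sA (R I)) ?Is) <= 1" "nA (lsum (%I. R I ** sA (R I)) ?Js) <= 1"
   unfolding RR by (rule G(2))+
  fix x y assume x: "!!J. J : set ?Js ==> x J : K" and y: "!!I. I : set ?Is ==> y I : K"
  have xy: "\<forall>J\<in>set ?Js. x J : K" "\<forall>I\<in>set ?Is. y I : K" using x y by blast+
  note X = word_vectors[OF es xy(1)] and Y = word_vectors[OF es xy(2)]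
  let ?v = "lsum (%J. W (J @ [x J])) ?Js" and ?v' = "lsum (%J. L J ** x J) ?Js"
  let ?u = "lsum (%I. W (I @ [y I])) ?Is" and ?u' = "lsum (%I. L I ** y I) ?Is"
  have Lx: "L J ** x J .: A" if "J : set ?Js" for J using JK[OF that] x[OF that] by simp
  have Ly: "L I ** y I .: A" if "I : set ?Is" for I using IK[OF that] y[OF that] by simp
  have "\<rho> (star A ?u ** (?q ** ?v)) = \<rho> (star A ?u' ** (?q ** ?v))" by (rule Y(5)) (use qc X(2) in simp)
  also have "... = \<rho> (star A ?u' ** (?q ** ?v'))"
   using X(4)[of "star A ?u' ** ?q"] qc X(2,3) Y(3) by (simp add: m_assoc)
  also have "star A ?u' ** (?q ** ?v') = lsum (%I. lsum (%J. sA (L I ** y I) ** (?q ** (L J ** x J))) ?Js) ?Is"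
  proof -
   have "star A ?u' = lsum (%I. sA (L I ** y I)) ?Is" by (rule lsum_star) (rule Ly)
   moreover have "lsum (%I. sA (L I ** y I)) ?Is ** (?q ** ?v')
    = lsum (%I. lsum (%J. sA (L I ** y I) ** (?q ** (L J ** x J))) ?Js) ?Is"
    by (rule lsum_mult_lsum) (use Lx Ly qc in auto)
   ultimately show ?thesis by simp
  qed
  also have "\<rho> ... = (\<Sum>I\<leftarrow>?Is. \<Sum>J\<leftarrow>?Js. \<rho> (sA (L I ** y I) ** (?q ** (L J ** x J))))"
   using Lx Ly qc by (simp add: \<rho>_lsum lsum_closed cong: map_cong)
  also have "... = (\<Sum>I\<leftarrow>?Is. \<Sum>J\<leftarrow>?Js. \<rho> (sA (y I) ** (b I J ** x J)))"
  proof (intro arg_cong[of _ _ sum_list] map_cong refl)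
   fix I J assume I: "I : set ?Is" and J: "J : set ?Js"
   let ?f = "%t. sA (y I) ** (sA (L I) ** (trm t ** (L J ** x J)))"
   have c: "sA (y I) .: A" "sA (L I) .: A" "L J .: A" "x J .: A" using IK[OF I] JK[OF J] x[OF J] y[OF I] by simp_all
   have eq: "sA (y I) ** (sA (L I) ** (lsum trm ss ** (L J ** x J))) = lsum ?f ss" if "set ss <= set ts" for ss
   proof -
    have s: "trm t .: A" if "t : set ss" for t using trm_closed[OF ts[OF subsetD[OF \<open>set ss <= set ts\<close> that]]] .
    have "lsum trm ss ** (L J ** x J) = lsum (%t. trm t ** (L J ** x J)) ss" by (rule lsum_mult_r) (use s c in auto)
    thus ?thesis using s c by (simp add: lsum_mult_l)
   qed
   have fc: "?f t .: A" if "t : set ts" for t using ts[OF that] c by simp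
   have "sA (L I ** y I) ** (?q ** (L J ** x J)) = lsum ?f ts"
    using eq[of ts] IK[OF I] JK[OF J] x[OF J] y[OF I] qc by (simp add: star_mult m_assoc)
   hence "\<rho> (sA (L I ** y I) ** (?q ** (L J ** x J))) = (\<Sum>t\<leftarrow>ts. \<rho> (?f t))"
    by (simp only:) (rule \<rho>_lsum[OF fc])
   also have "... = (\<Sum>t\<leftarrow>filter (adm k n) ts. \<rho> (?f t))"
    by (rule sum_list_map_filter[symmetric], rule block_zero)
     (use ts IK[OF I] JK[OF J] x[OF J] y[OF I] in auto)
   also have "... = \<rho> (lsum ?f (filter (adm k n) ts))" by (rule \<rho>_lsum[symmetric]) (use fc in auto)
   also have "lsum ?f (filter (adm k n) ts) = sA (y I) ** (b I J ** x J)"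
    using eq[of "filter (adm k n) ts"] c Tc by (simp add: b_def T_def m_assoc)
   finally show "\<rho> (sA (L I ** y I) ** (?q ** (L J ** x J))) = \<rho> (sA (y I) ** (b I J ** x J))" .
  qed
  finally have "(\<Sum>I\<leftarrow>?Is. \<Sum>J\<leftarrow>?Js. \<rho> (sA (y I) ** (b I J ** x J))) = \<rho> (star A ?u ** (?q ** ?v))" ..
  thus "cmod (\<Sum>I\<leftarrow>?Is. \<Sum>J\<leftarrow>?Js. \<rho> (sA (y I) ** (b I J ** x J)))
    <= M * sqrt (\<Sum>J\<leftarrow>?Js. (sn (x J))\<^sup>2) * sqrt (\<Sum>I\<leftarrow>?Is. (sn (y I))\<^sup>2)"
   using bound[OF Y(1) X(1)] X(6) Y(6) by simp
 qed auto
 moreover have "(\<Phi> es ^^ k) G ** (T k n ** (\<Phi> es ^^ n) G) = lsum (%I. lsum (%J. R I ** (b I J ** sA (R J))) ?Js) ?Is"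
 proof -
  have c: "L I .: A" if "I : set (List.n_lists m es)" for I m using n_lists_K(1)[OF es that] by simp
  have "(\<Phi> es ^^ k) G ** (T k n ** (\<Phi> es ^^ n) G) = lsum (%I. lsum (%J.
    (L I ** (G ** sA (L I))) ** (T k n ** (L J ** (G ** sA (L J))))) ?Js) ?Is"
   unfolding lsum_words[OF es Gc(1), symmetric] by (rule lsum_mult_lsum) (use c Gc Tc in auto)
  also have "... = lsum (%I. lsum (%J. R I ** (b I J ** sA (R J))) ?Js) ?Is"
   using c[of _ k] c[of _ n] Gc Tc by (intro lsum_cong) (simp add: R_def b_def star_mult m_assoc)
  finally show ?thesis .
 qed
 ultimately show ?thesis by simp
qed

text \<open>The terms creating \<open>k\<close> and annihilating \<open>n\<close> letters are the difference of two consecutive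
  sums \<open>T k n\<close> and \<open>T (k-1) (n-1)\<close>, each of which is a compression of the whole polynomial.\<close>

theorem Haagerup: assumes ts: "!!us c vs. (us, c, vs) : set ts ==> okt (us, c, vs) & length us <= d & length vs <= d"
  and M: "M >= 0"
  and bound: "!!u v. u : P ==> v : P ==> cmod (\<rho> (sA u ** (lsum trm ts ** v))) <= M * sn v * sn u"
 shows "nA (lsum trm ts) <= 2 * (real d + 1)\<^sup>2 * M"
proof -
 have ok: "okt t" if "t : set ts" for t using ts that by (cases t) auto
 let ?us = "concat (map (%(us, c, vs). us @ map (star A) vs) ts)"
 have K: "set ?us <= K" using ts by fastforce
 obtain es where es: "onb es" "!!u. u : set ?us ==> E es 1 ** (u ** l) = u ** l" using ex_onb[OF K] by blast
 define T where "T k n = lsum trm (filter (adm k n) ts)" for k n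
 define key where "key t = (length (fst t), length (snd (snd t)))" for t :: "'a list \<times> 'a \<times> 'a list"
 define t where "t k n = lsum trm (filter (%t. key t = (k, n)) ts)" for k n
 have Tc: "T k n .: A" "t k n .: A" for k n unfolding T_def t_def by (rule lsum_closed, use ok in auto)+
 have nE: "nA (E es k) <= 1" for k by (rule proj_nrm[OF E_proj[OF es(1)]])
 have EE: "nA (E es k ** (T k n ** E es n)) <= M" for k n unfolding T_def E_def
  by (rule block_bound[OF es(1) ok M bound]) (use nE in "simp_all add: E_def proj_def")
 \<comment> \<open>Starting from \<open>E es 1\<close> in place of 1 compresses the same block
   \<open>T k n\<close> by projections one step longer. This is the form needed when the preceding
   block is cut down by \<open>E es k\<close> and \<open>E es n\<close>.\<close>
 have EE': "nA (E es (Suc k) ** (T k n ** E es (Suc n))) <= M" for k n proof -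
  have "(\<Phi> es ^^ m) (E es 1) = E es (Suc m)" for m by (simp add: E_def funpow_swap1)
  thus ?thesis using block_bound[OF es(1) ok M bound E_proj[OF es(1), of 1], of k n] nE by (simp add: T_def)
 qed
 have absorb: "E es k ** (t k n ** E es n) = t k n" for k n proof -
  have one: "E es k ** (trm s ** E es n) = trm s" if s: "s : set (filter (%t. key t = (k, n)) ts)" for s proof -
   obtain us c vs where s': "s = (us, c, vs)" by (cases s)
   have m: "(us, c, vs) : set ts" and len: "length us = k" "length vs = n" using s s' by (auto simp: key_def)
   have c: "set us <= K" "c : K" "set vs <= K" using ts[OF m] by auto
   let ?vs = "map (star A) (rev vs)"
   have vK: "set ?vs <= K" using c by auto
   have "E es (length us) ** L us = L us" by (rule L_absorb[OF es(1) c(1)], rule es(2)) (use m in force)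
   hence 1: "E es k ** L us = L us" using len by simp
   have "E es (length ?vs) ** L ?vs = L ?vs" by (rule L_absorb[OF es(1) vK], rule es(2)) (use m in force)
   hence "sA (E es n ** L ?vs) = sA (L ?vs)" using len by simp
   hence 2: "An vs ** E es n = An vs"
    using An_L[OF c(3)] vK es(1) projD(3)[OF E_proj[OF es(1)]] by (simp add: star_mult)
   have "E es k ** (trm s ** E es n) = (E es k ** L us) ** (c ** (An vs ** E es n))"
    using c es(1) by (simp add: s' m_assoc)
   thus ?thesis unfolding 1 2 s' by simp
  qed
  have c: "trm s .: A" if "s : set (filter (%t. key t = (k, n)) ts)" for s using that ok by auto
  have "t k n ** E es n = lsum (%s. trm s ** E es n) (filter (%t. key t = (k, n)) ts)"
   unfolding t_def by (rule lsum_mult_r) (use c es(1) in auto)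
  also have "E es k ** ... = lsum (%s. E es k ** (trm s ** E es n)) (filter (%t. key t = (k, n)) ts)"
   by (rule lsum_mult_l) (use c es(1) in auto)
  also have "... = t k n" unfolding t_def by (rule lsum_cong) (rule one)
  finally show ?thesis .
 qed
 have split: "T (Suc k) (Suc n) = t (Suc k) (Suc n) .+ T k n" for k n proof -
  have "lsum trm (filter (adm (Suc k) (Suc n)) ss)
   = lsum trm (filter (%t. key t = (Suc k, Suc n)) ss) .+ lsum trm (filter (adm k n) ss)" if "set ss <= set ts" for ss
   using that proof (induction ss)
   case (Cons s ss)
   obtain us c vs where s: "s = (us, c, vs)" by (cases s)
   have c: "trm s .: A" "lsum trm (filter f ss) .: A" for f using Cons(2) ok by (auto intro!: lsum_closed)
   show ?case using Cons c by (cases "length us = Suc k") (auto simp: s key_def a_ac)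
  qed simp
  thus ?thesis unfolding T_def t_def by simp
 qed
 have edge: "t k n = T k n" if "k = 0 | n = 0" for k n
  unfolding T_def t_def using that by (intro arg_cong[of _ _ "lsum trm"] filter_cong) (auto simp: key_def)
 have tM: "nA (t k n) <= 2 * M" for k n proof (cases "k = 0 | n = 0")
  case True
  thus ?thesis using EE[of k n] absorb[of k n] edge[OF True] M by simp
 next
  case False
  then obtain k' n' where [simp]: "k = Suc k'" "n = Suc n'" by (metis not0_implies_Suc)
  have "t k n = T k n .- T k' n'" using split[of k' n'] Tc[of k n] Tc[of k' n'] by (simp, algebra)
  hence "t k n = E es k ** (T k n ** E es n) .- E es k ** (T k' n' ** E es n)"
   using absorb[of k n] Tc es(1) by (simp add: minus_eq l_distr r_distr l_minus r_minus)
  hence "nA (t k n) <= nA (E es k ** (T k n ** E es n)) + nA (E es k ** (T k' n' ** E es n))"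
   using nrm_triangle_diff Tc es(1) by simp
  thus ?thesis using EE[of k n] EE'[of k' n'] by simp
 qed
 \<comment> \<open>Both degrees range over 0..d, which gives (d + 1)^2 homogeneous parts, each of
   norm at most 2 M.\<close>
 define ks where "ks = List.product [0..<Suc d] [0..<Suc d]"
 have "key t : set ks" if "t : set ts" for t
  using ts[of "fst t" "fst (snd t)" "snd (snd t)"] that by (auto simp: ks_def key_def)
 hence "lsum trm ts = lsum (%kn. lsum trm (filter (%t. key t = kn) ts)) ks"
  by (intro lsum_partition) (use ok in "auto simp: ks_def distinct_product")
 also have "nrm A ... <= real (length ks) * (2 * M)" proof (rule nrm_lsum_bound)
  fix kn
  have "lsum trm (filter (%t. key t = kn) ts) = t (fst kn) (snd kn)" by (simp add: t_def)
  thus "lsum trm (filter (%t. key t = kn) ts) .: A" "nA (lsum trm (filter (%t. key t = kn) ts)) <= 2 * M"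
   using Tc tM by simp_all
 qed
 finally show ?thesis by (simp add: ks_def power2_eq_square algebra_simps)
qed

end

subsection \<open>Faithfulness and freeness\<close>

lemma poly_growth_contradiction:
 fixes r :: real assumes r: "r > 1" and le: "!!j::nat. r ^ (2 * 2 ^ j) <= C * (real n * real (2 * 2 ^ j) + 1)\<^sup>2"
 shows False
proof -
 have "(%N::nat. C * (real n * real N + 1)\<^sup>2 / r ^ N) ----> 0" proof -
  define y where "y = sqrt (1 / r)"
  have y: "norm y < 1" "y >= 0" "y ^ 2 = 1 / r" using r by (simp_all add: y_def)
  have "(%N. C * (real n * (real N * y ^ N) + y ^ N)\<^sup>2) ----> C * (real n * 0 + 0)\<^sup>2"
   by (intro tendsto_intros powser_times_n_limit_0 y(1) LIMSEQ_power_zero)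
  moreover have "C * (real n * (real N * y ^ N) + y ^ N)\<^sup>2 = C * (real n * real N + 1)\<^sup>2 / r ^ N" for N
  proof -
   have "real n * (real N * y ^ N) + y ^ N = (real n * real N + 1) * y ^ N" by (simp add: algebra_simps)
   moreover have "(y ^ N)\<^sup>2 = 1 / r ^ N"  using y(3) by (metis power_mult mult.commute power_one_over)
   ultimately show ?thesis by (simp add: power_mult_distrib)
  qed
  ultimately show ?thesis by simp
 qed
 moreover have "strict_mono (%j::nat. 2 * 2 ^ j :: nat)" by (simp add: strict_mono_def)
 ultimately have "(%j. C * (real n * real (2 * 2 ^ j) + 1)\<^sup>2 / r ^ (2 * 2 ^ j)) ----> 0"
  using LIMSEQ_subseq_LIMSEQ[of "%N. C * (real n * real N + 1)\<^sup>2 / r ^ N" 0 "%j. 2 * 2 ^ j"] by (simp add: o_def)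
 hence "\<forall>\<^sub>F j in sequentially. C * (real n * real (2 * 2 ^ j) + 1)\<^sup>2 / r ^ (2 * 2 ^ j) < 1"
  by (rule order_tendstoD) simp
 then obtain j where "C * (real n * real (2 * 2 ^ j) + 1)\<^sup>2 / r ^ (2 * 2 ^ j) < 1"
  by (auto dest: eventually_happens)
 thus False using le[of j] r by (simp add: divide_less_eq)
qed

lemma (in cstar_algebra) cs_closure_mult:
 assumes X: "V <= carrier A" "V' <= carrier A" "V'' <= carrier A" "!!x y. x : V ==> y : V' ==> x ** y : V''"
  and x: "x : cs_closure V" "y : cs_closure V'" shows "x ** y : cs_closure V''"
proof -
 obtain s t where s: "!!n. s n : V" "converges s x" and t: "!!n. t n : V'" "converges t y"
  using x cs_closure_converges[OF X(1)] cs_closure_converges[OF X(2)] by metis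
 show ?thesis by (rule cs_closure_limit[OF X(3) _ converges_mult[OF s(2) t(2)]]) (rule X(4)[OF s(1) t(1)])
qed

context cstar_state
begin

text \<open>A polynomial loss in the norm estimate is removed by applying it to the powers \<open>(p*p)^N\<close>.\<close>

lemma power_trick: assumes V: "!!n. V n <= carrier A" "!!m n x y. x : V m ==> y : V n ==> x ** y : V (m + n)"
   "!!n x. x : V n ==> sA x : V n"
  and growth: "!!n q M. q : V n ==> M >= 0 ==> (!!m v. v : V m ==> sn (q ** v) <= M * sn v) ==>
   nA q <= C * (real n + 1)\<^sup>2 * M"
  and p: "p : V n" and M: "M > 0" and le: "!!m v. v : V m ==> sn (p ** v) <= M * sn v" shows "nA p <= M"
proof -
 \<comment> \<open>\<open>q j\<close> is the 2^j-th power of p* p. Repeated squaring of a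
   self-adjoint element squares the norm exactly, so the norm of \<open>q j\<close> is that of
   \<open>p\<close> to the power 2 * 2^j, while the degree grows only by the same factor.\<close>
 define q where "q j = ((%x. x ** x) ^^ j) (sA p ** p)" for j
 have q: "q 0 = sA p ** p" "!!j. q (Suc j) = q j ** q j" by (simp_all add: q_def)
 have Vc: "x .: A" if "x : V n" for x n using V(1) that by blast
 have pc: "p .: A" by (rule Vc[OF p])
 \<comment> \<open>The bound passes to the adjoint: the square of the length of p* v is the pairing
   of p p* v with v, and p* v is again a vector from the filtered algebra, to which the bound for
   \<open>p\<close> applies.\<close>
 have star_le: "sn (sA p ** v) <= M * sn v" if v: "v : V m" for m v proof -
  have vc: "v .: A" "sA p ** v : V (n + m)" using Vc[OF v] V(2)[OF V(3)[OF p] v] by auto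
  have "complex_of_real ((sn (sA p ** v))\<^sup>2) = ip (p ** (sA p ** v)) v"
   using ip_self[of "sA p ** v"] pc vc(1) by (simp add: ip_def star_mult star_star m_assoc)
  hence "(sn (sA p ** v))\<^sup>2 = cmod (ip (p ** (sA p ** v)) v)"
   by (metis norm_of_real abs_of_nonneg zero_le_power2)
  also have "... <= sn (p ** (sA p ** v)) * sn v" by (rule Cauchy_Schwarz) (use pc vc in auto)
  also have "... <= (M * sn (sA p ** v)) * sn v" by (rule mult_right_mono[OF le[OF vc(2)]]) (use vc in simp)
  finally have "sn (sA p ** v) * sn (sA p ** v) <= (M * sn v) * sn (sA p ** v)"
   by (simp add: power2_eq_square mult_ac)
  thus ?thesis by (rule square_le_mult_cancel) (use pc vc M in auto)
 qed
 have main: "q j : V (n * (2 * 2 ^ j)) & sA (q j) = q j & nA (q j) = nA p ^ (2 * 2 ^ j) &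
  (\<forall>m. \<forall>v\<in>V m. sn (q j ** v) <= M ^ (2 * 2 ^ j) * sn v)" for j proof (induction j)
  case 0
  have "sn ((sA p ** p) ** v) <= M\<^sup>2 * sn v" if v: "v : V m" for m v proof -
   have "sn ((sA p ** p) ** v) <= M * sn (p ** v)" using star_le[OF V(2)[OF p v]] pc Vc[OF v] by (simp add: m_assoc)
   also have "... <= M * (M * sn v)" using le[OF v] M by simp
   finally show ?thesis by (simp add: power2_eq_square)
  qed
  thus ?case using V(2)[OF V(3)[OF p] p] pc cstar_identity[OF pc]
   by (simp add: q star_mult star_star mult_2_right power2_eq_square)
 next
  case (Suc j)
  let ?N = "2 * 2 ^ j :: nat"
  have qc: "q j .: A" using Suc Vc by blast
  have "sn ((q j ** q j) ** v) <= (M ^ ?N * M ^ ?N) * sn v" if v: "v : V m" for m v proof -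
   have "q j ** v : V (n * ?N + m)" using V(2) Suc v by blast
   hence "sn (q j ** (q j ** v)) <= M ^ ?N * sn (q j ** v)" using Suc by blast
   also have "... <= M ^ ?N * (M ^ ?N * sn v)" using Suc v M by (intro mult_left_mono) auto
   finally show ?thesis using qc Vc[OF v] by (simp add: m_assoc mult_ac)
  qed
  moreover have "q j ** q j : V (n * ?N + n * ?N)" using V(2) Suc by blast
  moreover have "nA (q j ** q j) = (nA (q j))\<^sup>2" using cstar_identity[OF qc] Suc by simp
  moreover have "2 * 2 ^ Suc j = ?N + ?N" by simp
  ultimately show ?case using Suc qc unfolding q(2) \<open>2 * 2 ^ Suc j = ?N + ?N\<close> power_add distrib_left
   by (simp add: star_mult power2_eq_square)
 qed
 show ?thesis proof (rule ccontr)
  assume "\<not> nA p <= M"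
  hence r: "nA p / M > 1" using M by simp
  have "(nA p / M) ^ (2 * 2 ^ j) <= C * (real n * real (2 * 2 ^ j) + 1)\<^sup>2" for j proof -
   have "nA (q j) <= C * (real (n * (2 * 2 ^ j)) + 1)\<^sup>2 * M ^ (2 * 2 ^ j)" by (rule growth) (use main M in auto)
   thus ?thesis using main[of j] M by (simp add: power_divide divide_le_eq)
  qed
  thus False by (rule poly_growth_contradiction[OF r])
 qed
qed

text \<open>An approximant of \<open>x\<close> within e/2 acts with bound e/2 on the vectors of the
  filtered algebra, since \<open>x\<close> acts as zero there. By \<open>power_trick\<close> its
  norm is then at most e/2 as well, so the norm of \<open>x\<close> is arbitrarily small.\<close>

lemma faithful_closure: assumes V: "!!n. V n <= carrier A" "!!m n x y. x : V m ==> y : V n ==> x ** y : V (m + n)"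
   "!!n x. x : V n ==> sA x : V n"
  and growth: "!!n q M. q : V n ==> M >= 0 ==> (!!m v. v : V m ==> sn (q ** v) <= M * sn v) ==>
   nA q <= C * (real n + 1)\<^sup>2 * M"
  and x: "x : cs_closure (\<Union>n. V n)" and null: "!!n v. v : V n ==> sn (x ** v) = 0" shows "x = \<zero>"
proof -
 have xc: "x .: A" using x by (simp add: cs_closure_def)
 have "nA x <= 0 + e" if e: "e > 0" for e proof -
  have "e / 2 > 0" using e by simp
  then obtain p where p: "p : (\<Union>n. V n)" "nA (x .- p) < e / 2" using x unfolding cs_closure_def by blast
  then obtain n where n: "p : V n" by blast
  have pc: "p .: A" using V(1) n by blast
  have "nA p <= e / 2" proof (rule power_trick[OF V growth n \<open>e / 2 > 0\<close>])
   fix m v assume v: "v : V m"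
   hence vc: "v .: A" using V(1) by blast
   have "p ** v = x ** v .- (x .- p) ** v" using xc pc vc by algebra
   hence "sn (p ** v) <= sn (x ** v) + sn ((x .- p) ** v)"
    using sn_triangle[of "x ** v" "\<ominus> ((x .- p) ** v)"] xc pc vc by (simp add: minus_eq)
   also have "... <= nA (x .- p) * sn v" using null[OF v] sn_mult_le[of "x .- p" v] xc pc vc by simp
   also have "... <= e / 2 * sn v" by (rule mult_right_mono) (use p(2) vc in auto)
   finally show "sn (p ** v) <= e / 2 * sn v" .
  qed
  thus ?thesis using nrm_le_diff[OF xc pc] p(2) by simp
 qed
 hence "nA x <= 0" by (rule field_le_epsilon)
 thus ?thesis using nrm_nonneg[OF xc] nrm_eq_0_iff[OF xc] by simp
qed

end

context fock
begin

section \<open>Filtered spaces of Wick polynomials\<close>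

definition SP :: "('a list => bool) => 'a set" where "SP S = {lsum W ws |ws. \<forall>w\<in>set ws. S w & set w <= K}"

lemma SP_carrier: "SP S <= carrier A" unfolding SP_def by (auto intro!: lsum_closed LAW_closed)

lemma SP_W: "S w ==> set w <= K ==> W w : SP S" unfolding SP_def by (intro CollectI exI[of _ "[w]"]) simp

lemma SP_add: "x : SP S ==> y : SP S ==> x .+ y : SP S"
proof -
 assume "x : SP S" "y : SP S"
 then obtain us vs where u: "x = lsum W us" "\<forall>w\<in>set us. S w & set w <= K" and v: "y = lsum W vs" "\<forall>w\<in>set vs. S w & set w <= K"
  unfolding SP_def by blast
 hence "lsum W (us @ vs) = x .+ y" by (auto intro!: lsum_append)
 thus ?thesis using u v unfolding SP_def by (intro CollectI exI[of _ "us @ vs"]) auto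
qed

lemma SP_zero: "\<zero> : SP S" unfolding SP_def by (intro CollectI exI[of _ "[]"]) simp

lemma SP_lsum: "(!!x. x : set xs ==> f x : SP S) ==> lsum f xs : SP S"
 by (induction xs) (simp_all add: SP_zero SP_add)

lemma SP_mono: "(!!w. S w ==> set w <= K ==> S' w) ==> SP S <= SP S'" unfolding SP_def by blast

lemma SP_map: assumes f: "!!w. S w ==> set w <= K ==> f (W w) : SP S'" and x: "x : SP S"
  and lin: "f \<zero> = \<zero>" "!!x y. x .: A ==> y .: A ==> f (x .+ y) = f x .+ f y" shows "f x : SP S'"
proof -
 obtain ws where ws: "x = lsum W ws" "\<forall>w\<in>set ws. S w & set w <= K" using x unfolding SP_def by blast
 have "\<forall>w\<in>set ws. S w & set w <= K ==> f (lsum W ws) = lsum (%w. f (W w)) ws" for ws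
  by (induction ws) (simp_all add: lin lsum_closed)
 thus ?thesis using ws f by (auto intro!: SP_lsum)
qed

lemma SP_mult_l:
 "t .: A ==> (!!w. S w ==> set w <= K ==> t ** W w : SP S') ==> x : SP S ==> t ** x : SP S'"
 by (rule SP_map[of S "%x. t ** x"]) (simp_all add: r_distr)

lemma SP_mult:
 assumes "!!v w. S v ==> set v <= K ==> S' w ==> set w <= K ==> W v ** W w : SP S''" and x: "x : SP S" and y: "y : SP S'"
 shows "x ** y : SP S''"
proof (rule SP_map[of S "%x. x ** y"])
 have yc: "y .: A" using y SP_carrier by blast
 show "\<zero> ** y = \<zero>" "!!x x'. x .: A ==> x' .: A ==> (x .+ x') ** y = x ** y .+ x' ** y"
  using yc by (simp_all add: l_distr)
 show "W v ** y : SP S''" if "S v" "set v <= K" for v by (rule SP_mult_l[OF _ _ y]) (use that assms(1) in auto)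
qed (rule x)

lemma W_scale: "x : K ==> set xs <= K ==> W ((c *. x) # xs) = c *. W (x # xs)" by (simp add: smult_mult_left sm_add_r)

text \<open>The *-algebra generated by \<open>l + l*\<close> and a *-closed set \<open>G\<close> of letters, filtered by degree.\<close>

definition wl :: "'a set => nat => 'a list => bool" where "wl G n w <-> set w <= G & length w <= Suc n"

definition letters :: "'a set => bool"
 where "letters G <-> G <= K & \<one> : G & (\<forall>x\<in>G. \<forall>y\<in>G. x ** y : G) & (\<forall>c. \<forall>x\<in>G. c *. x : G) & (\<forall>x\<in>G. sA x : G)"

lemma SP_smult: assumes G: "letters G" and x: "x : SP (wl G n)" shows "c *. x : SP (wl G n)"
proof (rule SP_map[OF _ x, of "%x. c *. x"])
 fix w assume w: "wl G n w" "set w <= K"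
 show "c *. W w : SP (wl G n)" proof (cases w)
  case Nil
  thus ?thesis by (simp add: SP_zero)
 next
  case (Cons y ys)
  have "c *. W w = W ((c *. y) # ys)" unfolding Cons by (rule W_scale[symmetric]) (use w Cons in auto)
  thus ?thesis using w Cons G by (simp only:) (rule SP_W, auto simp: wl_def letters_def)
 qed
qed (simp_all add: sm_add_r)

lemma SP_star: "letters G ==> x : SP (wl G n) ==> sA x : SP (wl G n)"
proof (erule SP_map[rotated])
 fix w assume "letters G" and w: "wl G n w" "set w <= K"
 hence "star A ` set w <= G" "star A ` set w <= K" by (auto simp: wl_def letters_def)
 thus "sA (W w) : SP (wl G n)" unfolding star_W[OF w(2)] using w by (intro SP_W) (auto simp: wl_def)
qed (simp_all add: star_add)

text \<open>The merged word has one letter fewer than its factors together, and each contraction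
  removes two letters from the pair. With length equal to degree plus one, degrees therefore
  add.\<close>

lemma W_mult_mem: assumes G: "letters G"
 shows "length v + length w <= k + 2 ==> set v <= G ==> set w <= G ==> W v ** W w : SP (wl G k)"
proof (induction v arbitrary: w rule: rev_induct)
 case Nil
 have "W w .: A" by (rule LAW_closed(3)) (use Nil G in "auto simp: letters_def")
 thus ?case by (simp add: SP_zero)
next
 case (snoc x xs)
 have GK: "G <= K" using G by (simp add: letters_def)
 show ?case proof (cases w)
  case Nil
  have "W (xs @ [x]) .: A" by (rule LAW_closed(3)) (use snoc GK in auto)
  thus ?thesis using Nil by (simp add: SP_zero)
 next
  case (Cons y ys)
  have c: "set xs <= G" "x : G" "y : G" "set ys <= G" using snoc Cons by auto
  have "W xs ** W ys : SP (wl G k)" by (rule snoc.IH) (use c snoc Cons in auto)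
  moreover have "W (xs @ (x ** y) # ys) : SP (wl G k)"
   by (rule SP_W) (use c snoc Cons G in "auto simp: wl_def letters_def")
  ultimately show ?thesis unfolding Cons by (subst W_mult) (use c GK in "auto intro!: SP_add SP_smult[OF G]")
 qed
qed

lemma SP_degree: assumes G: "letters G" and "x : SP (wl G m)" "y : SP (wl G n)" shows "x ** y : SP (wl G (m + n))"
 by (rule SP_mult[OF _ assms(2,3)], rule W_mult_mem[OF G]) (auto simp: wl_def)

definition PC :: "'a set => 'a set" where "PC G = cs_closure (\<Union>n. SP (wl G n))"

lemma wl_mono: "m <= n ==> SP (wl G m) <= SP (wl G n)" by (rule SP_mono) (auto simp: wl_def)

lemma PC_subalgebra: assumes G: "letters G" shows "unital_cstar_subalgebra (PC G) A" unfolding PC_def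
proof (rule unital_cstar_subalgebra_closure)
 show "(\<Union>n. SP (wl G n)) <= carrier A" using SP_carrier by blast
 have "W [\<one>] : SP (wl G 0)" by (rule SP_W) (use G in "auto simp: wl_def letters_def")
 thus "\<one> : (\<Union>n. SP (wl G n))" by auto
 fix x y c assume x: "x : (\<Union>n. SP (wl G n))"
 then obtain m where m: "x : SP (wl G m)" by blast
 show "c *. x : (\<Union>n. SP (wl G n))" "sA x : (\<Union>n. SP (wl G n))"
  using SP_smult[OF G m] SP_star[OF G m] by blast+
 assume "y : (\<Union>n. SP (wl G n))"
 then obtain n where n: "y : SP (wl G n)" by blast
 show "x ** y : (\<Union>n. SP (wl G n))" using SP_degree[OF G m n] by blast
 have "x .+ y : SP (wl G (max m n))" using m n wl_mono[of m "max m n" G] wl_mono[of n "max m n" G] by (auto intro: SP_add)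
 thus "x .+ y : (\<Union>n. SP (wl G n))" by blast
qed

lemma SP_PC: "SP (wl G n) <= PC G"
 unfolding PC_def using cs_closure_superset[of "\<Union>n. SP (wl G n)"] SP_carrier by blast

lemma PC_gen: "letters G ==> G <= PC G" "letters G ==> l .+ sA l : PC G"
proof -
 assume G: "letters G"
 have "W [x] : SP (wl G 0)" if "x : G" for x by (rule SP_W) (use G that in "auto simp: wl_def letters_def")
 moreover have "W [x] = x" if "x : G" for x using that G by (auto simp: letters_def)
 ultimately show "G <= PC G" using SP_PC[of G 0] by fastforce
 have "W [\<one>, \<one>] : SP (wl G 1)" by (rule SP_W) (use G in "auto simp: wl_def letters_def")
 thus "l .+ sA l : PC G" using SP_PC[of G 1] by (simp add: a_comm subset_iff)
qed

lemma letters_K: "letters K" by (simp add: letters_def)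

text \<open>With scalar letters only, Wick words describe the algebra generated by l + l*
  alone.\<close>

definition sc :: "'a set" where "sc = range (%c. c *. \<one>)"

lemma letters_sc: "letters sc"
 using rangeI[of "%c. c *. \<one>" 1] by (auto simp: letters_def sc_def smult_mult_left star_smult)

text \<open>Conversely, a Wick word lies in any *-algebra containing its letters and \<open>l + l*\<close>.\<close>

lemma W_mem: assumes B: "\<zero> : B" "l .+ sA l : B" "!!x y. x : B ==> y : B ==> x ** y : B"
  "!!x y. x : B ==> y : B ==> x .- y : B" "!!c x. x : B ==> c *. x : B" shows "set w <= K \<inter> B ==> W w : B"
proof (induction w rule: induct_list012)
 case 1
 thus ?case using B by simp
next
 case (2 x)
 thus ?case by simp
next
 case (3 x y ys)
 have W: "W (y # ys) : B" "W ys : B" by (rule 3; use 3(3) in simp)+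
 have c: "x : K" "y : K" "set ys <= K" "x : B" using 3(3) by auto
 show ?case unfolding W_recurrence[OF c(1-3)] by (intro B W c)
qed

section \<open>Faithfulness of the vacuum on the algebra with all letters\<close>

fun cuts :: "'a list => ('a list \<times> 'a \<times> 'a list) list" where
 "cuts [] = []"
| "cuts (x # xs) = ([], x, xs) # map (%(us, c, vs). (x # us, c, vs)) (cuts xs)"

lemma cuts_ok: "(us, c, vs) : set (cuts w) ==> set w <= K ==> okt (us, c, vs) & length us < length w & length vs < length w"
 by (induction w arbitrary: us c vs) fastforce+

lemma W_cuts: "set w <= K ==> W w = lsum trm (cuts w)"
proof (induction w)
 case (Cons x xs)
 have c: "trm t .: A" if "t : set (cuts xs)" for t using cuts_ok[of "fst t" "fst (snd t)" "snd (snd t)" xs] that Cons(2) trm_closed[of t] by auto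
 have "lsum trm (map (%(us, c, vs). (x # us, c, vs)) (cuts xs)) = lsum (%t. (x ** l) ** trm t) (cuts xs)"
  unfolding lsum_map proof (rule lsum_cong)
  fix t assume t: "t : set (cuts xs)"
  obtain us c vs where [simp]: "t = (us, c, vs)" by (cases t)
  have "okt (us, c, vs)" using cuts_ok[of us c vs xs] t Cons(2) by auto
  thus "trm ((%(us, c, vs). (x # us, c, vs)) t) = (x ** l) ** trm t" using Cons(2) by (simp add: m_assoc)
 qed
 also have "... = (x ** l) ** lsum trm (cuts xs)" by (rule lsum_mult_l[symmetric]) (use c Cons(2) in auto)
 moreover have "lsum trm (cuts xs) .: A" by (rule lsum_closed) (rule c)
 ultimately show ?case using Cons by (simp add: m_assoc)
qed simp

lemma P_SP: "P = (\<Union>n. SP (wl K n))"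
proof -
 have "lsum W ws : (\<Union>n. SP (wl K n))" if "\<forall>w\<in>set ws. set w <= K" for ws proof -
  have "length w <= Suc (\<Sum>w\<leftarrow>ws. length w)" if "w : set ws" for w
   using member_le_sum_list[of "length w" "map length ws"] that by simp
  hence "lsum W ws : SP (wl K (\<Sum>w\<leftarrow>ws. length w))" using that unfolding SP_def wl_def by blast
  thus ?thesis by blast
 qed
 thus ?thesis unfolding P_def SP_def by blast
qed

text \<open>A word of at most n + 1 letters, cut at one of them, has at most n letters on either
  side, so \<open>Haagerup\<close> applies with d = n; Cauchy-Schwarz provides its bilinear bound
  from the action on vectors.\<close>

lemma growth_K: assumes q: "q : SP (wl K n)" and M: "M >= 0" "!!m v. v : SP (wl K m) ==> sn (q ** v) <= M * sn v"
 shows "nA q <= 2 * (real n + 1)\<^sup>2 * M"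
proof -
 obtain ws where ws: "q = lsum W ws" "\<forall>w\<in>set ws. wl K n w & set w <= K" using q unfolding SP_def by blast
 define ts where "ts = concat (map cuts ws)"
 have ok: "okt (us, c, vs) & length us <= n & length vs <= n" if "(us, c, vs) : set ts" for us c vs proof -
  obtain w where w: "w : set ws" "(us, c, vs) : set (cuts w)" using \<open>(us, c, vs) : set ts\<close> by (auto simp: ts_def)
  thus ?thesis using cuts_ok[OF w(2)] ws(2) by (fastforce simp: wl_def)
 qed
 have eq: "q = lsum trm ts" proof -
  have "\<forall>w\<in>set vs. set w <= K ==> lsum W vs = lsum trm (concat (map cuts vs))" for vs proof (induction vs)
   case (Cons v vs)
   have "trm t .: A" if "t : set (cuts v @ concat (map cuts vs))" for t
    using that cuts_ok[of "fst t" "fst (snd t)" "snd (snd t)"] Cons(2) trm_closed[of t] by fastforce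
   hence "lsum trm (cuts v @ concat (map cuts vs)) = lsum trm (cuts v) .+ lsum trm (concat (map cuts vs))"
    by (rule lsum_append)
   thus ?case using Cons W_cuts[of v] by simp
  qed simp
  thus ?thesis using ws by (simp add: ts_def)
 qed
 have qc: "q .: A" using q SP_carrier by blast
 show ?thesis unfolding eq proof (rule Haagerup[OF ok M(1)])
  fix u v assume u: "u : P" and v: "v : P"
  have c: "u .: A" "v .: A" using u v P_SP SP_carrier by blast+
  obtain m where "v : SP (wl K m)" using v P_SP by blast
  have "cmod (\<rho> (sA u ** (q ** v))) <= sn (q ** v) * sn u"
   using Cauchy_Schwarz[of "q ** v" u] qc c by (simp add: ip_def)
  also have "... <= M * sn v * sn u" using M(2)[OF \<open>v : SP (wl K m)\<close>] c by (intro mult_right_mono) auto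
  finally show "cmod (\<rho> (sA u ** (lsum trm ts ** v))) <= M * sn v * sn u" unfolding eq .
 qed
qed

lemma faithful_K: assumes "x : PC K" "!!n v. v : SP (wl K n) ==> sn (x ** v) = 0" shows "x = \<zero>"
 by (rule faithful_closure[where V="%n. SP (wl K n)", OF SP_carrier SP_degree[OF letters_K] SP_star[OF letters_K] growth_K])
  (use assms in "auto simp: PC_def")

section \<open>The algebra generated by l + l* and its Chebyshev basis\<close>

definition Wn :: "nat => 'a" where "Wn j = W (replicate (Suc j) \<one>)"

lemma rep_K: "set (replicate j \<one>) <= K" by auto

lemma Wn_closed [simp]: "Wn j .: A" unfolding Wn_def by (rule LAW_closed(3)[OF rep_K])

text \<open>The merged word left by the product rule is centred unless both words had a single
  letter, and the contraction shortens both words by one. So the elements \<open>Wn j\<close> are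
  orthonormal.\<close>

lemma \<rho>_rep: "\<rho> (W (replicate i \<one>) ** W (replicate j \<one>)) = (if i = j & i ~= 0 then 1 else 0)"
proof (induction i arbitrary: j)
 case 0
 thus ?case using LAW_closed(3)[OF rep_K, of j] by simp
next
 case (Suc i)
 show ?case proof (cases j)
  case 0
  thus ?thesis using Wn_closed[of i, unfolded Wn_def] by simp
 next
  case (Suc j')
  have "replicate (Suc i) \<one> = replicate i \<one> @ [\<one>]" "replicate j \<one> = \<one> # replicate j' \<one>"
   using Suc by (simp_all add: replicate_append_same)
  hence "W (replicate (Suc i) \<one>) ** W (replicate j \<one>) = W (replicate i \<one> @ (\<one> ** \<one>) # replicate j' \<one>)
    .+ \<rho> (\<one> ** \<one>) *. (W (replicate i \<one>) ** W (replicate j' \<one>))"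
   using W_mult[OF rep_K K_one K_one rep_K] by simp
  moreover have c: "W (replicate i \<one> @ (\<one> ** \<one>) # replicate j' \<one>) .: A" "W (replicate i \<one>) .: A"
   "W (replicate j' \<one>) .: A" by (rule LAW_closed(3); auto)+
  moreover have "\<rho> (W (replicate i \<one> @ (\<one> ** \<one>) # replicate j' \<one>)) = (if i = 0 & j' = 0 then 1 else 0)"
  proof (cases "i = 0 & j' = 0")
   case False
   hence "\<rho> (W (replicate i \<one> @ (\<one> ** \<one>) # replicate j' \<one>)) = 0" by (intro \<rho>_W) auto
   thus ?thesis using False by simp
  qed simp
  ultimately show ?thesis using Suc.IH[of j'] Suc by simp
 qed
qed

lemma Wn_star: "sA (Wn j) = Wn j"
proof -
 have "map (star A) (rev (replicate (Suc j) \<one>)) = replicate (Suc j) \<one>" by (simp del: replicate_Suc)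
 thus ?thesis unfolding Wn_def star_W[OF rep_K] by simp
qed

lemma Wn_sn: "sn (Wn j) = 1"
 using \<rho>_rep[of "Suc j" "Suc j"] unfolding gns_seminorm_def Wn_star by (simp add: Wn_def del: replicate_Suc)

text \<open>By covariance at 1 the operator l is a contraction, and \<open>Wn j\<close> is a sum of
  j + 1 products of l and its adjoint.\<close>

lemma Wn_nrm: "nA (Wn j) <= real j + 1"
proof -
 have "nA (sA l ** (\<one> ** l)) <= 1" using cov[OF K_one] nrm_one_le by simp
 hence l1: "nA l <= 1" using cstar_identity[of l] square_le_1_imp[of "nA l"] by simp
 have An: "nA (An (replicate j \<one>)) <= 1" for j proof (induction j)
  case (Suc j)
  thus ?case using nrm_mult_le[of "sA l" "An (replicate j \<one>)" 1 1] l1 LAW_closed(2)[OF rep_K] by simp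
 qed (simp add: nrm_one_le)
 have "nA (W (replicate j \<one>)) <= real j" for j proof (induction j)
  case (Suc j)
  have c: "An (replicate j \<one>) .: A" "W (replicate j \<one>) .: A" by (rule LAW_closed[OF rep_K])+
  have "nA (l ** W (replicate j \<one>)) <= 1 * real j" by (rule nrm_mult_le) (use l1 Suc c in auto)
  thus ?case using nrm_triangle[of "An (replicate j \<one>)" "l ** W (replicate j \<one>)"] An[of j] c by simp
 qed simp
 from this[of "Suc j"] show ?thesis by (simp add: Wn_def)
qed

lemma W_sc: "set w <= sc ==> \<exists>s. W w = s *. W (replicate (length w) \<one>) & An w = s *. An (replicate (length w) \<one>)"
proof (induction w)
 case (Cons x w)
 then obtain s c where s: "W w = s *. W (replicate (length w) \<one>)" "An w = s *. An (replicate (length w) \<one>)" "x = c *. \<one>"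
  by (auto simp: sc_def)
 show ?case using s LAW_closed(2,3)[OF rep_K, of "length w"]
  by (intro exI[of _ "c * s"]) (simp add: smult_mult_left smult_mult_right sm_add_r mult.commute)
qed (simp add: exI[of _ 1])

lemma SP_sc: assumes "q : SP (wl sc n)" shows "\<exists>c. q = lsum (%j. c j *. Wn j) [0..<Suc n]"
proof -
 obtain ws where ws: "q = lsum W ws" "\<forall>w\<in>set ws. wl sc n w" using assms unfolding SP_def by blast
 have "\<forall>w\<in>set ws. wl sc n w ==> \<exists>c. lsum W ws = lsum (%j. c j *. Wn j) [0..<Suc n]" for ws
 proof (induction ws)
  case Nil
  show ?case by (intro exI[of _ "%_. 0"]) (simp add: lsum_zero del: upt_Suc)
 next
  case (Cons w ws)
  then obtain c where c: "lsum W ws = lsum (%j. c j *. Wn j) [0..<Suc n]" by auto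
  have w: "set w <= sc" "length w <= Suc n" using Cons(2) by (auto simp: wl_def)
  obtain s where s: "W w = s *. W (replicate (length w) \<one>)" using W_sc[OF w(1)] by blast
  have lc: "lsum (%j. c j *. Wn j) [0..<Suc n] .: A" by (rule lsum_closed) simp
  show ?case proof (cases "length w")
   case 0
   thus ?thesis using c lc by (intro exI[of _ c]) simp
  next
   case (Suc m)
   hence "W w = s *. Wn m" by (simp add: s Wn_def del: W.simps replicate_Suc)
   hence "W w = lsum (%j. if m = j then s *. Wn j else \<zero>) [0..<Suc n]" using w(2) Suc by (subst lsum_delta) auto
   hence "lsum W (w # ws) = lsum (%j. (if m = j then s *. Wn j else \<zero>) .+ c j *. Wn j) [0..<Suc n]"
    unfolding lsum_simps c by (subst lsum_add) auto
   also have "... = lsum (%j. ((if m = j then s else 0) + c j) *. Wn j) [0..<Suc n]"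
    by (rule lsum_cong) (simp add: sm_add_l)
   finally show ?thesis by (rule exI[of _ "%j. (if m = j then s else 0) + c j"])
  qed
 qed
 thus ?thesis using ws by blast
qed

lemma coefficient: assumes i: "i <= n" shows "\<rho> (Wn i ** lsum (%j. c j *. Wn j) [0..<Suc n]) = c i"
proof -
 have "Wn i ** lsum (%j. c j *. Wn j) [0..<Suc n] = lsum (%j. Wn i ** (c j *. Wn j)) [0..<Suc n]"
  by (rule lsum_mult_l) auto
 hence "\<rho> (Wn i ** lsum (%j. c j *. Wn j) [0..<Suc n]) = (\<Sum>j\<leftarrow>[0..<Suc n]. if j = i then c j else 0)"
  using \<rho>_rep[of "Suc i" "Suc j" for j]
  by (simp add: \<rho>_lsum smult_mult_right Wn_def[symmetric] del: upt_Suc replicate_Suc) (simp only: eq_commute[of i] if_distrib[of "(*) _"] mult_1_right mult_zero_right)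
 thus ?thesis using i by (simp add: sum_list_distinct_conv_sum_set del: upt_Suc)
qed

text \<open>Here the test vectors come only from the algebra of l + l*, so \<open>growth_K\<close>
  does not apply. Instead the coefficients in the orthonormal basis are bounded by the length of
  \<open>q\<close> applied to the vacuum, and each of the n + 1 basis elements has norm at most n +
  1.\<close>

lemma growth_sc: assumes q: "q : SP (wl sc n)" and M: "M >= 0" "!!m v. v : SP (wl sc m) ==> sn (q ** v) <= M * sn v"
 shows "nA q <= 1 * (real n + 1)\<^sup>2 * M"
proof -
 obtain c where c: "q = lsum (%j. c j *. Wn j) [0..<Suc n]" using SP_sc[OF q] by blast
 have qc: "q .: A" using q SP_carrier by blast
 have "W [\<one>] : SP (wl sc 0)" by (rule SP_W) (use letters_sc in "auto simp: wl_def letters_def")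
 hence q1: "sn q <= M" using M(2)[of \<one> 0] qc by simp
 have "nA (c j *. Wn j) <= M * (real n + 1)" if j: "j : set [0..<Suc n]" for j proof -
  have "cmod (c j) = cmod (ip q (Wn j))" using coefficient[of j n c] j c by (simp add: ip_def Wn_star del: upt_Suc)
  also have "... <= M" using Cauchy_Schwarz[OF qc Wn_closed[of j]] q1 by (simp add: Wn_sn)
  finally have "cmod (c j) * nA (Wn j) <= M * (real n + 1)"
   using Wn_nrm[of j] j M(1) by (intro mult_mono) (auto simp: nrm_nonneg)
  thus ?thesis by (simp add: nrm_smult)
 qed
 hence "nA q <= real (length [0..<Suc n]) * (M * (real n + 1))" unfolding c by (intro nrm_lsum_bound) auto
 thus ?thesis by (simp add: power2_eq_square algebra_simps)
qed

lemma faithful_sc: assumes "x : PC sc" "!!n v. v : SP (wl sc n) ==> sn (x ** v) = 0" shows "x = \<zero>"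
 by (rule faithful_closure[where V="%n. SP (wl sc n)", OF SP_carrier SP_degree[OF letters_sc] SP_star[OF letters_sc] growth_sc])
  (use assms in "auto simp: PC_def")

text \<open>A scalar equal to l + l* would be zero because l + l* is centred, but its vacuum vector
  has length 1.\<close>

lemma nontrivial: "l .+ sA l ~= c *. \<one>"
proof
 have h: "Wn 1 = l .+ sA l" by (simp add: Wn_def a_comm)
 assume eq: "l .+ sA l = c *. \<one>"
 have "\<rho> (Wn 1) = 0" unfolding Wn_def by (rule \<rho>_W) auto
 hence "c = 0" unfolding h eq by simp
 hence "sn (Wn 1) = 0" unfolding h eq by simp
 thus False by (simp add: Wn_sn)
qed

text \<open>The Wick words that occur in centred alternating products: with a leftmost factor from
  \<open>K\<close> the first letter is centred, with a leftmost factor from the algebra of l + l*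
  the first letter is scalar and further letters follow. Both kinds are centred.\<close>

definition VV :: "bool => 'a list => bool"
 where "VV k w <-> w ~= [] & (if k then \<rho> (hd w) = 0 else hd w : sc & length w >= 2)"

lemma \<rho>_VV: "x : cs_closure (SP (VV k)) ==> \<rho> x = 0"
proof -
 have SP: "\<rho> y = 0" if "y : SP (VV k)" for y proof -
  obtain ws where ws: "y = lsum W ws" "\<forall>w\<in>set ws. VV k w & set w <= K" using \<open>y : SP (VV k)\<close> unfolding SP_def by blast
  have "\<rho> (W w) = 0" if wv: "VV k w" "set w <= K" for w proof (cases "length w >= 2")
   case False
   then obtain x where "w = [x]" using wv(1) by (cases w; cases "tl w") (auto simp: VV_def)
   thus ?thesis using wv by (auto simp: VV_def split: if_splits)
  qed (use \<rho>_W wv in auto)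
  hence "(\<Sum>w\<leftarrow>ws. \<rho> (W w)) = (\<Sum>w\<leftarrow>ws. 0)" using ws by (intro arg_cong[of _ _ sum_list] map_cong) auto
  moreover have "\<rho> y = (\<Sum>w\<leftarrow>ws. \<rho> (W w))" unfolding ws(1) by (rule \<rho>_lsum) (use ws in auto)
  ultimately show ?thesis by simp
 qed
 assume "x : cs_closure (SP (VV k))"
 then obtain s where s: "!!n. s n : SP (VV k)" "converges s x" using cs_closure_converges[OF SP_carrier] by metis
 have "(%n. \<rho> (s n)) ----> \<rho> x" by (rule converges_\<rho>[OF s(2)])
 thus ?thesis using SP[OF s(1)] by (simp add: LIMSEQ_const_iff)
qed

lemma centred_sc: "p : SP (wl sc n) ==> \<rho> p = 0 ==> \<exists>c. p = lsum (%j. c j *. Wn (Suc j)) [0..<n]"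
proof -
 assume p: "p : SP (wl sc n)" "\<rho> p = 0"
 obtain c where c: "p = lsum (%j. c j *. Wn j) [0..<Suc n]" using SP_sc[OF p(1)] by blast
 have pc: "p .: A" using p SP_carrier by blast
 have "c 0 = 0" using coefficient[of 0 n c] p(2) pc by (simp add: c[symmetric] del: upt_Suc) (simp add: Wn_def)
 moreover have "[0..<Suc n] = 0 # map Suc [0..<n]" by (simp add: map_Suc_upt upt_conv_Cons del: upt_Suc)
 moreover have "lsum (%j. c (Suc j) *. Wn (Suc j)) [0..<n] .: A" by (rule lsum_closed) simp
 ultimately have "p = lsum (%j. c (Suc j) *. Wn (Suc j)) [0..<n]" unfolding c by (simp add: lsum_map del: upt_Suc)
 thus ?thesis by (intro exI[of _ "%j. c (Suc j)"])
qed

lemma cons_VV: assumes x: "x : K" "\<rho> x = 0" and y: "y : SP (VV False)" shows "x ** y : SP (VV True)"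
proof (rule SP_mult_l[OF _ _ y])
 fix w assume w: "VV False w" "set w <= K"
 then obtain c ys where [simp]: "w = (c *. \<one>) # ys" by (cases w) (auto simp: VV_def sc_def)
 have "x ** W w = W ((c *. x) # ys)"
  using w x by (simp add: r_distr smult_mult_left smult_mult_right m_assoc sm_add_r)
 thus "x ** W w : SP (VV True)" using w x by (simp only:) (rule SP_W, auto simp: VV_def)
qed (use x in simp)

text \<open>A centred polynomial in l + l* has no component of degree 0, so its basis words have at
  least two letters. Multiplied by a word with centred first letter x, the contraction carries the
  factor \<open>\<rho> (\<one> ** x) = 0\<close> and only the joined word survives.\<close>

lemma sc_VV:
 assumes p: "p : SP (wl sc n)" "\<rho> p = 0" shows "p : SP (VV False)" "y : SP (VV True) ==> p ** y : SP (VV False)"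
proof -
 obtain c where c: "p = lsum (%j. c j *. Wn (Suc j)) [0..<n]" using centred_sc[OF p] by blast
 have one: "c *. \<one> : sc" for c by (simp add: sc_def)
 have Wn: "c *. Wn (Suc j) = W ((c *. \<one>) # replicate (Suc j) \<one>)" for c j
  unfolding Wn_def using W_scale[OF K_one rep_K[of "Suc j"]] by simp
 show "p : SP (VV False)" unfolding c Wn by (rule SP_lsum, rule SP_W) (auto simp: VV_def one)
 assume y: "y : SP (VV True)"
 have yc: "y .: A" using y SP_carrier by blast
 have "p ** y = lsum (%j. (c j *. Wn (Suc j)) ** y) [0..<n]" unfolding c by (rule lsum_mult_r) (use yc in auto)
 also have "... : SP (VV False)" proof (rule SP_lsum, rule SP_mult_l[OF _ _ y])
  fix j w assume w: "VV True w" "set w <= K"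
  then obtain x xs where [simp]: "w = x # xs" and x: "\<rho> x = 0" by (cases w) (auto simp: VV_def)
  have xK: "x : K" "set xs <= K" using w by auto
  let ?u = "(c j *. \<one>) # replicate j \<one>"
  have "?u @ [\<one>] = (c j *. \<one>) # replicate (Suc j) \<one>" by (simp add: replicate_append_same)
  hence "(c j *. Wn (Suc j)) ** W w = W (?u @ [\<one>]) ** W (x # xs)" unfolding Wn by simp
  also have "... = W (?u @ (\<one> ** x) # xs) .+ \<rho> (\<one> ** x) *. (W ?u ** W xs)"
   by (rule W_mult) (use xK in auto)
  also have "... = W (?u @ x # xs)" proof -
   have "W ?u ** W xs .: A" "W (?u @ x # xs) .: A" by (intro m_closed LAW_closed(3); use xK in auto)+
   thus ?thesis using x xK by (simp del: W.simps)
  qed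
  finally show "(c j *. Wn (Suc j)) ** W w : SP (VV False)"
   by (simp only:) (rule SP_W, use xK one in "auto simp: VV_def")
 qed auto
 finally show "p ** y : SP (VV False)" .
qed

text \<open>Subtracting the means of the approximants keeps them in the polynomial algebra and still
  gives convergence, because the means tend to the value zero of the state at
  \<open>x\<close>.\<close>

lemma centred_closure:
 assumes x: "x : PC sc" "\<rho> x = 0" shows "x : cs_closure {p. \<rho> p = 0 & (\<exists>n. p : SP (wl sc n))}"
proof -
 let ?V = "{p. \<rho> p = 0 & (\<exists>n. p : SP (wl sc n))}"
 have sub: "(\<Union>n. SP (wl sc n)) <= carrier A" "?V <= carrier A" using SP_carrier by blast+
 obtain s where s: "!!n. s n : (\<Union>n. SP (wl sc n))" "converges s x"
  using x(1) cs_closure_converges[OF sub(1)] unfolding PC_def by metis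
 have sc: "s n .: A" for n using s(1) sub by blast
 define t where "t n = s n .+ (- \<rho> (s n)) *. \<one>" for n
 have t: "t n : ?V" for n proof -
  obtain m where m: "s n : SP (wl sc m)" using s(1) by blast
  have "W [(- \<rho> (s n)) *. \<one>] : SP (wl sc m)" by (rule SP_W) (auto simp: wl_def sc_def)
  hence "t n : SP (wl sc m)" unfolding t_def using m SP_add by simp
  moreover have "\<rho> (t n) = 0" using sc by (simp add: t_def)
  ultimately show ?thesis by blast
 qed
 have xc: "x .: A" using s(2) by (simp add: converges_def)
 have "(%n. nA (s n .- x) + cmod (\<rho> (s n)) * 1) ----> 0 + cmod 0 * 1"
  using converges_\<rho>[OF s(2)] s(2) x(2) by (intro tendsto_intros) (auto simp: converges_def)
 hence "(%n. nA (s n .- x) + cmod (\<rho> (s n))) ----> 0" by simp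
 moreover have "nA (t n .- x) <= nA (s n .- x) + cmod (\<rho> (s n))" for n proof -
  have "t n .- x = (s n .- x) .+ (- \<rho> (s n)) *. \<one>"
   unfolding t_def using sc[of n] xc by (simp add: minus_eq a_ac)
  hence "nA (t n .- x) <= nA (s n .- x) + nA ((- \<rho> (s n)) *. \<one>)"
   using nrm_triangle[of "s n .- x"] sc xc by simp
  thus ?thesis using nrm_smult[OF one_closed, of "- \<rho> (s n)"] mult_left_mono[OF nrm_one_le, of "cmod (\<rho> (s n))"] by simp
 qed
 moreover have tc: "t n .: A" for n using t sub by blast
 ultimately have "(%n. nA (t n .- x)) ----> 0"
  using LIMSEQ_squeeze_0[of "%n. nA (s n .- x) + cmod (\<rho> (s n))" "%n. nA (t n .- x)"] xc nrm_nonneg by simp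
 hence "converges t x" using tc xc by (simp add: converges_def)
 thus ?thesis by (rule cs_closure_limit[OF sub(2) t])
qed

text \<open>The product is built from the right. Factors from \<open>K\<close> turn
  \<open>VV False\<close> into \<open>VV True\<close>, centred factors from the algebra of l + l*
  turn it back, and closures absorb the passage from polynomials to their limits.\<close>

lemma free_words:
 "w ~= [] ==> distinct_adj (map fst w) ==> \<forall>(k, x)\<in>set w. x : (if k then K else PC sc) & \<rho> x = 0 ==>
  foldr (%x y. x ** y) (map snd w) \<one> : cs_closure (SP (VV (fst (hd w))))"
proof (induction w)
 case (Cons kx w)
 obtain k x where [simp]: "kx = (k, x)" by (cases kx)
 have x: "x : (if k then K else PC sc)" "\<rho> x = 0" using Cons(4) by auto
 let ?C = "{p. \<rho> p = 0 & (\<exists>n. p : SP (wl sc n))}"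
 have sub: "?C <= carrier A" "{x \<in> K. \<rho> x = 0} <= carrier A" using SP_carrier by auto
 define U where "U = (if k then {x \<in> K. \<rho> x = 0} else ?C)"
 have Xc: "U <= carrier A" unfolding U_def using sub by simp
 have xX: "x : cs_closure U" proof (cases k)
  case True
  thus ?thesis using x cs_closure_superset[OF sub(2)] by (auto simp: U_def)
 qed (use x centred_closure in "simp add: U_def")
 have one: "y : SP (VV k)" if y: "y : U" for y proof (cases k)
  case True
  hence "W [y] : SP (VV k)" by (intro SP_W) (use y in "auto simp: U_def VV_def")
  thus ?thesis using True y by (simp add: U_def)
 qed (use y sc_VV(1) in "auto simp: U_def")
 have two: "y ** y' : SP (VV k)" if y: "y : U" "y' : SP (VV (\<not> k))" for y y'
  using y cons_VV sc_VV(2) by (cases k) (auto simp: U_def)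
 show ?case proof (cases w)
  case Nil
  have "cs_closure U <= cs_closure (SP (VV k))" using one unfolding cs_closure_def by fast
  thus ?thesis using xX Nil by (auto simp: cs_closure_def)
 next
  case (Cons kx' w')
  have "fst (hd w) = (\<not> k)" using Cons.prems(2) Cons by auto
  hence "foldr (%x y. x ** y) (map snd w) \<one> : cs_closure (SP (VV (\<not> k)))"
   using Cons.IH Cons.prems Cons by (simp add: distinct_adj_Cons)
  thus ?thesis using cs_closure_mult[OF Xc SP_carrier SP_carrier two xX] by simp
 qed
qed simp

end

subsection \<open>The Fock representation in an ultrapower\<close>

lemma tendsto_sum_list:
 fixes g :: "'x => 'b::topological_comm_monoid_add"
 shows "(!!x. x : set xs ==> ((%n. f n x) ---> g x) F) ==> ((%n. \<Sum>x\<leftarrow>xs. f n x) ---> (\<Sum>x\<leftarrow>xs. g x)) F"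
 by (induction xs) (auto intro: tendsto_add)

lemma (in hilbert_space) inn_lsum:
 "v .: H ==> w .: H ==> (!!x. x : set xs ==> f x .: BO) ==>
  inn (B.lsum f xs v) w = (\<Sum>x\<leftarrow>xs. inn (f x v) w)"
 by (induction xs) (simp_all add: hinner_add B.lsum_closed)

context cstar_state
begin

lemma hat_sequence: assumes "\<xi> .: HH" shows "\<exists>x. (\<forall>n. x n .: A) & H.hconv (%n. hat (x n)) \<xi>"
proof -
 have "\<exists>x. x .: A & hnorm HH (\<xi> \<ominus>\<^bsub>HH\<^esub> hat x) <= 1 / real (Suc n)" for n proof -
  obtain x where "x .: A" "hnorm HH (\<xi> \<ominus>\<^bsub>HH\<^esub> hat x) <= 1 / real (Suc n)"
   by (rule hat_dense[OF assms, of "1 / real (Suc n)"]) simp_all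
  thus ?thesis by blast
 qed
 then obtain x where x: "!!n. x n .: A" "!!n. hnorm HH (\<xi> \<ominus>\<^bsub>HH\<^esub> hat (x n)) <= 1 / real (Suc n)" by metis
 have "(%n. hnorm HH (hat (x n) .-@HH \<xi>)) ----> 0" by (rule LIMSEQ_squeeze_0[OF lim_1_over_n[THEN LIMSEQ_Suc]])
   (use x assms H.hn_diff_commute[OF assms] in simp_all)
 thus ?thesis using x(1) assms by (intro exI[of _ x]) (simp add: H.hconv_def)
qed

text \<open>Algebra elements are dense in the completion. The limit is taken first in all right-hand
  vectors with the left-hand ones fixed, then in the left-hand ones.\<close>

lemma form_bound_vectors:
 fixes Is :: "'i list" and Js :: "'j list" assumes \<beta>: "!!I J. I : set Is ==> J : set Js ==> \<beta> I J .: A"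
  and bound: "!!x y. (!!J. J : set Js ==> x J .: A) ==> (!!I. I : set Is ==> y I .: A) ==>
   cmod (\<Sum>I\<leftarrow>Is. \<Sum>J\<leftarrow>Js. \<rho> (sA (y I) ** (\<beta> I J ** x J)))
    <= M * sqrt (\<Sum>J\<leftarrow>Js. (sn (x J))\<^sup>2) * sqrt (\<Sum>I\<leftarrow>Is. (sn (y I))\<^sup>2)"
  and \<xi>: "!!J. J : set Js ==> \<xi> J .: HH" and \<eta>: "!!I. I : set Is ==> \<eta> I .: HH"
 shows "cmod (\<Sum>I\<leftarrow>Is. \<Sum>J\<leftarrow>Js. hinner HH (\<pi> (\<beta> I J) (\<xi> J)) (\<eta> I))
  <= M * sqrt (\<Sum>J\<leftarrow>Js. (hnorm HH (\<xi> J))\<^sup>2) * sqrt (\<Sum>I\<leftarrow>Is. (hnorm HH (\<eta> I))\<^sup>2)"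
proof -
 have "\<exists>x. \<forall>J\<in>set Js. (\<forall>n. x J n .: A) & H.hconv (%n. hat (x J n)) (\<xi> J)"
  using hat_sequence[OF \<xi>] by (intro bchoice) blast
 then obtain x where x: "!!J n. J : set Js ==> x J n .: A" "!!J. J : set Js ==> H.hconv (%n. hat (x J n)) (\<xi> J)" by blast
 have "\<exists>y. \<forall>I\<in>set Is. (\<forall>n. y I n .: A) & H.hconv (%n. hat (y I n)) (\<eta> I)"
  using hat_sequence[OF \<eta>] by (intro bchoice) blast
 then obtain y where y: "!!I n. I : set Is ==> y I n .: A" "!!I. I : set Is ==> H.hconv (%n. hat (y I n)) (\<eta> I)" by blast
 have 1: "(%n. hinner HH (\<pi> (\<beta> I J) (hat (x J n))) (hat (y I m))) ----> hinner HH (\<pi> (\<beta> I J) (\<xi> J)) (hat (y I m))"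
  if "I : set Is" "J : set Js" for I J m
  by (rule H.hconv_inn_l[OF H.hconv_B[OF \<pi>_closed[OF \<beta>[OF that]] x(2)[OF that(2)]] hat_closed[OF y(1)[OF that(1)]]])
 have 2: "(%m. hinner HH (\<pi> (\<beta> I J) (\<xi> J)) (hat (y I m))) ----> hinner HH (\<pi> (\<beta> I J) (\<xi> J)) (\<eta> I)"
  if "I : set Is" "J : set Js" for I J
  by (rule H.hconv_inn_r[OF y(2)[OF that(1)] H.B_closed[OF \<pi>_closed[OF \<beta>[OF that]] \<xi>[OF that(2)]]])
 have "cmod (\<Sum>I\<leftarrow>Is. \<Sum>J\<leftarrow>Js. hinner HH (\<pi> (\<beta> I J) (\<xi> J)) (hat (y I m)))
   <= M * sqrt (\<Sum>J\<leftarrow>Js. (hnorm HH (\<xi> J))\<^sup>2) * sqrt (\<Sum>I\<leftarrow>Is. (hnorm HH (hat (y I m)))\<^sup>2)" for m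
 proof (rule LIMSEQ_le)
  show "(%n. cmod (\<Sum>I\<leftarrow>Is. \<Sum>J\<leftarrow>Js. hinner HH (\<pi> (\<beta> I J) (hat (x J n))) (hat (y I m))))
   ----> cmod (\<Sum>I\<leftarrow>Is. \<Sum>J\<leftarrow>Js. hinner HH (\<pi> (\<beta> I J) (\<xi> J)) (hat (y I m)))"
   by (intro tendsto_norm tendsto_sum_list 1)
  show "(%n. M * sqrt (\<Sum>J\<leftarrow>Js. (hnorm HH (hat (x J n)))\<^sup>2) * sqrt (\<Sum>I\<leftarrow>Is. (hnorm HH (hat (y I m)))\<^sup>2))
   ----> M * sqrt (\<Sum>J\<leftarrow>Js. (hnorm HH (\<xi> J))\<^sup>2) * sqrt (\<Sum>I\<leftarrow>Is. (hnorm HH (hat (y I m)))\<^sup>2)"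
   by (intro tendsto_mult tendsto_const tendsto_real_sqrt tendsto_sum_list tendsto_power H.hconv_hn[OF x(2)])
  have "cmod (\<Sum>I\<leftarrow>Is. \<Sum>J\<leftarrow>Js. hinner HH (\<pi> (\<beta> I J) (hat (x J n))) (hat (y I m)))
    <= M * sqrt (\<Sum>J\<leftarrow>Js. (hnorm HH (hat (x J n)))\<^sup>2) * sqrt (\<Sum>I\<leftarrow>Is. (hnorm HH (hat (y I m)))\<^sup>2)" for n
   using bound[of "%J. x J n" "%I. y I m"] \<beta> x y
   by (simp add: \<pi>_hat inn_hat ip_def H_norm_hat cong: map_cong)
  thus "\<exists>N. \<forall>n\<ge>N. cmod (\<Sum>I\<leftarrow>Is. \<Sum>J\<leftarrow>Js. hinner HH (\<pi> (\<beta> I J) (hat (x J n))) (hat (y I m)))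
    <= M * sqrt (\<Sum>J\<leftarrow>Js. (hnorm HH (hat (x J n)))\<^sup>2) * sqrt (\<Sum>I\<leftarrow>Is. (hnorm HH (hat (y I m)))\<^sup>2)"
   by blast
 qed
 moreover have "(%m. cmod (\<Sum>I\<leftarrow>Is. \<Sum>J\<leftarrow>Js. hinner HH (\<pi> (\<beta> I J) (\<xi> J)) (hat (y I m))))
   ----> cmod (\<Sum>I\<leftarrow>Is. \<Sum>J\<leftarrow>Js. hinner HH (\<pi> (\<beta> I J) (\<xi> J)) (\<eta> I))"
  by (intro tendsto_norm tendsto_sum_list 2)
 moreover have "(%m. M * sqrt (\<Sum>J\<leftarrow>Js. (hnorm HH (\<xi> J))\<^sup>2) * sqrt (\<Sum>I\<leftarrow>Is. (hnorm HH (hat (y I m)))\<^sup>2))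
   ----> M * sqrt (\<Sum>J\<leftarrow>Js. (hnorm HH (\<xi> J))\<^sup>2) * sqrt (\<Sum>I\<leftarrow>Is. (hnorm HH (\<eta> I))\<^sup>2)"
  by (intro tendsto_mult tendsto_const tendsto_real_sqrt tendsto_sum_list tendsto_power H.hconv_hn[OF y(2)])
 ultimately show ?thesis by (intro LIMSEQ_le) auto
qed

text \<open>The sum of squares is the pairing of the operator sum of R R* at \<open>v\<close> with
  \<open>v\<close>.\<close>

lemma row_vectors: assumes R: "!!I. I : set Is ==> R I .: BB" and v: "v .: HH"
 shows "sqrt (\<Sum>I\<leftarrow>Is. (hnorm HH (star BB (R I) v))\<^sup>2)
  <= sqrt (nrm BB (H.B.lsum (%I. R I **@BB star BB (R I)) Is)) * hnorm HH v"
proof -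
 let ?T = "H.B.lsum (%I. R I **@BB star BB (R I)) Is"
 have T: "?T .: BB" by (rule H.B.lsum_closed) (use R in simp)
 have cell: "hinner HH ((R I **@BB star BB (R I)) v) v = complex_of_real ((hnorm HH (star BB (R I) v))\<^sup>2)"
  if "I : set Is" for I
  using H.B_star[OF R[OF that], of "star BB (R I) v" v] H.inn_self[of "star BB (R I) v"] R[OF that] v by simp
 have "hinner HH (?T v) v = (\<Sum>I\<leftarrow>Is. hinner HH ((R I **@BB star BB (R I)) v) v)"
  by (rule H.inn_lsum) (use R v in simp_all)
 also have "... = (\<Sum>I\<leftarrow>Is. complex_of_real ((hnorm HH (star BB (R I) v))\<^sup>2))"
  by (intro arg_cong[of _ _ sum_list] map_cong refl cell)
 also have "... = complex_of_real (\<Sum>I\<leftarrow>Is. (hnorm HH (star BB (R I) v))\<^sup>2)"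
  by (induction Is) simp_all
 finally have eq: "hinner HH (?T v) v = complex_of_real (\<Sum>I\<leftarrow>Is. (hnorm HH (star BB (R I) v))\<^sup>2)" .
 have "(\<Sum>I\<leftarrow>Is. (hnorm HH (star BB (R I) v))\<^sup>2) <= cmod (hinner HH (?T v) v)"
  unfolding eq norm_of_real by (rule abs_ge_self)
 also have "... <= hnorm HH (?T v) * hnorm HH v" by (rule H.hCauchy_Schwarz) (use T v in simp_all)
 also have "... <= (nrm BB ?T * hnorm HH v) * hnorm HH v"
  by (rule mult_right_mono[OF H.B_nrm_apply[OF T v] H.hn_nonneg[OF v]])
 finally have "sqrt (\<Sum>I\<leftarrow>Is. (hnorm HH (star BB (R I) v))\<^sup>2) <= sqrt (nrm BB ?T * (hnorm HH v * hnorm HH v))"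
  by (simp add: mult.assoc)
 thus ?thesis using H.hn_nonneg[OF v] by (simp add: real_sqrt_mult)
qed

text \<open>Pairing with v and w moves the rows and columns to the vectors, where
  \<open>form_bound_vectors\<close> applies to the images of v and w under the adjoints;
  \<open>row_vectors\<close> measures these families.\<close>

lemma form_bound_operators:
 fixes Is :: "'i list" and Js :: "'j list" assumes \<beta>: "!!I J. I : set Is ==> J : set Js ==> \<beta> I J .: A"
  and bound: "!!x y. (!!J. J : set Js ==> x J .: A) ==> (!!I. I : set Is ==> y I .: A) ==>
   cmod (\<Sum>I\<leftarrow>Is. \<Sum>J\<leftarrow>Js. \<rho> (sA (y I) ** (\<beta> I J ** x J)))
    <= M * sqrt (\<Sum>J\<leftarrow>Js. (sn (x J))\<^sup>2) * sqrt (\<Sum>I\<leftarrow>Is. (sn (y I))\<^sup>2)"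
  and R: "!!I. I : set Is ==> R I .: BB" and S: "!!J. J : set Js ==> S J .: BB" and M: "0 <= M"
 shows "nrm BB (H.B.lsum (%I. H.B.lsum (%J. R I **@BB (\<pi> (\<beta> I J) **@BB star BB (S J))) Js) Is)
  <= M * sqrt (nrm BB (H.B.lsum (%J. S J **@BB star BB (S J)) Js))
    * sqrt (nrm BB (H.B.lsum (%I. R I **@BB star BB (R I)) Is))"
  (is "nrm _ ?Z <= M * sqrt ?s * sqrt ?r")
proof (rule H.B_nrm_le_inn)
 have c: "R I **@BB (\<pi> (\<beta> I J) **@BB star BB (S J)) .: BB" if "I : set Is" "J : set Js" for I J
  using that R S \<pi>_closed[OF \<beta>] by simp
 have c': "H.B.lsum (%J. R I **@BB (\<pi> (\<beta> I J) **@BB star BB (S J))) Js .: BB" if "I : set Is" for I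
  by (rule H.B.lsum_closed) (rule c[OF that])
 show "?Z .: BB" by (rule H.B.lsum_closed) (rule c')
 have "?s >= 0" "?r >= 0" by (intro H.B.nrm_nonneg H.B.lsum_closed H.B.m_closed H.B.star_closed R S; assumption)+
 thus "0 <= M * sqrt ?s * sqrt ?r" using M by simp
 fix v w assume v: "v .: HH" and w: "w .: HH"
 have "hinner HH (?Z v) w = (\<Sum>I\<leftarrow>Is. hinner HH (H.B.lsum (%J. R I **@BB (\<pi> (\<beta> I J) **@BB star BB (S J))) Js v) w)"
  by (rule H.inn_lsum[OF v w]) (rule c')
 also have "... = (\<Sum>I\<leftarrow>Is. \<Sum>J\<leftarrow>Js. hinner HH ((R I **@BB (\<pi> (\<beta> I J) **@BB star BB (S J))) v) w)"
  by (intro arg_cong[of _ _ sum_list] map_cong refl H.inn_lsum[OF v w] c)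
 also have "... = (\<Sum>I\<leftarrow>Is. \<Sum>J\<leftarrow>Js. hinner HH (\<pi> (\<beta> I J) (star BB (S J) v)) (star BB (R I) w))"
 proof (intro arg_cong[of _ _ sum_list] map_cong refl)
  fix I J assume IJ: "I : set Is" "J : set Js"
  have "\<pi> (\<beta> I J) (star BB (S J) v) .: HH" using \<pi>_closed[OF \<beta>[OF IJ]] S[OF IJ(2)] v by simp
  thus "hinner HH ((R I **@BB (\<pi> (\<beta> I J) **@BB star BB (S J))) v) w
   = hinner HH (\<pi> (\<beta> I J) (star BB (S J) v)) (star BB (R I) w)" using H.B_star[OF R[OF IJ(1)]] v w by simp
 qed
 also have "cmod ... <= M * sqrt (\<Sum>J\<leftarrow>Js. (hnorm HH (star BB (S J) v))\<^sup>2) * sqrt (\<Sum>I\<leftarrow>Is. (hnorm HH (star BB (R I) w))\<^sup>2)"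
  by (rule form_bound_vectors[OF \<beta> bound]) (use R S v w in auto)
 also have "... <= M * (sqrt ?s * hnorm HH v) * (sqrt ?r * hnorm HH w)" using M \<open>?s >= 0\<close> v
  by (intro mult_mono mult_left_mono row_vectors R S v w mult_nonneg_nonneg real_sqrt_ge_zero sum_list_nonneg) auto
 finally show "cmod (hinner HH (?Z v) w) <= M * sqrt ?s * sqrt ?r * hnorm HH v * hnorm HH w" by (simp add: mult_ac)
qed

end

lemma (in cstar_ultra) uc_lsum:
 "(!!x. x : set xs ==> f x : LL) ==>
  (%i. lsum (%x. f x i) xs) : LL & U.lsum (%x. uc (f x)) xs = uc (%i. lsum (%x. f x i) xs)"
 by (induction xs) (simp_all add: X_zero X_add LL_add LL_const)

text \<open>Two families over one index set: \<open>hf\<close> lies in the algebra,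
  \<open>lf\<close> only among the operators on its GNS space. Accordingly two ultrapowers are used,
  linked by the extension of the GNS representation. Vacuum and covariance relations hold in the
  limit only.\<close>

locale approx_creation = state_ultra A \<rho> \<omega> for A :: "'a cstar" (structure) and \<rho> and \<omega> :: "'i filter" +
 fixes hf :: "'i => 'a" and lf :: "'i => (nat => 'a) set => (nat => 'a) set"
 assumes inj: "inj_on (gns_rep A \<rho>) (carrier A)" and hf: "!!i. hf i .: A" "!!i. nA (hf i) <= 4"
  and lf: "!!i. lf i .: (BH (L2 A \<rho>))" "!!i. nrm (BH (L2 A \<rho>)) (lf i) <= 2"
  and \<pi>_hf: "!!i. gns_rep A \<rho> (hf i) = lf i .+@(BH (L2 A \<rho>)) star (BH (L2 A \<rho>)) (lf i)"
  and cov_lim: "!!x. x .: A ==> ((%i. nrm (BH (L2 A \<rho>)) (star (BH (L2 A \<rho>)) (lf i) **@(BH (L2 A \<rho>))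
   (gns_rep A \<rho> x **@(BH (L2 A \<rho>)) lf i) .-@(BH (L2 A \<rho>)) \<rho> x *.@(BH (L2 A \<rho>)) 1@(BH (L2 A \<rho>)))) ---> 0) \<omega>"
  and vac_lim: "!!x. x .: A ==>
   ((%i. hnorm (L2 A \<rho>) (star (BH (L2 A \<rho>)) (lf i) (gns_rel A \<rho> `` {%_. x}))) ---> 0) \<omega>"

sublocale approx_creation \<subseteq> UH: ultra_hom A "BH (L2 A \<rho>)" "gns_rep A \<rho>" \<omega>
 by (rule ultra_hom.intro[OF GNS.cstar_hom_pair_axioms ultra_axioms])

context approx_creation
begin

definition vec :: "((nat => 'a) set => (nat => 'a) set) => complex"
 where "vec T = hinner HH (T (hat \<one>)) (hat \<one>)"

lemma vec_state: "cstar_state BB vec" unfolding vec_def by (rule H.vector_state) (simp_all add: H_norm_hat)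

lemma vec_\<pi>: "x .: A ==> vec (\<pi> x) = \<rho> x" by (simp add: vec_def \<pi>_hat inn_hat ip_def)

end

sublocale approx_creation \<subseteq> V: state_ultra "BH (L2 A \<rho>)" vec \<omega>
 by (rule state_ultra.intro[OF vec_state ultra_axioms])

context approx_creation
begin

abbreviation "YY == ultrapower (BH (L2 A \<rho>)) \<omega>"
abbreviation "\<psi> == ultra_state vec \<omega>"

definition \<phi> :: "'a => ('i => (nat => 'a) set => (nat => 'a) set) set" where "\<phi> x = UH.UB.uc (%_. \<pi> x)"

lemma \<pi>_LL: "x .: A ==> (%_. \<pi> x) : UH.UB.LL" by (rule UH.UB.LL_const) (rule \<pi>_closed)

lemma \<phi>_hom: "x .: A ==> \<phi> x .: YY"
 "x .: A ==> y .: A ==> \<phi> (x .+ y) = \<phi> x .+@YY \<phi> y"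
 "x .: A ==> y .: A ==> \<phi> (x ** y) = \<phi> x **@YY \<phi> y"
 "x .: A ==> \<phi> (c *. x) = c *.@YY \<phi> x"
 "x .: A ==> \<phi> (sA x) = star YY (\<phi> x)" "\<phi> \<one> = 1@YY"
 unfolding \<phi>_def by (simp_all add: \<pi>_LL UH.UB.X_add UH.UB.X_mult UH.UB.X_smult UH.UB.X_star UH.UB.X_one)

lemma \<psi>_\<phi>: "x .: A ==> \<psi> (\<phi> x) = \<rho> x"
 unfolding \<phi>_def by (subst V.ultra_state_diag) (simp_all add: \<pi>_closed vec_\<pi>)

lemma lf_LL: "lf : UH.UB.LL" by (rule UH.UB.LL_I) (rule lf)+

lemma sn_\<phi>: "x .: A ==> gns_seminorm YY \<psi> (\<phi> x) = sn x"
 using \<phi>_hom(3)[of "sA x" x] \<phi>_hom(5)[of x] \<psi>_\<phi>[of "sA x ** x"] by (simp add: gns_seminorm_def)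

text \<open>Passing to classes makes the limit relations for \<open>lf\<close> exact. For the matrix
  bound, the entries are classes of constant families of the algebra, so the hypothesis, read on
  constant vectors, is an estimate in the algebra itself and can be used in every coordinate before
  taking the limit.\<close>

lemma fock: "fock YY \<psi> (\<phi> ` carrier A) (UH.UB.uc lf)"
proof (rule fock.intro[OF V.US.cstar_state_axioms], unfold_locales)
 let ?K = "\<phi> ` carrier A" and ?l = "UH.UB.uc lf"
 show "?K <= carrier YY" using \<phi>_hom(1) by blast
 show "1@YY : ?K" using \<phi>_hom(6) one_closed by (metis image_eqI)
 show "x .+@YY y : ?K" "x **@YY y : ?K" if "x : ?K" "y : ?K" for x y
  using that by (auto simp: \<phi>_hom(2,3)[symmetric])
 show "c *.@YY x : ?K" "star YY x : ?K" if "x : ?K" for x c using that by (auto simp: \<phi>_hom(4,5)[symmetric])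
 show "?l .: YY" by (rule UH.UB.uc_closed[OF lf_LL])
 show "star YY ?l **@YY (x **@YY ?l) = \<psi> x *.@YY 1@YY" if x: "x : ?K" for x proof -
  obtain a where a: "a .: A" "x = \<phi> a" using x by blast
  note LL = UH.UB.LL_mult[OF UH.UB.LL_star[OF lf_LL] UH.UB.LL_mult[OF \<pi>_LL[OF a(1)] lf_LL]]
  have "star YY ?l **@YY (x **@YY ?l) = UH.UB.uc (%i. star BB (lf i) **@BB (\<pi> a **@BB lf i))"
   unfolding a(2) \<phi>_def using lf_LL \<pi>_LL[OF a(1)] by (simp add: UH.UB.X_star UH.UB.X_mult UH.UB.LL_star UH.UB.LL_mult)
  also have "... = UH.UB.uc (%i. \<rho> a *.@BB 1@BB)"
   by (subst UH.UB.uc_eq_iff[OF LL UH.UB.LL_const]) (use cov_lim[OF a(1)] in simp_all)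
  also have "... = \<psi> x *.@YY 1@YY"
   using \<psi>_\<phi>[OF a(1)] a(2) by (simp add: UH.UB.X_one UH.UB.X_smult UH.UB.LL_const)
  finally show ?thesis .
 qed
 show "\<psi> (y **@YY (star YY ?l **@YY x)) = 0" if y: "y .: YY" and x: "x : ?K" for y x proof -
  obtain a where a: "a .: A" "x = \<phi> a" using x by blast
  obtain t where t: "t : UH.UB.LL" "y = UH.UB.uc t" by (rule UH.UB.X_cases[OF y])
  obtain k where k: "k >= 0" "!!i. nrm BB (t i) <= k" by (rule UH.UB.LL_bound[OF t(1)]) blast
  note LL = UH.UB.LL_mult[OF t(1) UH.UB.LL_mult[OF UH.UB.LL_star[OF lf_LL] \<pi>_LL[OF a(1)]]]
  have "y **@YY (star YY ?l **@YY x) = UH.UB.uc (%i. t i **@BB (star BB (lf i) **@BB \<pi> a))"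
   unfolding a(2) \<phi>_def t(2) using lf_LL \<pi>_LL[OF a(1)] t(1) by (simp add: UH.UB.X_star UH.UB.X_mult UH.UB.LL_star UH.UB.LL_mult)
  moreover have "((%i. vec (t i **@BB (star BB (lf i) **@BB \<pi> a))) ---> 0) \<omega>" proof -
   have le: "cmod (vec (t i **@BB (star BB (lf i) **@BB \<pi> a))) <= k * hnorm HH (star BB (lf i) (hat a))" for i
   proof -
    have tc: "t i .: BB" "star BB (lf i) (hat a) .: HH" using UH.UB.LL_carrier[OF t(1)] lf(1) a(1) by simp_all
    have "cmod (vec (t i **@BB (star BB (lf i) **@BB \<pi> a))) <= hnorm HH (t i (star BB (lf i) (hat a))) * 1"
     using H.hCauchy_Schwarz[of "t i (star BB (lf i) (hat a))" "hat \<one>"] tc a(1)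
     by (simp add: vec_def \<pi>_hat H_norm_hat)
    also have "... <= nrm BB (t i) * hnorm HH (star BB (lf i) (hat a))" using H.B_nrm_apply[OF tc] by simp
    also have "... <= k * hnorm HH (star BB (lf i) (hat a))" by (rule mult_right_mono[OF k(2) H.hn_nonneg[OF tc(2)]])
    finally show ?thesis .
   qed
   have "((%i. cmod (vec (t i **@BB (star BB (lf i) **@BB \<pi> a)))) ---> 0) \<omega>"
    by (rule ulim_squeeze_0[OF tendsto_mult_right_zero[OF vac_lim[OF a(1)], of k] norm_ge_zero le])
   thus ?thesis by (rule tendsto_norm_zero_cancel)
  qed
  ultimately show ?thesis using V.ultra_state_eq[OF LL] by simp
 qed
 fix Is Js :: "('i => (nat => 'a) set => (nat => 'a) set) set list list" and b R S and M :: real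
 assume b: "!!I J. I : set Is ==> J : set Js ==> b I J : ?K"
  and R: "!!I. I : set Is ==> R I .: YY" and S: "!!J. J : set Js ==> S J .: YY"
  and R1: "nrm YY (UH.UB.U.lsum (%I. R I **@YY star YY (R I)) Is) <= 1"
  and S1: "nrm YY (UH.UB.U.lsum (%J. S J **@YY star YY (S J)) Js) <= 1" and M: "0 <= M"
  and bound: "!!x y. (!!J. J : set Js ==> x J : ?K) ==> (!!I. I : set Is ==> y I : ?K) ==>
    cmod (\<Sum>I\<leftarrow>Is. \<Sum>J\<leftarrow>Js. \<psi> (star YY (y I) **@YY (b I J **@YY x J)))
     <= M * sqrt (\<Sum>J\<leftarrow>Js. (gns_seminorm YY \<psi> (x J))\<^sup>2) * sqrt (\<Sum>I\<leftarrow>Is. (gns_seminorm YY \<psi> (y I))\<^sup>2)"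
 define \<beta> where "\<beta> I J = (SOME x. x .: A & b I J = \<phi> x)" for I J
 have \<beta>: "\<beta> I J .: A" "b I J = \<phi> (\<beta> I J)" if "I : set Is" "J : set Js" for I J
  using someI_ex[of "%x. x .: A & b I J = \<phi> x"] b[OF that] unfolding \<beta>_def by blast+
 have ex: "\<exists>a. a : UH.UB.LL & U = UH.UB.uc a" if "U .: YY" for U by (rule UH.UB.X_cases[OF that]) blast
 define r where "r I = (SOME a. a : UH.UB.LL & R I = UH.UB.uc a)" for I
 define s where "s J = (SOME a. a : UH.UB.LL & S J = UH.UB.uc a)" for J
 have r: "r I : UH.UB.LL" "R I = UH.UB.uc (r I)" if "I : set Is" for I
  using someI_ex[OF ex[OF R[OF that]]] unfolding r_def by simp_all
 have s: "s J : UH.UB.LL" "S J = UH.UB.uc (s J)" if "J : set Js" for J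
  using someI_ex[OF ex[OF S[OF that]]] unfolding s_def by simp_all
 have b\<beta>: "b I J = UH.UB.uc (%_. \<pi> (\<beta> I J))" if "I : set Is" "J : set Js" for I J
  using \<beta>[OF that] by (simp add: \<phi>_def)
 let ?Z = "%i. H.B.lsum (%I. H.B.lsum (%J. r I i **@BB (\<pi> (\<beta> I J) **@BB star BB (s J i))) Js) Is"
 let ?Tr = "%i. H.B.lsum (%I. r I i **@BB star BB (r I i)) Is" and ?Ts = "%i. H.B.lsum (%J. s J i **@BB star BB (s J i)) Js"
 have rowL: "?Tr : UH.UB.LL & UH.UB.U.lsum (%I. R I **@YY star YY (R I)) Is = UH.UB.uc ?Tr" proof -
  have "UH.UB.U.lsum (%I. R I **@YY star YY (R I)) Is = UH.UB.U.lsum (%I. UH.UB.uc (%i. r I i **@BB star BB (r I i))) Is"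
   by (rule UH.UB.U.lsum_cong) (use r in "simp add: UH.UB.X_star UH.UB.X_mult UH.UB.LL_star")
  thus ?thesis using UH.UB.uc_lsum[of Is "%I i. r I i **@BB star BB (r I i)"] r by (simp add: UH.UB.LL_mult UH.UB.LL_star)
 qed
 have colL: "?Ts : UH.UB.LL & UH.UB.U.lsum (%J. S J **@YY star YY (S J)) Js = UH.UB.uc ?Ts" proof -
  have "UH.UB.U.lsum (%J. S J **@YY star YY (S J)) Js = UH.UB.U.lsum (%J. UH.UB.uc (%i. s J i **@BB star BB (s J i))) Js"
   by (rule UH.UB.U.lsum_cong) (use s in "simp add: UH.UB.X_star UH.UB.X_mult UH.UB.LL_star")
  thus ?thesis using UH.UB.uc_lsum[of Js "%J i. s J i **@BB star BB (s J i)"] s by (simp add: UH.UB.LL_mult UH.UB.LL_star)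
 qed
 have ZL: "?Z : UH.UB.LL & UH.UB.U.lsum (%I. UH.UB.U.lsum (%J. R I **@YY (b I J **@YY star YY (S J))) Js) Is = UH.UB.uc ?Z"
 proof -
  have c: "(%i. r I i **@BB (\<pi> (\<beta> I J) **@BB star BB (s J i))) : UH.UB.LL" if "I : set Is" "J : set Js" for I J
   by (intro UH.UB.LL_mult r UH.UB.LL_star s \<pi>_LL \<beta> that)
  have "UH.UB.U.lsum (%J. R I **@YY (b I J **@YY star YY (S J))) Js
   = UH.UB.U.lsum (%J. UH.UB.uc (%i. r I i **@BB (\<pi> (\<beta> I J) **@BB star BB (s J i)))) Js" if I: "I : set Is" for I
   by (rule UH.UB.U.lsum_cong) (use r[OF I] s b\<beta>[OF I] \<pi>_LL[OF \<beta>(1)[OF I]] in "simp add: UH.UB.X_star UH.UB.X_mult UH.UB.LL_star UH.UB.LL_mult")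
  hence "UH.UB.U.lsum (%I. UH.UB.U.lsum (%J. R I **@YY (b I J **@YY star YY (S J))) Js) Is
   = UH.UB.U.lsum (%I. UH.UB.uc (%i. H.B.lsum (%J. r I i **@BB (\<pi> (\<beta> I J) **@BB star BB (s J i))) Js)) Is"
   using UH.UB.uc_lsum[of Js "%J i. r I i **@BB (\<pi> (\<beta> I J) **@BB star BB (s J i))" for I] c
   by (intro UH.UB.U.lsum_cong) simp
  thus ?thesis
   using UH.UB.uc_lsum[of Is "%I i. H.B.lsum (%J. r I i **@BB (\<pi> (\<beta> I J) **@BB star BB (s J i))) Js"]
    UH.UB.uc_lsum[of Js "%J i. r I i **@BB (\<pi> (\<beta> I J) **@BB star BB (s J i))" for I] c by simp
 qed
 \<comment> \<open>The bound given for classes of constant families becomes a bound for the state of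
   the algebra, since the diagonal embedding preserves states and seminorms.\<close>
 have form: "cmod (\<Sum>I\<leftarrow>Is. \<Sum>J\<leftarrow>Js. \<rho> (sA (y I) ** (\<beta> I J ** x J)))
    <= M * sqrt (\<Sum>J\<leftarrow>Js. (sn (x J))\<^sup>2) * sqrt (\<Sum>I\<leftarrow>Is. (sn (y I))\<^sup>2)"
  if x: "!!J. J : set Js ==> x J .: A" and y: "!!I. I : set Is ==> y I .: A" for x y proof -
  have "\<psi> (star YY (\<phi> (y I)) **@YY (b I J **@YY \<phi> (x J))) = \<rho> (sA (y I) ** (\<beta> I J ** x J))"
   if "I : set Is" "J : set Js" for I J proof -
   have c: "sA (y I) .: A" "\<beta> I J ** x J .: A" using \<beta>[OF that] x[OF that(2)] y[OF that(1)] by simp_all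
   show ?thesis
    using \<phi>_hom(3)[OF c] \<phi>_hom(5)[OF y[OF that(1)]] \<phi>_hom(3)[OF \<beta>(1)[OF that] x[OF that(2)]] \<beta>(2)[OF that]
     \<psi>_\<phi>[OF m_closed[OF c]] by simp
  qed
  thus ?thesis using bound[of "%J. \<phi> (x J)" "%I. \<phi> (y I)"] x y by (simp add: sn_\<phi> cong: map_cong)
 qed
 have "nrm BB (?Z i) <= M * sqrt (nrm BB (?Ts i)) * sqrt (nrm BB (?Tr i))" for i
  by (rule form_bound_operators[OF \<beta>(1) form]) (use r s M UH.UB.LL_carrier in auto)
 hence "nrm YY (UH.UB.uc ?Z) <= M * sqrt (nrm YY (UH.UB.uc ?Ts)) * sqrt (nrm YY (UH.UB.uc ?Tr))"
  by (intro tendsto_le[OF nontriv tendsto_mult[OF tendsto_mult[OF tendsto_const tendsto_real_sqrt[OF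
    UH.UB.uc_nrm_lim[OF conjunct1[OF colL]]]] tendsto_real_sqrt[OF UH.UB.uc_nrm_lim[OF conjunct1[OF rowL]]]]
    UH.UB.uc_nrm_lim[OF conjunct1[OF ZL]]] always_eventually allI)
 also have "... <= M * 1 * 1" using R1 S1 rowL colL M UH.UB.U.nrm_nonneg
  by (intro mult_mono mult_left_mono mult_nonneg_nonneg) auto
 finally show "nrm YY (UH.UB.U.lsum (%I. UH.UB.U.lsum (%J. R I **@YY (b I J **@YY star YY (S J))) Js) Is) <= M"
  using ZL by simp
qed

end

context cstar_hom_pair
begin

lemma preimage_subalgebra: assumes C: "unital_cstar_subalgebra C B"
 shows "unital_cstar_subalgebra {x \<in> carrier A. f x : C} A"
proof -
 note D = B.unital_cstar_subalgebraD[OF C]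
 show ?thesis proof (rule A.unital_cstar_subalgebraI)
  fix s x assume s: "!!n. s n : {x \<in> carrier A. f x : C}" and x: "A.converges s x"
  have c: "s n .: A" "f (s n) : C" "x .: A" for n using s x by (auto simp: A.converges_def)
  have "(%n. nrm B (f (s n) .-@B f x)) ----> 0" by (rule LIMSEQ_squeeze_0[of "%n. nA (s n .-@A x)"])
    (use x c hom_contractive[of "s n .-@A x" for n] B.nrm_nonneg in "auto simp: A.converges_def")
  hence "B.converges (%n. f (s n)) (f x)" using c by (simp add: B.converges_def)
  hence "f x : C" by (rule D(8)[OF c(2)])
  thus "x : {x \<in> carrier A. f x : C}" using c by simp
 qed (use D(2,4-7) in auto)
qed

lemma generated_image: assumes "unital_cstar_subalgebra C B" "S <= carrier A" "f ` S <= C"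
 shows "f ` cstar_generated A S <= C"
 using A.cstar_generated_least[OF preimage_subalgebra[OF assms(1)], of S] assms(2,3) by blast

end

lemma (in cstar_state) inj_gnsI: assumes null: "!!x. x .: A ==> (!!v. v .: A ==> sn (x ** v) = 0) ==> x = \<zero>"
 shows "inj_on \<pi> (carrier A)"
proof (rule inj_onI)
 fix x y assume x: "x .: A" and y: "y .: A" and eq: "\<pi> x = \<pi> y"
 have "sn ((x .- y) ** v) = 0" if v: "v .: A" for v proof -
  have "hat ((x .- y) ** v) = \<pi> x (hat v) .-@HH \<pi> y (hat v)" using \<pi>_hat[of "x .- y" v] x y v by simp
  moreover have "\<pi> y (hat v) .-@HH \<pi> y (hat v) = 0@HH"
   using H.diff_eq_zero_iff H.B_closed[OF \<pi>_closed[OF y] hat_closed[OF v]] by blast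
  ultimately have "hnorm HH (hat ((x .- y) ** v)) = 0" by (simp add: eq)
  thus ?thesis using x y v H_norm_hat[of "(x .- y) ** v"] by simp
 qed
 from null[OF _ this] show "x = y" using x y by (simp add: diff_eq_zero_iff)
qed

sublocale approx_creation \<subseteq> FK: fock "ultrapower (BH (L2 A \<rho>)) \<omega>" "ultra_state vec \<omega>" "\<phi> ` carrier A" "ultra_class (BH (L2 A \<rho>)) \<omega> lf"
 by (rule fock)

context approx_creation
begin

section \<open>Return to the ultrapower of the algebra\<close>

abbreviation "\<Theta> == UH.umap"
abbreviation "J == %x. uc (%_. x)"

lemma \<Theta>_eq_zero: "U .: UU ==> \<Theta> U = 0@YY ==> U = 0@UU"
 using UH.umap_isometric[OF \<pi>_isometric[OF inj], of U] U.nrm_eq_0_iff[of U] by simp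

lemma \<psi>_\<Theta>: assumes "U .: UU" shows "\<psi> (\<Theta> U) = \<rho>\<^sub>\<omega> U"
proof -
 obtain a where a: "a : LL" "U = uc a" by (rule X_cases[OF assms])
 have "((%i. vec (\<pi> (a i))) ---> \<rho>\<^sub>\<omega> (uc a)) \<omega>"
  using ultra_state_lim[OF a(1)] LL_carrier[OF a(1)] by (simp add: vec_\<pi>)
 from V.ultra_state_eq[OF UH.LL_map[OF a(1)] this] show ?thesis unfolding a(2) UH.umap_uc[OF a(1)] .
qed

lemma sn_\<Theta>: "U .: UU ==> V.US.sn (\<Theta> U) = US.sn U"
 using \<psi>_\<Theta>[of "star UU U **@UU U"] by (simp add: gns_seminorm_def)

lemma hf_LL: "hf : LL" by (rule LL_I) (rule hf)+

lemma \<Theta>_h: "\<Theta> (uc hf) = UH.UB.uc lf .+@YY star YY (UH.UB.uc lf)"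
 unfolding UH.umap_uc[OF hf_LL] \<pi>_hf using lf_LL by (simp add: UH.UB.X_star UH.UB.X_add UH.UB.LL_star)

lemma J_closed: "x .: A ==> J x .: UU" by (rule uc_closed[OF LL_const])

lemma \<Theta>_J: "x .: A ==> \<Theta> (J x) = \<phi> x" unfolding \<phi>_def by (rule UH.umap_uc[OF LL_const])

text \<open>Wick words are written with l, which is not in the image of \<open>\<Theta>\<close>. By
  the recurrence behind \<open>W_mem\<close>, however, they are polynomials in their letters and l +
  l*, and both have preimages in \<open>D\<close>.\<close>

lemma SP_image:
 assumes D: "unital_cstar_subalgebra D UU" "uc hf : D" and G: "G <= \<phi> ` carrier A" "G <= \<Theta> ` D"
 shows "FK.SP (FK.wl G n) <= \<Theta> ` D"
proof -
 note DD = U.unital_cstar_subalgebraD[OF D(1)]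
 have c: "U .: UU" if "U : D" for U using DD(1) that by blast
 have op: "x .+@YY y : \<Theta> ` D" "x **@YY y : \<Theta> ` D" "x .-@YY y : \<Theta> ` D" "k *.@YY x : \<Theta> ` D"
  if xy: "x : \<Theta> ` D" "y : \<Theta> ` D" for x y k proof -
  obtain u v where u: "u : D" "x = \<Theta> u" and v: "v : D" "y = \<Theta> v" using xy by blast
  show "x .+@YY y : \<Theta> ` D" using UH.UM.hom_simps(2)[OF c[OF u(1)] c[OF v(1)]] u v DD(4)[OF u(1) v(1)] by (metis image_eqI)
  show "x **@YY y : \<Theta> ` D" using UH.UM.hom_simps(3)[OF c[OF u(1)] c[OF v(1)]] u v DD(5)[OF u(1) v(1)] by (metis image_eqI)
  show "x .-@YY y : \<Theta> ` D" using UH.UM.hom_diff[OF c[OF u(1)] c[OF v(1)]] u v DD(10)[OF u(1) v(1)] by (metis image_eqI)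
  show "k *.@YY x : \<Theta> ` D" using UH.UM.hom_simps(4)[OF c[OF u(1)]] u DD(6)[OF u(1)] by (metis image_eqI)
 qed
 have zero: "0@YY : \<Theta> ` D" using UH.UM.hom_zero DD(3) by (metis image_eqI)
 have h: "UH.UB.uc lf .+@YY star YY (UH.UB.uc lf) : \<Theta> ` D" using \<Theta>_h D(2) by (metis image_eqI)
 have W: "FK.W w : \<Theta> ` D" if "set w <= G" for w
  by (rule FK.W_mem[OF zero h op(2) op(3) op(4)]) (assumption+, use G that in blast)
 have "UH.UB.U.lsum FK.W ws : \<Theta> ` D" if "\<forall>w\<in>set ws. set w <= G" for ws
  using that by (induction ws) (simp_all add: zero op(1) W)
 thus ?thesis unfolding FK.SP_def FK.wl_def by blast
qed

end

context approx_creation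
begin

text \<open>The map \<open>\<Theta>\<close> is injective and preserves states. An element of
  \<open>D\<close> in the kernel of the GNS representation is sent to one that annihilates all
  vectors from Wick polynomials, and \<open>faithful\<close> applies to it. The same argument serves
  the free product and its second factor.\<close>

lemma prob_space_sub:
 assumes D: "unital_cstar_subalgebra D UU" and img: "\<Theta> ` D <= FK.PC G" "!!n. FK.SP (FK.wl G n) <= \<Theta> ` D"
  and faithful: "!!x. x : FK.PC G ==> (!!n v. v : FK.SP (FK.wl G n) ==> V.US.sn (x **@YY v) = 0) ==> x = 0@YY"
 shows "cstar_prob_space (U.restr D) \<rho>\<^sub>\<omega>"
proof -
 have Dc: "x .: UU" if "x : D" for x using U.unital_cstar_subalgebraD(1)[OF D] that by blast
 note st = U.restr_cstar_algebra[OF D] US.restr_state[OF D]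
 have cs: "cstar_state (U.restr D) \<rho>\<^sub>\<omega>" by (rule cstar_state.intro[OF st(1) cstar_state_axioms.intro[OF st(2)]])
 have "inj_on (gns_rep (U.restr D) \<rho>\<^sub>\<omega>) (carrier (U.restr D))"
 proof (rule cstar_state.inj_gnsI[OF cs])
  fix x assume "x .: (U.restr D)"
   and "!!v. v .: (U.restr D) ==> gns_seminorm (U.restr D) \<rho>\<^sub>\<omega> (x **@(U.restr D) v) = 0"
  hence x: "x : D" and null: "!!v. v : D ==> US.sn (x **@UU v) = 0" by (simp_all add: gns_seminorm_def)
  have "\<Theta> x = 0@YY" proof (rule faithful)
   show "\<Theta> x : FK.PC G" using img(1) x by blast
   fix n v assume "v : FK.SP (FK.wl G n)"
   then obtain u where u: "u : D" "v = \<Theta> u" using img(2) by blast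
   have "\<Theta> x **@YY v = \<Theta> (x **@UU u)" using UH.UM.hom_simps(3)[OF Dc[OF x] Dc[OF u(1)]] u(2) by simp
   thus "V.US.sn (\<Theta> x **@YY v) = 0"
    using sn_\<Theta>[OF U.m_closed[OF Dc[OF x] Dc[OF u(1)]]] null[OF u(1)] by simp
  qed
  hence "x = 0@UU" by (rule \<Theta>_eq_zero[OF Dc[OF x]])
  thus "x = 0@(U.restr D)" by simp
 qed
 thus ?thesis using st by (simp add: cstar_prob_space_def)
qed

text \<open>Freeness is read off in the larger ultrapower: \<open>\<Theta>\<close> turns an
  alternating centred product into one of the products treated by \<open>free_words\<close>, and the
  state does not change.\<close>

lemma free_sub: assumes D: "unital_cstar_subalgebra D UU" and C: "C <= carrier UU" "\<Theta> ` C <= FK.PC FK.sc"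
 shows "free_family (U.restr D) \<rho>\<^sub>\<omega> (%first. if first then J ` carrier A else C)"
 unfolding free_family_def
proof (intro allI impI, elim conjE)
 fix w :: "(bool \<times> ('i => 'a) set) list"
 assume w: "w ~= []" "distinct_adj (map fst w)"
  and el: "\<forall>(k, x)\<in>set w. x : (if k then J ` carrier A else C) & \<rho>\<^sub>\<omega> x = 0"
 have c: "x .: UU" if "(k, x) : set w" for k x proof -
  have "x : (if k then J ` carrier A else C)" using bspec[OF el that] by simp
  thus ?thesis using C(1) J_closed by (cases k) auto
 qed
 have f: "foldr (%x y. x **@UU y) (map snd v) 1@UU .: UU &
  \<Theta> (foldr (%x y. x **@UU y) (map snd v) 1@UU)
   = foldr (%x y. x **@YY y) (map snd (map (%(k, x). (k, \<Theta> x)) v)) 1@YY" if "set v <= set w" for v using that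
 proof (induction v)
  case (Cons kx v)
  obtain k x where [simp]: "kx = (k, x)" by (cases kx)
  have xc: "x .: UU" using c[of k x] Cons(2) by simp
  show ?case using Cons xc UH.UM.hom_simps(3)[OF xc] by simp
 qed simp
 let ?w = "map (%(k, x). (k, \<Theta> x)) w"
 have fst: "map fst ?w = map fst w" by (simp add: case_prod_beta)
 have el': "\<forall>(k, x)\<in>set ?w. x : (if k then \<phi> ` carrier A else FK.PC FK.sc) & \<psi> x = 0"
 proof clarify
  fix k y assume "(k, y) : set ?w"
  then obtain x where x: "(k, x) : set w" "y = \<Theta> x" by auto
  have "x : (if k then J ` carrier A else C)" "\<rho>\<^sub>\<omega> x = 0" using bspec[OF el x(1)] by simp_all
  thus "y : (if k then \<phi> ` carrier A else FK.PC FK.sc) & \<psi> y = 0"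
   using x(2) C(2) \<Theta>_J \<psi>_\<Theta>[OF c[OF x(1)]] by (cases k) auto
 qed
 have "?w ~= []" "distinct_adj (map fst ?w)" unfolding fst using w by simp_all
 note mem = FK.free_words[OF this el']
 have "\<rho>\<^sub>\<omega> (foldr (%x y. x **@UU y) (map snd w) 1@UU)
  = \<psi> (\<Theta> (foldr (%x y. x **@UU y) (map snd w) 1@UU))"
  by (rule \<psi>_\<Theta>[OF conjunct1[OF f[OF order_refl]], symmetric])
 also have "... = 0" unfolding conjunct2[OF f[OF order_refl]] by (rule FK.\<rho>_VV[OF mem])
 finally have "\<rho>\<^sub>\<omega> (foldr (%x y. x **@UU y) (map snd w) 1@UU) = 0" .
 thus "\<rho>\<^sub>\<omega> (foldr (%x y. x **@(U.restr D) y) (map snd w) 1@(U.restr D)) = 0" by simp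
qed

text \<open>Everything is found inside the ultrapower: the second factor is generated by the class
  of \<open>hf\<close>, the free product by it and the diagonal copy of the algebra, and the
  embedding is the inclusion. As \<open>hf\<close> takes values in B, the image of B * C stays in
  the closed subalgebra of families from B.\<close>

theorem selfless_witness: assumes B: "unital_cstar_subalgebra B A" and hB: "!!i. hf i : B"
 shows "\<exists>(C :: ('i => 'a) set cstar) \<kappa> (D :: ('i => 'a) set cstar) \<delta> jA jC \<sigma>.
   cstar_prob_space C \<kappa> &
   carrier C ~= range (%c. c *.@C 1@C) &
   is_reduced_free_product A \<rho> C \<kappa> D \<delta> jA jC &
   cstar_embedding D \<delta> (ultrapower A \<omega>) (ultra_state \<rho> \<omega>) \<sigma> &
   (\<forall>x\<in>carrier A. \<sigma> (jA x) = ultra_class A \<omega> (%i. x)) &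
   \<sigma> ` cstar_generated D (jA ` B \<union> jC ` carrier C) <= ultra_subalgebra A \<omega> B"
proof -
 let ?h = "uc hf"
 define D where "D = cstar_generated UU (J ` carrier A \<union> {?h})"
 define C where "C = cstar_generated UU {?h}"
 have hc: "?h .: UU" by (rule uc_closed[OF hf_LL])
 have sub: "J ` carrier A \<union> {?h} <= carrier UU" "{?h} <= carrier UU" using hc J_closed by blast+
 have Ds: "unital_cstar_subalgebra D UU" and Cs: "unital_cstar_subalgebra C UU"
  unfolding D_def C_def by (rule U.cstar_generated_subalgebra, rule sub)+
 have JD: "J ` carrier A \<union> {?h} <= D" unfolding D_def by (rule U.cstar_generated_superset)
 have "{?h} <= C" unfolding C_def by (rule U.cstar_generated_superset)
 hence hC: "?h : C" by simp
 have CD: "C <= D" unfolding C_def by (rule U.cstar_generated_least[OF Ds]) (use JD in blast)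
 have Cc: "C <= carrier UU" "D <= carrier UU"
  using U.unital_cstar_subalgebraD(1)[OF Cs] U.unital_cstar_subalgebraD(1)[OF Ds] .
 have imgD: "\<Theta> ` D <= FK.PC (\<phi> ` carrier A)" unfolding D_def
 proof (rule UH.UM.generated_image[OF FK.PC_subalgebra[OF FK.letters_K] sub(1)])
  show "\<Theta> ` (J ` carrier A \<union> {?h}) <= FK.PC (\<phi> ` carrier A)"
   using FK.PC_gen[OF FK.letters_K] \<Theta>_J \<Theta>_h by auto
 qed
 have imgC: "\<Theta> ` C <= FK.PC FK.sc" unfolding C_def
 proof (rule UH.UM.generated_image[OF FK.PC_subalgebra[OF FK.letters_sc] sub(2)])
  show "\<Theta> ` {?h} <= FK.PC FK.sc" using FK.PC_gen(2)[OF FK.letters_sc] \<Theta>_h by simp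
 qed
 have SPD: "FK.SP (FK.wl (\<phi> ` carrier A) n) <= \<Theta> ` D" for n proof (rule SP_image[OF Ds])
  show "\<phi> ` carrier A <= \<Theta> ` D" proof
   fix y assume "y : \<phi> ` carrier A"
   then obtain x where x: "x .: A" "y = \<phi> x" by blast
   thus "y : \<Theta> ` D" using \<Theta>_J[OF x(1)] JD by (intro image_eqI[of _ _ "J x"]) auto
  qed
 qed (use JD in auto)
 have SPC: "FK.SP (FK.wl FK.sc n) <= \<Theta> ` C" for n proof (rule SP_image[OF Cs hC])
  show "FK.sc <= \<phi> ` carrier A" using FK.letters_sc by (simp add: FK.letters_def)
  show "FK.sc <= \<Theta> ` C" proof
   fix y assume "y : FK.sc"
   then obtain k where "y = k *.@YY 1@YY" by (auto simp: FK.sc_def)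
   hence "y = \<Theta> (k *.@UU 1@UU)" using UH.UM.hom_simps(4)[OF U.one_closed, of k] UH.UM.hom_simps(6) by simp
   moreover have "k *.@UU 1@UU : C" using U.unital_cstar_subalgebraD(2,6)[OF Cs] by blast
   ultimately show "y : \<Theta> ` C" by blast
  qed
 qed
 have pD: "cstar_prob_space (U.restr D) \<rho>\<^sub>\<omega>" by (rule prob_space_sub[OF Ds imgD SPD FK.faithful_K])
 have pC: "cstar_prob_space (U.restr C) \<rho>\<^sub>\<omega>" by (rule prob_space_sub[OF Cs imgC SPC FK.faithful_sc])
 have pA: "cstar_prob_space A \<rho>" using cstar_algebra_axioms state inj by (simp add: cstar_prob_space_def)
 have nontriv: "carrier (U.restr C) ~= range (%c. c *.@(U.restr C) 1@(U.restr C))" proof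
  assume "carrier (U.restr C) = range (%c. c *.@(U.restr C) 1@(U.restr C))"
  then obtain k where "?h = k *.@UU 1@UU" using hC by auto
  hence "\<Theta> ?h = k *.@YY 1@YY" using UH.UM.hom_simps(4)[OF U.one_closed, of k] UH.UM.hom_simps(6) by simp
  thus False using FK.nontrivial[of k] \<Theta>_h by simp
 qed
 have eA: "cstar_embedding A \<rho> (U.restr D) \<rho>\<^sub>\<omega> J"
  using diag_hom diag_inj ultra_state_diag JD by (simp add: cstar_embedding_def cstar_hom_def ring_hom_def image_subset_iff Pi_iff)
 have eC: "cstar_embedding (U.restr C) \<rho>\<^sub>\<omega> (U.restr D) \<rho>\<^sub>\<omega> id"
  using CD by (auto simp: cstar_embedding_def cstar_hom_def ring_hom_def)
 have eD: "cstar_embedding (U.restr D) \<rho>\<^sub>\<omega> UU \<rho>\<^sub>\<omega> id"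
  using Cc by (auto simp: cstar_embedding_def cstar_hom_def ring_hom_def)
 have gen: "cstar_generated (U.restr D) (J ` carrier A \<union> id ` carrier (U.restr C)) = carrier (U.restr D)"
 proof -
  have "cstar_generated UU (J ` carrier A \<union> C) = D" proof
   show "cstar_generated UU (J ` carrier A \<union> C) <= D"
    by (rule U.cstar_generated_least[OF Ds]) (use JD CD in blast)
   have S: "J ` carrier A \<union> C <= carrier UU" using sub Cc by blast
   show "D <= cstar_generated UU (J ` carrier A \<union> C)" unfolding D_def
    by (rule U.cstar_generated_least[OF U.cstar_generated_subalgebra[OF S]])
     (use hC U.cstar_generated_superset[of "J ` carrier A \<union> C"] in blast)
  qed
  moreover have "J ` carrier A \<union> C <= D" using JD CD by blast
  ultimately show ?thesis using U.restr_generated[OF Ds] by simp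
 qed
 have free: "free_family (U.restr D) \<rho>\<^sub>\<omega> (%first. if first then J ` carrier A else id ` carrier (U.restr C))"
 proof -
  have "id ` carrier (U.restr C) = C" by simp
  thus ?thesis by (simp only:) (rule free_sub[OF Ds Cc(1) imgC])
 qed
 have fp: "is_reduced_free_product A \<rho> (U.restr C) \<rho>\<^sub>\<omega> (U.restr D) \<rho>\<^sub>\<omega> J id"
  unfolding is_reduced_free_product_def by (intro conjI pA pC pD eA eC free gen)
 have incl: "id ` cstar_generated (U.restr D) (J ` B \<union> id ` carrier (U.restr C)) <= ultra_subalgebra A \<omega> B"
 proof -
  have BA: "B <= carrier A" by (rule unital_cstar_subalgebraD(1)[OF B])
  have S: "J ` B \<union> C <= D" using JD CD BA by blast
  have Us: "unital_cstar_subalgebra (ultra_subalgebra A \<omega> B) UU" by (rule ultra_subalgebra_subalgebra[OF B])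
  have hU: "?h : ultra_subalgebra A \<omega> B" unfolding ultra_subalgebra_iff using hf_LL hB by blast
  have CU: "C <= ultra_subalgebra A \<omega> B" unfolding C_def by (rule U.cstar_generated_least[OF Us]) (use hU in blast)
  have JU: "J ` B <= ultra_subalgebra A \<omega> B" proof
   fix y assume "y : J ` B"
   then obtain x where "x : B" "y = J x" by blast
   thus "y : ultra_subalgebra A \<omega> B" unfolding ultra_subalgebra_iff
    using BA by (intro exI[of _ "%_. x"]) (auto intro: LL_const)
  qed
  have "cstar_generated UU (J ` B \<union> C) <= ultra_subalgebra A \<omega> B"
   by (rule U.cstar_generated_least[OF Us]) (use CU JU in blast)
  thus ?thesis using U.restr_generated[OF Ds S] by simp
 qed
 show ?thesis
  by (rule exI[of _ "U.restr C"], rule exI[of _ "\<rho>\<^sub>\<omega>"], rule exI[of _ "U.restr D"], rule exI[of _ "\<rho>\<^sub>\<omega>"],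
   rule exI[of _ J], rule exI[of _ id], rule exI[of _ id], intro conjI pC nontriv fp eD incl) simp
qed

end

theorem (in cstar_state) vector_PHP_selfless:
 assumes B: "unital_cstar_subalgebra B A" and inj: "inj_on \<pi> (carrier A)" and V: "vector_PHP B"
 shows "selfless B A \<rho>"
proof -
 \<comment> \<open>Along this filter the first component eventually contains any given element and
   the second tends to infinity; the second property also makes every ultrafilter below it
   free.\<close>
 let ?F = "finite_subsets_at_top (carrier A) \<times>\<^sub>F sequentially :: ('a set \<times> nat) filter"
 have ne: "?F ~= bot" by (simp add: prod_filter_eq_bot)
 obtain \<omega> where \<omega>: "\<omega> <= ?F" "\<omega> ~= bot" "!!P. eventually P \<omega> | eventually (%i. \<not> P i) \<omega>"
  by (rule ex_ultrafilter_le[OF ne]) blast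
 have fst: "filterlim fst (finite_subsets_at_top (carrier A)) \<omega>" and snd: "filterlim snd sequentially \<omega>"
  unfolding filterlim_def by (rule order.trans[OF filtermap_mono[OF \<omega>(1)] filtermap_fst_prod_filter],
   rule order.trans[OF filtermap_mono[OF \<omega>(1)] filtermap_snd_prod_filter])
 have "eventually (%j. j ~= i) \<omega>" for i proof -
  have "eventually (%j. snd i < snd j) \<omega>" by (rule eventually_compose_filterlim[OF eventually_gt_at_top snd])
  thus ?thesis by eventually_elim auto
 qed
 hence free: "free_ultrafilter \<omega>" using \<omega>(2,3) by (simp add: free_ultrafilter_def)
 let ?B = "BB"
 \<comment> \<open>The index type contains all sets, so indices whose first component is not a
   finite subset of the carrier get the default {}; along the filter such indices are
   negligible.\<close>
 define G where "G j = (if finite (fst j) & fst j <= carrier A then fst j else {})" for j :: "'a set \<times> nat"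
 define \<epsilon> where "\<epsilon> j = 1 / real (Suc (snd j))" for j :: "'a set \<times> nat"
 have "\<exists>hl. fst hl : B & nA (fst hl) <= 4 & snd hl .: ?B & nrm ?B (snd hl) <= 2 &
  \<pi> (fst hl) = snd hl .+@?B star ?B (snd hl) &
  (\<forall>x\<in>G j. nrm ?B (star ?B (snd hl) **@?B (\<pi> x **@?B snd hl) .-@?B \<rho> x *.@?B 1@?B) <= \<epsilon> j &
   hnorm HH (star ?B (snd hl) (hat x)) <= \<epsilon> j)" for j proof -
  have "finite (G j)" "G j <= carrier A" "\<epsilon> j > 0" by (simp_all add: G_def \<epsilon>_def)
  from ex_approx_creation[OF B inj V this] show ?thesis proof cases
   case (1 h l)
   thus ?thesis by (intro exI[of _ "(h, l)"]) simp
  qed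
 qed
 then obtain hl where hl: "!!j. fst (hl j) : B & nA (fst (hl j)) <= 4 & snd (hl j) .: ?B & nrm ?B (snd (hl j)) <= 2 &
  \<pi> (fst (hl j)) = snd (hl j) .+@?B star ?B (snd (hl j)) &
  (\<forall>x\<in>G j. nrm ?B (star ?B (snd (hl j)) **@?B (\<pi> x **@?B snd (hl j)) .-@?B \<rho> x *.@?B 1@?B) <= \<epsilon> j &
   hnorm HH (star ?B (snd (hl j)) (hat x)) <= \<epsilon> j)" by metis
 have \<epsilon>: "(\<epsilon> ---> 0) \<omega>"
  unfolding \<epsilon>_def by (rule filterlim_compose[OF LIMSEQ_Suc[OF lim_1_over_n] snd])
 have ev: "eventually (%j. x : G j) \<omega>" if x: "x .: A" for x proof -
  have "eventually (%Y. finite Y & Y <= carrier A & x : Y) (finite_subsets_at_top (carrier A))"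
   unfolding eventually_finite_subsets_at_top using x by (intro exI[of _ "{x}"]) auto
  hence "eventually (%j. finite (fst j) & fst j <= carrier A & x : fst j) \<omega>"
   using fst by (rule eventually_compose_filterlim)
  thus ?thesis by eventually_elim (simp add: G_def)
 qed
 have hB: "fst (hl j) : B" and h4: "nA (fst (hl j)) <= 4" and lc: "snd (hl j) .: ?B"
  and l2: "nrm ?B (snd (hl j)) <= 2" and \<pi>h: "\<pi> (fst (hl j)) = snd (hl j) .+@?B star ?B (snd (hl j))"
  and small: "x : G j ==> nrm ?B (star ?B (snd (hl j)) **@?B (\<pi> x **@?B snd (hl j)) .-@?B \<rho> x *.@?B 1@?B) <= \<epsilon> j"
   "x : G j ==> hnorm HH (star ?B (snd (hl j)) (hat x)) <= \<epsilon> j" for j x using hl[of j] by blast+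
 have hc: "fst (hl j) .: A" for j using hB unital_cstar_subalgebraD(1)[OF B] by blast
 have null: "(f ---> 0) \<omega>" if x: "x .: A" and f: "!!j. x : G j ==> \<bar>f j\<bar> <= \<epsilon> j" for x and f :: "_ => real"
 proof (rule tendsto_0_le[OF \<epsilon>, of _ 1])
  show "eventually (%j. norm (f j) <= norm (\<epsilon> j) * 1) \<omega>"
   using ev[OF x] by eventually_elim (use f in "simp add: \<epsilon>_def")
 qed
 have ul: "ultra \<omega>" using \<omega>(2,3) by (simp add: ultra_def)
 have ac: "approx_creation A \<rho> \<omega> (%j. fst (hl j)) (%j. snd (hl j))"
 proof (rule approx_creation.intro[OF state_ultra.intro[OF cstar_state_axioms ul]],
   rule approx_creation_axioms.intro[OF inj hc h4 lc l2 \<pi>h])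
  fix x assume x: "x .: A"
  have c: "star ?B (snd (hl j)) .: ?B" "\<pi> x .: ?B" for j using lc \<pi>_closed[OF x] by simp_all
  have c': "star ?B (snd (hl j)) **@?B (\<pi> x **@?B snd (hl j)) .-@?B \<rho> x *.@?B 1@?B .: ?B" for j
   using c lc by simp
  show "((%i. nrm ?B (star ?B (snd (hl i)) **@?B (\<pi> x **@?B snd (hl i)) .-@?B \<rho> x *.@?B 1@?B)) ---> 0) \<omega>"
   by (rule null[OF x]) (use small(1) H.B.nrm_nonneg[OF c'] in simp)
  show "((%i. hnorm HH (star ?B (snd (hl i)) (hat x))) ---> 0) \<omega>"
   by (rule null[OF x]) (use small(2) H.hn_nonneg[OF H.B_closed[OF c(1) hat_closed[OF x]]] in simp)
 qed
 have "cstar_inclusion B A \<rho>" using cstar_algebra_axioms state inj B by (simp add: cstar_inclusion_def cstar_prob_space_def)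
 thus ?thesis unfolding selfless_def
  using approx_creation.selfless_witness[OF ac B hB] free by (intro conjI exI[of _ \<omega>]) simp_all
qed

section \<open>Transfer of the hypotheses on the letters to the free product\<close>

lemma (in cstar_algebra) unitary_inv: "u : unitaries A ==> inv u = sA u"
 using inv_unique'[of u "sA u"] by (simp add: unitaries_def)

text \<open>The centraliser property is used on u* y and on y u*, where moving \<open>u\<close>
  across the state makes it cancel with its adjoint.\<close>

lemma (in cstar_algebra) centralizer_conj: assumes u: "u : unitaries A" "u : centralizer A \<tau>" and y: "y .: A"
 shows "\<tau> (sA u ** (y ** u)) = \<tau> y" "\<tau> (u ** (y ** sA u)) = \<tau> y"
proof -
 have uc: "u .: A" "sA u ** u = \<one>" "u ** sA u = \<one>" using u(1) by (auto simp: unitaries_def)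
 have cen: "\<tau> (u ** x) = \<tau> (x ** u)" if "x .: A" for x using u(2) that by (simp add: centralizer_def)
 have "u ** (sA u ** y) = y" "y ** sA u ** u = y" using uc y m_assoc[of u "sA u" y] by (simp_all add: m_assoc)
 thus "\<tau> (sA u ** (y ** u)) = \<tau> y" "\<tau> (u ** (y ** sA u)) = \<tau> y"
  using cen[of "sA u ** y"] cen[of "y ** sA u"] uc(1) y by (simp_all add: m_assoc)
qed

lemma (in cstar_hom_pair) image_ops:
 "f ` carrier A <= carrier B" "1@B : f ` carrier A"
 "x : f ` carrier A ==> y : f ` carrier A ==> x .+@B y : f ` carrier A"
 "x : f ` carrier A ==> y : f ` carrier A ==> x **@B y : f ` carrier A"
 "x : f ` carrier A ==> c *.@B x : f ` carrier A" "x : f ` carrier A ==> star B x : f ` carrier A"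
proof -
 show "1@B : f ` carrier A" by (metis hom_simps(6) A.one_closed image_eqI)
qed (auto simp: hom_simps(2-5)[symmetric] simp del: hom_simps(2-6))

theorem theorem3p4:
  fixes A1 :: "'a cstar" and A2 :: "'b cstar" and A :: "'c cstar"
    and \<rho>1 :: "'a \<Rightarrow> complex" and \<rho>2 :: "'b \<Rightarrow> complex" and \<rho> :: "'c \<Rightarrow> complex"
    and j1 :: "'a \<Rightarrow> 'c" and j2 :: "'b \<Rightarrow> 'c"
    and z :: 'a and a b c :: 'b and B :: "'c set"
  assumes "is_reduced_free_product A1 \<rho>1 A2 \<rho>2 A \<rho> j1 j2"
    and "z \<in> unitaries A1" and "a \<in> unitaries A2" and "b \<in> unitaries A2" and "c \<in> unitaries A2"
    and "\<rho>1 z = 0" and "\<rho>2 a = 0" and "\<rho>2 b = 0" and "\<rho>2 c = 0"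
    and "\<rho>2 (inv\<^bsub>A2\<^esub> c \<otimes>\<^bsub>A2\<^esub> b) = 0" and "\<rho>2 (inv\<^bsub>A2\<^esub> c \<otimes>\<^bsub>A2\<^esub> a) = 0"
    and "z \<in> centralizer A1 \<rho>1"
    and "a \<in> centralizer A2 \<rho>2" and "b \<in> centralizer A2 \<rho>2" and "c \<in> centralizer A2 \<rho>2"
    and "B = cstar_generated A
      {j1 (inv\<^bsub>A1\<^esub> z) \<otimes>\<^bsub>A\<^esub> j2 a \<otimes>\<^bsub>A\<^esub> j1 z, j2 b, j2 c}"
  shows "PHP B A \<rho> (L2 A \<rho>) (gns_rep A \<rho>) \<and> selfless B A \<rho>"
proof -
 note fp = assms(1)[unfolded is_reduced_free_product_def cstar_prob_space_def cstar_embedding_def]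
 have alg: "cstar_algebra A1" "cstar_algebra A2" "cstar_algebra A" "state A \<rho>" and inj: "inj_on (gns_rep A \<rho>) (carrier A)"
  and j: "j1 : cstar_hom A1 A" "j2 : cstar_hom A2 A"
  and r: "!!x. x .: A1 ==> \<rho> (j1 x) = \<rho>1 x" "!!x. x .: A2 ==> \<rho> (j2 x) = \<rho>2 x" using fp by blast+
 have st: "cstar_state A \<rho>" using alg by (simp add: cstar_state_def cstar_state_axioms_def)
 have h1: "cstar_hom_pair A1 A j1" and h2: "cstar_hom_pair A2 A j2"
  using alg j by (simp_all add: cstar_hom_pair_def cstar_hom_pair_axioms_def)
 note H1 = cstar_hom_pair.hom_simps[OF h1] and H2 = cstar_hom_pair.hom_simps[OF h2]
 have inv: "inv\<^bsub>A1\<^esub> z = star A1 z" "inv\<^bsub>A2\<^esub> c = star A2 c"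
  using cstar_algebra.unitary_inv[OF alg(1) assms(2)] cstar_algebra.unitary_inv[OF alg(2) assms(5)] .
 have zc: "z .: A1" "a .: A2" "b .: A2" "c .: A2" using assms(2-5) by (auto simp: unitaries_def)
 have s: "star A1 z .: A1" "star A2 c .: A2" "star A2 a .: A2"
  using cstar_algebra.star_closed[OF alg(1)] cstar_algebra.star_closed[OF alg(2)] zc by blast+
 have m1: "x **@A1 y .: A1" if "x .: A1" "y .: A1" for x y
  using ring.ring_simprules(5)[OF cstar_algebra.axioms(1)[OF alg(1)] that] .
 have m2: "x **@A2 y .: A2" if "x .: A2" "y .: A2" for x y
  using ring.ring_simprules(5)[OF cstar_algebra.axioms(1)[OF alg(2)] that] .
 define S where "S = (%first. if first then j1 ` carrier A1 else j2 ` carrier A2)"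
 have pair: "free_pair A \<rho> S" proof (rule free_pair.intro[OF st free_pair_axioms.intro])
  show "free_family A \<rho> S" "cstar_generated A (S True \<union> S False) = carrier A" using fp by (auto simp: S_def)
 qed (use cstar_hom_pair.image_ops[OF h1] cstar_hom_pair.image_ops[OF h2] in "auto simp: S_def")
 have un: "star A (j1 z) **@A j1 z = 1@A & j1 z **@A star A (j1 z) = 1@A"
  using H1(3)[OF s(1) zc(1)] H1(3)[OF zc(1) s(1)] H1(5)[OF zc(1)] H1(6) assms(2) by (simp add: unitaries_def)
 have un2: "star A (j2 x) **@A j2 x = 1@A & j2 x **@A star A (j2 x) = 1@A" if x: "x : unitaries A2" for x proof -
  have x: "x .: A2" "star A2 x .: A2" "star A2 x **@A2 x = 1@A2" "x **@A2 star A2 x = 1@A2"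
   using x cstar_algebra.star_closed[OF alg(2)] by (auto simp: unitaries_def)
  thus ?thesis using H2(3)[OF x(2,1)] H2(3)[OF x(1,2)] H2(5)[OF x(1)] H2(6) by simp
 qed
 have conj1: "\<rho> (star A (j1 z) **@A (j1 y **@A j1 z)) = \<rho> (j1 y)" "\<rho> (j1 z **@A (j1 y **@A star A (j1 z))) = \<rho> (j1 y)"
  if y: "y .: A1" for y using cstar_algebra.centralizer_conj[OF alg(1) assms(2,12) y] y zc s
  by (simp_all add: r m1 flip: H1(3,5))
 have conj2: "\<rho> (star A (j2 u) **@A (j2 y **@A j2 u)) = \<rho> (j2 y)" "\<rho> (j2 u **@A (j2 y **@A star A (j2 u))) = \<rho> (j2 y)"
  if u: "u : unitaries A2" "u : centralizer A2 \<rho>2" and y: "y .: A2" for u y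
  using cstar_algebra.centralizer_conj[OF alg(2) u y] y u cstar_algebra.star_closed[OF alg(2)]
  by (simp_all add: unitaries_def r m2 flip: H2(3,5))
 have F: "free_unitaries A \<rho> S (j1 z) (j2 a) (j2 b) (j2 c)"
 proof (rule free_unitaries.intro[OF pair free_unitaries_axioms.intro])
  show "j1 z : S True" "j2 a : S False" "j2 b : S False" "j2 c : S False" using zc by (simp_all add: S_def)
  show "star A u **@A u = 1@A & u **@A star A u = 1@A" if "u : {j1 z, j2 a, j2 b, j2 c}" for u
   using that un un2[OF assms(3)] un2[OF assms(4)] un2[OF assms(5)] by blast
  show "\<rho> (j1 z) = 0" "\<rho> (j2 a) = 0" "\<rho> (j2 b) = 0" "\<rho> (j2 c) = 0" using r zc assms(6-9) by simp_all
  show "\<rho> (star A (j2 c) **@A j2 b) = 0" "\<rho> (star A (j2 c) **@A j2 a) = 0"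
   using assms(10,11) zc s by (simp_all add: inv r m2 flip: H2(3,5))
  show "\<rho> (star A (j1 z) **@A (y **@A j1 z)) = \<rho> y" "\<rho> (j1 z **@A (y **@A star A (j1 z))) = \<rho> y" if "y : S True" for y
   using that conj1 by (auto simp: S_def)
  show "\<rho> (star A (j2 a) **@A (y **@A j2 a)) = \<rho> y" "\<rho> (star A (j2 c) **@A (y **@A j2 c)) = \<rho> y"
   "\<rho> (j2 c **@A (y **@A star A (j2 c))) = \<rho> y" if "y : S False" for y
   using that conj2(1)[OF assms(3,13)] conj2[OF assms(5,15)] by (auto simp: S_def)
 qed
 have g: "j1 (inv\<^bsub>A1\<^esub> z) **@A j2 a **@A j1 z = star A (j1 z) **@A (j2 a **@A j1 z)"
  using ring.ring_simprules(11)[OF cstar_algebra.axioms(1)[OF alg(3)] H1(1)[OF s(1)] H2(1)[OF zc(2)] H1(1)[OF zc(1)]]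
  by (simp add: inv H1(5)[OF zc(1)])
 have sub: "{j1 (inv\<^bsub>A1\<^esub> z) **@A j2 a **@A j1 z, j2 b, j2 c} <= carrier A"
  using ring.ring_simprules(5)[OF cstar_algebra.axioms(1)[OF alg(3)]] H1(1) H2(1) zc s by (simp add: inv)
 have B: "unital_cstar_subalgebra B A" unfolding assms(16) by (rule cstar_algebra.cstar_generated_subalgebra[OF alg(3) sub])
 have "{j1 (inv\<^bsub>A1\<^esub> z) **@A j2 a **@A j1 z, j2 b, j2 c} <= B"
  unfolding assms(16) by (rule cstar_algebra.cstar_generated_superset[OF alg(3)])
 hence V: "cstar_state.vector_PHP A \<rho> B" unfolding g by (intro free_unitaries.vector_PHP[OF F B]) simp_all
 show ?thesis
  using cstar_state.vector_PHP_imp_PHP[OF st B inj V] cstar_state.vector_PHP_selfless[OF st B inj V] by blast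
qed

end
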